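(* Suppose that $\gamma>\tfrac12$, that $\ell(N)=o(N)$ as $N\to\infty$, and that there exists $\epsilon'\in(0,2\gamma-1)$ such that $\mathbb{C}\setminus\mathcal{V}(\epsilon')$ has Lebesgue measure $0$. Suppose further that there is a compact set $K\subseteq\mathbb{C}$ such that all the measures $\mu_N$ are supported on $K$, and that there is a probability measure $\mu$ on $\mathbb{C}$ such that $\mu_N$ converges weakly to $\mu$ as $N\to\infty$. Then the empirical spectral measure $L_N$ of $M^N+N^{-\gamma}G^N$ converges to $\mu$ weakly in probability as $N\to\infty$.
   Context: Setting. For each $N$, let $B^1(N),\dots,B^{\ell(N)}(N)$ be Jordan blocks, where $B^i=B^i(N)$ has dimension $a_i\log N$ with $a_i=a_i(N)>0$ (so each $a_i\log N$ is a positive integer) and $\sum_{i=1}^{\ell(N)}a_i\log N=N$. The block $B^i$ has eigenvalue $c_i=c_i(N)\in\mathbb{C}$ on its diagonal, ones on the first superdiagonal, and zeros elsewhere. $M^N$ is the $N\times N$ block-diagonal matrix with diagonal blocks $B^1,\dots,B^{\ell(N)}$. $G^N$ is an $N\times N$ random matrix with i.i.d. (real) standard Gaussian entries. Let $r_i=r_i(N)=\exp\big((-\gamma+\tfrac12)/a_i\big)$, let $m_{c,r}$ be the uniform probability measure on the circle in $\mathbb{C}$ with center $c$ and radius $r$, and set $$\mu_N=\sum_{i=1}^{\ell(N)}\frac{a_i\log N}{N}\,m_{c_i,r_i}.$$ For $\epsilon'\in(0,2\gamma-1)$ set $$\mathcal{V}_N(\epsilon')=\Big\{z\in\mathbb{C}:\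 \forall i\in\{1,\dots,\ell(N)\},\ \min\big(a_i\log N,\ \big|1-|z-c_i|^2\big|^{-1}\big)<N^{2\gamma-1-\epsilon'}\Big\}$$ (with $0^{-1}=+\infty$) and $$\mathcal{V}(\epsilon')=\bigcup_{k=1}^\infty\bigcap_{N=k}^\infty\mathcal{V}_N(\epsilon').$$ The empirical spectral measure of an $N\times N$ matrix with eigenvalues $\lambda_1,\dots,\lambda_N$ (with algebraic multiplicity) is $\frac1N\sum_{i=1}^N\delta_{\lambda_i}$. Random probability measures $L_N$ on $\mathbb{C}$ converge to $\mu$ weakly in probability if $\int\phi\,dL_N\to\int\phi\,d\mu$ in probability for every bounded continuous $\phi:\mathbb{C}\to\mathbb{R}$. *)

theory Defs
  imports "HOL-Probability.Probability" "Jordan_Normal_Form.Spectral_Radius"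
begin

hide_const (open) Finite_Cartesian_Product.mat Finite_Cartesian_Product.vec

section \<open>Measures on the complex plane\<close>

text \<open>The weighted sum of Borel measures \<open>m i\<close> with nonnegative weights \<open>w i\<close>, over a finite
  index set \<open>I\<close>.\<close>

definition mixture :: "'i set \<Rightarrow> ('i \<Rightarrow> real) \<Rightarrow> ('i \<Rightarrow> complex measure) \<Rightarrow> complex measure" where
  "mixture I w m =
     measure_of UNIV (sets borel) (\<lambda>A. \<Sum>i\<in>I. ennreal (w i) * emeasure (m i) A)"

lemma space_mixture [simp]: "space (mixture I w m) = UNIV"
  and sets_mixture [simp, measurable_cong]: "sets (mixture I w m) = sets borel"
  by (simp_all add: mixture_def space_measure_of_conv
      sets.sigma_sets_eq[of borel, unfolded space_borel])

lemma emeasure_mixture: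
  assumes "\<And>i. i \<in> I \<Longrightarrow> sets (m i) = sets borel" and "A \<in> sets borel"
  shows "emeasure (mixture I w m) A = (\<Sum>i\<in>I. ennreal (w i) * emeasure (m i) A)"
proof (rule emeasure_measure_of[OF mixture_def])
  show "countably_additive (sets (mixture I w m))
          (\<lambda>A. \<Sum>i\<in>I. ennreal (w i) * emeasure (m i) A)"
  proof (rule countably_additiveI)
    fix F :: "nat \<Rightarrow> complex set"
    assume F: "range F \<subseteq> sets (mixture I w m)" "disjoint_family F"
    have "(\<Sum>n. \<Sum>i\<in>I. ennreal (w i) * emeasure (m i) (F n)) =
          (\<Sum>i\<in>I. \<Sum>n. ennreal (w i) * emeasure (m i) (F n))"
      by (rule suminf_sum) simp
    also have "\<dots> = (\<Sum>i\<in>I. ennreal (w i) * emeasure (m i) (\<Union>n. F n))"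
    proof (rule sum.cong[OF refl])
      fix i assume "i \<in> I"
      with assms(1) F have "range F \<subseteq> sets (m i)" by simp
      from suminf_emeasure[OF this F(2)]
      show "(\<Sum>n. ennreal (w i) * emeasure (m i) (F n)) =
            ennreal (w i) * emeasure (m i) (\<Union>n. F n)"
        by simp
    qed
    finally show "(\<Sum>n. \<Sum>i\<in>I. ennreal (w i) * emeasure (m i) (F n)) =
        (\<Sum>i\<in>I. ennreal (w i) * emeasure (m i) (\<Union>n. F n))" .
  qed
qed (use assms(2) in \<open>auto simp: positive_def\<close>)

definition uniform_circle :: "complex \<Rightarrow> real \<Rightarrow> complex measure" where
  "uniform_circle c r =
     distr (uniform_measure lborel {0..2 * pi}) borel (\<lambda>t. c + of_real r * cis t)"

lemma sets_uniform_circle [simp, measurable_cong]: "sets (uniform_circle c r) = sets borel"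
  by (simp add: uniform_circle_def)

lemma prob_space_uniform_circle: "prob_space (uniform_circle c r)"
  unfolding uniform_circle_def
proof (rule prob_space.prob_space_distr)
  show "prob_space (uniform_measure lborel {0..2 * pi})"
    by (rule prob_space_uniform_measure) auto
  have "continuous_on UNIV (\<lambda>t. c + of_real r * cis t)"
    by (intro continuous_intros)
  then show "(\<lambda>t. c + of_real r * cis t) \<in> uniform_measure lborel {0..2 * pi} \<rightarrow>\<^sub>M borel"
    by (subst measurable_cong_sets[OF sets_uniform_measure refl])
       (simp add: borel_measurable_continuous_onI)
qed

definition empirical_spectral_measure :: "complex mat \<Rightarrow> complex measure" where
  "empirical_spectral_measure A =
     mixture (spectrum A) (\<lambda>z. real (order z (char_poly A)) / real (dim_row A)) (return borel)"


section \<open>Modes of convergence\<close>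

definition weakly_converges :: "(nat \<Rightarrow> complex measure) \<Rightarrow> complex measure \<Rightarrow> bool" where
  "weakly_converges \<nu> \<mu> \<longleftrightarrow>
     (\<forall>\<phi> :: complex \<Rightarrow> real. continuous_on UNIV \<phi> \<longrightarrow> bounded (range \<phi>) \<longrightarrow>
        (\<lambda>N. \<integral>z. \<phi> z \<partial>\<nu> N) \<longlonglongrightarrow> (\<integral>z. \<phi> z \<partial>\<mu>))"

text \<open>Convergence to a constant; the \<open>N\<close>-th variable lives on its own probability space \<open>P N\<close>.
  Measurability is demanded explicitly because \<^const>\<open>measure\<close> is \<open>0\<close> on non-measurable sets.\<close>

definition converges_in_prob ::
  "(nat \<Rightarrow> 'w measure) \<Rightarrow> (nat \<Rightarrow> 'w \<Rightarrow> real) \<Rightarrow> real \<Rightarrow> bool" where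
  "converges_in_prob P X x \<longleftrightarrow>
     (\<forall>N. X N \<in> borel_measurable (P N)) \<and>
     (\<forall>\<epsilon>>0. (\<lambda>N. measure (P N) {\<omega> \<in> space (P N). \<bar>X N \<omega> - x\<bar> > \<epsilon>}) \<longlonglongrightarrow> 0)"

definition weakly_converges_in_prob ::
  "(nat \<Rightarrow> 'w measure) \<Rightarrow> (nat \<Rightarrow> 'w \<Rightarrow> complex measure) \<Rightarrow> complex measure \<Rightarrow> bool" where
  "weakly_converges_in_prob P L \<mu> \<longleftrightarrow>
     (\<forall>\<phi> :: complex \<Rightarrow> real. continuous_on UNIV \<phi> \<longrightarrow> bounded (range \<phi>) \<longrightarrow>
        converges_in_prob P (\<lambda>N \<omega>. \<integral>z. \<phi> z \<partial>L N \<omega>) (\<integral>z. \<phi> z \<partial>\<mu>))"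


section \<open>The model\<close>

definition std_gaussian_matrix :: "'w measure \<Rightarrow> nat \<Rightarrow> ('w \<Rightarrow> real mat) \<Rightarrow> bool" where
  "std_gaussian_matrix P n G \<longleftrightarrow>
     (\<forall>\<omega>\<in>space P. G \<omega> \<in> carrier_mat n n) \<and>
     prob_space.indep_vars P (\<lambda>_. borel) (\<lambda>ij \<omega>. G \<omega> $$ ij) ({..<n} \<times> {..<n}) \<and>
     (\<forall>i<n. \<forall>j<n. distributed P lborel (\<lambda>\<omega>. G \<omega> $$ (i, j)) std_normal_density)"

text \<open>For each \<open>N\<close> the blocks are numbered by \<open>i \<in> {1..l N}\<close>; block \<open>i\<close> has eigenvalue \<open>c N i\<close> and
  dimension \<open>d N i = a N i * ln N\<close>.\<close>

definition block_matrix ::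
  "(nat \<Rightarrow> nat) \<Rightarrow> (nat \<Rightarrow> nat \<Rightarrow> nat) \<Rightarrow> (nat \<Rightarrow> nat \<Rightarrow> complex) \<Rightarrow> nat \<Rightarrow> complex mat" where
  "block_matrix l d c N = jordan_matrix (map (\<lambda>i. (d N i, c N i)) [1..<Suc (l N)])"

definition perturbed_matrix ::
  "real \<Rightarrow> complex mat \<Rightarrow> nat \<Rightarrow> real mat \<Rightarrow> complex mat" where
  "perturbed_matrix \<gamma> M N G =
     M + complex_of_real (real N powr (- \<gamma>)) \<cdot>\<^sub>m map_mat complex_of_real G"

definition block_radius :: "real \<Rightarrow> (nat \<Rightarrow> nat \<Rightarrow> real) \<Rightarrow> nat \<Rightarrow> nat \<Rightarrow> real" where
  "block_radius \<gamma> a N i = exp ((- \<gamma> + 1 / 2) / a N i)"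

definition circle_mixture ::
  "real \<Rightarrow> (nat \<Rightarrow> nat) \<Rightarrow> (nat \<Rightarrow> nat \<Rightarrow> real) \<Rightarrow> (nat \<Rightarrow> nat \<Rightarrow> complex) \<Rightarrow> nat \<Rightarrow> complex measure"
  where
  "circle_mixture \<gamma> l a c N =
     mixture {1..l N} (\<lambda>i. a N i * ln (real N) / real N)
       (\<lambda>i. uniform_circle (c N i) (block_radius \<gamma> a N i))"

text \<open>The inequality is taken in \<^typ>\<open>ereal\<close>, where \<open>inverse 0 = \<infinity>\<close>.\<close>

definition good_set_at ::
  "real \<Rightarrow> (nat \<Rightarrow> nat) \<Rightarrow> (nat \<Rightarrow> nat \<Rightarrow> real) \<Rightarrow> (nat \<Rightarrow> nat \<Rightarrow> complex) \<Rightarrow> real \<Rightarrow> nat \<Rightarrow> complex set"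
  where
  "good_set_at \<gamma> l a c \<epsilon> N =
     {z. \<forall>i\<in>{1..l N}.
        min (ereal (a N i * ln (real N))) (inverse (ereal \<bar>1 - (cmod (z - c N i))\<^sup>2\<bar>))
          < ereal (real N powr (2 * \<gamma> - 1 - \<epsilon>))}"

definition good_set ::
  "real \<Rightarrow> (nat \<Rightarrow> nat) \<Rightarrow> (nat \<Rightarrow> nat \<Rightarrow> real) \<Rightarrow> (nat \<Rightarrow> nat \<Rightarrow> complex) \<Rightarrow> real \<Rightarrow> complex set" where
  "good_set \<gamma> l a c \<epsilon> = (\<Union>k\<in>{1..}. \<Inter>N\<in>{k..}. good_set_at \<gamma> l a c \<epsilon> N)"

end

theory Submission
  imports Defs "HOL-Real_Asymp.Real_Asymp" "HOL-Complex_Analysis.Complex_Analysis"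
begin

text \<open>
  Write \<open>\<beta> = \<gamma> - 1/2\<close>. For almost every \<open>z\<close>, \<open>ln \<bar>det (M + N powr (-\<gamma>) G - z)\<bar>\<close> is, in probability, within \<open>o(N)\<close> of
  \<open>\<Sum>\<^sub>i ln (max \<bar>c\<^sub>i - z\<bar>^d\<^sub>i (N powr -\<beta>))\<close>, which is \<open>N\<close> times the logarithmic potential of \<open>\<mu>\<^sub>N\<close>.
  The upper bound is deterministic on the event that the operator norm of \<open>G\<close> is at most
  \<open>N powr (1/2 + \<eta>/2)\<close>: the perturbed matrix is compared with a well-conditioned matrix \<open>H\<close> obtained
  by repairing the blocks for which \<open>\<bar>c\<^sub>i - z\<bar>\<close> is close to one or \<open>\<bar>c\<^sub>i - z\<bar>^d\<^sub>i\<close> is negligible.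
  For the lower bound, the rows that were repaired carry fresh Gaussian noise, and expanding the
  determinant along them one at a time bounds the moment of order \<open>-1/2\<close> of the determinant.
  Both errors are integrable in \<open>z\<close>, so the potentials agree after integration against any bounded
  function of compact support. Every continuous function of compact support is a uniform limit of
  logarithmic potentials of such functions, and a cutoff argument extends the convergence from
  compactly supported to bounded continuous test functions.
\<close>

text \<open>The exponent \<beta> comes from counting placements. Each of the k repaired rows
  contributes a factor \<open>N powr (-\<gamma>)\<close>, and the k! permutations of their unit rows
  give minors of equal modulus, so the moment bound gains \<open>sqrt (fact k)\<close>. This
  replaces \<open>N powr (k/2)\<close> at a logarithmic cost O(sqrt (k N)), which is o(N) on average
  over z, because k is at most \<open>l N\<close> plus the dimension of the blocks near the unit
  circle. The obstacle is non-normality: inverting a block with |w| < 1 costs about |w|^(-d).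
  Against noise of norm \<open>N powr (-\<beta> + \<eta>/2)\<close> this is affordable when |w|^d is
  at least \<open>\<tau> = N powr (-\<beta> + \<eta>)\<close>; the gap
  \<open>N powr (-\<eta>/2)\<close> absorbs every power of ln N. The threshold costs \<eta> ln N per
  decaying block, and \<open>l N * ln N\<close> need not be o(N). But a decaying block has d * (- ln
  |w|) at least (\<beta> - \<eta>) ln N, so this cost is charged to the integrable singularities of
  ln |c - z|: in total 16 N \<eta> / (\<beta> - \<eta>) after integration in z, which disappears
  when \<eta> tends to 0 after N tends to infinity.\<close>

hide_const (open) Finite_Cartesian_Product.mat Finite_Cartesian_Product.vec Determinants.det

section \<open>Determinants\<close>

text \<open>A matrix is represented by its entry function, of which only the values at indices below the
  dimension matter, so that a row can be replaced by a plain function update.\<close>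

definition dt :: "nat \<Rightarrow> (nat \<Rightarrow> nat \<Rightarrow> complex) \<Rightarrow> complex" where
  "dt n f = det (mat n n (\<lambda>(i, j). f i j))"

definition mv :: "nat \<Rightarrow> (nat \<Rightarrow> nat \<Rightarrow> complex) \<Rightarrow> (nat \<Rightarrow> complex) \<Rightarrow> nat \<Rightarrow> complex" where
  "mv n f v i = (\<Sum>j<n. f i j * v j)"

lemma mult_mat_vec_mv:
  assumes "i < n" "v \<in> carrier_vec n"
  shows "vec_index (mat n n (\<lambda>(i, j). f i j) *\<^sub>v v) i = mv n f (vec_index v) i"
  using assms by (auto simp: mv_def scalar_prod_def lessThan_atLeast0 intro!: sum.cong)

lemma prod_list_le_power:
  fixes xs :: "real list"
  assumes "\<And>x. x \<in> set xs \<Longrightarrow> 0 \<le> x \<and> x \<le> q"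
  shows "prod_list xs \<le> q ^ length xs \<and> 0 \<le> prod_list xs"
  using assms
proof (induction xs)
  case (Cons x xs)
  then have "0 \<le> x" "x \<le> q" "prod_list xs \<le> q ^ length xs" "0 \<le> prod_list xs" by auto
  then show ?case by (auto intro!: mult_mono)
qed simp

lemma cmod_poly_linear_factors:
  "cmod (poly (\<Prod>a\<leftarrow>as. [:- a, 1:]) z) = (\<Prod>a\<leftarrow>as. cmod (z - a))"
proof (induction as)
  case (Cons a as)
  have "poly (\<Prod>a\<leftarrow>a # as. [:- a, 1:]) z = (z - a) * poly (\<Prod>a\<leftarrow>as. [:- a, 1:]) z"
    by (simp add: algebra_simps)
  then show ?case using Cons by (simp add: norm_mult del: poly_mult)
qed simp

lemma cmod_det_sub_scalar:
  fixes A :: "complex mat"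
  assumes A: "A \<in> carrier_mat n n" and "char_poly A = (\<Prod>a\<leftarrow>as. [:- a, 1:])"
  shows "cmod (det (A - z \<cdot>\<^sub>m 1\<^sub>m n)) = (\<Prod>a\<leftarrow>as. cmod (z - a))"
proof -
  have 1: "- char_matrix A z = (-1) \<cdot>\<^sub>m (A - z \<cdot>\<^sub>m 1\<^sub>m n)"
    using A by (intro eq_matI) (auto simp: char_matrix_def)
  have "poly (char_poly A) z = (-1) ^ n * det (A - z \<cdot>\<^sub>m 1\<^sub>m n)"
    unfolding char_poly_matrix[OF A] 1 using A by (subst det_smult) auto
  then have "cmod (det (A - z \<cdot>\<^sub>m 1\<^sub>m n)) = cmod (poly (char_poly A) z)"
    by (simp add: norm_mult norm_power)
  then show ?thesis
    unfolding assms(2) cmod_poly_linear_factors .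
qed

lemma cmod_det_le_of_eigenvalue_le:
  fixes M :: "complex mat"
  assumes M: "M \<in> carrier_mat n n" and ev: "\<And>a. eigenvalue M a \<Longrightarrow> cmod a \<le> q"
  shows "cmod (det M) \<le> q ^ n"
proof -
  obtain as where as: "char_poly M = (\<Prod>a\<leftarrow>as. [:- a, 1:])" "length as = n"
    using char_poly_factorized[OF M] by auto
  have "M - 0 \<cdot>\<^sub>m 1\<^sub>m n = M" using M by (intro eq_matI) auto
  with cmod_det_sub_scalar[OF M as(1), of 0]
  have d: "cmod (det M) = (\<Prod>a\<leftarrow>as. cmod a)" by simp
  have "cmod a \<le> q" if "a \<in> set as" for a
  proof (rule ev)
    have "poly (\<Prod>a\<leftarrow>as. [:- a, 1:]) a = 0"
      using that by (simp add: poly_prod_list prod_list_zero_iff)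
    then show "eigenvalue M a" using eigenvalue_root_char_poly[OF M] as by simp
  qed
  then have "prod_list (map cmod as) \<le> q ^ length (map cmod as)"
    by (intro conjunct1[OF prod_list_le_power]) auto
  then show ?thesis using d as by simp
qed

text \<open>If \<open>A\<close> is invertible, every eigenvalue of \<open>B inverse A\<close> has modulus at most \<open>q\<close>.\<close>

lemma cmod_dt_le:
  assumes le: "\<And>v. (\<Sum>i<n. (cmod (mv n B v i))\<^sup>2) \<le> q\<^sup>2 * (\<Sum>i<n. (cmod (mv n A v i))\<^sup>2)"
    and q: "0 \<le> q"
  shows "cmod (dt n B) \<le> q ^ n * cmod (dt n A)"
proof -
  define mA where "mA = mat n n (\<lambda>(i, j). A i j)"
  define mB where "mB = mat n n (\<lambda>(i, j). B i j)"
  have cA: "mA \<in> carrier_mat n n" and cB: "mB \<in> carrier_mat n n"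
    by (auto simp: mA_def mB_def)
  have le': "(\<Sum>i<n. (cmod (vec_index (mB *\<^sub>v v) i))\<^sup>2) \<le> q\<^sup>2 * (\<Sum>i<n. (cmod (vec_index (mA *\<^sub>v v) i))\<^sup>2)"
    if "v \<in> carrier_vec n" for v
    using le[of "vec_index v"] that by (simp add: mA_def mB_def mult_mat_vec_mv del: index_mult_mat_vec)
  show ?thesis
  proof (cases "det mA = 0")
    \<comment> \<open>In the singular case the hypothesis puts the kernel of A inside the kernel of
      B, so both determinants vanish.\<close>
    case True
    then obtain v where v: "v \<in> carrier_vec n" "v \<noteq> 0\<^sub>v n" "mA *\<^sub>v v = 0\<^sub>v n"
      using det_0_iff_vec_prod_zero[OF cA] by auto
    from le'[OF v(1)] v(3) have "(\<Sum>i<n. (cmod (vec_index (mB *\<^sub>v v) i))\<^sup>2) \<le> 0"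
      by simp
    then have "(\<Sum>i<n. (cmod (vec_index (mB *\<^sub>v v) i))\<^sup>2) = 0"
      by (intro antisym sum_nonneg) auto
    then have "\<forall>i<n. vec_index (mB *\<^sub>v v) i = 0"
      by (subst (asm) sum_nonneg_eq_0_iff) auto
    then have "mB *\<^sub>v v = 0\<^sub>v n" using cB by (intro eq_vecI) auto
    with v have "det mB = 0" using det_0_iff_vec_prod_zero[OF cB] by auto
    then show ?thesis using q by (simp add: dt_def mB_def)
  next
    case False
    then obtain C where C: "C \<in> carrier_mat n n" "mA * C = 1\<^sub>m n"
      using det_non_zero_imp_unit[OF cA, of undefined] by (auto simp: Units_def ring_mat_def)
    have "cmod (det (mB * C)) \<le> q ^ n"
    proof (rule cmod_det_le_of_eigenvalue_le)
      show "mB * C \<in> carrier_mat n n" using cB C by auto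
      fix a assume "eigenvalue (mB * C) a"
      then obtain u where u: "u \<in> carrier_vec n" "u \<noteq> 0\<^sub>v n" "(mB * C) *\<^sub>v u = a \<cdot>\<^sub>v u"
        using cB C by (auto simp: eigenvalue_def eigenvector_def)
      \<comment> \<open>With v = C u one has A v = u and B v = a u, so the hypothesis compares |a|
        with q on the single vector u.\<close>
      define v where "v = C *\<^sub>v u"
      have v: "v \<in> carrier_vec n" "mA *\<^sub>v v = u" "mB *\<^sub>v v = a \<cdot>\<^sub>v u"
        using C(1) u(1,3) assoc_mult_mat_vec[OF cA C(1) u(1)] assoc_mult_mat_vec[OF cB C(1) u(1)]
        by (simp_all add: v_def C(2))
      define S where "S = (\<Sum>i<n. (cmod (vec_index u i))\<^sup>2)"
      have "(\<Sum>i<n. (cmod (vec_index (a \<cdot>\<^sub>v u) i))\<^sup>2) = (cmod a)\<^sup>2 * S"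
        using u by (auto simp: S_def sum_distrib_left norm_mult power_mult_distrib intro!: sum.cong)
      then have *: "(cmod a)\<^sup>2 * S \<le> q\<^sup>2 * S"
        using le'[OF v(1)] unfolding v S_def by simp
      have "S \<ge> 0" by (simp add: S_def sum_nonneg)
      moreover have "S \<noteq> 0"
      proof
        assume "S = 0"
        then have "\<forall>i<n. vec_index u i = 0"
          by (auto simp: S_def sum_nonneg_eq_0_iff)
        with u show False by auto
      qed
      ultimately have "(cmod a)\<^sup>2 \<le> q\<^sup>2" using * by simp
      then show "cmod a \<le> q" using q by (simp add: power2_le_iff_abs_le)
    qed
    moreover have "det mA * det C = 1"
      using det_mult[OF cA C(1)] C by simp
    then have "cmod (det mA) * cmod (det C) = 1"
      by (metis norm_mult norm_one)
    moreover have "cmod (det (mB * C)) = cmod (det mB) * cmod (det C)"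
      using det_mult[OF cB C(1)] by (simp add: norm_mult)
    ultimately have "cmod (det mB) * cmod (det C) * cmod (det mA) \<le> q ^ n * cmod (det mA)"
      by (metis mult_right_mono norm_ge_zero)
    moreover have "cmod (det mB) * cmod (det C) * cmod (det mA) = cmod (det mB)"
      using \<open>cmod (det mA) * cmod (det C) = 1\<close> by (simp add: mult.assoc mult.commute[of "cmod (det C)"])
    ultimately have "cmod (det mB) \<le> q ^ n * cmod (det mA)" by argo
    then show ?thesis by (simp add: dt_def mA_def mB_def)
  qed
qed

lemma dt_scale_rows: "dt n (\<lambda>i j. s i * f i j) = (\<Prod>i<n. s i) * dt n f"
proof -
  have "det (mat n n (\<lambda>(i, j). s i * f i j)) = (\<Prod>i<n. s i) * det (mat n n (\<lambda>(i, j). f i j))"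
    by (simp add: det_def prod.distrib sum_distrib_left lessThan_atLeast0 mult_ac permutes_in_image)
  then show ?thesis by (simp add: dt_def)
qed

lemma dt_cong: "(\<And>i j. i < n \<Longrightarrow> j < n \<Longrightarrow> f i j = g i j) \<Longrightarrow> dt n f = dt n g"
  unfolding dt_def by (intro arg_cong[of _ _ det] eq_matI) auto

text \<open>Scaling rows multiplies a determinant by the product of the weights, so
  \<open>cmod_dt_le\<close> applies to the scaled matrices. Separate weights s and t account for
  each row's gain individually, instead of charging the worst row n times.\<close>

lemma cmod_dt_weighted_le:
  fixes s t :: "nat \<Rightarrow> real"
  assumes le: "\<And>v. (\<Sum>i<n. (s i * cmod (mv n B v i))\<^sup>2) \<le> q\<^sup>2 * (\<Sum>i<n. (t i * cmod (mv n A v i))\<^sup>2)"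
    and q: "0 \<le> q" and s: "\<And>i. i < n \<Longrightarrow> 0 \<le> s i" and t: "\<And>i. i < n \<Longrightarrow> 0 \<le> t i"
  shows "(\<Prod>i<n. s i) * cmod (dt n B) \<le> q ^ n * ((\<Prod>i<n. t i) * cmod (dt n A))"
proof -
  have mvs: "mv n (\<lambda>i j. complex_of_real (r i) * F i j) v i = complex_of_real (r i) * mv n F v i" for r F v i
    by (simp add: mv_def sum_distrib_left mult.assoc)
  have "cmod (dt n (\<lambda>i j. complex_of_real (s i) * B i j)) \<le> q ^ n * cmod (dt n (\<lambda>i j. complex_of_real (t i) * A i j))"
    by (rule cmod_dt_le) (use le q s t in \<open>auto simp: mvs norm_mult power_mult_distrib\<close>)
  moreover have "(\<Prod>i<n. \<bar>s i\<bar>) = (\<Prod>i<n. s i)" "(\<Prod>i<n. \<bar>t i\<bar>) = (\<Prod>i<n. t i)"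
    using s t by (auto intro!: prod.cong)
  ultimately show ?thesis
    by (simp add: dt_scale_rows norm_mult prod_norm[symmetric])
qed

definition unit_row :: "nat \<Rightarrow> nat \<Rightarrow> complex" where
  "unit_row j k = (if k = j then 1 else 0)"

text \<open>Laplace expansion: the cofactors along row p do not see that row, and each is the
  determinant with a unit vector in its place. Minors can therefore be handled as determinants of
  the full size n.\<close>

lemma dt_expand_row:
  assumes p: "p < n"
  shows "dt n (f(p := r)) = (\<Sum>j<n. r j * dt n (f(p := unit_row j)))"
proof -
  define M where "M r = mat n n (\<lambda>(i, j). (f(p := r)) i j)" for r
  have del: "mat_delete (M r) p j = mat_delete (M r') p j" for r r' j
    by (rule eq_matI) (auto simp: M_def mat_delete_def)
  have lap: "det (M r) = (\<Sum>j<n. r j * cofactor (M r) p j)" for r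
    using laplace_expansion_row[of "M r" n p] p by (auto simp: M_def lessThan_atLeast0)
  have cof: "cofactor (M r) p j = cofactor (M r') p j" for r r' j
    using del[of r j r'] by (simp add: cofactor_def)
  have "det (M (unit_row j)) = cofactor (M r) p j" if "j < n" for j
    unfolding lap[of "unit_row j"] cof[of "unit_row j" _ r] unit_row_def
    using that by (simp add: if_distrib[of "\<lambda>x. x * _"] cong: if_cong)
  with lap[of r] show ?thesis
    by (simp add: dt_def M_def del: fun_upd_apply)
qed

lemma cmod_dt_permute_rows:
  assumes "\<sigma> permutes {..<n}"
  shows "cmod (dt n (\<lambda>i. f (\<sigma> i))) = cmod (dt n f)"
proof -
  have s: "\<sigma> permutes {0..<n}" using assms by (simp add: lessThan_atLeast0)
  have "det (mat n n (\<lambda>(i, j). mat n n (\<lambda>(i, j). f i j) $$ (\<sigma> i, j)))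
     = signof \<sigma> * det (mat n n (\<lambda>(i, j). f i j))"
    by (rule det_permute_rows) (use s in auto)
  moreover have "mat n n (\<lambda>(i, j). mat n n (\<lambda>(i, j). f i j) $$ (\<sigma> i, j)) = mat n n (\<lambda>(i, j). f (\<sigma> i) j)"
    using s by (intro eq_matI) (auto simp: permutes_in_image)
  ultimately show ?thesis
    by (auto simp: dt_def norm_mult sign_def)
qed

section \<open>Block-diagonal matrices and Jordan blocks\<close>

abbreviation boff :: "(nat \<Rightarrow> nat) \<Rightarrow> nat \<Rightarrow> nat" where
  "boff d i \<equiv> (\<Sum>k<i. d k)"

definition bdiag :: "nat \<Rightarrow> (nat \<Rightarrow> nat) \<Rightarrow> (nat \<Rightarrow> nat \<Rightarrow> nat \<Rightarrow> complex) \<Rightarrow> complex mat" where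
  "bdiag m d b = diag_block_mat (map (\<lambda>i. mat (d i) (d i) (\<lambda>(j, k). b i j k)) [0..<m])"

lemma bdiag_0: "bdiag 0 d b = 0\<^sub>m 0 0"
  by (simp add: bdiag_def)

lemma dim_bdiag: "bdiag m d b \<in> carrier_mat (boff d m) (boff d m)"
proof -
  have "(\<Sum>x\<leftarrow>[0..<m]. d x) = boff d m"
    by (simp add: interv_sum_list_conv_sum_set_nat lessThan_atLeast0)
  then show ?thesis
    by (intro carrier_matI) (simp_all add: bdiag_def dim_diag_block_mat o_def)
qed

lemma bdiag_Suc:
  "bdiag (Suc m) d b = four_block_mat (bdiag m d b) (0\<^sub>m (boff d m) (d m)) (0\<^sub>m (d m) (boff d m))
     (mat (d m) (d m) (\<lambda>(j, k). b m j k))"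
  using dim_bdiag[of m d b] by (simp add: bdiag_def diag_block_mat_last Let_def)

lemma det_bdiag: "det (bdiag m d b) = (\<Prod>i<m. dt (d i) (b i))"
proof (induction m)
  case 0
  then show ?case by (simp add: bdiag_0)
next
  case (Suc m)
  have "det (bdiag (Suc m) d b) = det (bdiag m d b) * det (mat (d m) (d m) (\<lambda>(j, k). b m j k))"
    unfolding bdiag_Suc by (rule det_four_block_mat_lower_left_zero) (use dim_bdiag in auto)
  then show ?case using Suc by (simp add: dt_def)
qed

definition bd :: "nat \<Rightarrow> (nat \<Rightarrow> nat) \<Rightarrow> (nat \<Rightarrow> nat \<Rightarrow> nat \<Rightarrow> complex) \<Rightarrow> nat \<Rightarrow> nat \<Rightarrow> complex" where
  "bd m d b p q = bdiag m d b $$ (p, q)"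

lemma dt_bd: "dt (boff d m) (bd m d b) = (\<Prod>i<m. dt (d i) (b i))"
proof -
  have "mat (boff d m) (boff d m) (\<lambda>(i, j). bd m d b i j) = bdiag m d b"
    using dim_bdiag[of m d b] by (intro eq_matI) (auto simp: bd_def)
  then show ?thesis by (simp add: dt_def det_bdiag)
qed

lemma boff_mono: "i \<le> m \<Longrightarrow> boff d i \<le> boff d m"
  by (rule sum_mono2) auto

lemma boff_less: "i < m \<Longrightarrow> j < d i \<Longrightarrow> boff d i + j < boff d m"
  using boff_mono[of "Suc i" m d] by simp

lemma sum_boff: "(\<Sum>p<boff d m. F p) = (\<Sum>i<m. \<Sum>j<d i. F (boff d i + j))" for F :: "nat \<Rightarrow> 'a::comm_monoid_add"
proof (induction m)
  case (Suc m)
  have "(\<Sum>p<boff d (Suc m). F p) = (\<Sum>p<boff d m. F p) + (\<Sum>p=boff d m..<boff d m + d m. F p)"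
    by (simp add: lessThan_atLeast0 sum.atLeastLessThan_concat)
  also have "(\<Sum>p=boff d m..<boff d m + d m. F p) = (\<Sum>j<d m. F (boff d m + j))"
    using sum.shift_bounds_nat_ivl[of F 0 "boff d m" "d m"] by (simp add: lessThan_atLeast0 add.commute)
  finally show ?case using Suc by simp
qed simp

lemma bd_block:
  "p < boff d m \<Longrightarrow> q < boff d m \<Longrightarrow> bd (Suc m) d b p q = bd m d b p q"
  "j < d m \<Longrightarrow> k < d m \<Longrightarrow> bd (Suc m) d b (boff d m + j) (boff d m + k) = b m j k"
  "j < d m \<Longrightarrow> q < boff d m \<Longrightarrow> bd (Suc m) d b (boff d m + j) q = 0"
  "p < boff d m \<Longrightarrow> k < d m \<Longrightarrow> bd (Suc m) d b p (boff d m + k) = 0"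
  using dim_bdiag[of m d b] by (simp_all add: bd_def bdiag_Suc)

lemma mv_bd:
  assumes "i < m" "j < d i"
  shows "mv (boff d m) (bd m d b) v (boff d i + j) = mv (d i) (b i) (\<lambda>k. v (boff d i + k)) j"
  using assms
proof (induction m)
  case (Suc m)
  have split: "mv (boff d (Suc m)) (bd (Suc m) d b) v p
      = (\<Sum>q<boff d m. bd (Suc m) d b p q * v q) + (\<Sum>k<d m. bd (Suc m) d b p (boff d m + k) * v (boff d m + k))" for p
    unfolding mv_def sum_boff[where m = "Suc m" and d = d] sum_boff[where m = m and d = d] by simp
  show ?case
  proof (cases "i = m")
    case True
    then show ?thesis using Suc.prems unfolding split by (simp add: bd_block mv_def)
  next
    case False
    with Suc.prems have i: "i < m" by simp
    have p: "boff d i + j < boff d m" using boff_less[OF i] Suc.prems by simp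
    have "mv (boff d (Suc m)) (bd (Suc m) d b) v (boff d i + j) = mv (boff d m) (bd m d b) v (boff d i + j)"
      unfolding split using p by (simp add: bd_block mv_def)
    then show ?thesis using Suc.IH[OF i Suc.prems(2)] by simp
  qed
qed simp

lemma jordan_matrix_bdiag:
  "jordan_matrix (map (\<lambda>i. (d i, c i)) [0..<m])
     = bdiag m d (\<lambda>i j k. if j = k then c i else if Suc j = k then 1 else 0)"
  by (simp add: jordan_matrix_def bdiag_def jordan_block_def o_def)

lemma bd_diag: "p < boff d m \<Longrightarrow> 
  \<exists>i<m. \<exists>j<d i. p = boff d i + j"
proof (induction m)
  case (Suc m)
  show ?case
  proof (cases "p < boff d m")
    case True
    with Suc show ?thesis by (meson less_Suc_eq)
  next
    case False
    with Suc.prems show ?thesis by (intro exI[of _ m] conjI exI[of _ "p - boff d m"]) auto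
  qed
qed simp

lemma bd_sub_diag:
  assumes "p < boff d m" "q < boff d m"
  shows "bd m d b p q - (if p = q then z else 0) = bd m d (\<lambda>i j k. b i j k - (if j = k then z else 0)) p q"
  using assms
proof (induction m)
  case (Suc m)
  consider "p < boff d m" "q < boff d m" | j k where "p = boff d m + j" "q = boff d m + k" "j < d m" "k < d m"
    | j where "p = boff d m + j" "j < d m" "q < boff d m" | k where "q = boff d m + k" "k < d m" "p < boff d m"
    using Suc.prems by (simp, metis add.commute add_less_cancel_right le_add_diff_inverse2 not_less)
  then show ?case
    by cases (use Suc.IH in \<open>auto simp: bd_block\<close>)
qed simp

lemma boff_inject:
  assumes "boff d i + j = boff d i' + j'" "j < d i" "j' < d i'"
  shows "i = i' \<and> j = j'"
proof -
  have "\<not> i < i'" using boff_less[of i i' j d] assms by auto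
  moreover have "\<not> i' < i" using boff_less[of i' i j' d] assms by auto
  ultimately have "i = i'" by simp
  with assms show ?thesis by simp
qed

text \<open>For w = 0 this is the matrix of a cyclic permutation. In general it differs from that
  isometry by a matrix of norm at most |w|, so for |w| < 1 its inverse has norm at most 1 / (1 -
  |w|).\<close>

definition cyc_rows :: "nat \<Rightarrow> complex \<Rightarrow> nat \<Rightarrow> nat \<Rightarrow> complex" where
  "cyc_rows d w j k = (if Suc j < d then (if j = k then w else if Suc j = k then 1 else 0)
                       else (if k = 0 then 1 else 0))"

lemma dt_upper_const:
  assumes "\<And>j k. k < j \<Longrightarrow> j < d \<Longrightarrow> f j k = 0" "\<And>j. j < d \<Longrightarrow> f j j = w"
  shows "dt d f = w ^ d"
proof -
  have "det (mat d d (\<lambda>(i, j). f i j)) = prod_list (diag_mat (mat d d (\<lambda>(i, j). f i j)))"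
    by (rule det_upper_triangular[of _ d]) (use assms in auto)
  also have "diag_mat (mat d d (\<lambda>(i, j). f i j)) = replicate d w"
    using assms by (auto simp: diag_mat_def intro!: nth_equalityI)
  finally show ?thesis by (simp add: dt_def)
qed

text \<open>Expansion along the last row leaves a single minor, and deleting the first column moves
  the superdiagonal of ones onto the diagonal of a lower triangular matrix.\<close>

lemma cmod_dt_cyc_rows:
  assumes d: "0 < d"
  shows "cmod (dt d (cyc_rows d w)) = 1"
proof -
  obtain m where m: "d = Suc m" using d by (cases d) auto
  let ?M = "mat d d (\<lambda>(i, j). cyc_rows d w i j)"
  have "det ?M = (\<Sum>j<d. ?M $$ (m, j) * cofactor ?M m j)"
    using laplace_expansion_row[of ?M d m] by (simp add: m)
  also have "\<dots> = (\<Sum>j<d. if j = 0 then cofactor ?M m j else 0)"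
    by (intro sum.cong) (auto simp: cyc_rows_def m)
  also have "\<dots> = cofactor ?M m 0" using d by simp
  finally have 1: "cmod (det ?M) = cmod (det (mat_delete ?M m 0))"
    by (simp add: cofactor_def norm_mult norm_power)
  let ?L = "mat m m (\<lambda>(i, j). if i = Suc j then w else if i = j then (1::complex) else 0)"
  have del: "mat_delete ?M m 0 = ?L"
    by (intro eq_matI) (auto simp: mat_delete_def m cyc_rows_def)
  have "det ?L = prod_list (diag_mat ?L)"
    by (rule det_lower_triangular[of m]) auto
  also have "diag_mat ?L = replicate m 1"
    by (auto simp: diag_mat_def intro!: nth_equalityI)
  finally show ?thesis using 1 del by (simp add: dt_def)
qed

section \<open>Euclidean norm bounds for single blocks\<close>

abbreviation l2 :: "nat \<Rightarrow> (nat \<Rightarrow> complex) \<Rightarrow> real" where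
  "l2 d x \<equiv> L2_set (\<lambda>j. cmod (x j)) {..<d}"

definition jmul :: "nat \<Rightarrow> complex \<Rightarrow> (nat \<Rightarrow> complex) \<Rightarrow> nat \<Rightarrow> complex" where
  "jmul d w x j = w * x j + (if Suc j < d then x (Suc j) else 0)"

definition cmul :: "nat \<Rightarrow> complex \<Rightarrow> (nat \<Rightarrow> complex) \<Rightarrow> nat \<Rightarrow> complex" where
  "cmul d w x j = (if Suc j < d then w * x j + x (Suc j) else x 0)"

lemma l2_cmult: "l2 d (\<lambda>j. w * x j) = cmod w * l2 d x"
  using L2_set_right_distrib[of "cmod w" "\<lambda>j. cmod (x j)" "{..<d}"] by (simp add: norm_mult)

lemma l2_triangle: "l2 d (\<lambda>j. x j + y j) \<le> l2 d x + l2 d y"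
proof -
  have "l2 d (\<lambda>j. x j + y j) \<le> L2_set (\<lambda>j. cmod (x j) + cmod (y j)) {..<d}"
    by (rule L2_set_mono) (auto intro: norm_triangle_ineq)
  also note L2_set_triangle_ineq
  finally show ?thesis .
qed

lemma l2_shift_up: "l2 d (\<lambda>j. if Suc j < d then x (Suc j) else 0) \<le> l2 d x"
proof (cases d)
  case (Suc m)
  have "(\<Sum>j<Suc m. (cmod (if Suc j < Suc m then x (Suc j) else 0))\<^sup>2) = (\<Sum>j<m. (cmod (x (Suc j)))\<^sup>2)"
    by simp
  also have "\<dots> \<le> (\<Sum>j<Suc m. (cmod (x j))\<^sup>2)"
    by (subst sum.lessThan_Suc_shift) simp
  finally show ?thesis by (simp add: L2_set_def Suc)
qed simp

lemma l2_shift_down: "l2 d (\<lambda>j. if j = 0 then 0 else x (j - 1)) \<le> l2 d x"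
proof (cases d)
  case (Suc m)
  have "(\<Sum>j<Suc m. (cmod (if j = 0 then 0 else x (j - 1)))\<^sup>2) = (\<Sum>j<m. (cmod (x j))\<^sup>2)"
    by (subst sum.lessThan_Suc_shift) simp
  also have "\<dots> \<le> (\<Sum>j<Suc m. (cmod (x j))\<^sup>2)"
    by simp
  finally show ?thesis by (simp add: L2_set_def Suc)
qed simp

lemma l2_jmul_le: "l2 d (jmul d w x) \<le> (cmod w + 1) * l2 d x"
proof -
  have "l2 d (jmul d w x) \<le> l2 d (\<lambda>j. w * x j) + l2 d (\<lambda>j. if Suc j < d then x (Suc j) else 0)"
    unfolding jmul_def by (rule l2_triangle)
  then show ?thesis using l2_shift_up[of d x] by (simp add: l2_cmult algebra_simps)
qed

text \<open>The block is w times the identity plus a shift of norm at most 1.\<close>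

lemma l2_le_jmul_large:
  "(cmod w - 1) * l2 d x \<le> l2 d (jmul d w x)"
proof -
  have "l2 d (\<lambda>j. w * x j) = l2 d (\<lambda>j. jmul d w x j + (-1) * (if Suc j < d then x (Suc j) else 0))"
    by (simp add: jmul_def if_distrib cong: if_cong)
  also have "\<dots> \<le> l2 d (jmul d w x) + l2 d (\<lambda>j. (-1) * (if Suc j < d then x (Suc j) else 0))"
    by (rule l2_triangle)
  finally show ?thesis
    using l2_shift_up[of d x] unfolding l2_cmult by (simp add: algebra_simps)
qed

lemma l2_sq: "(l2 d x)\<^sup>2 = (\<Sum>j<d. (cmod (x j))\<^sup>2)"
  by (simp add: L2_set_def sum_nonneg)

lemma cmod_le_l2: "j < d \<Longrightarrow> cmod (x j) \<le> l2 d x"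
  using member_le_L2_set[of "{..<d}" j "\<lambda>j. cmod (x j)"] by simp

lemma sum_cmod_le_l2: "(\<Sum>j<d. cmod (x j)) \<le> sqrt d * l2 d x"
proof -
  have "(\<Sum>j<d. \<bar>cmod (x j)\<bar> * \<bar>1\<bar>) \<le> l2 d x * L2_set (\<lambda>_. 1) {..<d}"
    by (rule L2_set_mult_ineq)
  then show ?thesis by (simp add: L2_set_def mult.commute)
qed

lemma l2_le_of_bound:
  assumes "\<And>j. j < d \<Longrightarrow> cmod (x j) \<le> b" "0 \<le> b"
  shows "l2 d x \<le> sqrt d * b"
proof -
  have "l2 d x \<le> L2_set (\<lambda>_. b) {..<d}"
    by (rule L2_set_mono) (use assms in auto)
  then show ?thesis using assms(2) by (simp add: L2_set_def real_sqrt_mult)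
qed

text \<open>Back substitution from the last coordinate divides by w at every step, hence the loss of
  |w|^d. The factor d is sqrt d for passing from the maximum to the Euclidean norm times sqrt d for
  bounding a sum of moduli by the Euclidean norm.\<close>

lemma l2_le_jmul_small:
  assumes w: "w \<noteq> 0" "cmod w \<le> 1"
  shows "cmod w ^ d * l2 d x \<le> real d * l2 d (jmul d w x)"
proof -
  have key: "cmod w ^ (d - j) * cmod (x j) \<le> (\<Sum>i=j..<d. cmod (jmul d w x i))" if "j < d" for j
    using that
  proof (induction "d - j" arbitrary: j)
    case (Suc m j)
    have x: "w * x j = jmul d w x j - (if Suc j < d then x (Suc j) else 0)"
      by (simp add: jmul_def)
    have p: "cmod w ^ (d - Suc j) \<le> 1" using w by (simp add: power_le_one)
    have eq: "cmod w ^ (d - j) * cmod (x j) = cmod w ^ (d - Suc j) * cmod (w * x j)"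
      using Suc.prems by (simp add: norm_mult Suc_diff_Suc[symmetric])
    also have "\<dots> \<le> cmod w ^ (d - Suc j) * (cmod (jmul d w x j) + cmod (if Suc j < d then x (Suc j) else 0))"
      unfolding x by (intro mult_left_mono norm_triangle_ineq4) auto
    also have "\<dots> \<le> cmod (jmul d w x j) + cmod w ^ (d - Suc j) * cmod (if Suc j < d then x (Suc j) else 0)"
      using mult_right_mono[OF p, of "cmod (jmul d w x j)"] by (simp add: algebra_simps)
    also have "cmod w ^ (d - Suc j) * cmod (if Suc j < d then x (Suc j) else 0) \<le> (\<Sum>i=Suc j..<d. cmod (jmul d w x i))"
      using Suc.hyps(1)[of "Suc j"] Suc.hyps(2) by auto
    finally show ?case using Suc.prems by (simp add: sum.atLeast_Suc_lessThan)
  qed simp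
  have b: "cmod w ^ d * cmod (x j) \<le> (\<Sum>i<d. cmod (jmul d w x i))" if "j < d" for j
  proof -
    have "cmod w ^ d * cmod (x j) \<le> cmod w ^ (d - j) * cmod (x j)"
      using w by (intro mult_right_mono power_decreasing) auto
    also note key[OF that]
    also have "(\<Sum>i=j..<d. cmod (jmul d w x i)) \<le> (\<Sum>i<d. cmod (jmul d w x i))"
      by (rule sum_mono2) auto
    finally show ?thesis .
  qed
  have "l2 d (\<lambda>j. w ^ d * x j) \<le> sqrt d * (\<Sum>i<d. cmod (jmul d w x i))"
    by (rule l2_le_of_bound) (use b in \<open>auto simp: norm_mult norm_power sum_nonneg\<close>)
  also have "\<dots> \<le> sqrt d * (sqrt d * l2 d (jmul d w x))"
    by (intro mult_left_mono sum_cmod_le_l2) auto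
  finally show ?thesis by (simp add: l2_cmult norm_power mult.assoc[symmetric])
qed

lemma l2_le_cmul:
  assumes d: "0 < d"
  shows "(1 - cmod w) * l2 d x \<le> l2 d (cmul d w x)"
proof -
  define y where "y = cmul d w x"
  \<comment> \<open>Reading the entries of y one place later, cyclically, is an isometry. It aligns
    y with x: the last row of the block returns \<open>x 0\<close>, and row j - 1 returns
    \<open>x j\<close> up to \<open>w * x (j - 1)\<close>.\<close>
  define y' where "y' j = (if j = 0 then y (d - 1) else y (j - 1))" for j
  have x: "x j = y' j + (-w) * (if j = 0 then 0 else x (j - 1))" if "j < d" for j
    using that d by (auto simp: y'_def y_def cmul_def)
  obtain m where m: "d = Suc m" using d by (cases d) auto
  have "(\<Sum>j<Suc m. (cmod (y' j))\<^sup>2) = (\<Sum>j<Suc m. (cmod (y j))\<^sup>2)"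
    by (subst sum.lessThan_Suc_shift, subst sum.lessThan_Suc) (simp add: y'_def m)
  then have y': "l2 d y' = l2 d y" by (simp add: L2_set_def m)
  have "l2 d x = l2 d (\<lambda>j. y' j + (-w) * (if j = 0 then 0 else x (j - 1)))"
  proof (rule L2_set_cong[OF refl])
    fix j assume "j \<in> {..<d}"
    then have "j < d" by simp
    from arg_cong[OF x[OF this], of cmod]
    show "cmod (x j) = cmod (y' j + (-w) * (if j = 0 then 0 else x (j - 1)))" .
  qed
  also have "\<dots> \<le> l2 d y' + l2 d (\<lambda>j. (-w) * (if j = 0 then 0 else x (j - 1)))"
    by (rule l2_triangle)
  also have "\<dots> \<le> l2 d y + cmod w * l2 d x"
    unfolding l2_cmult y' using l2_shift_down[where x = x and d = d] by (auto intro!: mult_left_mono)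
  finally show ?thesis by (simp add: y_def algebra_simps)
qed

text \<open>The rows other than the last give the recursion x(j + 1) = y(j) - w x(j). The influence
  of x(0) decays like |w|^j, and the y(j) add up to a geometric series. Only the first d - 1 entries
  of y enter; the last one, which is x(0) itself, stays separate and can be given a weight of its
  own.\<close>

lemma cmul_last:
  assumes w: "cmod w < 1" and j: "j < d"
  shows "cmod (x j) \<le> cmod w ^ j * cmod (x 0) + l2 (d - 1) (cmul d w x) / (1 - cmod w)"
  using j
proof (induction j)
  case 0
  then show ?case using w by (simp add: L2_set_nonneg)
next
  case (Suc j)
  define Y where "Y = l2 (d - 1) (cmul d w x)"
  have "cmod (cmul d w x j) \<le> Y"
    unfolding Y_def by (rule cmod_le_l2) (use Suc.prems in auto)
  moreover have "x (Suc j) = cmul d w x j - w * x j"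
    using Suc.prems by (simp add: cmul_def)
  ultimately have "cmod (x (Suc j)) \<le> Y + cmod w * cmod (x j)"
    by (metis (no_types, lifting) add_mono_thms_linordered_semiring(3) norm_mult norm_triangle_ineq4 order_trans)
  also have "\<dots> \<le> Y + cmod w * (cmod w ^ j * cmod (x 0) + Y / (1 - cmod w))"
    using Suc by (intro add_left_mono mult_left_mono) (auto simp: Y_def)
  also have "\<dots> = cmod w ^ Suc j * cmod (x 0) + Y / (1 - cmod w)"
    using w by (simp add: field_simps)
  finally show ?case by (simp add: Y_def)
qed

text \<open>Together with \<open>loc\<close> this inverts the map from (i, j) to
  \<open>boff d i + j\<close>, so that weights indexed by block and position become weights indexed
  by rows.\<close>

definition blk :: "(nat \<Rightarrow> nat) \<Rightarrow> nat \<Rightarrow> nat" where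
  "blk d p = (LEAST i. p < boff d (Suc i))"

definition loc :: "(nat \<Rightarrow> nat) \<Rightarrow> nat \<Rightarrow> nat" where
  "loc d p = p - boff d (blk d p)"

lemma blk_boff: "j < d i \<Longrightarrow> blk d (boff d i + j) = i"
  unfolding blk_def
proof (rule Least_equality)
  fix k assume j: "j < d i" and k: "boff d i + j < boff d (Suc k)"
  show "i \<le> k"
  proof (rule ccontr)
    assume "\<not> i \<le> k"
    then have "boff d (Suc k) \<le> boff d i" by (intro boff_mono) auto
    with k show False by simp
  qed
qed simp

lemma loc_boff: "j < d i \<Longrightarrow> loc d (boff d i + j) = j"
  by (simp add: loc_def blk_boff)

lemma prod_boff: "(\<Prod>p<boff d m. F p) = (\<Prod>i<m. \<Prod>j<d i. F (boff d i + j))" for F :: "nat \<Rightarrow> 'a::comm_monoid_mult"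
proof (induction m)
  case (Suc m)
  have "(\<Prod>p<boff d (Suc m). F p) = (\<Prod>p<boff d m. F p) * (\<Prod>p=boff d m..<boff d m + d m. F p)"
    by (simp add: lessThan_atLeast0 prod.atLeastLessThan_concat)
  also have "(\<Prod>p=boff d m..<boff d m + d m. F p) = (\<Prod>j<d m. F (boff d m + j))"
    using prod.shift_bounds_nat_ivl[of F 0 "boff d m" "d m"] by (simp add: lessThan_atLeast0 add.commute)
  finally show ?case using Suc by simp
qed simp

lemma L2_set_boff_le:
  assumes le: "\<And>i. i < m \<Longrightarrow> L2_set (\<lambda>j. F (boff d i + j)) {..<d i} \<le> q * L2_set (\<lambda>j. G (boff d i + j)) {..<d i}"
    and q: "0 \<le> q"
  shows "L2_set F {..<boff d m} \<le> q * L2_set G {..<boff d m}"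
proof -
  have sq: "(L2_set f A)\<^sup>2 = (\<Sum>x\<in>A. (f x)\<^sup>2)" for f and A :: "nat set"
    by (simp add: L2_set_def sum_nonneg)
  have "(L2_set F {..<boff d m})\<^sup>2 = (\<Sum>i<m. (L2_set (\<lambda>j. F (boff d i + j)) {..<d i})\<^sup>2)"
    by (simp add: sq sum_boff)
  also have "\<dots> \<le> (\<Sum>i<m. (q * L2_set (\<lambda>j. G (boff d i + j)) {..<d i})\<^sup>2)"
    using le by (intro sum_mono power_mono) (auto simp: L2_set_nonneg)
  also have "\<dots> = (q * L2_set G {..<boff d m})\<^sup>2"
    by (simp add: sq sum_boff power_mult_distrib sum_distrib_left)
  finally show ?thesis
    by (rule power2_le_imp_le) (use q in \<open>simp add: L2_set_nonneg\<close>)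
qed

lemma mv_add: "mv n (\<lambda>i j. A i j + E i j) v p = mv n A v p + mv n E v p"
  by (simp add: mv_def distrib_right sum.distrib)

definition jrows :: "complex \<Rightarrow> nat \<Rightarrow> nat \<Rightarrow> complex" where
  "jrows w j k = (if j = k then w else if Suc j = k then 1 else 0)"

lemma mv_jrows:
  assumes "j < d" shows "mv d (jrows w) x j = jmul d w x j"
proof -
  have "mv d (jrows w) x j = (\<Sum>k<d. (if k = j then w * x k else 0) + (if k = Suc j then x k else 0))"
    unfolding mv_def jrows_def by (intro sum.cong) auto
  then show ?thesis using assms by (simp add: sum.distrib jmul_def)
qed

lemma mv_cyc_rows:
  assumes "j < d" shows "mv d (cyc_rows d w) x j = cmul d w x j"
proof (cases "Suc j < d")
  case True
  have "mv d (cyc_rows d w) x j = (\<Sum>k<d. (if k = j then w * x k else 0) + (if k = Suc j then x k else 0))"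
    unfolding mv_def cyc_rows_def using True by (intro sum.cong) auto
  then show ?thesis using True by (simp add: sum.distrib cmul_def)
next
  case False
  have "mv d (cyc_rows d w) x j = (\<Sum>k<d. (if k = 0 then x k else 0))"
    unfolding mv_def cyc_rows_def using False by (intro sum.cong) auto
  then show ?thesis using False assms by (simp add: cmul_def)
qed

lemma mv_unit_row:
  assumes "j < d" shows "mv d unit_row x j = x j"
proof -
  have "mv d unit_row x j = (\<Sum>k<d. if k = j then x k else 0)"
    unfolding mv_def unit_row_def by (intro sum.cong) auto
  then show ?thesis using assms by simp
qed

section \<open>Deterministic comparison for Jordan blocks\<close>

text \<open>Here \<open>w i\<close> stands for \<open>c i - z\<close>. The rows of a block near the unit circle are all replaced by those of
  the identity; in a decaying block only the last row is replaced, by the first unit vector, which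
  makes the determinant of the block \<open>\<plusminus>1\<close> and its inverse polynomially bounded in \<open>1 / \<kappa>\<close>. The remaining blocks
  are kept. The replaced rows are those in which the noise drives the determinant.\<close>

locale jordan_blocks =
  fixes m :: nat and d :: "nat \<Rightarrow> nat" and w :: "nat \<Rightarrow> complex" and \<kappa> \<tau> :: real
  assumes d_pos: "\<And>i. i < m \<Longrightarrow> 0 < d i"
    and \<kappa>: "0 < \<kappa>" "\<kappa> \<le> 1 / 2" and \<tau>: "0 < \<tau>" "\<tau> < 1"
begin

abbreviation n :: nat where "n \<equiv> boff d m"

definition near_unit :: "nat \<Rightarrow> bool" where
  "near_unit i \<longleftrightarrow> \<bar>cmod (w i) - 1\<bar> < \<kappa>"

definition decaying :: "nat \<Rightarrow> bool" where
  "decaying i \<longleftrightarrow> cmod (w i) \<le> 1 - \<kappa> \<and> cmod (w i) ^ d i < \<tau>"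

definition hrows :: "nat \<Rightarrow> nat \<Rightarrow> nat \<Rightarrow> complex" where
  "hrows i = (if near_unit i then unit_row else if decaying i then cyc_rows (d i) (w i) else jrows (w i))"

definition hmul :: "nat \<Rightarrow> (nat \<Rightarrow> complex) \<Rightarrow> nat \<Rightarrow> complex" where
  "hmul i x = (if near_unit i then x else if decaying i then cmul (d i) (w i) x else jmul (d i) (w i) x)"

definition A :: "nat \<Rightarrow> nat \<Rightarrow> complex" where "A = bd m d (\<lambda>i. jrows (w i))"

definition H :: "nat \<Rightarrow> nat \<Rightarrow> complex" where "H = bd m d hrows"

text \<open>The last row of a decaying block of \<open>A\<close> is a power of modulus below \<open>\<tau>\<close> times the last row of \<open>H\<close>, plus a
  combination of the other rows with coefficients summable to at most \<open>1 / \<kappa>\<close>. The weight \<open>\<kappa>\<^sup>2\<close> makes this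
  combination cost a factor of only \<open>1 + \<kappa>\<close>.\<close>

definition wt :: "nat \<Rightarrow> nat \<Rightarrow> real" where
  "wt i j = (if \<not> near_unit i \<and> decaying i \<and> Suc j = d i then \<kappa>\<^sup>2 else 1)"

text \<open>The quotient of \<open>ub\<close> by \<open>lb\<close>, spread over the rows of a block.
  A near-unit block has norm at most |w| + 1, which is below 3; in a decaying block the last row
  alone carries the factor \<tau>.\<close>

definition gain :: "nat \<Rightarrow> nat \<Rightarrow> real" where
  "gain i j = (if near_unit i then 3 else if decaying i \<and> Suc j = d i then \<tau> else 1)"

text \<open>The share of block i in the upper bound for the determinant of \<open>A\<close> plus
  noise; \<open>lb\<close> is the modulus of the determinant of the repaired block.\<close>

definition ub :: "nat \<Rightarrow> real" where
  "ub i = (if near_unit i then 3 ^ d i else if decaying i then \<tau> else cmod (w i) ^ d i)"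

definition lb :: "nat \<Rightarrow> real" where
  "lb i = (if near_unit i \<or> decaying i then 1 else cmod (w i) ^ d i)"

lemma near_unit_not_decaying: "decaying i \<Longrightarrow> \<not> near_unit i"
  by (auto simp: near_unit_def decaying_def)

lemma mv_A: "i < m \<Longrightarrow> j < d i \<Longrightarrow> mv n A v (boff d i + j) = jmul (d i) (w i) (\<lambda>k. v (boff d i + k)) j"
  by (simp add: A_def mv_bd mv_jrows)

lemma mv_H: "i < m \<Longrightarrow> j < d i \<Longrightarrow> mv n H v (boff d i + j) = hmul i (\<lambda>k. v (boff d i + k)) j"
  by (simp add: H_def mv_bd hrows_def hmul_def mv_jrows mv_cyc_rows mv_unit_row)

lemma cmod_dt_H: "cmod (dt n H) = (\<Prod>i<m. lb i)"
proof -
  have "cmod (dt (d i) (hrows i)) = lb i" if "i < m" for i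
  proof -
    have "dt (d i) unit_row = 1 ^ d i"
      by (rule dt_upper_const) (auto simp: unit_row_def)
    moreover have "dt (d i) (jrows (w i)) = w i ^ d i"
      by (rule dt_upper_const) (auto simp: jrows_def)
    ultimately show ?thesis
      using cmod_dt_cyc_rows[OF d_pos[OF that]] by (simp add: hrows_def lb_def norm_power)
  qed
  then show ?thesis by (simp add: H_def dt_bd prod_norm[symmetric])
qed

context
  fixes \<Lambda> :: real
  assumes \<Lambda>_large: "1 / (\<kappa> ^ 3 * \<tau>) \<le> \<Lambda>"
    and \<Lambda>_small: "\<And>i. i < m \<Longrightarrow> cmod (w i) \<le> 1 - \<kappa> \<Longrightarrow> \<tau> \<le> cmod (w i) ^ d i \<Longrightarrow>
      real (d i) \<le> \<Lambda> * cmod (w i) ^ d i"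
begin

lemma \<Lambda>: "1 / \<kappa> \<le> \<Lambda>"
proof -
  have "\<kappa> ^ 3 * \<tau> \<le> \<kappa> ^ 1 * 1"
    using \<kappa> \<tau> by (intro mult_mono power_decreasing) auto
  then have "1 / \<kappa> \<le> 1 / (\<kappa> ^ 3 * \<tau>)"
    using \<kappa> \<tau> by (intro divide_left_mono) auto
  with \<Lambda>_large show ?thesis by linarith
qed

lemma \<Lambda>_ge: "2 \<le> \<Lambda>"
proof -
  have "2 \<le> 1 / \<kappa>" using \<kappa> by (simp add: field_simps)
  with \<Lambda> show ?thesis by linarith
qed

text \<open>\<Lambda> bounds the inverse of every repaired block. A near-unit block is the identity;
  a decaying block and a block with |w| at least 1 + \<kappa> cost 1 / \<kappa>; a kept block with
  |w| at most 1 - \<kappa> costs d / |w|^d, which is what \<open>\<Lambda>_small\<close>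
  controls.\<close>

lemma l2_le_hmul:
  assumes i: "i < m"
  shows "l2 (d i) x \<le> \<Lambda> * l2 (d i) (hmul i x)"
proof (cases "near_unit i")
  case True
  then show ?thesis
    using \<Lambda>_ge mult_right_mono[of 1 \<Lambda> "l2 (d i) x"] by (simp add: hmul_def L2_set_nonneg)
next
  case near: False
  have inv: "l2 (d i) x \<le> \<Lambda> * y" if "\<kappa> * l2 (d i) x \<le> y" for y
  proof -
    have "l2 (d i) x \<le> (1 / \<kappa>) * y" using that \<kappa> by (simp add: field_simps)
    moreover have "0 \<le> y" using that \<kappa> by (meson L2_set_nonneg less_imp_le mult_nonneg_nonneg order_trans)
    ultimately show ?thesis using mult_right_mono[OF \<Lambda>, of y] by linarith
  qed
  show ?thesis
  proof (cases "decaying i")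
    case True
    have "\<kappa> * l2 (d i) x \<le> (1 - cmod (w i)) * l2 (d i) x"
      using True by (intro mult_right_mono) (auto simp: decaying_def L2_set_nonneg)
    also have "\<dots> \<le> l2 (d i) (cmul (d i) (w i) x)" by (rule l2_le_cmul[OF d_pos[OF i]])
    finally show ?thesis using inv near True by (simp add: hmul_def)
  next
    case False
    show ?thesis
    proof (cases "cmod (w i) \<le> 1 - \<kappa>")
      case True
      with False have t: "\<tau> \<le> cmod (w i) ^ d i" by (auto simp: decaying_def)
      have p: "0 < cmod (w i) ^ d i" using t \<tau> by linarith
      then have "w i \<noteq> 0" using d_pos[OF i] by (auto simp: zero_power)
      have "cmod (w i) ^ d i * l2 (d i) x \<le> real (d i) * l2 (d i) (jmul (d i) (w i) x)"
        using \<open>w i \<noteq> 0\<close> True \<kappa> by (intro l2_le_jmul_small) auto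
      also have "\<dots> \<le> (\<Lambda> * cmod (w i) ^ d i) * l2 (d i) (jmul (d i) (w i) x)"
        by (intro mult_right_mono \<Lambda>_small[OF i True t]) (simp add: L2_set_nonneg)
      finally have "cmod (w i) ^ d i * l2 (d i) x \<le> cmod (w i) ^ d i * (\<Lambda> * l2 (d i) (jmul (d i) (w i) x))"
        by (simp add: mult_ac)
      with p show ?thesis using near False by (simp add: hmul_def)
    next
      case wl: False
      have "\<kappa> * l2 (d i) x \<le> (cmod (w i) - 1) * l2 (d i) x"
        using wl near by (intro mult_right_mono) (auto simp: near_unit_def L2_set_nonneg)
      also have "\<dots> \<le> l2 (d i) (jmul (d i) (w i) x)" by (rule l2_le_jmul_large)
      finally show ?thesis using inv near False by (simp add: hmul_def)
    qed
  qed
qed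

lemma L2_le_mv_H: "l2 n v \<le> \<Lambda> * l2 n (mv n H v)"
proof (rule L2_set_boff_le)
  fix i assume i: "i < m"
  have "L2_set (\<lambda>j. cmod (mv n H v (boff d i + j))) {..<d i} = l2 (d i) (hmul i (\<lambda>k. v (boff d i + k)))"
    using i by (intro L2_set_cong) (auto simp: mv_H)
  then show "l2 (d i) (\<lambda>j. v (boff d i + j)) \<le> \<Lambda> * l2 (d i) (\<lambda>j. mv n H v (boff d i + j))"
    using l2_le_hmul[OF i] by simp
qed (use \<Lambda>_ge in simp)

lemma weighted_jmul_le:
  assumes i: "i < m"
  shows "L2_set (\<lambda>j. wt i j * cmod (jmul (d i) (w i) x j)) {..<d i}
     \<le> (1 + \<kappa>) * L2_set (\<lambda>j. wt i j * gain i j * cmod (hmul i x j)) {..<d i}" (is "?L \<le> _ * ?R")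
proof -
  have R0: "0 \<le> ?R" by (rule L2_set_nonneg)
  consider "near_unit i" | "\<not> near_unit i" "\<not> decaying i" | "\<not> near_unit i" "decaying i" by blast
  then show ?thesis
  proof cases
    case 1
    have "?L = l2 (d i) (jmul (d i) (w i) x)" using 1 by (simp add: wt_def)
    also have "\<dots> \<le> (cmod (w i) + 1) * l2 (d i) x" by (rule l2_jmul_le)
    also have "\<dots> \<le> 3 * l2 (d i) x"
      using 1 \<kappa> by (intro mult_right_mono) (auto simp: near_unit_def L2_set_nonneg)
    also have "\<dots> = ?R"
      using 1 L2_set_right_distrib[of 3 "\<lambda>j. cmod (x j)" "{..<d i}"] by (simp add: wt_def gain_def hmul_def)
    also have "\<dots> \<le> (1 + \<kappa>) * ?R" using R0 \<kappa> by (simp add: distrib_right)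
    finally show ?thesis .
  next
    case 2
    have "?L = ?R" using 2 by (simp add: wt_def gain_def hmul_def)
    then show ?thesis using R0 \<kappa> by (simp add: distrib_right)
  next
    case 3
    define y where "y = cmul (d i) (w i) x"
    define Y where "Y = l2 (d i - 1) y"
    have w: "cmod (w i) \<le> 1 - \<kappa>" "cmod (w i) ^ d i < \<tau>" using 3 by (auto simp: decaying_def)
    have pw: "cmod (w i) * cmod (w i) ^ (d i - 1) = cmod (w i) ^ d i"
      using d_pos[OF i] by (cases "d i") auto
    have R: "?R = L2_set (\<lambda>j. (if Suc j = d i then \<kappa>\<^sup>2 * \<tau> else 1) * cmod (y j)) {..<d i}"
      using 3 by (intro L2_set_cong) (auto simp: wt_def gain_def hmul_def y_def)
    have YR: "Y \<le> ?R"
    proof -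
      have "Y = L2_set (\<lambda>j. (if Suc j = d i then \<kappa>\<^sup>2 * \<tau> else 1) * cmod (y j)) {..<d i - 1}"
        unfolding Y_def by (intro L2_set_cong) auto
      also have "\<dots> \<le> ?R" unfolding R unfolding L2_set_def
        by (intro real_sqrt_le_mono sum_mono2) auto
      finally show ?thesis .
    qed
    \<comment> \<open>Row d - 1 of the Jordan block sees only w x(d - 1). The recursion of
      \<open>cmul_last\<close> multiplies x(0) by |w|^(d - 1), and the extra factor w completes
      |w|^d, which is below \<tau>.\<close>
    have last: "cmod (w i) * cmod (x (d i - 1)) \<le> \<tau> * cmod (x 0) + Y / \<kappa>"
    proof -
      have Y0: "0 \<le> Y" by (simp add: Y_def L2_set_nonneg)
      have "cmod (x (d i - 1)) \<le> cmod (w i) ^ (d i - 1) * cmod (x 0) + Y / (1 - cmod (w i))"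
        unfolding Y_def y_def by (rule cmul_last) (use w \<kappa> d_pos[OF i] in auto)
      also have "Y / (1 - cmod (w i)) \<le> Y / \<kappa>"
        using w \<kappa> Y0 by (intro divide_left_mono) auto
      finally have "cmod (w i) * cmod (x (d i - 1)) \<le> cmod (w i) * (cmod (w i) ^ (d i - 1) * cmod (x 0) + Y / \<kappa>)"
        by (intro mult_left_mono) auto
      also have "\<dots> = cmod (w i) ^ d i * cmod (x 0) + cmod (w i) * (Y / \<kappa>)"
        using pw by (simp add: distrib_left mult.assoc[symmetric])
      also have "\<dots> \<le> \<tau> * cmod (x 0) + 1 * (Y / \<kappa>)"
        using w \<kappa> Y0 by (intro add_mono mult_right_mono) auto
      finally show ?thesis by simp
    qed
    \<comment> \<open>The excess sits in a single coordinate, so the triangle inequality charges it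
      once, as \<open>\<kappa> * Y\<close>.\<close>
    have "?L \<le> L2_set (\<lambda>j. (if Suc j = d i then \<kappa>\<^sup>2 * \<tau> else 1) * cmod (y j) + (if j = d i - 1 then \<kappa> * Y else 0)) {..<d i}"
    proof (rule L2_set_mono)
      fix j assume j: "j \<in> {..<d i}"
      show "wt i j * cmod (jmul (d i) (w i) x j) \<le> (if Suc j = d i then \<kappa>\<^sup>2 * \<tau> else 1) * cmod (y j) + (if j = d i - 1 then \<kappa> * Y else 0)"
      proof (cases "Suc j = d i")
        case True
        then have "wt i j * cmod (jmul (d i) (w i) x j) = \<kappa>\<^sup>2 * (cmod (w i) * cmod (x (d i - 1)))"
          using 3 by (simp add: wt_def jmul_def norm_mult flip: True)
        also have "\<dots> \<le> \<kappa>\<^sup>2 * (\<tau> * cmod (x 0) + Y / \<kappa>)"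
          by (intro mult_left_mono last) auto
        also have "\<dots> = \<kappa>\<^sup>2 * \<tau> * cmod (x 0) + \<kappa> * Y"
          using \<kappa> by (simp add: field_simps power2_eq_square)
        finally have "wt i j * cmod (jmul (d i) (w i) x j) \<le> \<kappa>\<^sup>2 * \<tau> * cmod (x 0) + \<kappa> * Y" .
        moreover have jl: "j = d i - 1" and "y j = x 0" using True by (auto simp: y_def cmul_def)
        ultimately show ?thesis unfolding if_P[OF True] if_P[OF jl] \<open>y j = x 0\<close> by simp
      next
        case False
        then show ?thesis using j by (auto simp: wt_def jmul_def y_def cmul_def)
      qed
    qed (use \<kappa> in \<open>auto simp: wt_def\<close>)
    also have "\<dots> \<le> ?R + L2_set (\<lambda>j. if j = d i - 1 then \<kappa> * Y else 0) {..<d i}"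
      unfolding R by (rule L2_set_triangle_ineq)
    also have "L2_set (\<lambda>j. if j = d i - 1 then \<kappa> * Y else 0) {..<d i} = \<kappa> * Y"
    proof -
      have "(\<Sum>j<d i. (if j = d i - 1 then \<kappa> * Y else 0)\<^sup>2) = (\<Sum>j<d i. if j = d i - 1 then (\<kappa> * Y)\<^sup>2 else 0)"
        by (intro sum.cong) auto
      moreover have "0 \<le> \<kappa> * Y" using \<kappa> by (simp add: Y_def L2_set_nonneg)
      ultimately show ?thesis using d_pos[OF i] by (simp add: L2_set_def del: power_mult_distrib)
    qed
    also have "\<kappa> * Y \<le> \<kappa> * ?R" using YR \<kappa> by (intro mult_left_mono) auto
    finally show ?thesis by (simp add: algebra_simps)
  qed
qed

text \<open>In a decaying block the smallest weight times gain is
  \<open>\<kappa>\<^sup>2 * \<tau>\<close>, and inverting the repaired block costs another 1 /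
  \<kappa>; their product is the origin of \<open>\<kappa> ^ 3 * \<tau>\<close> in
  \<open>\<Lambda>_large\<close>. In the other blocks weight times gain is at least 1.\<close>

lemma l2_le_weighted_hmul:
  assumes i: "i < m"
  shows "l2 (d i) x \<le> \<Lambda> * L2_set (\<lambda>j. wt i j * gain i j * cmod (hmul i x j)) {..<d i}" (is "_ \<le> _ * ?R")
proof (cases "decaying i")
  case False
  have "l2 (d i) (hmul i x) \<le> ?R"
    using False by (intro L2_set_mono) (auto simp: wt_def gain_def mult_le_cancel_right1)
  then have "\<Lambda> * l2 (d i) (hmul i x) \<le> \<Lambda> * ?R"
    using \<Lambda>_ge by (intro mult_left_mono) auto
  with l2_le_hmul[OF i, of x] show ?thesis by linarith
next
  case True
  then have near: "\<not> near_unit i" by (rule near_unit_not_decaying)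
  define \<sigma> where "\<sigma> = \<kappa>\<^sup>2 * \<tau>"
  have \<sigma>: "0 < \<sigma>" "\<sigma> \<le> 1"
    using \<kappa> \<tau> by (auto simp: \<sigma>_def intro!: mult_le_one power_le_one)
  have "\<sigma> * l2 (d i) (hmul i x) = L2_set (\<lambda>j. \<sigma> * cmod (hmul i x j)) {..<d i}"
    using \<sigma> by (intro L2_set_right_distrib) auto
  also have "\<dots> \<le> ?R"
    using True near \<sigma> by (intro L2_set_mono mult_right_mono) (auto simp: wt_def gain_def \<sigma>_def)
  finally have 1: "\<sigma> * l2 (d i) (hmul i x) \<le> ?R" .
  have "\<kappa> * l2 (d i) x \<le> (1 - cmod (w i)) * l2 (d i) x"
    using True by (intro mult_right_mono) (auto simp: decaying_def L2_set_nonneg)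
  also have "\<dots> \<le> l2 (d i) (hmul i x)"
    using l2_le_cmul[OF d_pos[OF i]] True near by (simp add: hmul_def)
  finally have "\<sigma> * (\<kappa> * l2 (d i) x) \<le> ?R"
    using 1 \<sigma> by (meson less_imp_le mult_left_mono order_trans)
  then have "(\<kappa> ^ 3 * \<tau>) * l2 (d i) x \<le> ?R"
    by (simp add: \<sigma>_def power2_eq_square power3_eq_cube mult_ac)
  then have "l2 (d i) x \<le> 1 / (\<kappa> ^ 3 * \<tau>) * ?R"
    using \<kappa> \<tau> by (simp add: field_simps)
  also have "\<dots> \<le> \<Lambda> * ?R" by (intro mult_right_mono \<Lambda>_large L2_set_nonneg)
  finally show ?thesis .
qed

definition wtp :: "nat \<Rightarrow> real" where "wtp p = wt (blk d p) (loc d p)"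

definition gainp :: "nat \<Rightarrow> real" where "gainp p = gain (blk d p) (loc d p)"

lemma wtp_gainp_boff: "j < d i \<Longrightarrow> wtp (boff d i + j) = wt i j" "j < d i \<Longrightarrow> gainp (boff d i + j) = gain i j"
  by (simp_all add: wtp_def gainp_def blk_boff loc_boff)

lemma wt_bounds: "0 < wt i j" "wt i j \<le> 1"
  using \<kappa> by (auto simp: wt_def power_le_one)

lemma prod_gainp: "(\<Prod>p<n. gainp p) * (\<Prod>i<m. lb i) = (\<Prod>i<m. ub i)"
proof -
  have "(\<Prod>j<d i. gain i j) * lb i = ub i" if "i < m" for i
  proof (cases "decaying i")
    case True
    have "(\<Prod>j<d i. gain i j) = (\<Prod>j<d i. if j = d i - 1 then \<tau> else 1)"
      using True near_unit_not_decaying[OF True] d_pos[OF that] by (intro prod.cong) (auto simp: gain_def)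
    then show ?thesis using True near_unit_not_decaying[OF True] d_pos[OF that]
      by (simp add: ub_def lb_def)
  next
    case False
    then show ?thesis by (simp add: ub_def lb_def gain_def)
  qed
  then show ?thesis
    by (simp add: prod_boff wtp_gainp_boff prod.distrib[symmetric])
qed

text \<open>In the weighted norm \<open>A\<close> costs a factor 1 + \<kappa> against the gained
  rows of \<open>H\<close>, and the noise costs g times the inverse bound \<Lambda>. The product of
  the weights \<open>wtp\<close> stands on both sides and cancels, so the weights improve the
  comparison without entering the result; what remains is the product of the gains times |det
  H|.\<close>

theorem cmod_dt_upper:
  assumes E: "\<And>v. l2 n (mv n E v) \<le> g * l2 n v" and g: "0 \<le> g"
  shows "cmod (dt n (\<lambda>p q. A p q + E p q)) \<le> (1 + \<kappa> + g * \<Lambda>) ^ n * (\<Prod>i<m. ub i)"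
proof -
  let ?q = "1 + \<kappa> + g * \<Lambda>"
  have q: "0 \<le> ?q" using \<kappa> g \<Lambda>_ge by simp
  have "L2_set (\<lambda>p. wtp p * cmod (mv n (\<lambda>p q. A p q + E p q) v p)) {..<n}
     \<le> ?q * L2_set (\<lambda>p. wtp p * gainp p * cmod (mv n H v p)) {..<n}" (is "_ \<le> ?q * ?R") for v
  proof -
    have RR: "L2_set (\<lambda>j. wtp (boff d i + j) * gainp (boff d i + j) * cmod (mv n H v (boff d i + j))) {..<d i}
        = L2_set (\<lambda>j. wt i j * gain i j * cmod (hmul i (\<lambda>k. v (boff d i + k)) j)) {..<d i}" if "i < m" for i
      using that by (intro L2_set_cong) (auto simp: wtp_gainp_boff mv_H)
    have "L2_set (\<lambda>p. wtp p * cmod (mv n (\<lambda>p q. A p q + E p q) v p)) {..<n}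
        \<le> L2_set (\<lambda>p. wtp p * cmod (mv n A v p) + cmod (mv n E v p)) {..<n}"
    proof (rule L2_set_mono)
      fix p
      have "wtp p * cmod (mv n A v p + mv n E v p) \<le> wtp p * cmod (mv n A v p) + wtp p * cmod (mv n E v p)"
        using wt_bounds[of "blk d p" "loc d p"] norm_triangle_ineq[of "mv n A v p" "mv n E v p"]
        by (simp add: wtp_def distrib_left[symmetric])
      also have "wtp p * cmod (mv n E v p) \<le> 1 * cmod (mv n E v p)"
        using wt_bounds by (intro mult_right_mono) (auto simp: wtp_def)
      finally show "wtp p * cmod (mv n (\<lambda>p q. A p q + E p q) v p) \<le> wtp p * cmod (mv n A v p) + cmod (mv n E v p)"
        by (simp add: mv_add)
      show "0 \<le> wtp p * cmod (mv n (\<lambda>p q. A p q + E p q) v p)"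
        using wt_bounds[of "blk d p" "loc d p"] by (simp add: wtp_def)
    qed
    also have "\<dots> \<le> L2_set (\<lambda>p. wtp p * cmod (mv n A v p)) {..<n} + l2 n (mv n E v)"
      by (rule L2_set_triangle_ineq)
    also have "L2_set (\<lambda>p. wtp p * cmod (mv n A v p)) {..<n} \<le> (1 + \<kappa>) * ?R"
    proof (rule L2_set_boff_le)
      fix i assume i: "i < m"
      have "L2_set (\<lambda>j. wtp (boff d i + j) * cmod (mv n A v (boff d i + j))) {..<d i}
        = L2_set (\<lambda>j. wt i j * cmod (jmul (d i) (w i) (\<lambda>k. v (boff d i + k)) j)) {..<d i}"
        using i by (intro L2_set_cong) (auto simp: wtp_gainp_boff mv_A)
      then show "L2_set (\<lambda>j. wtp (boff d i + j) * cmod (mv n A v (boff d i + j))) {..<d i} \<le> (1 + \<kappa>) *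
         L2_set (\<lambda>j. wtp (boff d i + j) * gainp (boff d i + j) * cmod (mv n H v (boff d i + j))) {..<d i}"
        using weighted_jmul_le[OF i] RR[OF i] by simp
    qed (use \<kappa> in simp)
    also have "l2 n (mv n E v) \<le> g * (\<Lambda> * ?R)"
    proof -
      have "l2 n v \<le> \<Lambda> * ?R"
      proof (rule L2_set_boff_le)
        fix i assume i: "i < m"
        show "l2 (d i) (\<lambda>j. v (boff d i + j)) \<le> \<Lambda> *
         L2_set (\<lambda>j. wtp (boff d i + j) * gainp (boff d i + j) * cmod (mv n H v (boff d i + j))) {..<d i}"
          using l2_le_weighted_hmul[OF i] RR[OF i] by simp
      qed (use \<Lambda>_ge in simp)
      with E[of v] g show ?thesis by (meson mult_left_mono order_trans)
    qed
    finally show ?thesis by (simp add: algebra_simps)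
  qed
  note L = this
  have "(\<Sum>p<n. (wtp p * cmod (mv n (\<lambda>p q. A p q + E p q) v p))\<^sup>2)
     \<le> ?q\<^sup>2 * (\<Sum>p<n. (wtp p * gainp p * cmod (mv n H v p))\<^sup>2)" for v
    using power_mono[OF L[of v] L2_set_nonneg, of 2]
    by (simp add: power_mult_distrib[of ?q] L2_set_def sum_nonneg)
  then have "(\<Prod>p<n. wtp p) * cmod (dt n (\<lambda>p q. A p q + E p q)) \<le> ?q ^ n * ((\<Prod>p<n. wtp p * gainp p) * cmod (dt n H))"
    using q wt_bounds \<tau> by (intro cmod_dt_weighted_le) (auto simp: wtp_def gainp_def gain_def less_imp_le)
  also have "\<dots> = (\<Prod>p<n. wtp p) * (?q ^ n * (\<Prod>i<m. ub i))"
    by (simp add: prod.distrib cmod_dt_H prod_gainp[symmetric])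
  finally have *: "(\<Prod>p<n. wtp p) * cmod (dt n (\<lambda>p q. A p q + E p q)) \<le> (\<Prod>p<n. wtp p) * (?q ^ n * (\<Prod>i<m. ub i))" .
  have "0 < (\<Prod>p<n. wtp p)" using wt_bounds by (intro prod_pos) (auto simp: wtp_def)
  with * show ?thesis by (simp only: mult_le_cancel_left_pos)
qed

end

section \<open>The replaced rows and the lower bound\<close>

definition noise_row :: "nat \<Rightarrow> bool" where
  "noise_row p \<longleftrightarrow> near_unit (blk d p) \<or> decaying (blk d p) \<and> Suc (loc d p) = d (blk d p)"

text \<open>On a replaced row this is the column of the 1 in the corresponding row of
  \<open>H\<close>: the diagonal in a near-unit block, the first column of the block in a decaying
  one.\<close>

definition noise_col :: "nat \<Rightarrow> nat" where
  "noise_col p = (if near_unit (blk d p) then p else boff d (blk d p))"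

lemma noise_row_boff: "j < d i \<Longrightarrow> noise_row (boff d i + j) \<longleftrightarrow> near_unit i \<or> decaying i \<and> Suc j = d i"
  by (simp add: noise_row_def blk_boff loc_boff)

lemma noise_col_boff: "j < d i \<Longrightarrow> noise_col (boff d i + j) = boff d i + (if near_unit i then j else 0)"
  by (simp add: noise_col_def blk_boff)

lemma bd_entry:
  assumes "i < m'" "j < d i" "i' < m'" "k < d i'"
  shows "bd m' d b (boff d i + j) (boff d i' + k) = (if i = i' then b i j k else 0)"
  using assms
proof (induction m')
  case (Suc m')
  have l: "boff d i + j < boff d m'" if "i < m'" using boff_less[OF that] Suc.prems by simp
  have l': "boff d i' + k < boff d m'" if "i' < m'" using boff_less[OF that] Suc.prems by simp
  consider "i < m'" "i' < m'" | "i < m'" "i' = m'" | "i = m'" "i' < m'" | "i = m'" "i' = m'"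
    using Suc.prems by linarith
  then show ?case
    using Suc l l' by cases (auto simp: bd_block)
qed simp

lemma H_entry:
  assumes "p < n" "q < n"
  shows "H p q = (if noise_row p then unit_row (noise_col p) q else A p q)"
proof -
  obtain i j where p: "i < m" "j < d i" "p = boff d i + j" using bd_diag[OF assms(1)] by blast
  obtain i' k where q: "i' < m" "k < d i'" "q = boff d i' + k" using bd_diag[OF assms(2)] by blast
  have "boff d i' + k = boff d i + j \<longleftrightarrow> i' = i \<and> k = j"
    using boff_inject[of d i' k i j] p q by auto
  then have u1: "unit_row (boff d i + j) (boff d i' + k) = (if i' = i \<and> k = j then 1 else 0)"
    by (simp add: unit_row_def)
  have "boff d i' + k = boff d i \<longleftrightarrow> i' = i \<and> k = 0"
    using boff_inject[of d i' k i 0] d_pos[OF p(1)] q by auto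
  then have u2: "unit_row (boff d i) (boff d i' + k) = (if i' = i \<and> k = 0 then 1 else 0)"
    by (simp add: unit_row_def)
  have u3: "unit_row j k = (if k = j then 1 else 0)" "unit_row a a = 1" for a by (simp_all add: unit_row_def)
  have lt: "Suc j < d i" if "Suc j \<noteq> d i" using p that by simp
  consider "near_unit i" | "\<not> near_unit i" "decaying i" "Suc j = d i" | "\<not> near_unit i" "decaying i" "Suc j \<noteq> d i" | "\<not> near_unit i" "\<not> decaying i"
    by blast
  then have "H (boff d i + j) (boff d i' + k) = (if noise_row (boff d i + j) then unit_row (noise_col (boff d i + j)) (boff d i' + k)
      else A (boff d i + j) (boff d i' + k))"
    using p(1,2) q(1,2) near_unit_not_decaying[of i] lt unfolding H_def A_def
    by cases (auto simp: bd_entry noise_row_boff noise_col_boff hrows_def jrows_def cyc_rows_def u1 u2 u3)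
  then show ?thesis unfolding p(3) q(3) .
qed

text \<open>The noise acts only on the kept rows here, as a perturbation of \<open>H\<close> whose
  relative size g \<Lambda> is below 1. Since the unit rows are free of noise, the bound concerns
  noise independent of that in the replaced rows, which is left for the moment estimate.\<close>

lemma cmod_dt_lower:
  assumes \<Lambda>: "1 / (\<kappa> ^ 3 * \<tau>) \<le> \<Lambda>"
    and \<Lambda>_small: "\<And>i. i < m \<Longrightarrow> cmod (w i) \<le> 1 - \<kappa> \<Longrightarrow> \<tau> \<le> cmod (w i) ^ d i \<Longrightarrow>
      real (d i) \<le> \<Lambda> * cmod (w i) ^ d i"
    and E: "\<And>v. l2 n (mv n E v) \<le> g * l2 n v" and g: "0 \<le> g" "g * \<Lambda> < 1"
  shows "(1 - g * \<Lambda>) ^ n * (\<Prod>i<m. lb i)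
    \<le> cmod (dt n (\<lambda>p q. if noise_row p then unit_row (noise_col p) q else A p q + E p q))"
proof -
  let ?H = "\<lambda>p q. if noise_row p then unit_row (noise_col p) q else A p q + E p q"
  let ?r = "1 - g * \<Lambda>"
  have le: "?r * l2 n (mv n H v) \<le> l2 n (mv n ?H v)" for v
  proof -
    define E' where "E' p q = (if noise_row p then 0 else - E p q)" for p q
    have "mv n H v p = mv n ?H v p + mv n E' v p" if "p < n" for p
      using that by (auto simp: mv_def H_entry E'_def sum.distrib[symmetric] distrib_right[symmetric] intro!: sum.cong)
    then have "l2 n (mv n H v) = l2 n (\<lambda>p. mv n ?H v p + mv n E' v p)"
      by (intro L2_set_cong) simp_all
    also have "\<dots> \<le> l2 n (mv n ?H v) + l2 n (mv n E' v)" by (rule l2_triangle)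
    also have "l2 n (mv n E' v) \<le> l2 n (mv n E v)"
    proof (rule L2_set_mono)
      fix p show "cmod (mv n E' v p) \<le> cmod (mv n E v p)"
        by (cases "noise_row p") (simp_all add: mv_def E'_def sum_negf)
    qed simp
    also note E[of v]
    also have "g * l2 n v \<le> g * (\<Lambda> * l2 n (mv n H v))"
      using L2_le_mv_H[OF \<Lambda> \<Lambda>_small] g by (intro mult_left_mono) auto
    finally show ?thesis by (simp add: algebra_simps)
  qed
  have "cmod (dt n H) \<le> (1 / ?r) ^ n * cmod (dt n ?H)"
  proof (rule cmod_dt_le)
    fix v
    have "l2 n (mv n H v) \<le> 1 / ?r * l2 n (mv n ?H v)"
      using le[of v] g by (simp add: field_simps)
    from power_mono[OF this L2_set_nonneg, of 2]
    show "(\<Sum>p<n. (cmod (mv n H v p))\<^sup>2) \<le> (1 / ?r)\<^sup>2 * (\<Sum>p<n. (cmod (mv n ?H v p))\<^sup>2)"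
      unfolding power_mult_distrib l2_sq .
  qed (use g in simp)
  moreover have "0 < ?r ^ n" using g by simp
  ultimately show ?thesis
    unfolding cmod_dt_H by (simp add: power_divide field_simps)
qed

lemma noise_col_less: "p < n \<Longrightarrow> noise_col p < n"
proof -
  assume "p < n"
  then obtain i j where p: "i < m" "j < d i" "p = boff d i + j" using bd_diag by blast
  show ?thesis using boff_less[of i m j d] boff_less[of i m 0 d] p d_pos by (auto simp: noise_col_boff)
qed

lemma inj_on_noise_col: "inj_on noise_col {p. p < n \<and> noise_row p}"
proof (rule inj_onI, clarsimp)
  fix p q assume pq: "p < n" "q < n" "noise_row p" "noise_row q" and eq: "noise_col p = noise_col q"
  obtain i j where p: "i < m" "j < d i" "p = boff d i + j" using bd_diag[OF pq(1)] by blast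
  obtain i' k where q: "i' < m" "k < d i'" "q = boff d i' + k" using bd_diag[OF pq(2)] by blast
  have "i = i' \<and> (if near_unit i then j else 0) = (if near_unit i' then k else 0)"
    by (rule boff_inject[of d]) (use eq p q in \<open>auto simp: noise_col_boff\<close>)
  then show "p = q"
    using pq(3,4) p q by (auto simp: noise_row_boff split: if_splits)
qed

lemma card_noise_row: "card {p. p < n \<and> noise_row p} = (\<Sum>i<m. if near_unit i then d i else if decaying i then 1 else 0)"
proof -
  have "card {p. p < n \<and> noise_row p} = (\<Sum>p<n. if noise_row p then 1 else 0)"
    by (simp add: sum.If_cases Int_def)
  also have "\<dots> = (\<Sum>i<m. \<Sum>j<d i. if near_unit i \<or> decaying i \<and> Suc j = d i then 1 else 0)"
    unfolding sum_boff by (intro sum.cong) (auto simp: noise_row_boff)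
  also have "\<dots> = (\<Sum>i<m. if near_unit i then d i else if decaying i then 1 else 0)"
  proof (rule sum.cong[OF refl])
    fix i assume "i \<in> {..<m}"
    then have "0 < d i" using d_pos by simp
    have "(\<Sum>j<d i. if Suc j = d i then 1 else 0) = (\<Sum>j<d i. if j = d i - 1 then 1 else (0::nat))"
      using \<open>0 < d i\<close> by (intro sum.cong) auto
    then show "(\<Sum>j<d i. if near_unit i \<or> decaying i \<and> Suc j = d i then 1 else 0) = (if near_unit i then d i else if decaying i then 1 else 0)"
      using \<open>0 < d i\<close> by auto
  qed
  finally show ?thesis .
qed

end

section \<open>Negative moments of a noisy determinant\<close>

text \<open>Applied to squared moduli; the exponent \<open>-1/2\<close> of the modulus is integrable against a Gaussian density.\<close>

definition ninv :: "real \<Rightarrow> ennreal" where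
  "ninv x = (if x = 0 then \<infinity> else ennreal (\<bar>x\<bar> powr (-1/4)))"

lemma measurable_ninv [measurable]: "ninv \<in> borel_measurable borel"
  unfolding ninv_def by measurable

lemma ninv_antimono: "0 \<le> x \<Longrightarrow> x \<le> y \<Longrightarrow> ninv y \<le> ninv x"
  by (auto simp: ninv_def intro!: ennreal_leI powr_mono2')

lemma ninv_mult: "0 \<le> x \<Longrightarrow> 0 < y \<Longrightarrow> ninv (x * y) = ninv x * ennreal (y powr (-1/4))"
  by (auto simp: ninv_def powr_mult ennreal_mult ennreal_top_mult abs_mult)

text \<open>Jensen's inequality for the convex function \<open>x powr (-1/4)\<close> with value
  \<infinity> at 0. A zero \<open>x i\<close> of positive weight makes the right side infinite;
  indices of weight 0 are dropped first, in agreement with \<open>0 * \<infinity> = 0\<close> in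
  \<open>ennreal\<close>.\<close>

lemma ninv_convex_sum:
  fixes p x :: "'a \<Rightarrow> real"
  assumes "finite S" and p: "\<And>i. i \<in> S \<Longrightarrow> 0 \<le> p i" "(\<Sum>i\<in>S. p i) = 1" and x: "\<And>i. i \<in> S \<Longrightarrow> 0 \<le> x i"
  shows "ninv (\<Sum>i\<in>S. p i * x i) \<le> (\<Sum>i\<in>S. ennreal (p i) * ninv (x i))"
proof (cases "\<exists>i\<in>S. p i \<noteq> 0 \<and> x i = 0")
  case True
  then obtain i where i: "i \<in> S" "p i \<noteq> 0" "x i = 0" by blast
  have "ennreal (p i) * ninv (x i) = \<infinity>"
    using i p(1)[OF i(1)] by (simp add: ninv_def ennreal_mult_top less_le)
  then have "(\<Sum>i\<in>S. ennreal (p i) * ninv (x i)) = \<infinity>"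
    using i(1) assms(1) by (simp add: sum.remove[of S i])
  then show ?thesis by simp
next
  case False
  define T where "T = {i\<in>S. p i \<noteq> 0}"
  have T: "finite T" "\<And>i. i \<in> T \<Longrightarrow> 0 < p i" "\<And>i. i \<in> T \<Longrightarrow> 0 < x i"
    using assms(1) False p(1) x by (auto simp: T_def less_le)
  have "sum p T = sum p S"
    unfolding T_def using assms(1) by (intro sum.mono_neutral_left) auto
  moreover have "(\<Sum>i\<in>S. p i * x i) = (\<Sum>i\<in>T. p i * x i)"
    unfolding T_def using assms(1) by (intro sum.mono_neutral_right) auto
  moreover have "(\<Sum>i\<in>S. ennreal (p i) * ninv (x i)) = (\<Sum>i\<in>T. ennreal (p i) * ninv (x i))"
    unfolding T_def using assms(1) by (intro sum.mono_neutral_right) auto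
  ultimately have sT: "(\<Sum>i\<in>T. p i) = 1" "(\<Sum>i\<in>S. p i * x i) = (\<Sum>i\<in>T. p i * x i)"
    "(\<Sum>i\<in>S. ennreal (p i) * ninv (x i)) = (\<Sum>i\<in>T. ennreal (p i) * ninv (x i))"
    using p(2) by simp_all
  have ne: "T \<noteq> {}" using sT(1) by auto
  have conv: "convex_on {0<..} (\<lambda>x::real. x powr (-1/4))"
  proof (rule f''_ge0_imp_convex)
    fix x :: real assume x: "x \<in> {0<..}"
    show "((\<lambda>x. x powr (-1/4)) has_real_derivative (-1/4) * x powr (-5/4)) (at x)"
      using x by (auto intro!: derivative_eq_intros)
    show "((\<lambda>x. (-1/4) * x powr (-5/4)) has_real_derivative (5/16) * x powr (-9/4)) (at x)"
      using x by (auto intro!: derivative_eq_intros)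
    show "0 \<le> (5/16) * x powr (-9/4)" by simp
  qed simp
  have "(\<Sum>i\<in>T. p i * x i) powr (-1/4) \<le> (\<Sum>i\<in>T. p i * x i powr (-1/4))"
    using convex_on_sum[OF T(1) ne conv sT(1), of x] T(2,3) by (auto simp: less_imp_le)
  moreover have "0 < (\<Sum>i\<in>T. p i * x i)" using T ne by (intro sum_pos) auto
  ultimately have "ninv (\<Sum>i\<in>T. p i * x i) \<le> ennreal (\<Sum>i\<in>T. p i * x i powr (-1/4))"
    by (auto simp: ninv_def intro!: ennreal_leI)
  also have "\<dots> = (\<Sum>i\<in>T. ennreal (p i * x i powr (-1/4)))"
    using T by (intro sum_ennreal[symmetric]) (auto simp: less_imp_le)
  also have "\<dots> = (\<Sum>i\<in>T. ennreal (p i) * ninv (x i))"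
    using T by (intro sum.cong) (auto simp: ninv_def ennreal_mult less_imp_le abs_of_pos dest: T(3))
  finally show ?thesis unfolding sT .
qed

section \<open>Gaussian moments of affine functions\<close>

abbreviation ngauss :: "real measure" where
  "ngauss \<equiv> density lborel std_normal_density"

text \<open>\<open>ninv (x\<^sup>2)\<close> is 1 / sqrt |x|, whose integral over each of the two
  halves is 2.\<close>

lemma nn_integral_ninv_unit: "(\<integral>\<^sup>+x. ninv (x\<^sup>2) * indicator {-1..1} x \<partial>lborel) \<le> 4"
proof -
  have half: "(\<integral>\<^sup>+x. ennreal (x powr (-1/2)) * indicator {0..1} x \<partial>lborel) = ennreal 2"
  proof -
    have "((\<lambda>x. if x \<in> {0..1} then x powr (-1/2) else 0) has_integral (2::real)) UNIV"
      using has_integral_powr_from_0[of "-1/2" 1] by (subst has_integral_restrict_UNIV) simp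
    then have "(\<integral>\<^sup>+x. ennreal (if x \<in> {0..1} then x powr (-1/2) else 0) \<partial>lborel) = ennreal 2"
      by (intro nn_integral_has_integral_lborel) auto
    moreover have "ennreal (if x \<in> {0..1} then x powr (-1/2) else 0) = ennreal (x powr (-1/2)) * indicator {0..1} x" for x :: real
      by (simp add: indicator_def)
    ultimately show ?thesis by simp
  qed
  have sq: "ninv (x\<^sup>2) = ennreal (\<bar>x\<bar> powr (-1/2))" if "x \<noteq> 0" for x :: real
  proof -
    have "(x\<^sup>2) powr (-1/4) = (\<bar>x\<bar> powr 2) powr (-1/4)"
      using that by (simp add: powr_numeral)
    also have "\<dots> = \<bar>x\<bar> powr (-1/2)" by (simp only: powr_powr) simp
    finally show ?thesis using that by (simp add: ninv_def)
  qed
  have "(\<integral>\<^sup>+x. ninv (x\<^sup>2) * indicator {-1..1} x \<partial>lborel) 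
     \<le> (\<integral>\<^sup>+x. ennreal (x powr (-1/2)) * indicator {0..1} x + ennreal ((-x) powr (-1/2)) * indicator {0..1} (-x) \<partial>lborel)"
  proof (rule nn_integral_mono_AE)
    have "AE x in lborel. x \<noteq> (0::real)" by (rule AE_lborel_singleton)
    then show "AE x in lborel. ninv (x\<^sup>2) * indicator {-1..1} x \<le>
       ennreal (x powr (-1/2)) * indicator {0..1} x + ennreal ((-x) powr (-1/2)) * indicator {0..1} (-x)"
    proof eventually_elim
      case (elim x)
      then show ?case using sq[of x] by (auto simp: indicator_def abs_if)
    qed
  qed
  also have "\<dots> = ennreal 2 + (\<integral>\<^sup>+x. ennreal ((-x) powr (-1/2)) * indicator {0..1} (-x) \<partial>lborel)"
    by (subst nn_integral_add) (auto simp: half[simplified])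
  also have "(\<integral>\<^sup>+x. ennreal ((-x) powr (-1/2)) * indicator {0..1} (-x) \<partial>lborel) = ennreal 2"
    using nn_integral_real_affine[of "\<lambda>x. ennreal (x powr (-1/2)) * indicator {0..1} x" "-1" 0] half
    by simp
  finally show ?thesis
    by (simp add: ennreal_numeral[symmetric] ennreal_plus[symmetric] del: ennreal_plus ennreal_numeral)
qed

text \<open>Uniformity in the mean a is the point. The density is at most 1/2, which gives 1/2 * 4
  near the singularity; where |x| > 1 one has \<open>ninv (x\<^sup>2)\<close> at most 1 and total
  mass at most 1. The sum 3 is rounded up to 5.\<close>

lemma nn_integral_ninv_normal:
  "(\<integral>\<^sup>+x. ninv (x\<^sup>2) * ennreal (normal_density a 1 x) \<partial>lborel) \<le> ennreal 5"
proof -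
  have dens: "normal_density a 1 x \<le> 1/2" for x
  proof -
    have "normal_density a 1 x \<le> 1 / sqrt (2 * pi) * 1"
      unfolding normal_density_def by (intro mult_mono) auto
    moreover have "2 \<le> sqrt (2 * pi)" using pi_gt3 by (intro real_le_rsqrt) auto
    ultimately show ?thesis by (smt (verit) frac_le)
  qed
  have le: "ninv (x\<^sup>2) * ennreal (normal_density a 1 x) \<le>
      ennreal (1/2) * (ninv (x\<^sup>2) * indicator {-1..1} x) + ennreal (normal_density a 1 x)" for x :: real
  proof (cases "x \<in> {-1..1}")
    case True
    have "ninv (x\<^sup>2) * ennreal (normal_density a 1 x) \<le> ninv (x\<^sup>2) * ennreal (1/2)"
      by (intro mult_left_mono ennreal_leI dens) auto
    then show ?thesis using True by (simp add: mult.commute add_increasing2)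
  next
    case False
    then have "\<bar>1\<bar> \<le> \<bar>x\<bar>" by auto
    then have "1 \<le> x\<^sup>2" by (subst (asm) abs_le_square_iff) simp
    then have "ninv (x\<^sup>2) \<le> ninv 1" by (intro ninv_antimono) auto
    then have "ninv (x\<^sup>2) * ennreal (normal_density a 1 x) \<le> 1 * ennreal (normal_density a 1 x)"
      by (intro mult_right_mono) (auto simp: ninv_def)
    then show ?thesis by (simp add: add_increasing)
  qed
  have one: "(\<integral>\<^sup>+x. ennreal (normal_density a 1 x) \<partial>lborel) = 1"
    using prob_space.emeasure_space_1[OF prob_space_normal_density[of 1 a]] by (simp add: emeasure_density)
  have "(\<integral>\<^sup>+x. ninv (x\<^sup>2) * ennreal (normal_density a 1 x) \<partial>lborel) \<le>
     (\<integral>\<^sup>+x. ennreal (1/2) * (ninv (x\<^sup>2) * indicator {-1..1} x) + ennreal (normal_density a 1 x) \<partial>lborel)"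
    by (intro nn_integral_mono le)
  also have "\<dots> = ennreal (1/2) * (\<integral>\<^sup>+x. ninv (x\<^sup>2) * indicator {-1..1} x \<partial>lborel) + 1"
    by (subst nn_integral_add) (auto simp: nn_integral_cmult one)
  also have "\<dots> \<le> ennreal (1/2) * 4 + 1"
    by (intro add_right_mono mult_left_mono nn_integral_ninv_unit) auto
  also have "ennreal (1/2) * 4 = ennreal 2"
    by (subst ennreal_numeral[symmetric], subst ennreal_mult[symmetric]) simp_all
  also have "ennreal 2 + 1 \<le> ennreal 5"
    by (subst ennreal_1[symmetric], subst ennreal_plus[symmetric]) (auto intro: ennreal_leI)
  finally show ?thesis .
qed

interpretation gauss_prob: prob_space ngauss
  using prob_space_normal_density[of 1 0] by simp

interpretation gauss_pf: product_sigma_finite "\<lambda>_. ngauss" by standard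

lemma indep_vars_PiM_ngauss:
  assumes "finite J" "J \<noteq> {}"
  shows "prob_space.indep_vars (PiM J (\<lambda>_. ngauss)) (\<lambda>_. borel) (\<lambda>j y. y j) J"
proof -
  interpret P: prob_space "PiM J (\<lambda>_. ngauss)" by (rule prob_space_PiM) (rule gauss_prob.prob_space_axioms)
  have rv: "(\<lambda>y. y j) \<in> PiM J (\<lambda>_. ngauss) \<rightarrow>\<^sub>M borel" if "j \<in> J" for j
    using measurable_component_singleton[OF that, of "\<lambda>_. ngauss"] by simp
  have "distr (PiM J (\<lambda>_. ngauss)) (PiM J (\<lambda>_. borel)) (\<lambda>y. \<lambda>j\<in>J. y j) = distr (PiM J (\<lambda>_. ngauss)) (PiM J (\<lambda>_. ngauss)) (\<lambda>y. y)"
  proof (rule distr_cong)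
    show "sets (PiM J (\<lambda>_. borel)) = sets (PiM J (\<lambda>_. ngauss))"
      by (rule sets_PiM_cong) auto
    show "(\<lambda>j\<in>J. y j) = y" if "y \<in> space (PiM J (\<lambda>_. ngauss))" for y
      using that by (auto simp: space_PiM PiE_def extensional_restrict)
  qed simp
  also have "\<dots> = PiM J (\<lambda>_. ngauss)" by (rule distr_id)
  also have "\<dots> = PiM J (\<lambda>j. distr (PiM J (\<lambda>_. ngauss)) borel (\<lambda>y. y j))"
  proof (rule PiM_cong[OF refl])
    fix j assume j: "j \<in> J"
    have "distr (PiM J (\<lambda>_. ngauss)) borel (\<lambda>y. y j) = distr (PiM J (\<lambda>_. ngauss)) ngauss (\<lambda>y. y j)"
      by (rule distr_cong) auto
    also have "\<dots> = ngauss"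
      using distr_PiM_component[of J "\<lambda>_. ngauss" j] j gauss_prob.prob_space_axioms by simp
    finally show "ngauss = distr (PiM J (\<lambda>_. ngauss)) borel (\<lambda>y. y j)" ..
  qed
  finally show ?thesis
    using P.indep_vars_iff_distr_eq_PiM'[OF assms(2), of "\<lambda>j y. y j" "\<lambda>_. borel"] rv by simp
qed

lemma distributed_PiM_ngauss:
  assumes "j \<in> J"
  shows "distributed (PiM J (\<lambda>_. ngauss)) lborel (\<lambda>y. y j) std_normal_density"
proof -
  have m: "(\<lambda>y. y j) \<in> PiM J (\<lambda>_. ngauss) \<rightarrow>\<^sub>M lborel"
    using measurable_component_singleton[OF assms, of "\<lambda>_. ngauss"] by simp
  have "distr (PiM J (\<lambda>_. ngauss)) lborel (\<lambda>y. y j) = distr (PiM J (\<lambda>_. ngauss)) ngauss (\<lambda>y. y j)"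
    by (rule distr_cong) auto
  also have "\<dots> = ngauss" using distr_PiM_component[of J "\<lambda>_. ngauss" j] assms gauss_prob.prob_space_axioms by simp
  finally show ?thesis using m by (simp add: distributed_def)
qed

text \<open>A linear form in independent standard normal variables is normal with standard deviation
  s, the Euclidean norm of its coefficients. Division by s leaves variance 1 and an arbitrary mean,
  which the preceding uniform bound covers. Zero coefficients are dropped so that every summand has
  positive variance.\<close>

lemma nn_integral_ninv_real_affine:
  fixes a :: "'i \<Rightarrow> real"
  assumes J: "finite J" and pos: "0 < (\<Sum>j\<in>J. (a j)\<^sup>2)"
  shows "(\<integral>\<^sup>+y. ninv ((b + (\<Sum>j\<in>J. a j * y j))\<^sup>2) \<partial>PiM J (\<lambda>_. ngauss)) \<le> 5 * ninv (\<Sum>j\<in>J. (a j)\<^sup>2)"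
proof -
  define M where "M = PiM J (\<lambda>_. ngauss)"
  interpret P: prob_space M unfolding M_def by (rule prob_space_PiM) (rule gauss_prob.prob_space_axioms)
  define J' where "J' = {j\<in>J. a j \<noteq> 0}"
  define s where "s = sqrt (\<Sum>j\<in>J. (a j)\<^sup>2)"
  have s: "0 < s" "s\<^sup>2 = (\<Sum>j\<in>J. (a j)\<^sup>2)" using pos by (auto simp: s_def)
  have s': "s = sqrt (\<Sum>j\<in>J'. \<bar>a j\<bar>\<^sup>2)"
    unfolding s_def J'_def using J by (intro arg_cong[where f = sqrt] sum.mono_neutral_cong_right) auto
  have ne: "J' \<noteq> {}" using s(1) unfolding s' by auto
  have fin: "finite J'" using J by (simp add: J'_def)
  have sum': "(\<Sum>j\<in>J. a j * y j) = (\<Sum>j\<in>J'. a j * y j)" for y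
    unfolding J'_def using J by (intro sum.mono_neutral_right) auto
  have ind: "P.indep_vars (\<lambda>_. borel) (\<lambda>j y. y j) J'"
    by (rule P.indep_vars_subset[of _ _ J])
       (use indep_vars_PiM_ngauss[of J] J ne in \<open>auto simp: M_def J'_def\<close>)
  then have ind: "P.indep_vars (\<lambda>_. borel) (\<lambda>j y. a j * y j) J'"
    by (rule P.indep_vars_compose2[where Y = "\<lambda>j x. a j * x"]) auto
  have dist: "distributed M lborel (\<lambda>y. a j * y j) (normal_density 0 \<bar>a j\<bar>)" if "j \<in> J'" for j
    using P.normal_density_affine[of "\<lambda>y. y j" 0 1 "a j" 0] distributed_PiM_ngauss[of j J] that
    by (auto simp: M_def J'_def)
  have "distributed M lborel (\<lambda>y. \<Sum>j\<in>J'. a j * y j) (normal_density (\<Sum>j\<in>J'. 0) (sqrt (\<Sum>j\<in>J'. \<bar>a j\<bar>\<^sup>2)))"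
    by (rule P.sum_indep_normal[OF fin ne ind]) (use dist in \<open>auto simp: J'_def\<close>)
  then have "distributed M lborel (\<lambda>y. \<Sum>j\<in>J. a j * y j) (normal_density 0 s)"
    unfolding sum' s' by simp
  from P.normal_density_affine[OF this s(1), of "1 / s" "b / s"]
  have D: "distributed M lborel (\<lambda>y. b / s + 1 / s * (\<Sum>j\<in>J. a j * y j)) (normal_density (b / s) 1)"
    using s by simp
  define X where "X y = b / s + 1 / s * (\<Sum>j\<in>J. a j * y j)" for y
  have Xsq: "(b + (\<Sum>j\<in>J. a j * y j))\<^sup>2 = (X y)\<^sup>2 * s\<^sup>2" for y
    using s(1) by (simp add: X_def power_mult_distrib[symmetric] field_simps)
  have eq: "ninv ((b + (\<Sum>j\<in>J. a j * y j))\<^sup>2) = ninv (s\<^sup>2) * ninv ((X y)\<^sup>2)" for y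
    unfolding Xsq using s(1) by (subst ninv_mult) (auto simp: ninv_def[of "s\<^sup>2"] mult.commute)
  have X: "X \<in> borel_measurable M"
    using distributed_measurable[OF D] by (simp add: X_def[abs_def])
  have "(\<integral>\<^sup>+y. ninv ((b + (\<Sum>j\<in>J. a j * y j))\<^sup>2) \<partial>M) = ninv (s\<^sup>2) * (\<integral>\<^sup>+y. ninv ((X y)\<^sup>2) \<partial>M)"
    unfolding eq by (rule nn_integral_cmult) (use X in measurable)
  also have "(\<integral>\<^sup>+y. ninv ((X y)\<^sup>2) \<partial>M) = (\<integral>\<^sup>+x. ennreal (normal_density (b / s) 1 x) * ninv (x\<^sup>2) \<partial>lborel)"
    using distributed_nn_integral[OF D, of "\<lambda>x. ninv (x\<^sup>2)"] by (simp add: X_def)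
  also have "\<dots> \<le> 5"
    using nn_integral_ninv_normal[of "b / s"] by (simp add: mult.commute)
  finally show ?thesis unfolding M_def s(2) by (simp add: mult.commute[of _ "ninv _"] mult_left_mono)
qed

text \<open>The noise is real and the coefficients are complex. Either the real or the imaginary
  parts carry half of the squared norm, and passing to that part only increases \<open>ninv\<close>.
  The half costs 2^(1/4), at most 6/5, and 5 * 6/5 = 6.\<close>

lemma nn_integral_ninv_affine:
  fixes C :: "'i \<Rightarrow> complex"
  assumes J: "finite J"
  shows "(\<integral>\<^sup>+y. ninv ((cmod (\<alpha> + (\<Sum>j\<in>J. C j * of_real (y j))))\<^sup>2) \<partial>PiM J (\<lambda>_. ngauss))
    \<le> 6 * ninv (\<Sum>j\<in>J. (cmod (C j))\<^sup>2)"
proof (cases "(\<Sum>j\<in>J. (cmod (C j))\<^sup>2) = 0")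
  case True
  then show ?thesis by (simp add: ninv_def ennreal_mult_top)
next
  case False
  define S where "S = (\<Sum>j\<in>J. (cmod (C j))\<^sup>2)"
  have S: "0 < S" using False by (simp add: S_def less_le sum_nonneg)
  have half: "ninv (S / 2) \<le> ennreal (6/5) * ninv S"
  proof -
    have "((1::real)/2) powr (-1/4) \<le> 6/5"
    proof -
      have "((1::real)/2) powr (-1/4) = 2 powr (1/4)"
        by (simp add: powr_divide powr_minus_divide)
      also have "\<dots> \<le> ((6/5) powr 4) powr (1/4)"
        by (intro powr_mono2) (auto simp: powr_numeral power_divide)
      also have "\<dots> = 6/5" by (simp only: powr_powr) simp
      finally show ?thesis .
    qed
    then show ?thesis
      using ninv_mult[of S "1/2"] S by (simp add: mult.commute mult_left_mono ennreal_leI)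
  qed
  have main: "?thesis" if re: "\<And>y. b + (\<Sum>j\<in>J. a j * y j) = f (\<alpha> + (\<Sum>j\<in>J. C j * of_real (y j)))"
      and le: "\<And>z. \<bar>f z\<bar> \<le> cmod z" and ge: "S / 2 \<le> (\<Sum>j\<in>J. (a j)\<^sup>2)" for a b and f :: "complex \<Rightarrow> real"
  proof -
    have "(\<integral>\<^sup>+y. ninv ((cmod (\<alpha> + (\<Sum>j\<in>J. C j * of_real (y j))))\<^sup>2) \<partial>PiM J (\<lambda>_. ngauss))
      \<le> (\<integral>\<^sup>+y. ninv ((b + (\<Sum>j\<in>J. a j * y j))\<^sup>2) \<partial>PiM J (\<lambda>_. ngauss))"
      unfolding re by (intro nn_integral_mono ninv_antimono) (use le in \<open>auto simp: power2_le_iff_abs_le\<close>)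
    also have "\<dots> \<le> 5 * ninv (\<Sum>j\<in>J. (a j)\<^sup>2)"
      by (rule nn_integral_ninv_real_affine[OF J]) (use ge S in auto)
    also have "\<dots> \<le> 5 * ninv (S / 2)"
      by (intro mult_left_mono ninv_antimono ge) (use S in auto)
    also have "\<dots> \<le> 5 * (ennreal (6/5) * ninv S)"
      by (intro mult_left_mono half) auto
    also have "\<dots> = 6 * ninv S"
      by (simp add: mult.assoc[symmetric] ennreal_numeral[symmetric] ennreal_mult[symmetric] del: ennreal_numeral)
    finally show ?thesis by (simp add: S_def)
  qed
  have "S = (\<Sum>j\<in>J. (Re (C j))\<^sup>2) + (\<Sum>j\<in>J. (Im (C j))\<^sup>2)"
    by (simp add: S_def cmod_power2 sum.distrib)
  then consider "S / 2 \<le> (\<Sum>j\<in>J. (Re (C j))\<^sup>2)" | "S / 2 \<le> (\<Sum>j\<in>J. (Im (C j))\<^sup>2)" by linarith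
  then show ?thesis
  proof cases
    case 1
    then show ?thesis
      by (intro main[of "Re \<alpha>" "\<lambda>j. Re (C j)" Re]) (auto simp: abs_Re_le_cmod)
  next
    case 2
    then show ?thesis
      by (intro main[of "Im \<alpha>" "\<lambda>j. Im (C j)" Im]) (auto simp: abs_Im_le_cmod)
  qed
qed

text \<open>Summing over all placements of unit rows keeps the quantity stable under the expansion along
  a further row, whose noise has the minors as coefficients.\<close>

definition minor_sum :: "nat \<Rightarrow> nat set \<Rightarrow> nat set \<Rightarrow> (nat \<Rightarrow> nat \<Rightarrow> complex) \<Rightarrow> real" where
  "minor_sum n J R f = (\<Sum>\<phi>\<in>R \<rightarrow>\<^sub>E J. (cmod (dt n (\<lambda>p. if p \<in> R then unit_row (\<phi> p) else f p)))\<^sup>2)"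

lemma minor_sum_nonneg: "0 \<le> minor_sum n J R f"
  by (simp add: minor_sum_def sum_nonneg)

lemma minor_sum_empty: "minor_sum n J {} f = (cmod (dt n f))\<^sup>2"
  by (simp add: minor_sum_def)

lemma minor_sum_insert:
  assumes "p \<notin> R"
  shows "minor_sum n J (insert p R) f =
    (\<Sum>\<phi>\<in>R \<rightarrow>\<^sub>E J. \<Sum>j\<in>J. (cmod (dt n ((\<lambda>p. if p \<in> R then unit_row (\<phi> p) else f p)(p := unit_row j))))\<^sup>2)"
proof -
  have "minor_sum n J (insert p R) f = (\<Sum>(j, \<phi>)\<in>J \<times> (R \<rightarrow>\<^sub>E J).
      (cmod (dt n (\<lambda>q. if q \<in> insert p R then unit_row ((\<phi>(p := j)) q) else f q)))\<^sup>2)"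
    unfolding minor_sum_def PiE_insert_eq using assms
    by (subst sum.reindex[OF inj_combinator]) (auto simp: case_prod_unfold)
  also have "\<dots> = (\<Sum>(j, \<phi>)\<in>J \<times> (R \<rightarrow>\<^sub>E J).
      (cmod (dt n ((\<lambda>p. if p \<in> R then unit_row (\<phi> p) else f p)(p := unit_row j))))\<^sup>2)"
    using assms by (intro sum.cong refl) (auto intro!: arg_cong[where f = "\<lambda>z. (cmod z)\<^sup>2"] dt_cong)
  also have "\<dots> = (\<Sum>\<phi>\<in>R \<rightarrow>\<^sub>E J. \<Sum>j\<in>J. (cmod (dt n ((\<lambda>p. if p \<in> R then unit_row (\<phi> p) else f p)(p := unit_row j))))\<^sup>2)"
    by (simp add: sum.cartesian_product[symmetric] sum.swap[of _ J])
  finally show ?thesis .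
qed

text \<open>Each term of the sum is the squared modulus of an affine function of the noise in row \<open>p\<close>. Jensen's
  inequality for the convex function \<open>ninv\<close>, with weights proportional to the squared norms of the
  coefficient vectors, reduces the sum to its terms without loss.\<close>

lemma nn_integral_ninv_row:
  assumes p: "p < n" "p \<notin> R" and fin: "finite J" "finite R" and J: "J \<subseteq> {..<n}" and \<delta>: "0 < \<delta>"
  shows "(\<integral>\<^sup>+y. ninv (minor_sum n J R (f(p := \<lambda>q. f p q + (if q \<in> J then of_real (\<delta> * y (p, q)) else 0)))) \<partial>PiM ({p} \<times> J) (\<lambda>_. ngauss))
    \<le> 6 * ennreal (\<delta> powr (-1/2)) * ninv (minor_sum n J (insert p R) f)" (is "?L \<le> ?K * _")
proof (cases "minor_sum n J (insert p R) f = 0")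
  case True
  then show ?thesis using \<delta> by (simp add: ninv_def ennreal_mult_top)
next
  case False
  define D where "D \<phi> r = dt n ((\<lambda>p. if p \<in> R then unit_row (\<phi> p) else f p)(p := r))" for \<phi> r
  define C where "C \<phi> j = D \<phi> (unit_row j)" for \<phi> j
  define S where "S \<phi> = (\<Sum>j\<in>J. (cmod (C \<phi> j))\<^sup>2)" for \<phi>
  define W where "W = minor_sum n J (insert p R) f"
  let ?P = "R \<rightarrow>\<^sub>E J"
  let ?r = "\<lambda>y q. f p q + (if q \<in> J then complex_of_real (\<delta> * y (p, q)) else 0)"
  have finP: "finite ?P" using fin by (intro finite_PiE) auto
  have W: "W = (\<Sum>\<phi>\<in>?P. S \<phi>)" unfolding W_def minor_sum_insert[OF p(2)] S_def C_def D_def ..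
  have Wpos: "0 < W" using False minor_sum_nonneg[of n J "insert p R" f] by (simp add: W_def)
  have S0: "0 \<le> S \<phi>" for \<phi> by (simp add: S_def sum_nonneg)
  have sing: "(\<Sum>k\<in>{p} \<times> J. F k) = (\<Sum>j\<in>J. F (p, j))" for F :: "nat \<times> nat \<Rightarrow> 'b::comm_monoid_add"
    using sum.cartesian_product[of "\<lambda>i j. F (i, j)" J "{p}"] by (simp add: case_prod_unfold)
  have Dexp: "D \<phi> (?r y) = D \<phi> (f p) + (\<Sum>k\<in>{p} \<times> J. (of_real \<delta> * C \<phi> (snd k)) * of_real (y k))" for \<phi> y
  proof -
    have "D \<phi> (?r y) = (\<Sum>j<n. ?r y j * C \<phi> j)"
      unfolding D_def C_def by (rule dt_expand_row[OF p(1)])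
    also have "\<dots> = (\<Sum>j<n. f p j * C \<phi> j) + (\<Sum>j<n. (if j \<in> J then of_real (\<delta> * y (p, j)) else 0) * C \<phi> j)"
      by (simp add: distrib_right sum.distrib)
    also have "(\<Sum>j<n. f p j * C \<phi> j) = D \<phi> (f p)"
      unfolding D_def C_def by (rule dt_expand_row[OF p(1), symmetric])
    also have "(\<Sum>j<n. (if j \<in> J then of_real (\<delta> * y (p, j)) else 0) * C \<phi> j) = (\<Sum>j\<in>J. (of_real \<delta> * C \<phi> j) * of_real (y (p, j)))"
      by (rule sum.mono_neutral_cong_right) (use J in auto)
    finally show ?thesis by (simp add: sing)
  qed
  have VD: "minor_sum n J R (f(p := ?r y)) = (\<Sum>\<phi>\<in>?P. (cmod (D \<phi> (?r y)))\<^sup>2)" for y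
    unfolding minor_sum_def D_def using p(2)
    by (intro sum.cong refl arg_cong[where f = "\<lambda>z. (cmod z)\<^sup>2"] dt_cong) auto
  define pr where "pr \<phi> = S \<phi> / W" for \<phi>
  have pt: "ninv (minor_sum n J R (f(p := ?r y))) \<le>
      (\<Sum>\<phi>\<in>?P. ennreal (pr \<phi>) * (if S \<phi> = 0 then 0 else ninv ((cmod (D \<phi> (?r y)))\<^sup>2) * ennreal ((W / S \<phi>) powr (-1/4))))" for y
  proof -
    \<comment> \<open>Weights and values are matched so that \<open>pr \<phi> * ?x \<phi>\<close> is
      the squared modulus of the determinant. Where \<open>S \<phi> = 0\<close> the weight is 0, and
      the value 1 merely keeps \<open>ninv\<close> finite.\<close>
    let ?x = "\<lambda>\<phi>. if S \<phi> = 0 then 1 else (cmod (D \<phi> (?r y)))\<^sup>2 * (W / S \<phi>)"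
    have "(\<Sum>\<phi>\<in>?P. pr \<phi> * ?x \<phi>) \<le> minor_sum n J R (f(p := ?r y))"
      unfolding VD by (intro sum_mono) (use Wpos in \<open>auto simp: pr_def\<close>)
    then have "ninv (minor_sum n J R (f(p := ?r y))) \<le> ninv (\<Sum>\<phi>\<in>?P. pr \<phi> * ?x \<phi>)"
      by (intro ninv_antimono sum_nonneg) (use Wpos S0 in \<open>auto simp: pr_def\<close>)
    also have "\<dots> \<le> (\<Sum>\<phi>\<in>?P. ennreal (pr \<phi>) * ninv (?x \<phi>))"
      by (rule ninv_convex_sum[OF finP]) (use Wpos S0 W in \<open>auto simp: pr_def sum_divide_distrib[symmetric]\<close>)
    also have "\<dots> = (\<Sum>\<phi>\<in>?P. ennreal (pr \<phi>) * (if S \<phi> = 0 then 0 else ninv ((cmod (D \<phi> (?r y)))\<^sup>2) * ennreal ((W / S \<phi>) powr (-1/4))))"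
    proof (rule sum.cong[OF refl])
      fix \<phi>
      show "ennreal (pr \<phi>) * ninv (?x \<phi>) = ennreal (pr \<phi>) * (if S \<phi> = 0 then 0 else ninv ((cmod (D \<phi> (?r y)))\<^sup>2) * ennreal ((W / S \<phi>) powr (-1/4)))"
        using S0[of \<phi>] Wpos ninv_mult[of "(cmod (D \<phi> (?r y)))\<^sup>2" "W / S \<phi>"]
        by (cases "S \<phi> = 0") (simp_all add: pr_def)
    qed
    finally show ?thesis .
  qed
  have m: "(\<lambda>y. y j) \<in> borel_measurable (PiM ({p} \<times> J) (\<lambda>_. ngauss))" if "j \<in> {p} \<times> J" for j
    using distributed_measurable[OF distributed_PiM_ngauss[OF that]] by simp
  have mD: "(\<lambda>y. D \<phi> (?r y)) \<in> borel_measurable (PiM ({p} \<times> J) (\<lambda>_. ngauss))" for \<phi>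
    unfolding Dexp by (intro borel_measurable_add borel_measurable_sum borel_measurable_times
        borel_measurable_const measurable_compose[OF m] borel_measurable_of_real) auto
  have one: "(\<integral>\<^sup>+y. (if S \<phi> = 0 then 0 else ninv ((cmod (D \<phi> (?r y)))\<^sup>2) * ennreal ((W / S \<phi>) powr (-1/4))) \<partial>PiM ({p} \<times> J) (\<lambda>_. ngauss))
     \<le> ?K * ninv W" for \<phi>
  proof (cases "S \<phi> = 0")
    case False
    then have S: "0 < S \<phi>" using S0[of \<phi>] by simp
    have "(\<integral>\<^sup>+y. ninv ((cmod (D \<phi> (?r y)))\<^sup>2) \<partial>PiM ({p} \<times> J) (\<lambda>_. ngauss)) \<le> 6 * ninv (\<Sum>k\<in>{p} \<times> J. (cmod (of_real \<delta> * C \<phi> (snd k)))\<^sup>2)"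
      unfolding Dexp by (rule nn_integral_ninv_affine) (use fin in simp)
    also have "(\<Sum>k\<in>{p} \<times> J. (cmod (of_real \<delta> * C \<phi> (snd k)))\<^sup>2) = S \<phi> * \<delta>\<^sup>2"
      by (simp add: sing S_def norm_mult power_mult_distrib sum_distrib_left mult.commute)
    also have "ninv (S \<phi> * \<delta>\<^sup>2) = ninv (S \<phi>) * ennreal (\<delta> powr (-1/2))"
    proof -
      have "(\<delta>\<^sup>2) powr (-1/4) = (\<delta> powr 2) powr (-1/4)" using \<delta> by (simp add: powr_numeral)
      also have "\<dots> = \<delta> powr (-1/2)" by (simp only: powr_powr) simp
      finally show ?thesis using S \<delta> by (subst ninv_mult) auto
    qed
    finally have "(\<integral>\<^sup>+y. ninv ((cmod (D \<phi> (?r y)))\<^sup>2) \<partial>PiM ({p} \<times> J) (\<lambda>_. ngauss)) * ennreal ((W / S \<phi>) powr (-1/4))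
       \<le> 6 * (ninv (S \<phi>) * ennreal (\<delta> powr (-1/2))) * ennreal ((W / S \<phi>) powr (-1/4))"
      by (rule mult_right_mono) simp
    also have "\<dots> = ?K * (ninv (S \<phi>) * ennreal ((W / S \<phi>) powr (-1/4)))"
      by (simp add: mult_ac)
    also have "ninv (S \<phi>) * ennreal ((W / S \<phi>) powr (-1/4)) = ninv W"
      using S Wpos ninv_mult[of "S \<phi>" "W / S \<phi>"] by simp
    finally show ?thesis using False mD by (simp add: nn_integral_multc)
  qed simp
  have "?L \<le> (\<integral>\<^sup>+y. (\<Sum>\<phi>\<in>?P. ennreal (pr \<phi>) * (if S \<phi> = 0 then 0 else ninv ((cmod (D \<phi> (?r y)))\<^sup>2) * ennreal ((W / S \<phi>) powr (-1/4)))) \<partial>PiM ({p} \<times> J) (\<lambda>_. ngauss))"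
    by (intro nn_integral_mono pt)
  also have "\<dots> = (\<Sum>\<phi>\<in>?P. \<integral>\<^sup>+y. ennreal (pr \<phi>) * (if S \<phi> = 0 then 0 else ninv ((cmod (D \<phi> (?r y)))\<^sup>2) * ennreal ((W / S \<phi>) powr (-1/4))) \<partial>PiM ({p} \<times> J) (\<lambda>_. ngauss))"
    by (rule nn_integral_sum) (use mD in measurable)
  also have "\<dots> \<le> (\<Sum>\<phi>\<in>?P. ennreal (pr \<phi>) * (?K * ninv W))"
    by (intro sum_mono, subst nn_integral_cmult) (use mD one in \<open>auto intro!: mult_left_mono\<close>)
  also have "\<dots> = (\<Sum>\<phi>\<in>?P. ennreal (pr \<phi>)) * (?K * ninv W)"
    by (simp add: sum_distrib_right)
  also have "(\<Sum>\<phi>\<in>?P. ennreal (pr \<phi>)) = 1"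
    using Wpos S0 W by (subst sum_ennreal) (auto simp: pr_def sum_divide_distrib[symmetric])
  finally show ?thesis by (simp only: mult_1_left W_def)
qed

text \<open>Composing \<pi> with the permutations of I gives distinct placements, whose determinants
  differ only by a permutation of rows and so have equal modulus. This factorial supplies the factor
  of order sqrt N per row by which \<beta> differs from \<gamma>.\<close>

lemma minor_sum_ge_fact:
  assumes I: "I \<subseteq> {..<n}" and inj: "inj_on \<pi> I" and img: "\<pi> ` I = J"
  shows "fact (card I) * (cmod (dt n (\<lambda>p. if p \<in> I then unit_row (\<pi> p) else f p)))\<^sup>2 \<le> minor_sum n J I f"
proof -
  have finI: "finite I" using I by (rule finite_subset) simp
  then have finJ: "finite J" using img by auto
  define c where "c = (cmod (dt n (\<lambda>p. if p \<in> I then unit_row (\<pi> p) else f p)))\<^sup>2"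
  define F where "F \<phi> = (cmod (dt n (\<lambda>p. if p \<in> I then unit_row (\<phi> p) else f p)))\<^sup>2" for \<phi>
  define m where "m \<sigma> = restrict (\<pi> \<circ> \<sigma>) I" for \<sigma>
  have mem: "m \<sigma> \<in> I \<rightarrow>\<^sub>E J" if "\<sigma> permutes I" for \<sigma>
    using img permutes_in_image[OF that] by (auto simp: m_def)
  have injm: "inj_on m {\<sigma>. \<sigma> permutes I}"
  proof (rule inj_onI, clarsimp)
    fix \<sigma> \<sigma>' assume s: "\<sigma> permutes I" "\<sigma>' permutes I" "m \<sigma> = m \<sigma>'"
    show "\<sigma> = \<sigma>'"
    proof
      fix p
      show "\<sigma> p = \<sigma>' p"
      proof (cases "p \<in> I")
        case True
        then have "\<pi> (\<sigma> p) = \<pi> (\<sigma>' p)" using fun_cong[OF s(3), of p] by (simp add: m_def)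
        then show ?thesis using inj True permutes_in_image[OF s(1)] permutes_in_image[OF s(2)]
          by (meson inj_onD)
      qed (use s in \<open>simp add: permutes_not_in\<close>)
    qed
  qed
  have Fm: "F (m \<sigma>) = c" if s: "\<sigma> permutes I" for \<sigma>
  proof -
    have "\<sigma> permutes {..<n}" using s I by (rule permutes_subset)
    then have "cmod (dt n (\<lambda>p. (\<lambda>p. if p \<in> I then unit_row (\<pi> p) else f p) (\<sigma> p))) = cmod (dt n (\<lambda>p. if p \<in> I then unit_row (\<pi> p) else f p))"
      by (rule cmod_dt_permute_rows)
    moreover have "(\<lambda>p. (\<lambda>p. if p \<in> I then unit_row (\<pi> p) else f p) (\<sigma> p)) = (\<lambda>p. if p \<in> I then unit_row (m \<sigma> p) else f p)"
      using permutes_in_image[OF s] permutes_not_in[OF s] by (auto simp: m_def fun_eq_iff)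
    ultimately show ?thesis by (simp add: F_def c_def)
  qed
  have "fact (card I) * c = (\<Sum>\<sigma> | \<sigma> permutes I. c)"
    using card_permutations[OF refl finI] by simp
  also have "\<dots> = (\<Sum>\<phi>\<in>m ` {\<sigma>. \<sigma> permutes I}. F \<phi>)"
    by (subst sum.reindex[OF injm]) (simp add: Fm)
  also have "\<dots> \<le> (\<Sum>\<phi>\<in>I \<rightarrow>\<^sub>E J. F \<phi>)"
    by (rule sum_mono2) (use mem finI finJ in \<open>auto intro!: finite_PiE simp: F_def\<close>)
  finally show ?thesis by (simp add: minor_sum_def F_def c_def)
qed

lemma borel_measurable_dt:
  assumes "\<And>p q. p < n \<Longrightarrow> q < n \<Longrightarrow> (\<lambda>x. F x p q) \<in> borel_measurable M"
  shows "(\<lambda>x. dt n (F x)) \<in> borel_measurable M"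
proof -
  have "dt n (F x) = (\<Sum>\<sigma> | \<sigma> permutes {0..<n}. signof \<sigma> * (\<Prod>i = 0..<n. F x i (\<sigma> i)))" for x
    by (auto simp: dt_def det_def permutes_in_image intro!: sum.cong prod.cong)
  then show ?thesis
    using assms by (simp only:) (intro borel_measurable_sum borel_measurable_times borel_measurable_const
      borel_measurable_prod, auto simp: permutes_in_image)
qed

lemma borel_measurable_dt_if:
  assumes "\<And>p q. p < n \<Longrightarrow> q < n \<Longrightarrow> (\<lambda>x. F x p q) \<in> borel_measurable M"
  shows "(\<lambda>x. dt n (\<lambda>p. if p \<in> R then u p else F x p)) \<in> borel_measurable M"
proof (rule borel_measurable_dt)
  fix p q assume "p < n" "q < n"
  then show "(\<lambda>x. (if p \<in> R then u p else F x p) q) \<in> borel_measurable M"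
    using assms by (cases "p \<in> R") auto
qed

lemma borel_measurable_minor_sum:
  assumes "\<And>p q. p < n \<Longrightarrow> q < n \<Longrightarrow> (\<lambda>x. F x p q) \<in> borel_measurable M"
  shows "(\<lambda>x. minor_sum n J R (F x)) \<in> borel_measurable M"
  unfolding minor_sum_def
  by (intro borel_measurable_sum borel_measurable_power measurable_compose[OF _ borel_measurable_norm]
      borel_measurable_dt_if assms)

lemma measurable_PiM_ngauss_component:
  "k \<in> K \<Longrightarrow> (\<lambda>y. y k) \<in> borel_measurable (PiM K (\<lambda>_. ngauss))"
  using distributed_measurable[OF distributed_PiM_ngauss] by simp

text \<open>Rows are integrated out one at a time. The row integrated innermost turns from a noisy
  row into one that ranges over unit rows, that is, it moves from R1 to R; hence the induction with
  R arbitrary.\<close>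

lemma nn_integral_ninv_rows:
  assumes "finite R1" "finite R" "finite J" "J \<subseteq> {..<n}" "R1 \<subseteq> {..<n}" "R \<inter> R1 = {}" "0 < \<delta>"
  shows "(\<integral>\<^sup>+x. ninv (minor_sum n J R (\<lambda>p q. f p q + (if p \<in> R1 \<and> q \<in> J then of_real (\<delta> * x (p, q)) else 0))) \<partial>PiM (R1 \<times> J) (\<lambda>_. ngauss))
    \<le> (6 * ennreal (\<delta> powr (-1/2))) ^ card R1 * ninv (minor_sum n J (R \<union> R1) f)"
  using assms
proof (induction R1 arbitrary: R rule: finite_induct)
  case empty
  interpret P: prob_space "PiM ({} :: (nat \<times> nat) set) (\<lambda>_. ngauss)"
    by (rule prob_space_PiM) (rule gauss_prob.prob_space_axioms)
  show ?case by (simp add: P.emeasure_space_1)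
next
  case (insert p R1)
  let ?K = "6 * ennreal (\<delta> powr (-1/2))"
  let ?f = "\<lambda>x p q. f p q + (if p \<in> R1 \<and> q \<in> J then complex_of_real (\<delta> * x (p, q)) else 0)"
  let ?F = "\<lambda>x. ninv (minor_sum n J R (\<lambda>p' q. f p' q + (if p' \<in> insert p R1 \<and> q \<in> J then complex_of_real (\<delta> * x (p', q)) else 0)))"
  have un: "insert p R1 \<times> J = (R1 \<times> J) \<union> ({p} \<times> J)" by auto
  have dis: "(R1 \<times> J) \<inter> ({p} \<times> J) = {}" using insert by auto
  have mF: "?F \<in> borel_measurable (PiM ((R1 \<times> J) \<union> ({p} \<times> J)) (\<lambda>_. ngauss))"
  proof (rule measurable_compose[OF borel_measurable_minor_sum measurable_ninv])
    fix p' q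
    show "(\<lambda>x. f p' q + (if p' \<in> insert p R1 \<and> q \<in> J then complex_of_real (\<delta> * x (p', q)) else 0))
       \<in> borel_measurable (PiM ((R1 \<times> J) \<union> ({p} \<times> J)) (\<lambda>_. ngauss))"
      using measurable_PiM_ngauss_component[of "(p', q)" "(R1 \<times> J) \<union> ({p} \<times> J)"]
      by (cases "p' \<in> insert p R1 \<and> q \<in> J") auto
  qed
  have "integral\<^sup>N (PiM (insert p R1 \<times> J) (\<lambda>_. ngauss)) ?F =
     (\<integral>\<^sup>+x. (\<integral>\<^sup>+y. ?F (merge (R1 \<times> J) ({p} \<times> J) (x, y)) \<partial>PiM ({p} \<times> J) (\<lambda>_. ngauss)) \<partial>PiM (R1 \<times> J) (\<lambda>_. ngauss))"
    unfolding un by (rule gauss_pf.product_nn_integral_fold[OF dis _ _ mF]) (use insert in auto)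
  also have "\<dots> \<le> (\<integral>\<^sup>+x. ?K * ninv (minor_sum n J (insert p R) (?f x)) \<partial>PiM (R1 \<times> J) (\<lambda>_. ngauss))"
  proof (rule nn_integral_mono)
    fix x
    have eq: "?F (merge (R1 \<times> J) ({p} \<times> J) (x, y)) =
       ninv (minor_sum n J R ((?f x)(p := \<lambda>q. ?f x p q + (if q \<in> J then of_real (\<delta> * y (p, q)) else 0))))" for y
      using insert.hyps by (intro arg_cong[where f = ninv] arg_cong[where f = "minor_sum n J R"] ext) (auto simp: merge_def)
    show "(\<integral>\<^sup>+y. ?F (merge (R1 \<times> J) ({p} \<times> J) (x, y)) \<partial>PiM ({p} \<times> J) (\<lambda>_. ngauss)) \<le> ?K * ninv (minor_sum n J (insert p R) (?f x))"
      unfolding eq by (rule nn_integral_ninv_row) (use insert in auto)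
  qed
  also have "\<dots> = ?K * (\<integral>\<^sup>+x. ninv (minor_sum n J (insert p R) (?f x)) \<partial>PiM (R1 \<times> J) (\<lambda>_. ngauss))"
  proof (rule nn_integral_cmult, rule measurable_compose[OF borel_measurable_minor_sum measurable_ninv])
    fix p' q
    show "(\<lambda>x. ?f x p' q) \<in> borel_measurable (PiM (R1 \<times> J) (\<lambda>_. ngauss))"
      using measurable_PiM_ngauss_component[of "(p', q)" "R1 \<times> J"]
      by (cases "p' \<in> R1 \<and> q \<in> J") auto
  qed
  also have "\<dots> \<le> ?K * (?K ^ card R1 * ninv (minor_sum n J (insert p R \<union> R1) f))"
    by (intro mult_left_mono insert.IH) (use insert in auto)
  also have "\<dots> = ?K ^ card (insert p R1) * ninv (minor_sum n J (R \<union> insert p R1) f)"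
    using insert.hyps by (simp add: mult.assoc)
  finally show ?case .
qed

theorem nn_integral_ninv_dt:
  fixes A :: "nat \<Rightarrow> nat \<Rightarrow> complex"
  assumes I: "I \<subseteq> {..<n}" and inj: "inj_on \<pi> I" and img: "\<pi> ` I \<subseteq> {..<n}" and \<delta>: "0 < \<delta>" and L: "0 < L"
  defines "B \<equiv> \<lambda>x p q. A p q + of_real (\<delta> * x (p, q))"
  shows "(\<integral>\<^sup>+x. ninv ((cmod (dt n (B x)))\<^sup>2) *
       indicator {x. L \<le> cmod (dt n (\<lambda>p. if p \<in> I then unit_row (\<pi> p) else B x p))} x
       \<partial>PiM ({..<n} \<times> {..<n}) (\<lambda>_. ngauss))
     \<le> (6 * ennreal (\<delta> powr (-1/2))) ^ card I * ninv (fact (card I) * L\<^sup>2)"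
proof -
  define J where "J = \<pi> ` I"
  define K1 where "K1 = {..<n} \<times> {..<n} - I \<times> J"
  let ?Hm = "\<lambda>x. dt n (\<lambda>p. if p \<in> I then unit_row (\<pi> p) else B x p)"
  let ?F = "\<lambda>x. ninv ((cmod (dt n (B x)))\<^sup>2) * indicator {x. L \<le> cmod (?Hm x)} x"
  have fin: "finite I" "finite J" using I by (auto simp: J_def intro: finite_subset)
  have un: "{..<n} \<times> {..<n} = K1 \<union> I \<times> J" and dis: "K1 \<inter> I \<times> J = {}"
    using I img by (auto simp: K1_def J_def)
  have fK: "finite K1" by (simp add: K1_def)
  have mB: "(\<lambda>x. B x p q) \<in> borel_measurable (PiM (K1 \<union> I \<times> J) (\<lambda>_. ngauss))" if "p < n" "q < n" for p q
    unfolding B_def un[symmetric]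
    using measurable_PiM_ngauss_component[of "(p, q)" "{..<n} \<times> {..<n}"] that by auto
  have mH: "(\<lambda>x. cmod (?Hm x)) \<in> borel_measurable (PiM (K1 \<union> I \<times> J) (\<lambda>_. ngauss))"
    by (intro measurable_compose[OF _ borel_measurable_norm] borel_measurable_dt_if mB)
  have mF: "?F \<in> borel_measurable (PiM (K1 \<union> I \<times> J) (\<lambda>_. ngauss))"
  proof (rule borel_measurable_times_ennreal)
    show "(\<lambda>x. ninv ((cmod (dt n (B x)))\<^sup>2)) \<in> borel_measurable (PiM (K1 \<union> I \<times> J) (\<lambda>_. ngauss))"
      by (intro measurable_compose[OF _ measurable_ninv] borel_measurable_power measurable_compose[OF _ borel_measurable_norm] borel_measurable_dt mB)
    have "indicator {x. L \<le> cmod (?Hm x)} = (\<lambda>x. indicator {L..} (cmod (?Hm x)) :: ennreal)"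
      by (auto simp: indicator_def)
    then show "(indicator {x. L \<le> cmod (?Hm x)} :: _ \<Rightarrow> ennreal) \<in> borel_measurable (PiM (K1 \<union> I \<times> J) (\<lambda>_. ngauss))"
      using measurable_compose[OF mH, of "indicator {L..}" borel] by simp
  qed
  interpret P: prob_space "PiM K1 (\<lambda>_. ngauss)"
    by (rule prob_space_PiM) (rule gauss_prob.prob_space_axioms)
  have "integral\<^sup>N (PiM ({..<n} \<times> {..<n}) (\<lambda>_. ngauss)) ?F =
     (\<integral>\<^sup>+x. (\<integral>\<^sup>+y. ?F (merge K1 (I \<times> J) (x, y)) \<partial>PiM (I \<times> J) (\<lambda>_. ngauss)) \<partial>PiM K1 (\<lambda>_. ngauss))"
    unfolding un by (rule gauss_pf.product_nn_integral_fold[OF dis fK _ mF]) (use fin in auto)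
  also have "\<dots> \<le> (\<integral>\<^sup>+x. (6 * ennreal (\<delta> powr (-1/2))) ^ card I * ninv (fact (card I) * L\<^sup>2) \<partial>PiM K1 (\<lambda>_. ngauss))"
  proof (rule nn_integral_mono)
    fix x
    define f where "f p q = A p q + (if (p, q) \<in> K1 then of_real (\<delta> * x (p, q)) else 0)" for p q
    let ?h = "dt n (\<lambda>p. if p \<in> I then unit_row (\<pi> p) else f p)"
    \<comment> \<open>Rows in I are unit rows here, and the noise in the other rows belongs to K1,
      so this determinant does not depend on y.\<close>
    have H: "?Hm (merge K1 (I \<times> J) (x, y)) = ?h" for y
      by (rule dt_cong) (auto simp: B_def f_def merge_def K1_def)
    have Bm: "dt n (B (merge K1 (I \<times> J) (x, y))) = dt n (\<lambda>p q. f p q + (if p \<in> I \<and> q \<in> J then of_real (\<delta> * y (p, q)) else 0))" for y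
      by (rule dt_cong) (use I in \<open>auto simp: B_def f_def merge_def K1_def\<close>)
    show "(\<integral>\<^sup>+y. ?F (merge K1 (I \<times> J) (x, y)) \<partial>PiM (I \<times> J) (\<lambda>_. ngauss)) \<le> (6 * ennreal (\<delta> powr (-1/2))) ^ card I * ninv (fact (card I) * L\<^sup>2)"
    proof (cases "L \<le> cmod ?h")
      case False
      then show ?thesis by (simp add: H indicator_def)
    next
      case True
      have "(\<integral>\<^sup>+y. ?F (merge K1 (I \<times> J) (x, y)) \<partial>PiM (I \<times> J) (\<lambda>_. ngauss)) =
        (\<integral>\<^sup>+y. ninv (minor_sum n J {} (\<lambda>p q. f p q + (if p \<in> I \<and> q \<in> J then of_real (\<delta> * y (p, q)) else 0))) \<partial>PiM (I \<times> J) (\<lambda>_. ngauss))"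
        by (simp only: Bm minor_sum_empty indicator_def mem_Collect_eq H True if_True mult_1_right of_bool_eq)
      also have "\<dots> \<le> (6 * ennreal (\<delta> powr (-1/2))) ^ card I * ninv (minor_sum n J ({} \<union> I) f)"
        by (rule nn_integral_ninv_rows) (use fin img I \<delta> in \<open>auto simp: J_def\<close>)
      also have "ninv (minor_sum n J ({} \<union> I) f) \<le> ninv (fact (card I) * L\<^sup>2)"
      proof (rule ninv_antimono)
        have "fact (card I) * L\<^sup>2 \<le> fact (card I) * (cmod ?h)\<^sup>2"
          using True L by (intro mult_left_mono power_mono) auto
        also have "\<dots> \<le> minor_sum n J I f" by (rule minor_sum_ge_fact[OF I inj]) (simp add: J_def)
        finally show "fact (card I) * L\<^sup>2 \<le> minor_sum n J ({} \<union> I) f" by simp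
      qed simp
      finally show ?thesis by (simp add: mult_left_mono)
    qed
  qed
  also have "\<dots> = (6 * ennreal (\<delta> powr (-1/2))) ^ card I * ninv (fact (card I) * L\<^sup>2)"
    by (simp add: P.emeasure_space_1)
  finally show ?thesis .
qed

section \<open>Operator norm of the noise\<close>

text \<open>The points \<open>k / (4 * sqrt n)\<close>, \<open>k \<in> net n\<close>, form a net of the unit ball with mesh \<open>1/4\<close>, whence the
  constant in \<open>net_event\<close>: \<open>8 * n * t = (4 * sqrt n)\<^sup>2 * t / 2\<close>.\<close>

definition bil :: "nat \<Rightarrow> (nat \<times> nat \<Rightarrow> real) \<Rightarrow> (nat \<Rightarrow> real) \<Rightarrow> (nat \<Rightarrow> real) \<Rightarrow> real" where
  "bil n g u v = (\<Sum>p<n. \<Sum>q<n. u p * g (p, q) * v q)"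

definition net :: "nat \<Rightarrow> (nat \<Rightarrow> int) set" where
  "net n = {k \<in> {..<n} \<rightarrow>\<^sub>E {- int (16 * n)..int (16 * n)}. (\<Sum>p<n. (k p)\<^sup>2) \<le> int (16 * n)}"

definition net_event :: "nat \<Rightarrow> real \<Rightarrow> (nat \<times> nat \<Rightarrow> real) set" where
  "net_event n t = {g. \<forall>k\<in>net n. \<forall>l\<in>net n. \<bar>bil n g (\<lambda>p. of_int (k p)) (\<lambda>p. of_int (l p))\<bar> \<le> 8 * real n * t}"

abbreviation rl2 :: "nat \<Rightarrow> (nat \<Rightarrow> real) \<Rightarrow> real" where
  "rl2 n v \<equiv> L2_set v {..<n}"

lemma finite_net: "finite (net n)"
  unfolding net_def by (rule finite_subset[of _ "{..<n} \<rightarrow>\<^sub>E {- int (16 * n)..int (16 * n)}"]) (auto intro: finite_PiE)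

lemma sum_half_power_abs: "(\<Sum>i=-int m..int m. (1/2::real) ^ nat \<bar>i\<bar>) \<le> 3 - 2 * (1/2) ^ m"
proof (induction m)
  case (Suc m)
  have "{-int (Suc m)..int (Suc m)} = insert (- int (Suc m)) (insert (int (Suc m)) {-int m..int m})"
    by auto
  then have "(\<Sum>i=-int (Suc m)..int (Suc m). (1/2::real) ^ nat \<bar>i\<bar>) = 2 * (1/2) ^ Suc m + (\<Sum>i=-int m..int m. (1/2) ^ nat \<bar>i\<bar>)"
    by (simp add: nat_add_distrib)
  then show ?case using Suc by simp
qed simp

text \<open>Since \<open>\<Sum> \<bar>k p\<bar> \<le> \<Sum> (k p)\<^sup>2 \<le> 16 * n\<close>, each element has weight at least \<open>2 powr (-16 * n)\<close> under \<open>\<Prod> (1/2) ^ \<bar>k p\<bar>\<close>.\<close>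

lemma card_net: "real (card (net n)) \<le> (2 ^ 16 * 3) ^ n"
proof -
  let ?P = "{..<n} \<rightarrow>\<^sub>E {- int (16 * n)..int (16 * n)}"
  have one: "1 \<le> 2 ^ (16 * n) * (\<Prod>p<n. (1/2::real) ^ nat \<bar>k p\<bar>)" if k: "k \<in> net n" for k
  proof -
    have "(\<Sum>p<n. nat \<bar>k p\<bar>) \<le> 16 * n"
    proof -
      have "\<bar>i\<bar> \<le> i\<^sup>2" for i :: int
        by (cases "i = 0") (auto simp: power2_eq_square abs_mult[symmetric] intro: self_le_power[of "\<bar>i\<bar>" 2, simplified power2_eq_square abs_mult_self_eq])
      then have "(\<Sum>p<n. \<bar>k p\<bar>) \<le> (\<Sum>p<n. (k p)\<^sup>2)" by (rule sum_mono)
      also have "\<dots> \<le> int (16 * n)" using k by (simp add: net_def)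
      also have "(\<Sum>p<n. \<bar>k p\<bar>) = int (\<Sum>p<n. nat \<bar>k p\<bar>)" by simp
      finally show ?thesis by linarith
    qed
    then have "(1/2::real) ^ (16 * n) \<le> (1/2) ^ (\<Sum>p<n. nat \<bar>k p\<bar>)"
      by (intro power_decreasing) auto
    also have "\<dots> = (\<Prod>p<n. (1/2::real) ^ nat \<bar>k p\<bar>)" by (rule power_sum)
    finally have "2 ^ (16 * n) * (1/2::real) ^ (16 * n) \<le> 2 ^ (16 * n) * (\<Prod>p<n. (1/2::real) ^ nat \<bar>k p\<bar>)"
      by (intro mult_left_mono) auto
    then show ?thesis by (simp add: power_mult_distrib[symmetric])
  qed
  have "real (card (net n)) = (\<Sum>k\<in>net n. 1)" by simp
  also have "\<dots> \<le> (\<Sum>k\<in>net n. 2 ^ (16 * n) * (\<Prod>p<n. (1/2::real) ^ nat \<bar>k p\<bar>))"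
    by (rule sum_mono) (rule one)
  also have "\<dots> \<le> (\<Sum>k\<in>?P. 2 ^ (16 * n) * (\<Prod>p<n. (1/2::real) ^ nat \<bar>k p\<bar>))"
  proof (rule sum_mono2)
    show "finite ?P" by (intro finite_PiE) auto
    show "net n \<subseteq> ?P" by (auto simp: net_def)
    show "0 \<le> 2 ^ (16 * n) * (\<Prod>p<n. (1/2::real) ^ nat \<bar>k p\<bar>)" for k :: "nat \<Rightarrow> int"
      by (intro mult_nonneg_nonneg prod_nonneg) auto
  qed
  also have "\<dots> = 2 ^ (16 * n) * (\<Prod>p<n. \<Sum>i=-int (16 * n)..int (16 * n). (1/2::real) ^ nat \<bar>i\<bar>)"
    unfolding sum_distrib_left[symmetric]
    by (subst prod_sum_PiE[of "{..<n}" "\<lambda>_. {- int (16 * n)..int (16 * n)}" "\<lambda>_ i. (1/2::real) ^ nat \<bar>i\<bar>"]) simp_all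
  also have "\<dots> \<le> 2 ^ (16 * n) * (\<Prod>p<n. 3)"
  proof (intro mult_left_mono prod_mono conjI)
    fix p
    have "3 - 2 * (1/2::real) ^ (16 * n) \<le> 3" by simp
    then show "(\<Sum>i=-int (16 * n)..int (16 * n). (1/2::real) ^ nat \<bar>i\<bar>) \<le> 3"
      using sum_half_power_abs[of "16 * n"] by linarith
  qed (auto intro: sum_nonneg)
  also have "\<dots> = (2 ^ 16 * 3) ^ n" by (simp only: power_mult power_mult_distrib prod_constant card_lessThan)
  finally show ?thesis .
qed

lemma bil_add_left: "bil n g (\<lambda>p. u p + u' p) v = bil n g u v + bil n g u' v"
  by (simp add: bil_def distrib_right sum.distrib)

lemma bil_add_right: "bil n g u (\<lambda>p. v p + v' p) = bil n g u v + bil n g u v'"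
  by (simp add: bil_def distrib_left sum.distrib)

lemma bil_scale_left: "bil n g (\<lambda>p. a * u p) v = a * bil n g u v"
  by (simp add: bil_def sum_distrib_left mult.assoc)

lemma bil_scale_right: "bil n g u (\<lambda>p. a * v p) = a * bil n g u v"
  by (simp add: bil_def sum_distrib_left mult.left_commute)

lemma bil_bounded: "rl2 n u \<le> 1 \<Longrightarrow> rl2 n v \<le> 1 \<Longrightarrow> \<bar>bil n g u v\<bar> \<le> (\<Sum>p<n. \<Sum>q<n. \<bar>g (p, q)\<bar>)"
proof -
  assume uv: "rl2 n u \<le> 1" "rl2 n v \<le> 1"
  have b: "\<bar>w p\<bar> \<le> 1" if "p < n" "rl2 n w \<le> 1" for w p
    using member_le_L2_set[of "{..<n}" p "\<lambda>p. \<bar>w p\<bar>"] that order_trans[of "\<bar>w p\<bar>" "rl2 n w" 1]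
    by (simp add: L2_set_def)
  have "\<bar>u p * g (p, q) * v q\<bar> \<le> \<bar>g (p, q)\<bar>" if "p < n" "q < n" for p q
  proof -
    have "\<bar>u p\<bar> * \<bar>v q\<bar> \<le> 1" using b[OF that(1) uv(1)] b[OF that(2) uv(2)] by (intro mult_le_one) auto
    from mult_right_mono[OF this, of "\<bar>g (p, q)\<bar>"] show ?thesis by (simp add: abs_mult mult_ac)
  qed
  then show ?thesis unfolding bil_def
    by (intro order_trans[OF sum_abs] sum_mono) auto
qed

lemma rl2_scale: "rl2 n (\<lambda>p. a * v p) = \<bar>a\<bar> * rl2 n v"
  by (simp add: L2_set_def power_mult_distrib sum_distrib_left[symmetric] real_sqrt_mult)

text \<open>Rounding the scaled coordinates towards zero does not increase any modulus, so the
  approximant stays in the unit ball and its numerators satisfy the bound in \<open>net\<close>.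
  Each coordinate moves by at most 1 / (4 sqrt n), hence the error has norm at most 1/4.\<close>

lemma net_approx:
  assumes n: "0 < n" and v: "rl2 n v \<le> 1"
  obtains k where "k \<in> net n" "rl2 n (\<lambda>p. of_int (k p) / (4 * sqrt n)) \<le> 1"
    "rl2 n (\<lambda>p. v p - of_int (k p) / (4 * sqrt n)) \<le> 1/4"
proof -
  let ?s = "4 * sqrt (real n)"
  have s: "0 < ?s" using n by simp
  define k where "k p = (if p < n then (if 0 \<le> v p then \<lfloor>?s * v p\<rfloor> else \<lceil>?s * v p\<rceil>) else undefined)" for p
  have k1: "\<bar>of_int (k p)\<bar> \<le> ?s * \<bar>v p\<bar>" and k2: "\<bar>?s * v p - of_int (k p)\<bar> \<le> 1" if "p < n" for p
  proof -
    have "\<bar>of_int (k p)\<bar> \<le> ?s * \<bar>v p\<bar> \<and> \<bar>?s * v p - of_int (k p)\<bar> \<le> 1"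
    proof (cases "0 \<le> v p")
      case True
      then have "0 \<le> ?s * v p" using s by simp
      then have "0 \<le> \<lfloor>?s * v p\<rfloor>" by simp
      then show ?thesis using True that by (simp add: k_def) linarith
    next
      case False
      then have "?s * v p \<le> 0" using s by (simp add: mult_nonneg_nonpos)
      then have "\<lceil>?s * v p\<rceil> \<le> 0" by simp
      then show ?thesis using False that by (simp add: k_def) linarith
    qed
    then show "\<bar>of_int (k p)\<bar> \<le> ?s * \<bar>v p\<bar>" "\<bar>?s * v p - of_int (k p)\<bar> \<le> 1" by auto
  qed
  have v2: "(\<Sum>p<n. (v p)\<^sup>2) \<le> 1" using v by (simp add: L2_set_def)
  have ksq: "(of_int (k p))\<^sup>2 \<le> ?s\<^sup>2 * (v p)\<^sup>2" if "p < n" for p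
    using power_mono[OF k1[OF that] abs_ge_zero, of 2] by (simp add: power_mult_distrib)
  have s2: "?s\<^sup>2 = 16 * real n" by (simp add: power_mult_distrib)
  have "real_of_int (\<Sum>p<n. (k p)\<^sup>2) \<le> (\<Sum>p<n. ?s\<^sup>2 * (v p)\<^sup>2)"
    unfolding of_int_sum of_int_power by (rule sum_mono) (use ksq in auto)
  also have "\<dots> \<le> 16 * real n"
    using v2 n unfolding sum_distrib_left[symmetric] s2 by simp
  finally have ks: "(\<Sum>p<n. (k p)\<^sup>2) \<le> int (16 * n)" by linarith
  have "\<bar>k p\<bar> \<le> int (16 * n)" if "p < n" for p
  proof -
    have "\<bar>k p\<bar> \<le> (k p)\<^sup>2"
      by (cases "k p = 0") (auto simp: power2_eq_square abs_mult[symmetric] intro: self_le_power[of "\<bar>k p\<bar>" 2, simplified power2_eq_square abs_mult_self_eq])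
    also have "\<dots> \<le> (\<Sum>p<n. (k p)\<^sup>2)" using that by (intro member_le_sum) auto
    finally show ?thesis using ks by simp
  qed
  then have "k \<in> net n"
    using ks by (auto simp: net_def PiE_iff extensional_def abs_le_iff minus_le_iff) (simp add: k_def)
  moreover have "rl2 n (\<lambda>p. of_int (k p) / ?s) \<le> 1"
  proof -
    have "rl2 n (\<lambda>p. of_int (k p) / ?s) \<le> rl2 n (\<lambda>p. \<bar>v p\<bar>)"
      unfolding L2_set_def using ksq s
      by (intro real_sqrt_le_mono sum_mono) (auto simp: power_divide field_simps)
    then show ?thesis using v by (simp add: L2_set_def)
  qed
  moreover have "rl2 n (\<lambda>p. v p - of_int (k p) / ?s) \<le> 1/4"
  proof -
    have "(v p - of_int (k p) / ?s)\<^sup>2 \<le> (1 / ?s)\<^sup>2" if "p < n" for p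
    proof -
      have "v p - of_int (k p) / ?s = (?s * v p - of_int (k p)) / ?s" using s by (simp add: field_simps)
      also have "\<bar>\<dots>\<bar> \<le> 1 / ?s" unfolding abs_divide using k2[OF that] s by (intro frac_le) auto
      finally show ?thesis using s by (simp add: abs_le_square_iff[symmetric])
    qed
    then have "(\<Sum>p<n. (v p - of_int (k p) / ?s)\<^sup>2) \<le> (\<Sum>p<n. (1 / ?s)\<^sup>2)" by (intro sum_mono) auto
    also have "\<dots> = (1/4)\<^sup>2" using n by (simp add: power_divide power_mult_distrib)
    finally show ?thesis unfolding L2_set_def by (intro real_le_lsqrt) auto
  qed
  ultimately show ?thesis by (rule that)
qed

text \<open>With S the supremum of the form over the unit balls, finite by
  \<open>bil_bounded\<close>, approximation of both arguments by net points gives S \<le> t/2 + S/4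
  + S/4, hence S \<le> t.\<close>

lemma bil_le_of_net_event:
  assumes n: "0 < n" and g: "g \<in> net_event n t"
  shows "\<bar>bil n g u v\<bar> \<le> t * rl2 n u * rl2 n v"
proof -
  define S where "S = Sup {\<bar>bil n g u v\<bar> | u v. rl2 n u \<le> 1 \<and> rl2 n v \<le> 1}" (is "_ = Sup ?X")
  have bdd: "bdd_above ?X" by (auto intro!: bdd_aboveI[of _ "\<Sum>p<n. \<Sum>q<n. \<bar>g (p, q)\<bar>"] bil_bounded)
  have ne: "?X \<noteq> {}"
  proof -
    have "rl2 n (\<lambda>_. 0) \<le> 1" by (simp add: L2_set_def)
    then show ?thesis by blast
  qed
  have le: "\<bar>bil n g u v\<bar> \<le> S" if "rl2 n u \<le> 1" "rl2 n v \<le> 1" for u v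
    unfolding S_def by (rule cSup_upper[OF _ bdd]) (use that in blast)
  have S0: "0 \<le> S" using le[of "\<lambda>_. 0" "\<lambda>_. 0"] by (simp add: L2_set_def bil_def)
  have le': "\<bar>bil n g u v\<bar> \<le> S * rl2 n u * rl2 n v" for u v
  proof (cases "rl2 n u = 0 \<or> rl2 n v = 0")
    case True
    then have "(\<forall>p<n. u p = 0) \<or> (\<forall>p<n. v p = 0)" by (auto simp: L2_set_eq_0_iff)
    then have "bil n g u v = 0" by (auto simp: bil_def)
    then show ?thesis using S0 by (simp add: L2_set_nonneg)
  next
    case False
    then have pos: "0 < rl2 n u" "0 < rl2 n v" by (auto simp: less_le L2_set_nonneg)
    have "\<bar>bil n g (\<lambda>p. 1 / rl2 n u * u p) (\<lambda>p. 1 / rl2 n v * v p)\<bar> \<le> S"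
      by (rule le; subst rl2_scale) (use pos in auto)
    then show ?thesis using pos unfolding bil_scale_left bil_scale_right
      by (simp add: abs_mult field_simps)
  qed
  have aux: "\<bar>bil n g u v\<bar> \<le> S * a * b" if "rl2 n u \<le> a" "rl2 n v \<le> b" "0 \<le> a" for u v a b
  proof -
    have "S * rl2 n u * rl2 n v \<le> S * a * b"
      by (rule mult_mono[OF mult_left_mono[OF that(1) S0] that(2)]) (use S0 that L2_set_nonneg in auto)
    with le'[of u v] show ?thesis by linarith
  qed
  have "S \<le> t / 2 + S / 2"
    unfolding S_def
  proof (rule cSup_least[OF ne], clarify)
    fix u v assume uv: "rl2 n u \<le> 1" "rl2 n v \<le> 1"
    let ?s = "4 * sqrt (real n)"
    obtain k where k: "k \<in> net n" "rl2 n (\<lambda>p. of_int (k p) / ?s) \<le> 1" "rl2 n (\<lambda>p. u p - of_int (k p) / ?s) \<le> 1/4"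
      using net_approx[OF n uv(1)] by blast
    obtain l where l: "l \<in> net n" "rl2 n (\<lambda>p. of_int (l p) / ?s) \<le> 1" "rl2 n (\<lambda>p. v p - of_int (l p) / ?s) \<le> 1/4"
      using net_approx[OF n uv(2)] by blast
    let ?u = "\<lambda>p. of_int (k p) / ?s" and ?v = "\<lambda>p. of_int (l p) / ?s"
    have eq: "bil n g u v = bil n g ?u ?v + bil n g (\<lambda>p. u p - ?u p) ?v + bil n g u (\<lambda>p. v p - ?v p)"
      using bil_add_left[of n g ?u "\<lambda>p. u p - ?u p" ?v] bil_add_right[of n g u ?v "\<lambda>p. v p - ?v p"] by simp
    have b1: "\<bar>bil n g (\<lambda>p. u p - ?u p) ?v\<bar> \<le> S * (1/4) * 1"
      using aux[OF k(3) l(2)] by simp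
    have b2: "\<bar>bil n g u (\<lambda>p. v p - ?v p)\<bar> \<le> S * 1 * (1/4)"
      using aux[OF uv(1) l(3)] by simp
    have b3: "\<bar>bil n g ?u ?v\<bar> \<le> t / 2"
    proof -
      have "bil n g ?u ?v = 1 / ?s * (1 / ?s * bil n g (\<lambda>p. of_int (k p)) (\<lambda>p. of_int (l p)))"
        using bil_scale_left[of n g "1 / ?s" "\<lambda>p. of_int (k p)" ?v]
          bil_scale_right[of n g "\<lambda>p. of_int (k p)" "1 / ?s" "\<lambda>p. of_int (l p)"] by simp
      also have "\<bar>\<dots>\<bar> = \<bar>bil n g (\<lambda>p. of_int (k p)) (\<lambda>p. of_int (l p))\<bar> / (16 * real n)"
        using n by (simp add: abs_mult)
      also have "\<dots> \<le> (8 * real n * t) / (16 * real n)"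
        using g k(1) l(1) by (intro divide_right_mono) (auto simp: net_event_def)
      also have "\<dots> = t / 2" using n by simp
      finally show ?thesis .
    qed
    show "\<bar>bil n g u v\<bar> \<le> t / 2 + Sup ?X / 2"
      unfolding S_def[symmetric] eq using b1 b2 b3 by linarith
  qed
  then have "S \<le> t" by simp
  then have "S * (rl2 n u * rl2 n v) \<le> t * (rl2 n u * rl2 n v)"
    by (intro mult_right_mono) (auto simp: L2_set_nonneg)
  with le'[of u v] show ?thesis by (simp add: mult.assoc)
qed

text \<open>A real matrix acts separately on real and imaginary parts. For a real vector y the norm
  of its image is recovered from the bilinear form by pairing with the image itself.\<close>

lemma l2_mv_of_real_le:
  assumes n: "0 < n" and g: "g \<in> net_event n t"
  shows "l2 n (mv n (\<lambda>p q. of_real (g (p, q))) v) \<le> t * l2 n v"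
proof -
  have t: "0 \<le> t"
  proof -
    \<comment> \<open>The zero vector lies in the net, so membership in the event forces t to be
      nonnegative.\<close>
    have "(\<lambda>p. if p < n then 0 else undefined) \<in> net n" by (auto simp: net_def PiE_iff extensional_def)
    then have "0 \<le> 8 * real n * t" using g abs_ge_zero order_trans unfolding net_event_def by blast
    then show ?thesis using n by (simp add: zero_le_mult_iff)
  qed
  have real: "(\<Sum>p<n. (\<Sum>q<n. g (p, q) * y q)\<^sup>2) \<le> t\<^sup>2 * (\<Sum>q<n. (y q)\<^sup>2)" for y
  proof -
    let ?G = "\<lambda>p. \<Sum>q<n. g (p, q) * y q"
    have "(rl2 n ?G)\<^sup>2 = (\<Sum>p<n. (?G p)\<^sup>2)"
      by (simp add: L2_set_def sum_nonneg)
    also have "\<dots> = bil n g ?G y"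
      unfolding bil_def power2_eq_square
      by (simp only: mult.assoc sum_distrib_left[symmetric])
    also have "\<dots> \<le> t * rl2 n ?G * rl2 n y" using bil_le_of_net_event[OF n g, of ?G y] by simp
    finally have "rl2 n ?G * rl2 n ?G \<le> rl2 n ?G * (t * rl2 n y)" by (simp add: power2_eq_square mult_ac)
    then have "rl2 n ?G \<le> t * rl2 n y"
      using t by (cases "rl2 n ?G = 0") (auto simp: L2_set_nonneg less_le mult_le_cancel_left_pos)
    from power_mono[OF this L2_set_nonneg, of 2] show ?thesis
      by (simp add: power_mult_distrib L2_set_def sum_nonneg)
  qed
  have re: "Re (mv n (\<lambda>p q. of_real (g (p, q))) v p) = (\<Sum>q<n. g (p, q) * Re (v q))"
    and im: "Im (mv n (\<lambda>p q. of_real (g (p, q))) v p) = (\<Sum>q<n. g (p, q) * Im (v q))" for p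
    by (simp_all add: mv_def)
  have "(l2 n (mv n (\<lambda>p q. of_real (g (p, q))) v))\<^sup>2 = (\<Sum>p<n. (\<Sum>q<n. g (p, q) * Re (v q))\<^sup>2) + (\<Sum>p<n. (\<Sum>q<n. g (p, q) * Im (v q))\<^sup>2)"
    by (simp add: l2_sq cmod_power2 re im sum.distrib)
  also have "\<dots> \<le> t\<^sup>2 * (\<Sum>q<n. (Re (v q))\<^sup>2) + t\<^sup>2 * (\<Sum>q<n. (Im (v q))\<^sup>2)"
    by (intro add_mono real)
  also have "\<dots> = (t * l2 n v)\<^sup>2"
    by (simp add: power_mult_distrib l2_sq cmod_power2 sum.distrib distrib_left)
  finally show ?thesis by (rule power2_le_imp_le) (simp add: t L2_set_nonneg)
qed

section \<open>Tail bounds for Gaussian linear forms and for the operator norm\<close>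

lemma nn_integral_exp_gauss: "(\<integral>\<^sup>+x. ennreal (exp (c * x)) \<partial>ngauss) = ennreal (exp (c\<^sup>2 / 2))"
proof -
  have "(\<integral>\<^sup>+x. ennreal (exp (c * x)) \<partial>ngauss) = (\<integral>\<^sup>+x. ennreal (std_normal_density x) * ennreal (exp (c * x)) \<partial>lborel)"
    by (rule nn_integral_density) auto
  also have "\<dots> = (\<integral>\<^sup>+x. ennreal (exp (c\<^sup>2 / 2)) * ennreal (normal_density c 1 x) \<partial>lborel)"
  proof (rule nn_integral_cong)
    fix x :: real
    have "std_normal_density x * exp (c * x) = exp (c\<^sup>2 / 2) * normal_density c 1 x"
      by (simp add: normal_density_def field_simps power2_eq_square flip: exp_add)
    then show "ennreal (std_normal_density x) * ennreal (exp (c * x)) = ennreal (exp (c\<^sup>2 / 2)) * ennreal (normal_density c 1 x)"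
      by (simp add: ennreal_mult[symmetric])
  qed
  also have "\<dots> = ennreal (exp (c\<^sup>2 / 2)) * (\<integral>\<^sup>+x. ennreal (normal_density c 1 x) \<partial>lborel)"
    by (rule nn_integral_cmult) auto
  also have "(\<integral>\<^sup>+x. ennreal (normal_density c 1 x) \<partial>lborel) = 1"
    using prob_space.emeasure_space_1[OF prob_space_normal_density[of 1 c]] by (simp add: emeasure_density)
  finally show ?thesis by simp
qed

lemma nn_integral_exp_linear:
  assumes "finite K"
  shows "(\<integral>\<^sup>+x. ennreal (exp (\<Sum>k\<in>K. c k * x k)) \<partial>PiM K (\<lambda>_. ngauss)) = ennreal (exp ((\<Sum>k\<in>K. (c k)\<^sup>2) / 2))"
proof -
  have "(\<integral>\<^sup>+x. ennreal (exp (\<Sum>k\<in>K. c k * x k)) \<partial>PiM K (\<lambda>_. ngauss)) = (\<integral>\<^sup>+x. (\<Prod>k\<in>K. ennreal (exp (c k * x k))) \<partial>PiM K (\<lambda>_. ngauss))"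
    using assms by (simp add: exp_sum prod_ennreal)
  also have "\<dots> = (\<Prod>k\<in>K. \<integral>\<^sup>+x. ennreal (exp (c k * x)) \<partial>ngauss)"
    by (rule gauss_pf.product_nn_integral_prod[OF assms]) auto
  also have "\<dots> = ennreal (\<Prod>k\<in>K. exp ((c k)\<^sup>2 / 2))"
    by (simp add: nn_integral_exp_gauss prod_ennreal)
  also have "(\<Prod>k\<in>K. exp ((c k)\<^sup>2 / 2)) = exp ((\<Sum>k\<in>K. (c k)\<^sup>2) / 2)"
    using assms by (simp add: exp_sum sum_divide_distrib)
  finally show ?thesis .
qed

text \<open>Chernoff's bound with exponent s = T / v, the optimal one for variance v; a smaller
  variance only decreases the exponential moment.\<close>

lemma gauss_linear_tail:
  assumes K: "finite K" and v: "(\<Sum>k\<in>K. (c k)\<^sup>2) \<le> v" "0 < v" and T: "0 < T"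
  shows "emeasure (PiM K (\<lambda>_. ngauss)) {x\<in>space (PiM K (\<lambda>_. ngauss)). T < (\<Sum>k\<in>K. c k * x k)} \<le> ennreal (exp (- T\<^sup>2 / (2 * v)))"
proof -
  let ?M = "PiM K (\<lambda>_. ngauss)"
  let ?X = "\<lambda>x. \<Sum>k\<in>K. c k * x k"
  define s where "s = T / v"
  have s: "0 < s" using v T by (simp add: s_def)
  have mX: "?X \<in> borel_measurable ?M"
    by (intro borel_measurable_sum borel_measurable_times borel_measurable_const measurable_PiM_ngauss_component)
  have "emeasure ?M {x\<in>space ?M. T < ?X x} = (\<integral>\<^sup>+x. indicator {x\<in>space ?M. T < ?X x} x \<partial>?M)"
    using mX by (subst nn_integral_indicator) auto
  also have "\<dots> \<le> (\<integral>\<^sup>+x. ennreal (exp (- s * T)) * ennreal (exp (\<Sum>k\<in>K. (s * c k) * x k)) \<partial>?M)"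
  proof (rule nn_integral_mono)
    fix x
    have "1 \<le> exp (- s * T) * exp (\<Sum>k\<in>K. (s * c k) * x k)" if "T < ?X x"
    proof -
      have "s * T \<le> s * ?X x" using that s by simp
      then show ?thesis by (simp add: exp_add[symmetric] sum_distrib_left mult.assoc)
    qed
    then show "indicator {x\<in>space ?M. T < ?X x} x \<le> ennreal (exp (- s * T)) * ennreal (exp (\<Sum>k\<in>K. (s * c k) * x k))"
      by (auto simp: indicator_def ennreal_mult[symmetric])
  qed
  also have "\<dots> = ennreal (exp (- s * T)) * ennreal (exp ((\<Sum>k\<in>K. (s * c k)\<^sup>2) / 2))"
    by (subst nn_integral_cmult)
       (auto simp: nn_integral_exp_linear[OF K] intro!: borel_measurable_sum borel_measurable_times measurable_PiM_ngauss_component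
         measurable_compose[OF _ measurable_ennreal] measurable_compose[OF _ borel_measurable_exp])
  also have "\<dots> = ennreal (exp (- s * T + s\<^sup>2 * (\<Sum>k\<in>K. (c k)\<^sup>2) / 2))"
    by (simp add: ennreal_mult[symmetric] exp_add[symmetric] power_mult_distrib sum_distrib_left)
  also have "\<dots> \<le> ennreal (exp (- T\<^sup>2 / (2 * v)))"
  proof (intro ennreal_leI, subst exp_le_cancel_iff)
    have "- s * T + s\<^sup>2 * (\<Sum>k\<in>K. (c k)\<^sup>2) / 2 \<le> - s * T + s\<^sup>2 * v / 2"
      using v by (simp add: mult_left_mono)
    also have "\<dots> = - T\<^sup>2 / (2 * v)"
      using v by (simp add: s_def field_simps power2_eq_square)
    finally show "- s * T + s\<^sup>2 * (\<Sum>k\<in>K. (c k)\<^sup>2) / 2 \<le> - T\<^sup>2 / (2 * v)" .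
  qed
  finally show ?thesis .
qed

lemma borel_measurable_bil [measurable]:
  "(\<lambda>g. bil n g u v) \<in> borel_measurable (PiM ({..<n} \<times> {..<n}) (\<lambda>_. ngauss))"
  unfolding bil_def
  by (intro borel_measurable_sum borel_measurable_times borel_measurable_const measurable_PiM_ngauss_component) auto

text \<open>A union bound over pairs of net points and two signs. Each form has variance at most (16
  n)^2, and the threshold 8 n t gives the exponent (8 n t)^2 / (2 (16 n)^2) = t^2 / 8.\<close>

lemma emeasure_net_event:
  assumes n: "0 < n" and t: "0 < t"
  defines "M \<equiv> PiM ({..<n} \<times> {..<n}) (\<lambda>_. ngauss)"
  shows "emeasure M (space M - net_event n t) \<le> ennreal (2 * (2 ^ 16 * 3) ^ (2 * n) * exp (- t\<^sup>2 / 8))"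
proof -
  let ?b = "\<lambda>k l g. bil n g (\<lambda>p. real_of_int (k p)) (\<lambda>p. of_int (l p))"
  let ?T = "8 * real n * t"
  let ?A = "\<lambda>k l. {g\<in>space M. ?T < ?b k l g}"
  have T: "0 < ?T" using n t by simp
  have A: "emeasure M (?A k l) \<le> ennreal (exp (- t\<^sup>2 / 8))" and A': "emeasure M {g\<in>space M. ?T < - ?b k l g} \<le> ennreal (exp (- t\<^sup>2 / 8))"
    if "k \<in> net n" "l \<in> net n" for k l
  proof -
    let ?c = "\<lambda>x::nat \<times> nat. real_of_int (k (fst x)) * of_int (l (snd x))"
    have b: "?b k l g = (\<Sum>x\<in>{..<n} \<times> {..<n}. ?c x * g x)" for g
      by (simp add: bil_def sum.cartesian_product case_prod_unfold mult_ac)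
    have r: "(\<Sum>p<n. (real_of_int (k p))\<^sup>2) \<le> 16 * real n" if "k \<in> net n" for k
    proof -
      have "real_of_int (\<Sum>p<n. (k p)\<^sup>2) \<le> real_of_int (int (16 * n))"
        using that unfolding of_int_le_iff by (simp add: net_def)
      then show ?thesis by simp
    qed
    have "(\<Sum>x\<in>{..<n} \<times> {..<n}. (?c x)\<^sup>2) = (\<Sum>p<n. (real_of_int (k p))\<^sup>2) * (\<Sum>q<n. (real_of_int (l q))\<^sup>2)"
      by (simp add: sum_product sum.cartesian_product case_prod_unfold power_mult_distrib)
    also have "\<dots> \<le> (16 * real n) * (16 * real n)"
      using r that by (intro mult_mono sum_nonneg) auto
    finally have v: "(\<Sum>x\<in>{..<n} \<times> {..<n}. (?c x)\<^sup>2) \<le> (16 * real n)\<^sup>2" by (simp add: power2_eq_square)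
    have e: "- ?T\<^sup>2 / (2 * (16 * real n)\<^sup>2) = - t\<^sup>2 / 8"
      using n by (simp add: field_simps power2_eq_square)
    show "emeasure M (?A k l) \<le> ennreal (exp (- t\<^sup>2 / 8))"
      using gauss_linear_tail[of "{..<n} \<times> {..<n}" ?c, OF _ v _ T, unfolded e] n by (simp add: M_def b)
    have "(\<Sum>x\<in>{..<n} \<times> {..<n}. (- ?c x)\<^sup>2) \<le> (16 * real n)\<^sup>2" using v by simp
    from gauss_linear_tail[of "{..<n} \<times> {..<n}" "\<lambda>x. - ?c x", OF _ this _ T, unfolded e]
    show "emeasure M {g\<in>space M. ?T < - ?b k l g} \<le> ennreal (exp (- t\<^sup>2 / 8))"
      using n by (simp add: M_def b sum_negf)
  qed
  have mb: "?b k l \<in> borel_measurable M" for k l unfolding M_def by measurable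
  have sA: "?A k l \<in> sets M" "{g\<in>space M. ?T < - ?b k l g} \<in> sets M" for k l
    using mb[of k l] by measurable
  have "space M - net_event n t \<subseteq> (\<Union>(k, l)\<in>net n \<times> net n. ?A k l \<union> {g\<in>space M. ?T < - ?b k l g})" (is "_ \<subseteq> ?U")
    by (auto simp: net_event_def not_le abs_if split: if_splits)
  then have "emeasure M (space M - net_event n t) \<le> emeasure M ?U"
    by (intro emeasure_mono sets.finite_UN) (auto simp: finite_net sA)
  also have "\<dots> \<le> (\<Sum>x\<in>net n \<times> net n. emeasure M (case x of (k, l) \<Rightarrow> ?A k l \<union> {g\<in>space M. ?T < - ?b k l g}))"
    by (intro emeasure_subadditive_finite) (auto simp: finite_net sA)
  also have "\<dots> \<le> (\<Sum>x\<in>net n \<times> net n. ennreal (2 * exp (- t\<^sup>2 / 8)))"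
  proof (rule sum_mono, clarify)
    fix k l assume kl: "k \<in> net n" "l \<in> net n"
    have "emeasure M (?A k l \<union> {g\<in>space M. ?T < - ?b k l g}) \<le> emeasure M (?A k l) + emeasure M {g\<in>space M. ?T < - ?b k l g}"
      by (rule emeasure_subadditive) (auto simp: sA)
    also have "\<dots> \<le> ennreal (exp (- t\<^sup>2 / 8)) + ennreal (exp (- t\<^sup>2 / 8))"
      by (intro add_mono A A' kl)
    finally show "emeasure M (?A k l \<union> {g\<in>space M. ?T < - ?b k l g}) \<le> ennreal (2 * exp (- t\<^sup>2 / 8))"
      by (simp add: ennreal_plus[symmetric] del: ennreal_plus)
  qed
  also have "\<dots> = ennreal (real (card (net n)) * real (card (net n)) * (2 * exp (- t\<^sup>2 / 8)))"
    by (simp add: card_cartesian_product ennreal_mult ennreal_of_nat_eq_real_of_nat)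
  also have "\<dots> \<le> ennreal ((2 ^ 16 * 3) ^ n * (2 ^ 16 * 3) ^ n * (2 * exp (- t\<^sup>2 / 8)))"
    by (intro ennreal_leI mult_right_mono mult_mono card_net) auto
  also have "(2 ^ 16 * 3) ^ n * (2 ^ 16 * 3) ^ n * (2 * exp (- t\<^sup>2 / 8)) = 2 * (2 ^ 16 * 3 :: real) ^ (2 * n) * exp (- t\<^sup>2 / 8)"
  proof -
    have "C ^ (2 * n) = C ^ n * C ^ n" for C :: real by (simp only: mult_2 power_add)
    then show ?thesis by (simp only: mult_ac)
  qed
  finally show ?thesis .
qed

section \<open>Logarithmic potentials\<close>

text \<open>Mean value property at 0 of the harmonic function ln |1 - a u|. Cauchy's formula applies
  to the principal logarithm, because 1 - a u has positive real part on the closed disc.\<close>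

lemma has_integral_ln_circle:
  assumes a: "cmod a < 1"
  shows "((\<lambda>t. ln (cmod (1 - a * cis t))) has_integral 0) {0..2 * pi}"
proof -
  define f where "f = (\<lambda>u. Ln (1 - a * u))"
  have re: "0 < Re (1 - a * u)" if "cmod u \<le> 1" for u
  proof -
    have "cmod (a * u) < 1"
      using a that by (simp add: norm_mult) (metis mult_le_one norm_ge_zero mult_left_le order_le_less_trans mult.commute)
    then have "Re (a * u) < 1" by (meson complex_Re_le_cmod le_less_trans)
    then show ?thesis by simp
  qed
  have "f holomorphic_on cball 0 1"
    unfolding f_def
  proof (intro holomorphic_intros)
    fix u :: complex assume "u \<in> cball 0 1"
    then have "0 < Re (1 - a * u)" by (intro re) auto
    then show "1 - a * u \<notin> \<real>\<^sub>\<le>\<^sub>0" by (auto simp: complex_nonpos_Reals_iff)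
  qed
  then have "((\<lambda>u. f u / (u - 0)) has_contour_integral (2 * of_real pi * \<i> * f 0)) (circlepath 0 1)"
    by (rule Cauchy_integral_circlepath_simple) simp
  then have "((\<lambda>t. f (cis t) / cis t * \<i> * cis t) has_integral 0) {0..2 * pi}"
    unfolding circlepath_def by (subst (asm) has_contour_integral_part_circlepath_iff) (auto simp: f_def)
  then have "((\<lambda>t. \<i> * f (cis t)) has_integral 0) {0..2 * pi}"
    by (simp add: mult_ac)
  \<comment> \<open>The parametrization of the circle contributes a factor \<i>, which moves the
    real part of the logarithm into the imaginary part.\<close>
  then have "((\<lambda>t. Im (\<i> * f (cis t))) has_integral Im 0) {0..2 * pi}"
    by (rule has_integral_Im)
  moreover have "Im (\<i> * f (cis t)) = ln (cmod (1 - a * cis t))" for t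
  proof -
    have "1 - a * cis t \<noteq> 0" using re[of "cis t"] by (metis norm_cis order_refl less_irrefl zero_complex.simps(1))
    then show ?thesis by (simp add: f_def)
  qed
  ultimately show ?thesis by simp
qed

lemma integral_uniform_circle:
  assumes "continuous_on UNIV (\<lambda>t. f (c + of_real r * cis t))" and f: "f \<in> borel_measurable borel"
    and I: "((\<lambda>t. f (c + of_real r * cis t)) has_integral I) {0..2 * pi}"
  shows "(\<integral>w. (f w :: real) \<partial>uniform_circle c r) = I / (2 * pi)"
proof -
  have "continuous_on UNIV (\<lambda>t. c + of_real r * cis t)"
    by (intro continuous_intros)
  then have m: "(\<lambda>t. c + of_real r * cis t) \<in> uniform_measure lborel {0..2 * pi} \<rightarrow>\<^sub>M borel"
    by (subst measurable_cong_sets[OF sets_uniform_measure refl]) (simp add: borel_measurable_continuous_onI)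
  have "(\<integral>w. f w \<partial>uniform_circle c r) = (\<integral>t. f (c + of_real r * cis t) \<partial>uniform_measure lborel {0..2 * pi})"
    unfolding uniform_circle_def by (rule integral_distr[OF m f])
  also have "uniform_measure lborel {0..2 * pi} = density lborel (\<lambda>t. ennreal (indicator {0..2 * pi} t / (2 * pi)))"
    unfolding uniform_measure_def
    by (intro density_cong) (auto simp: indicator_def divide_ennreal intro!: AE_I2 simp flip: ennreal_1)
  also have "(\<integral>t. f (c + of_real r * cis t) \<partial>density lborel (\<lambda>t. ennreal (indicator {0..2 * pi} t / (2 * pi))))
      = (\<integral>t. indicator {0..2 * pi} t / (2 * pi) * f (c + of_real r * cis t) \<partial>lborel)"
    by (subst integral_real_density) (auto intro!: borel_measurable_continuous_onI assms(1))
  also have "\<dots> = (\<integral>t. (indicator {0..2 * pi} t *\<^sub>R f (c + of_real r * cis t)) / (2 * pi) \<partial>lborel)"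
    by (rule Bochner_Integration.integral_cong) auto
  also have "\<dots> = (LINT t:{0..2 * pi}|lborel. f (c + of_real r * cis t)) / (2 * pi)"
    unfolding set_lebesgue_integral_def by (rule integral_divide_zero)
  also have "(LINT t:{0..2 * pi}|lborel. f (c + of_real r * cis t)) = I"
  proof -
    have "set_integrable lborel {0..2 * pi} (\<lambda>t. f (c + of_real r * cis t))"
      by (intro borel_integrable_atLeastAtMost' continuous_on_subset[OF assms(1)]) auto
    from set_borel_integral_eq_integral(2)[OF this] I show ?thesis by (simp add: integral_unique)
  qed
  finally show ?thesis .
qed

text \<open>Taking out the larger of |z - c| and r leaves |1 - a cis t| with |a| < 1, whose
  logarithm averages to 0. On the circle itself, a null set, the integrand would be
  singular.\<close>

lemma circle_potential:
  assumes r: "0 < r" and ne: "cmod (z - c) \<noteq> r"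
  shows "(\<integral>w. ln (cmod (z - w)) \<partial>uniform_circle c r) = ln (max (cmod (z - c)) r)"
proof -
  define m where "m = max (cmod (z - c)) r"
  have m: "0 < m" using r by (auto simp: m_def)
  obtain a where a: "cmod a < 1" "\<And>t. cmod (z - (c + of_real r * cis t)) = m * cmod (1 - a * cis t)"
  proof (cases "cmod (z - c) < r")
    case True
    \<comment> \<open>Inside the circle, r cis t is the dominant term and dividing by it produces
      cis (-t). Conjugating first restores the form 1 - a cis t.\<close>
    define a where "a = cnj (z - c) / of_real r"
    have "cmod (z - (c + of_real r * cis t)) = m * cmod (1 - a * cis t)" for t
    proof -
      have "z - (c + of_real r * cis t) = (z - c) - of_real r * cis t" by simp
      then have "cmod (z - (c + of_real r * cis t)) = cmod (cnj ((z - c) - of_real r * cis t))"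
        by (simp only: complex_mod_cnj)
      also have "cnj ((z - c) - of_real r * cis t) = cnj (z - c) - of_real r * cis (- t)"
        by (simp add: cis_cnj)
      also have "\<dots> = of_real r * cis (- t) * (a * cis t - 1)"
      proof -
        have "cis (- t) * cis t = 1" by (simp add: cis_mult)
        moreover have "of_real r * cis (- t) * (a * cis t) = (of_real r * a) * (cis (- t) * cis t)"
          by (simp only: mult_ac)
        moreover have "of_real r * a = cnj (z - c)" using r by (simp add: a_def)
        ultimately show ?thesis by (simp only: right_diff_distrib mult_1_right)
      qed
      also have "cmod \<dots> = r * cmod (1 - a * cis t)"
        using r norm_minus_commute[of "a * cis t" 1] by (simp add: norm_mult)
      finally show ?thesis using True by (simp add: m_def)
    qed
    moreover have "cmod a < 1" using True r by (simp add: a_def norm_divide del: complex_cnj_diff)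
    ultimately show ?thesis using that by blast
  next
    case False
    then have gt: "r < cmod (z - c)" using ne by simp
    then have zc: "z - c \<noteq> 0" using r by auto
    define a where "a = of_real r / (z - c)"
    have "cmod (z - (c + of_real r * cis t)) = m * cmod (1 - a * cis t)" for t
    proof -
      have "z - (c + of_real r * cis t) = (z - c) * (1 - a * cis t)"
      proof -
        have "(z - c) * (a * cis t) = of_real r * cis t" using zc by (simp add: a_def)
        then show ?thesis by (simp only: right_diff_distrib mult_1_right diff_diff_eq)
      qed
      then show ?thesis using gt by (simp add: norm_mult m_def)
    qed
    moreover have "cmod a < 1" using gt r zc by (simp add: a_def norm_divide)
    ultimately show ?thesis using that by blast
  qed
  have ne0: "1 - a * cis t \<noteq> 0" for t
  proof
    assume "1 - a * cis t = 0"
    then have "cmod (a * cis t) = 1" by (metis eq_iff_diff_eq_0 norm_one)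
    then show False using a(1) by (simp add: norm_mult)
  qed
  have ne1: "a * cis t \<noteq> 1" for t using ne0[of t] by auto
  have eq: "ln (cmod (z - (c + of_real r * cis t))) = ln m + ln (cmod (1 - a * cis t))" for t
    using a(2)[of t] m ne0[of t] by (simp add: ln_mult)
  have "((\<lambda>t. ln m + ln (cmod (1 - a * cis t))) has_integral (2 * pi * ln m + 0)) {0..2 * pi}"
    using has_integral_const_real[of "ln m" 0 "2 * pi"]
    by (intro has_integral_add has_integral_ln_circle a) simp
  then have "(\<integral>w. ln (cmod (z - w)) \<partial>uniform_circle c r) = (2 * pi * ln m + 0) / (2 * pi)"
    by (intro integral_uniform_circle) (auto simp: eq ne0 ne1 intro!: continuous_intros)
  then show ?thesis by (simp add: m_def)
qed

lemma AE_uniform_circle_bounded: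
  assumes "0 \<le> r" shows "AE w in uniform_circle c r. cmod w \<le> cmod c + r"
proof -
  have "continuous_on UNIV (\<lambda>t. c + of_real r * cis t)"
    by (intro continuous_intros)
  then have m: "(\<lambda>t. c + of_real r * cis t) \<in> uniform_measure lborel {0..2 * pi} \<rightarrow>\<^sub>M borel"
    by (subst measurable_cong_sets[OF sets_uniform_measure refl]) (simp add: borel_measurable_continuous_onI)
  have "cmod (c + of_real r * cis t) \<le> cmod c + r" for t
    using norm_triangle_ineq[of c "of_real r * cis t"] assms by (simp add: norm_mult)
  then show ?thesis unfolding uniform_circle_def by (subst AE_distr_iff[OF m]) auto
qed

text \<open>The negative part of ln |z|, integrable over the whole plane. By the convention
  \<open>ln 0 = 0\<close> it vanishes at 0.\<close>

definition lnm :: "complex \<Rightarrow> real" where "lnm z = max 0 (- ln (cmod z))"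

lemma borel_measurable_lnm [measurable]: "lnm \<in> borel_measurable borel"
  unfolding lnm_def[abs_def] by measurable

lemma lnm_nonneg: "0 \<le> lnm z" by (simp add: lnm_def)

lemma abs_ln_le_lnm: "\<bar>ln (cmod z)\<bar> \<le> cmod z + lnm z"
proof (cases "z = 0")
  case False
  then have "ln (cmod z) \<le> cmod z" by (meson ln_le_minus_one zero_less_norm_iff order_trans diff_le_self less_imp_le ln_less_self)
  moreover have "- ln (cmod z) \<le> lnm z" "0 \<le> lnm z" by (simp_all add: lnm_def)
  ultimately show ?thesis using norm_ge_zero[of z] by linarith
qed (simp add: lnm_def)

text \<open>On the unit disc - ln |z| is at most - ln |Re z|, hence at most 2 / sqrt |Re z|. This is
  a product function on the square with sides [-1, 1], with integral at most 2 * 4 * 2.\<close>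

lemma nn_integral_lnm: "(\<integral>\<^sup>+z. ennreal (lnm z) \<partial>lborel) \<le> ennreal 16"
proof -
  define F where "F b x = (if b = 1 then 2 * (ninv (x\<^sup>2) * indicator {-1..1} x) else indicator {-1..1} x :: ennreal)" for b :: complex and x :: real
  have "ennreal (lnm z) \<le> (\<Prod>b\<in>Basis. F b (z \<bullet> b))" for z
  proof (cases "z = 0 \<or> 1 < cmod z")
    case True
    then have "lnm z = 0" by (auto simp: lnm_def)
    then show ?thesis by simp
  next
    case False
    then have z: "0 < cmod z" "cmod z \<le> 1" by auto
    then have ri: "\<bar>Re z\<bar> \<le> 1" "\<bar>Im z\<bar> \<le> 1"
      using abs_Re_le_cmod[of z] abs_Im_le_cmod[of z] by linarith+
    have "ennreal (lnm z) \<le> 2 * ninv ((Re z)\<^sup>2)"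
    proof (cases "Re z = 0")
      case True
      then show ?thesis by (simp add: ninv_def ennreal_mult_top)
    next
      case False
      have "lnm z = - ln (cmod z)" using z by (simp add: lnm_def)
      also have "\<dots> \<le> - ln \<bar>Re z\<bar>" using False abs_Re_le_cmod[of z] z by simp
      also have "\<dots> = 2 * ln (((Re z)\<^sup>2) powr (-1/4))"
      proof -
        have "ln ((Re z)\<^sup>2) = 2 * ln \<bar>Re z\<bar>" using ln_realpow[of "\<bar>Re z\<bar>" 2] False by simp
        then show ?thesis using False by (simp add: ln_powr)
      qed
      also have "\<dots> \<le> 2 * ((Re z)\<^sup>2) powr (-1/4)"
        using False by (intro mult_left_mono less_imp_le[OF ln_less_self]) auto
      finally have "ennreal (lnm z) \<le> ennreal (2 * ((Re z)\<^sup>2) powr (-1/4))" by (rule ennreal_leI)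
      then show ?thesis using False by (simp add: ninv_def ennreal_mult)
    qed
    then show ?thesis
      using ri by (simp add: Basis_complex_def F_def inner_complex_def complex_eq_iff indicator_def abs_le_iff)
  qed
  then have "(\<integral>\<^sup>+z. ennreal (lnm z) \<partial>lborel) \<le> (\<integral>\<^sup>+z. (\<Prod>b\<in>Basis. F b (z \<bullet> b)) \<partial>lborel)"
    by (intro nn_integral_mono)
  also have "\<dots> = (\<Prod>b\<in>(Basis::complex set). (\<integral>\<^sup>+x. F b x \<partial>lborel))"
    by (rule nn_integral_lborel_prod) (auto simp: F_def)
  also have "\<dots> = (2 * (\<integral>\<^sup>+x. ninv (x\<^sup>2) * indicator {-1..1} x \<partial>lborel)) * (\<integral>\<^sup>+x. indicator {-1..1::real} x \<partial>lborel)"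
    by (simp add: Basis_complex_def F_def complex_eq_iff nn_integral_cmult)
  also have "\<dots> \<le> (2 * 4) * 2"
    by (intro mult_mono mult_left_mono nn_integral_ninv_unit) auto
  also have "\<dots> = ennreal 16"
    by simp
  finally show ?thesis .
qed

lemma nn_integral_translate:
  fixes f :: "complex \<Rightarrow> ennreal"
  assumes [measurable]: "f \<in> borel_measurable borel"
  shows "(\<integral>\<^sup>+z. f (z - c) \<partial>lborel) = (\<integral>\<^sup>+z. f z \<partial>lborel)"
proof -
  have "(\<integral>\<^sup>+z. f z \<partial>lborel) = (\<integral>\<^sup>+z. f z \<partial>distr lborel borel ((+) (-c)))"
    by (simp add: lborel_distr_plus)
  also have "\<dots> = (\<integral>\<^sup>+z. f (- c + z) \<partial>lborel)" by (rule nn_integral_distr) auto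
  finally show ?thesis by (simp add: add.commute)
qed

lemma nn_integral_lnm_translate: "(\<integral>\<^sup>+z. ennreal (lnm (z - c)) \<partial>lborel) \<le> ennreal 16"
  using nn_integral_translate[of "\<lambda>z. ennreal (lnm z)" c] nn_integral_lnm by simp

lemma nn_integral_abs_ln_cball:
  assumes R: "0 \<le> R"
  shows "(\<integral>\<^sup>+z. ennreal \<bar>ln (cmod (z - w))\<bar> * indicator (cball 0 R) z \<partial>lborel) \<le> ennreal ((R + cmod w) * (pi * R\<^sup>2) + 16)"
proof -
  have "(\<integral>\<^sup>+z. ennreal \<bar>ln (cmod (z - w))\<bar> * indicator (cball 0 R) z \<partial>lborel)
     \<le> (\<integral>\<^sup>+z. ennreal (R + cmod w) * indicator (cball 0 R) z + ennreal (lnm (z - w)) \<partial>lborel)"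
  proof (rule nn_integral_mono)
    fix z :: complex
    have "\<bar>ln (cmod (z - w))\<bar> \<le> (R + cmod w) + lnm (z - w)" if "cmod z \<le> R"
      using abs_ln_le_lnm[of "z - w"] norm_triangle_ineq4[of z w] that by linarith
    then show "ennreal \<bar>ln (cmod (z - w))\<bar> * indicator (cball 0 R) z \<le> ennreal (R + cmod w) * indicator (cball 0 R) z + ennreal (lnm (z - w))"
      using R by (auto simp: indicator_def lnm_nonneg ennreal_plus[symmetric] simp del: ennreal_plus intro!: ennreal_leI)
  qed
  also have "\<dots> = ennreal (R + cmod w) * emeasure lborel (cball (0::complex) R) + (\<integral>\<^sup>+z. ennreal (lnm (z - w)) \<partial>lborel)"
    by (subst nn_integral_add) (auto intro!: borel_measurable_times_ennreal borel_measurable_indicator borel_closed simp: nn_integral_cmult_indicator)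
  also have "\<dots> \<le> ennreal (R + cmod w) * ennreal (pi * R\<^sup>2) + ennreal 16"
    using R by (intro add_mono nn_integral_lnm_translate) (simp add: emeasure_cball unit_ball_vol_2)
  also have "\<dots> = ennreal ((R + cmod w) * (pi * R\<^sup>2) + 16)"
    using R by (subst ennreal_mult[symmetric], simp, simp, subst ennreal_plus[symmetric]) auto
  finally show ?thesis .
qed

lemma emeasure_annulus:
  assumes \<kappa>: "0 < \<kappa>" "\<kappa> \<le> 1"
  shows "emeasure lborel {z. \<bar>cmod (z - c) - 1\<bar> < \<kappa>} \<le> ennreal (4 * pi * \<kappa>)"
proof -
  have "emeasure lborel {z. \<bar>cmod (z - c) - 1\<bar> < \<kappa>} \<le> emeasure lborel (ball c (1 + \<kappa>) - ball c (1 - \<kappa>))"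
    by (intro emeasure_mono) (auto simp: dist_norm norm_minus_commute)
  also have "\<dots> = emeasure lborel (ball c (1 + \<kappa>)) - emeasure lborel (ball c (1 - \<kappa>))"
    using \<kappa> by (intro emeasure_Diff) (auto simp: emeasure_ball subset_ball)
  also have "\<dots> = ennreal (pi * (1 + \<kappa>)\<^sup>2) - ennreal (pi * (1 - \<kappa>)\<^sup>2)"
    using \<kappa> by (simp add: emeasure_ball unit_ball_vol_2)
  also have "\<dots> = ennreal (pi * (1 + \<kappa>)\<^sup>2 - pi * (1 - \<kappa>)\<^sup>2)"
    by (rule ennreal_minus) simp
  also have "pi * (1 + \<kappa>)\<^sup>2 - pi * (1 - \<kappa>)\<^sup>2 = 4 * pi * \<kappa>"
    by (simp add: power2_eq_square algebra_simps)
  finally show ?thesis .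
qed

text \<open>The joint integrability behind the uses of Fubini's theorem for circle averages and
  potentials. It holds because |ln |z - v|| has an integral over a ball that is bounded uniformly
  for bounded v. The shift v u and the dependence of g on u cover translated integrands as
  well.\<close>

lemma integrable_ln_pair:
  fixes \<nu> :: "complex measure" and g :: "complex \<times> complex \<Rightarrow> real" and v :: "complex \<Rightarrow> complex"
  assumes "prob_space \<nu>" and sets [measurable_cong]: "sets \<nu> = sets borel"
    and bd: "AE u in \<nu>. cmod u \<le> \<rho>"
    and g [measurable]: "g \<in> borel_measurable (borel \<Otimes>\<^sub>M borel)"
    and gb: "\<And>u z. \<bar>g (u, z)\<bar> \<le> M" and gs: "\<And>u z. cmod u \<le> \<rho> \<Longrightarrow> R < cmod z \<Longrightarrow> g (u, z) = 0"
    and v [measurable]: "v \<in> borel_measurable borel" and vb: "\<And>u. cmod u \<le> \<rho> \<Longrightarrow> cmod (v u) \<le> \<rho>'"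
    and R: "0 \<le> R"
  shows "integrable (\<nu> \<Otimes>\<^sub>M lborel) (\<lambda>(u, z). g (u, z) * ln (cmod (z - v u)))"
proof -
  interpret prob_space \<nu> by fact
  have M: "0 \<le> M" using gb[of 0 0] by (meson abs_ge_zero order_trans)
  have meas [measurable]: "(\<lambda>(u, z). g (u, z) * ln (cmod (z - v u))) \<in> borel_measurable (\<nu> \<Otimes>\<^sub>M lborel)"
    by measurable
  have "(\<integral>\<^sup>+x. ennreal (norm (case x of (u, z) \<Rightarrow> g (u, z) * ln (cmod (z - v u)))) \<partial>(\<nu> \<Otimes>\<^sub>M lborel))
     = (\<integral>\<^sup>+u. \<integral>\<^sup>+z. ennreal (norm (g (u, z) * ln (cmod (z - v u)))) \<partial>lborel \<partial>\<nu>)"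
    by (subst lborel.nn_integral_fst[symmetric]) auto
  also have "\<dots> \<le> (\<integral>\<^sup>+u. ennreal (M * ((R + \<rho>') * (pi * R\<^sup>2) + 16)) \<partial>\<nu>)"
  proof (rule nn_integral_mono_AE, use bd in eventually_elim)
    fix u assume u: "cmod u \<le> \<rho>"
    have "(\<integral>\<^sup>+z. ennreal (norm (g (u, z) * ln (cmod (z - v u)))) \<partial>lborel)
       \<le> (\<integral>\<^sup>+z. ennreal M * (ennreal \<bar>ln (cmod (z - v u))\<bar> * indicator (cball 0 R) z) \<partial>lborel)"
    proof (rule nn_integral_mono)
      fix z
      show "ennreal (norm (g (u, z) * ln (cmod (z - v u)))) \<le> ennreal M * (ennreal \<bar>ln (cmod (z - v u))\<bar> * indicator (cball 0 R) z)"
      proof (cases "cmod z \<le> R")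
        case True
        have "norm (g (u, z) * ln (cmod (z - v u))) \<le> M * \<bar>ln (cmod (z - v u))\<bar>"
          using gb[of u z] by (simp add: abs_mult mult_right_mono)
        then show ?thesis using True M by (simp add: ennreal_mult[symmetric] ennreal_leI)
      next
        case False
        then show ?thesis using gs[OF u] by simp
      qed
    qed
    also have "\<dots> = ennreal M * (\<integral>\<^sup>+z. ennreal \<bar>ln (cmod (z - v u))\<bar> * indicator (cball 0 R) z \<partial>lborel)"
      by (rule nn_integral_cmult) (auto intro!: borel_measurable_times_ennreal borel_measurable_indicator borel_closed)
    also have "\<dots> \<le> ennreal M * ennreal ((R + cmod (v u)) * (pi * R\<^sup>2) + 16)"
      by (intro mult_left_mono nn_integral_abs_ln_cball R) auto
    also have "\<dots> \<le> ennreal M * ennreal ((R + \<rho>') * (pi * R\<^sup>2) + 16)"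
      using vb[OF u] by (intro mult_left_mono ennreal_leI add_right_mono mult_right_mono) auto
    also have "\<dots> = ennreal (M * ((R + \<rho>') * (pi * R\<^sup>2) + 16))"
      using M vb[OF u] R by (intro ennreal_mult[symmetric]) (auto intro!: add_nonneg_nonneg mult_nonneg_nonneg order_trans[OF norm_ge_zero vb[OF u]])
    finally show "(\<integral>\<^sup>+z. ennreal (norm (g (u, z) * ln (cmod (z - v u)))) \<partial>lborel) \<le> ennreal (M * ((R + \<rho>') * (pi * R\<^sup>2) + 16))" .
  qed
  also have "\<dots> < \<infinity>" by (simp add: emeasure_space_1)
  finally show ?thesis using meas by (simp add: integrable_iff_bounded)
qed

lemma integral_potential_swap:
  fixes \<nu> :: "complex measure" and f :: "complex \<Rightarrow> real"
  assumes "prob_space \<nu>" and sets: "sets \<nu> = sets borel" and bd: "AE u in \<nu>. cmod u \<le> \<rho>"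
    and f [measurable]: "f \<in> borel_measurable borel"
    and fb: "\<And>z. \<bar>f z\<bar> \<le> M" and fs: "\<And>z. R < cmod z \<Longrightarrow> f z = 0" and R: "0 \<le> R"
  shows "(\<integral>u. (\<integral>z. f z * ln (cmod (z - u)) \<partial>lborel) \<partial>\<nu>) = (\<integral>z. f z * (\<integral>u. ln (cmod (z - u)) \<partial>\<nu>) \<partial>lborel)"
    and "integrable \<nu> (\<lambda>u. \<integral>z. f z * ln (cmod (z - u)) \<partial>lborel)"
    and "integrable lborel (\<lambda>z. f z * (\<integral>u. ln (cmod (z - u)) \<partial>\<nu>))"
proof -
  interpret prob_space \<nu> by fact
  interpret P: pair_sigma_finite \<nu> lborel by standard
  have int: "integrable (\<nu> \<Otimes>\<^sub>M lborel) (\<lambda>(u, z). (\<lambda>(u, z). f z) (u, z) * ln (cmod (z - u)))"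
    by (rule integrable_ln_pair[OF assms(1) sets bd, of _ M R _ \<rho>]) (use fb fs R in \<open>auto simp: case_prod_unfold\<close>)
  then have int: "integrable (\<nu> \<Otimes>\<^sub>M lborel) (\<lambda>(u, z). f z * ln (cmod (z - u)))" by simp
  from P.Fubini_integral[OF int]
  show "(\<integral>u. (\<integral>z. f z * ln (cmod (z - u)) \<partial>lborel) \<partial>\<nu>) = (\<integral>z. f z * (\<integral>u. ln (cmod (z - u)) \<partial>\<nu>) \<partial>lborel)"
    by simp
  show "integrable \<nu> (\<lambda>u. \<integral>z. f z * ln (cmod (z - u)) \<partial>lborel)"
    using P.integrable_fst'[OF int] by simp
  show "integrable lborel (\<lambda>z. f z * (\<integral>u. ln (cmod (z - u)) \<partial>\<nu>))"
    using P.integrable_snd[OF int] by simp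
qed

lemma AE_cmod_ne: "AE z in lborel. cmod (z - c) \<noteq> r"
proof -
  have "{z. cmod (z - c) = r} = sphere c r" by (auto simp: dist_norm norm_minus_commute)
  moreover have "negligible (sphere c r)" by (rule negligible_sphere)
  then have "sphere c r \<in> null_sets lebesgue" by (simp add: negligible_iff_null_sets)
  ultimately have "{z. cmod (z - c) = r} \<in> null_sets lborel"
    by (simp add: null_sets_completion_iff borel_closed)
  then show ?thesis by (auto dest: AE_not_in)
qed

text \<open>The difference of the potentials of two concentric uniform circles: a nonnegative kernel of compact
  support, so that, rescaled, it is an approximate identity made of logarithmic potentials.\<close>

definition annulus_kernel :: "real \<Rightarrow> complex \<Rightarrow> real" where
  "annulus_kernel r w = ln (max (cmod w) (2 * r)) - ln (max (cmod w) r)"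

lemma annulus_kernel_nonneg: "0 < r \<Longrightarrow> 0 \<le> annulus_kernel r w"
  by (simp add: annulus_kernel_def)

lemma annulus_kernel_le: "0 < r \<Longrightarrow> annulus_kernel r w \<le> ln 2"
proof -
  assume r: "0 < r"
  have "ln (max (cmod w) (2 * r)) \<le> ln (2 * max (cmod w) r)" using r by (subst ln_le_cancel_iff) auto
  also have "\<dots> = ln 2 + ln (max (cmod w) r)" using r by (intro ln_mult_pos) auto
  finally show ?thesis by (simp add: annulus_kernel_def)
qed

lemma annulus_kernel_eq_0: "0 < r \<Longrightarrow> 2 * r \<le> cmod w \<Longrightarrow> annulus_kernel r w = 0"
  by (simp add: annulus_kernel_def)

lemma annulus_kernel_inner: "0 < r \<Longrightarrow> cmod w \<le> r \<Longrightarrow> annulus_kernel r w = ln 2"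
  by (simp add: annulus_kernel_def max_def ln_mult_pos)

lemma borel_measurable_annulus_kernel [measurable]: "annulus_kernel r \<in> borel_measurable borel"
  unfolding annulus_kernel_def[abs_def] by measurable

lemma integrable_bounded_support:
  fixes f :: "complex \<Rightarrow> real"
  assumes "f \<in> borel_measurable borel" "\<And>z. \<bar>f z\<bar> \<le> M" "\<And>z. R < cmod z \<Longrightarrow> f z = 0"
  shows "integrable lborel f"
proof -
  have "emeasure lborel (cball (0::complex) R) < \<infinity>"
    by (rule emeasure_lborel_cball_finite)
  then have "integrable lborel (indicator (cball (0::complex) R) :: complex \<Rightarrow> real)"
    by (intro integrable_real_indicator) (auto intro: borel_closed)
  then have "integrable lborel (\<lambda>z::complex. M * indicator (cball 0 R) z :: real)" by simp
  then show ?thesis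
  proof (rule Bochner_Integration.integrable_bound)
    show "f \<in> borel_measurable lborel" using assms by simp
    show "AE z in lborel. norm (f z) \<le> norm (M * indicator (cball 0 R) z)"
    proof (rule AE_I2)
      fix z
      show "norm (f z) \<le> norm (M * indicator (cball 0 R) z)"
        using assms(2)[of z] assms(3)[of z] by (cases "cmod z \<le> R") auto
    qed
  qed
qed

lemma integral_annulus_kernel_const:
  assumes r: "0 < r"
  obtains C where "0 < C" "\<And>w. (\<integral>c. annulus_kernel r (c - w) \<partial>lborel) = C"
proof -
  define C where "C = (\<integral>c. annulus_kernel r c \<partial>lborel)"
  have int: "integrable lborel (annulus_kernel r)"
    by (rule integrable_bounded_support[of _ "ln 2" "2 * r"]) (use r annulus_kernel_nonneg annulus_kernel_le annulus_kernel_eq_0 in \<open>auto simp: abs_le_iff intro: order_trans[of _ 0]\<close>)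
  have "(\<integral>c. annulus_kernel r (c - w) \<partial>lborel) = C" for w
  proof -
    have "C = (\<integral>c. annulus_kernel r c \<partial>distr lborel borel ((+) (-w)))"
      by (simp add: lborel_distr_plus C_def)
    also have "\<dots> = (\<integral>c. annulus_kernel r (- w + c) \<partial>lborel)" by (rule integral_distr) auto
    finally show ?thesis by (simp add: add.commute)
  qed
  moreover have "0 < C"
  proof -
    have i: "integrable lborel (\<lambda>z::complex. ln 2 * indicator (cball 0 r) z :: real)"
      by (rule integrable_bounded_support[of _ "ln 2" r]) (auto simp: indicator_def intro!: borel_measurable_times borel_measurable_indicator borel_closed)
    have "0 < ln 2 * (pi * r\<^sup>2)" using r by simp
    also have "ln 2 * (pi * r\<^sup>2) = (\<integral>z. ln 2 * indicator (cball (0::complex) r) z \<partial>lborel)"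
      using r by (simp add: measure_def emeasure_cball unit_ball_vol_2)
    also have "\<dots> \<le> C" unfolding C_def
      by (rule integral_mono[OF i int]) (use r annulus_kernel_nonneg annulus_kernel_inner in \<open>auto simp: indicator_def\<close>)
    finally show ?thesis .
  qed
  ultimately show ?thesis using that by blast
qed

definition circ_avg :: "(complex \<Rightarrow> real) \<Rightarrow> real \<Rightarrow> complex \<Rightarrow> real" where
  "circ_avg \<phi> \<rho> z = (\<integral>u. \<phi> (z - u) \<partial>uniform_circle 0 \<rho>)"

text \<open>\<open>circ_avg \<phi> \<rho>\<close> is the convolution of \<phi> with the uniform
  measure on a circle. By associativity of convolution its logarithmic potential is \<phi> convolved
  with the potential ln (max |.| \<rho>) of that circle; the last equation carries this out by
  Fubini, a translation in z, and Fubini again.\<close>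

lemma circ_avg_props:
  fixes \<phi> :: "complex \<Rightarrow> real"
  assumes \<phi> [measurable]: "\<phi> \<in> borel_measurable borel" and b: "\<And>z. \<bar>\<phi> z\<bar> \<le> M" and s: "\<And>z. R < cmod z \<Longrightarrow> \<phi> z = 0"
    and \<rho>: "0 < \<rho>" and R: "0 \<le> R"
  shows "circ_avg \<phi> \<rho> \<in> borel_measurable borel" "\<bar>circ_avg \<phi> \<rho> z\<bar> \<le> M" "R + \<rho> < cmod z \<Longrightarrow> circ_avg \<phi> \<rho> z = 0"
    "integrable lborel (\<lambda>z. circ_avg \<phi> \<rho> z * ln (cmod (z - w)))"
    "integrable lborel (\<lambda>c. \<phi> c * ln (max (cmod (c - w)) \<rho>))"
    "(\<integral>z. circ_avg \<phi> \<rho> z * ln (cmod (z - w)) \<partial>lborel) = (\<integral>c. \<phi> c * ln (max (cmod (c - w)) \<rho>) \<partial>lborel)"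
proof -
  let ?\<nu> = "uniform_circle 0 \<rho>"
  interpret prob_space ?\<nu> by (rule prob_space_uniform_circle)
  interpret P: pair_sigma_finite ?\<nu> lborel by standard
  have bd: "AE u in ?\<nu>. cmod u \<le> \<rho>" using AE_uniform_circle_bounded[of \<rho> 0] \<rho> by simp
  have meas: "(\<lambda>u. f u) \<in> borel_measurable ?\<nu>" if "f \<in> borel_measurable borel" for f :: "complex \<Rightarrow> real"
    using that by (simp add: measurable_cong_sets[OF sets_uniform_circle refl])
  show "circ_avg \<phi> \<rho> \<in> borel_measurable borel"
    unfolding circ_avg_def[abs_def]
    by (rule borel_measurable_lebesgue_integral) measurable
  have int1: "integrable ?\<nu> (\<lambda>u. \<phi> (z - u))" for z
    by (rule integrable_const_bound[of _ M]) (auto simp: b intro!: meas)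
  show "\<bar>circ_avg \<phi> \<rho> z\<bar> \<le> M"
  proof -
    have "\<bar>circ_avg \<phi> \<rho> z\<bar> \<le> (\<integral>u. \<bar>\<phi> (z - u)\<bar> \<partial>?\<nu>)"
      unfolding circ_avg_def using integral_norm_bound[of ?\<nu> "\<lambda>u. \<phi> (z - u)"] by simp
    also have "\<dots> \<le> (\<integral>u. M \<partial>?\<nu>)"
      by (rule integral_mono) (use int1[of z] b in auto)
    finally show ?thesis by (simp add: prob_space)
  qed
  show "circ_avg \<phi> \<rho> z = 0" if z: "R + \<rho> < cmod z"
  proof -
    have "AE u in ?\<nu>. \<phi> (z - u) = 0"
      using bd
    proof eventually_elim
      case (elim u)
      have "cmod z \<le> cmod (z - u) + cmod u" by (metis add.commute norm_triangle_sub)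
      then show ?case using z elim by (intro s) linarith
    qed
    then show ?thesis unfolding circ_avg_def by (intro integral_eq_zero_AE)
  qed
  have I1: "integrable (?\<nu> \<Otimes>\<^sub>M lborel) (\<lambda>(u, z). (\<lambda>(u, z). \<phi> (z - u)) (u, z) * ln (cmod (z - w)))"
  proof (rule integrable_ln_pair[OF prob_space_uniform_circle sets_uniform_circle bd, of _ M "R + \<rho>" _ "cmod w"])
    fix u z :: complex assume "cmod u \<le> \<rho>" "R + \<rho> < cmod z"
    moreover have "cmod z \<le> cmod (z - u) + cmod u" by (metis add.commute norm_triangle_sub)
    ultimately show "(\<lambda>(u, z). \<phi> (z - u)) (u, z) = 0" by (simp add: s)
  qed (use b R \<rho> in auto)
  have I2: "integrable (?\<nu> \<Otimes>\<^sub>M lborel) (\<lambda>(u, z). (\<lambda>(u, z). \<phi> z) (u, z) * ln (cmod (z - (w - u))))"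
  proof (rule integrable_ln_pair[OF prob_space_uniform_circle sets_uniform_circle bd, of _ M R _ "cmod w + \<rho>"])
    fix u assume "cmod u \<le> \<rho>"
    then show "cmod (w - u) \<le> cmod w + \<rho>" using norm_triangle_ineq4[of w u] by linarith
  qed (use b s R in auto)
  note J1 = I1[simplified split_conv] and J2 = I2[simplified split_conv]
  have "(\<integral>u. \<phi> (z - u) * ln (cmod (z - w)) \<partial>?\<nu>) = circ_avg \<phi> \<rho> z * ln (cmod (z - w))" for z
    by (simp add: circ_avg_def)
  note ca = this
  show "integrable lborel (\<lambda>z. circ_avg \<phi> \<rho> z * ln (cmod (z - w)))"
    using P.integrable_snd[OF J1] by (simp add: circ_avg_def)
  have pot: "AE c in lborel. (\<integral>u. \<phi> c * ln (cmod (c - (w - u))) \<partial>?\<nu>) = \<phi> c * ln (max (cmod (c - w)) \<rho>)"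
    using AE_cmod_ne[of w \<rho>]
  proof eventually_elim
    case (elim c)
    have "(\<integral>u. \<phi> c * ln (cmod (c - (w - u))) \<partial>?\<nu>) = \<phi> c * (\<integral>u. ln (cmod ((w - c) - u)) \<partial>?\<nu>)"
    proof -
      have n: "cmod (c - (w - u)) = cmod ((w - c) - u)" for u
        using norm_minus_commute[of c "w - u"] by (simp add: algebra_simps)
      show ?thesis unfolding n by simp
    qed
    also have "(\<integral>u. ln (cmod ((w - c) - u)) \<partial>?\<nu>) = ln (max (cmod ((w - c) - 0)) \<rho>)"
      by (rule circle_potential) (use \<rho> elim in \<open>auto simp: norm_minus_commute\<close>)
    finally show ?case by (simp add: norm_minus_commute)
  qed
  have mln: "(\<lambda>c. \<phi> c * ln (max (cmod (c - w)) \<rho>)) \<in> borel_measurable lborel" by measurable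
  have snd2: "integrable lborel (\<lambda>c. \<integral>u. \<phi> c * ln (cmod (c - (w - u))) \<partial>?\<nu>)"
    by (rule P.integrable_snd[OF J2])
  show "integrable lborel (\<lambda>c. \<phi> c * ln (max (cmod (c - w)) \<rho>))"
    using integrable_cong_AE[OF borel_measurable_integrable[OF snd2] mln pot] snd2 by simp
  have "(\<integral>z. circ_avg \<phi> \<rho> z * ln (cmod (z - w)) \<partial>lborel) = (\<integral>u. (\<integral>z. \<phi> (z - u) * ln (cmod (z - w)) \<partial>lborel) \<partial>?\<nu>)"
    using P.Fubini_integral[OF J1] by (simp add: circ_avg_def)
  also have "\<dots> = (\<integral>u. (\<integral>c. \<phi> c * ln (cmod (c - (w - u))) \<partial>lborel) \<partial>?\<nu>)"
  proof (rule Bochner_Integration.integral_cong[OF refl])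
    fix u
    have "(\<integral>c. \<phi> c * ln (cmod (c - (w - u))) \<partial>lborel) = (\<integral>c. \<phi> c * ln (cmod (c - (w - u))) \<partial>distr lborel borel ((+) (-u)))"
      by (simp add: lborel_distr_plus)
    also have "\<dots> = (\<integral>z. \<phi> (- u + z) * ln (cmod ((- u + z) - (w - u))) \<partial>lborel)" by (rule integral_distr) auto
    finally show "(\<integral>z. \<phi> (z - u) * ln (cmod (z - w)) \<partial>lborel) = (\<integral>c. \<phi> c * ln (cmod (c - (w - u))) \<partial>lborel)"
      by (simp add: algebra_simps)
  qed
  also have "\<dots> = (\<integral>c. (\<integral>u. \<phi> c * ln (cmod (c - (w - u))) \<partial>?\<nu>) \<partial>lborel)"
    by (rule P.Fubini_integral[OF J2, symmetric])
  also have "\<dots> = (\<integral>c. \<phi> c * ln (max (cmod (c - w)) \<rho>) \<partial>lborel)"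
    by (rule integral_cong_AE[OF borel_measurable_integrable[OF snd2] mln pot])
  finally show "(\<integral>z. circ_avg \<phi> \<rho> z * ln (cmod (z - w)) \<partial>lborel) = (\<integral>c. \<phi> c * ln (max (cmod (c - w)) \<rho>) \<partial>lborel)" .
qed

lemma compact_support_bounded:
  fixes \<phi> :: "complex \<Rightarrow> real"
  assumes "continuous_on UNIV \<phi>" "\<And>z. R < cmod z \<Longrightarrow> \<phi> z = 0"
  obtains M where "\<And>z. \<bar>\<phi> z\<bar> \<le> M"
proof -
  have "compact (\<phi> ` cball 0 R)"
    by (intro compact_continuous_image continuous_on_subset[OF assms(1)]) auto
  then obtain B where B: "\<And>z. z \<in> cball 0 R \<Longrightarrow> norm (\<phi> z) \<le> B"
    by (meson bounded_iff compact_imp_bounded imageI)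
  have "\<bar>\<phi> z\<bar> \<le> max B 0" for z
    using B[of z] assms(2)[of z] by (cases "cmod z \<le> R") auto
  then show ?thesis by (rule that)
qed

text \<open>\<Phi> is the difference of the circle averages of \<phi> at radii 2 r and r, divided by
  C. Its potential is \<phi> convolved with \<open>annulus_kernel r\<close> divided by C, a
  probability density supported in the disc of radius 2 r, so the error is bounded by the
  oscillation of \<phi> at that scale.\<close>

theorem log_potential_approx:
  fixes \<phi> :: "complex \<Rightarrow> real"
  assumes cont: "continuous_on UNIV \<phi>" and s: "\<And>z. R0 < cmod z \<Longrightarrow> \<phi> z = 0" and \<epsilon>: "0 < \<epsilon>"
  obtains \<Phi> M R where "\<Phi> \<in> borel_measurable borel" "\<And>z. \<bar>\<Phi> z\<bar> \<le> M" "\<And>z. R < cmod z \<Longrightarrow> \<Phi> z = 0" "0 \<le> R"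
    "\<And>w. \<bar>(\<integral>z. \<Phi> z * ln (cmod (z - w)) \<partial>lborel) - \<phi> w\<bar> \<le> \<epsilon>"
proof -
  define R1 where "R1 = max R0 0"
  have s1: "\<And>z. R1 < cmod z \<Longrightarrow> \<phi> z = 0" and R1: "0 \<le> R1" using s by (auto simp: R1_def)
  obtain M0 where M0: "\<And>z. \<bar>\<phi> z\<bar> \<le> M0" using compact_support_bounded[OF cont s1] by blast
  have m\<phi> [measurable]: "\<phi> \<in> borel_measurable borel" by (rule borel_measurable_continuous_onI[OF cont])
  \<comment> \<open>The margin 2 allows a centre of modulus up to R1 + 1 together with its
    neighbours at distance below 2 r < 1; for larger centres both values of \<phi> are 0.\<close>
  have "uniformly_continuous_on (cball 0 (R1 + 2)) \<phi>"
    by (intro compact_uniformly_continuous continuous_on_subset[OF cont]) auto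
  then obtain \<delta> where \<delta>: "0 < \<delta>" "\<And>x y. x \<in> cball 0 (R1 + 2) \<Longrightarrow> y \<in> cball 0 (R1 + 2) \<Longrightarrow> dist y x < \<delta> \<Longrightarrow> dist (\<phi> y) (\<phi> x) < \<epsilon>"
    unfolding uniformly_continuous_on_def using \<epsilon> by metis
  define r where "r = min \<delta> 1 / 4"
  have r: "0 < r" "2 * r < \<delta>" "2 * r < 1" using \<delta>(1) by (auto simp: r_def min_def)
  have close: "\<bar>\<phi> c - \<phi> w\<bar> \<le> \<epsilon>" if "cmod (c - w) < 2 * r" for c w
  proof -
    have tri: "cmod c \<le> cmod w + cmod (c - w)" "cmod w \<le> cmod c + cmod (c - w)"
      using norm_triangle_ineq2[of c w] norm_triangle_ineq3[of w c] by (auto simp: norm_minus_commute)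
    show ?thesis
    proof (cases "cmod w \<le> R1 + 1")
      case True
      then have "dist (\<phi> c) (\<phi> w) < \<epsilon>" using tri that r by (intro \<delta>(2)) (auto simp: dist_norm)
      then show ?thesis by (simp add: dist_norm)
    next
      case False
      then have "\<phi> w = 0" "\<phi> c = 0" using tri that r by (auto intro!: s1)
      then show ?thesis using \<epsilon> by simp
    qed
  qed
  obtain C where C: "0 < C" "\<And>w. (\<integral>c. annulus_kernel r (c - w) \<partial>lborel) = C" using integral_annulus_kernel_const[OF r(1)] by blast
  define \<Phi> where "\<Phi> z = (circ_avg \<phi> (2 * r) z - circ_avg \<phi> r z) / C" for z
  note p1 = circ_avg_props[OF m\<phi> M0 s1 r(1) R1]
  have r2: "0 < 2 * r" using r by simp
  note p2 = circ_avg_props[OF m\<phi> M0 s1 r2 R1]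
  show ?thesis
  proof (rule that)
    show "\<Phi> \<in> borel_measurable borel" unfolding \<Phi>_def[abs_def] using p1(1) p2(1) by measurable
    show "\<bar>\<Phi> z\<bar> \<le> 2 * M0 / C" for z
    proof -
      have "\<bar>circ_avg \<phi> (2 * r) z - circ_avg \<phi> r z\<bar> \<le> 2 * M0" using p1(2)[of z] p2(2)[of z] by linarith
      then show ?thesis using C by (simp add: \<Phi>_def abs_divide divide_right_mono)
    qed
    show "\<Phi> z = 0" if "R1 + 2 * r < cmod z" for z
      using p1(3)[of z] p2(3)[of z] that r by (simp add: \<Phi>_def)
    show "0 \<le> R1 + 2 * r" using R1 r by simp
    fix w
    \<comment> \<open>The integral C is nonzero, whereas the integral of a non-integrable function
      is 0 by convention.\<close>
    have psii: "integrable lborel (\<lambda>c. annulus_kernel r (c - w))"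
      using C(1) C(2)[of w] not_integrable_integral_eq by fastforce
    have pi: "integrable lborel (\<lambda>c. \<phi> c * annulus_kernel r (c - w))"
      using Bochner_Integration.integrable_diff[OF p2(5)[of w] p1(5)[of w]] by (simp add: annulus_kernel_def right_diff_distrib)
    have "(\<integral>z. \<Phi> z * ln (cmod (z - w)) \<partial>lborel) = (\<integral>z. (circ_avg \<phi> (2 * r) z * ln (cmod (z - w)) - circ_avg \<phi> r z * ln (cmod (z - w))) / C \<partial>lborel)"
      by (simp add: \<Phi>_def diff_divide_distrib left_diff_distrib)
    also have "\<dots> = ((\<integral>c. \<phi> c * ln (max (cmod (c - w)) (2 * r)) \<partial>lborel) - (\<integral>c. \<phi> c * ln (max (cmod (c - w)) r) \<partial>lborel)) / C"
      using Bochner_Integration.integral_diff[OF p2(4)[of w] p1(4)[of w]] p1(6)[of w] p2(6)[of w] by simp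
    also have "\<dots> = (\<integral>c. \<phi> c * annulus_kernel r (c - w) \<partial>lborel) / C"
      using Bochner_Integration.integral_diff[OF p2(5)[of w] p1(5)[of w]] by (simp add: annulus_kernel_def right_diff_distrib)
    finally have e1: "(\<integral>z. \<Phi> z * ln (cmod (z - w)) \<partial>lborel) = (\<integral>c. \<phi> c * annulus_kernel r (c - w) \<partial>lborel) / C" .
    have "(\<integral>c. \<phi> c * annulus_kernel r (c - w) \<partial>lborel) - \<phi> w * C = (\<integral>c. (\<phi> c - \<phi> w) * annulus_kernel r (c - w) \<partial>lborel)"
      using Bochner_Integration.integral_diff[OF pi integrable_mult_right[OF psii, of "\<phi> w"]] C(2)[of w]
      by (simp add: left_diff_distrib)
    also have "\<bar>\<dots>\<bar> \<le> (\<integral>c. \<bar>(\<phi> c - \<phi> w) * annulus_kernel r (c - w)\<bar> \<partial>lborel)"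
      using integral_norm_bound[of lborel "\<lambda>c. (\<phi> c - \<phi> w) * annulus_kernel r (c - w)"] by simp
    also have "\<dots> \<le> (\<integral>c. \<epsilon> * annulus_kernel r (c - w) \<partial>lborel)"
    proof (rule integral_mono)
      show "integrable lborel (\<lambda>c. \<bar>(\<phi> c - \<phi> w) * annulus_kernel r (c - w)\<bar>)"
        using Bochner_Integration.integrable_diff[OF pi integrable_mult_right[OF psii, of "\<phi> w"]]
        by (intro integrable_abs) (simp add: left_diff_distrib)
      show "integrable lborel (\<lambda>c. \<epsilon> * annulus_kernel r (c - w))" using psii by simp
      fix c
      show "\<bar>(\<phi> c - \<phi> w) * annulus_kernel r (c - w)\<bar> \<le> \<epsilon> * annulus_kernel r (c - w)"
      proof (cases "cmod (c - w) < 2 * r")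
        case True
        then show ?thesis using close[OF True] annulus_kernel_nonneg[OF r(1), of "c - w"] by (simp add: abs_mult mult_right_mono)
      next
        case False
        then show ?thesis using annulus_kernel_eq_0[OF r(1), of "c - w"] by simp
      qed
    qed
    also have "\<dots> = \<epsilon> * C" using C(2)[of w] by simp
    finally have "\<bar>(\<integral>c. \<phi> c * annulus_kernel r (c - w) \<partial>lborel) - \<phi> w * C\<bar> \<le> \<epsilon> * C" .
    then show "\<bar>(\<integral>z. \<Phi> z * ln (cmod (z - w)) \<partial>lborel) - \<phi> w\<bar> \<le> \<epsilon>"
      unfolding e1 using C(1) by (simp add: abs_le_iff field_simps)
  qed
qed

section \<open>Empirical spectral measures\<close>

lemma nn_integral_mixture:
  assumes fin: "finite I" and sets: "\<And>i. i \<in> I \<Longrightarrow> sets (m i) = sets borel"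
    and f: "f \<in> borel_measurable borel"
  shows "(\<integral>\<^sup>+z. f z \<partial>mixture I w m) = (\<Sum>i\<in>I. ennreal (w i) * (\<integral>\<^sup>+z. f z \<partial>m i))"
  using f
proof (induction rule: borel_measurable_induct)
  case (cong f g)
  then show ?case by (simp cong: nn_integral_cong)
next
  case (set A)
  have "(\<integral>\<^sup>+z. indicator A z \<partial>mixture I w m) = emeasure (mixture I w m) A"
    using set by (subst nn_integral_indicator) auto
  also have "\<dots> = (\<Sum>i\<in>I. ennreal (w i) * emeasure (m i) A)"
    by (rule emeasure_mixture) (use sets set in auto)
  also have "\<dots> = (\<Sum>i\<in>I. ennreal (w i) * (\<integral>\<^sup>+z. indicator A z \<partial>m i))"
    using set sets by (intro sum.cong refl) (subst nn_integral_indicator, auto)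
  finally show ?case .
next
  case (mult u c)
  have mm: "u \<in> borel_measurable (m i)" if "i \<in> I" for i
    using mult(2) sets[OF that] by (simp cong: measurable_cong_sets)
  show ?case using mult mm
    by (simp add: nn_integral_cmult sum_distrib_left mult_ac cong: measurable_cong_sets)
next
  case (add u v)
  have mm: "u \<in> borel_measurable (m i)" "v \<in> borel_measurable (m i)" if "i \<in> I" for i
    using add sets[OF that] by (simp_all cong: measurable_cong_sets)
  show ?case using add mm
    by (simp add: nn_integral_add sum.distrib distrib_left cong: measurable_cong_sets)
next
  case (seq U)
  have mm: "U k \<in> borel_measurable (m i)" if "i \<in> I" for i k
    using seq sets[OF that] by (simp cong: measurable_cong_sets)
  have "(\<integral>\<^sup>+z. (SUP k. U k) z \<partial>mixture I w m) = (SUP k. \<integral>\<^sup>+z. U k z \<partial>mixture I w m)"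
    unfolding SUP_apply using seq by (intro nn_integral_monotone_convergence_SUP) (auto cong: measurable_cong_sets)
  also have "\<dots> = (SUP k. \<Sum>i\<in>I. ennreal (w i) * (\<integral>\<^sup>+z. U k z \<partial>m i))"
    using seq by simp
  also have "\<dots> = (\<Sum>i\<in>I. SUP k. ennreal (w i) * (\<integral>\<^sup>+z. U k z \<partial>m i))"
  proof (rule ennreal_SUP_sum, rule incseq_SucI)
    fix i k
    show "ennreal (w i) * (\<integral>\<^sup>+z. U k z \<partial>m i) \<le> ennreal (w i) * (\<integral>\<^sup>+z. U (Suc k) z \<partial>m i)"
      using incseq_SucD[OF seq(3), of k] by (intro mult_left_mono nn_integral_mono) (auto simp: le_fun_def)
  qed
  also have "\<dots> = (\<Sum>i\<in>I. ennreal (w i) * (\<integral>\<^sup>+z. (SUP k. U k) z \<partial>m i))"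
  proof (rule sum.cong[OF refl])
    fix i assume i: "i \<in> I"
    have "(\<integral>\<^sup>+z. (SUP k. U k) z \<partial>m i) = (SUP k. \<integral>\<^sup>+z. U k z \<partial>m i)"
      unfolding SUP_apply using seq mm[OF i] by (intro nn_integral_monotone_convergence_SUP) auto
    then show "(SUP k. ennreal (w i) * (\<integral>\<^sup>+z. U k z \<partial>m i)) = ennreal (w i) * (\<integral>\<^sup>+z. (SUP k. U k) z \<partial>m i)"
      by (simp add: SUP_mult_left_ennreal)
  qed
  finally show ?case .
qed

lemma integral_mixture:
  fixes f :: "complex \<Rightarrow> real"
  assumes fin: "finite I" and sets: "\<And>i. i \<in> I \<Longrightarrow> sets (m i) = sets borel"
    and f: "f \<in> borel_measurable borel" and int: "\<And>i. i \<in> I \<Longrightarrow> integrable (m i) f" and w: "\<And>i. i \<in> I \<Longrightarrow> 0 \<le> w i"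
  shows "(\<integral>z. f z \<partial>mixture I w m) = (\<Sum>i\<in>I. w i * (\<integral>z. f z \<partial>m i))" "integrable (mixture I w m) f"
proof -
  have fin_nn: "(\<integral>\<^sup>+z. ennreal (g z) \<partial>m i) < \<infinity>" if "i \<in> I" "g = f \<or> g = (\<lambda>z. - f z)" for i and g :: "complex \<Rightarrow> real"
  proof -
    have "(\<integral>\<^sup>+z. ennreal (g z) \<partial>m i) \<le> (\<integral>\<^sup>+z. ennreal (norm (f z)) \<partial>m i)"
      using that by (intro nn_integral_mono ennreal_leI) auto
    also have "\<dots> < \<infinity>" using int[OF that(1)] by (simp add: integrable_iff_bounded)
    finally show ?thesis .
  qed
  have fm: "(\<lambda>z. ennreal (g z)) \<in> borel_measurable borel" if "g = f \<or> g = (\<lambda>z. - f z)" for g :: "complex \<Rightarrow> real"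
    using that f by auto
  have tr: "enn2real (\<integral>\<^sup>+z. ennreal (g z) \<partial>mixture I w m) = (\<Sum>i\<in>I. w i * enn2real (\<integral>\<^sup>+z. ennreal (g z) \<partial>m i))"
    and tf: "(\<integral>\<^sup>+z. ennreal (g z) \<partial>mixture I w m) < \<infinity>"
    if g: "g = f \<or> g = (\<lambda>z. - f z)" for g :: "complex \<Rightarrow> real"
  proof -
    have e: "(\<integral>\<^sup>+z. ennreal (g z) \<partial>mixture I w m) = (\<Sum>i\<in>I. ennreal (w i) * (\<integral>\<^sup>+z. ennreal (g z) \<partial>m i))"
      by (rule nn_integral_mixture[OF fin sets fm[OF g]])
    also have "\<dots> = (\<Sum>i\<in>I. ennreal (w i * enn2real (\<integral>\<^sup>+z. ennreal (g z) \<partial>m i)))"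
      using fin_nn[OF _ g] w by (intro sum.cong) (auto simp: ennreal_mult less_top[symmetric])
    also have "\<dots> = ennreal (\<Sum>i\<in>I. w i * enn2real (\<integral>\<^sup>+z. ennreal (g z) \<partial>m i))"
      using w by (intro sum_ennreal) auto
    finally have e: "(\<integral>\<^sup>+z. ennreal (g z) \<partial>mixture I w m) = ennreal (\<Sum>i\<in>I. w i * enn2real (\<integral>\<^sup>+z. ennreal (g z) \<partial>m i))" .
    show "(\<integral>\<^sup>+z. ennreal (g z) \<partial>mixture I w m) < \<infinity>" unfolding e by simp
    show "enn2real (\<integral>\<^sup>+z. ennreal (g z) \<partial>mixture I w m) = (\<Sum>i\<in>I. w i * enn2real (\<integral>\<^sup>+z. ennreal (g z) \<partial>m i))"
      unfolding e using w by (simp add: sum_nonneg)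
  qed
  show int': "integrable (mixture I w m) f"
    unfolding real_integrable_def using f tf[of f] tf[of "\<lambda>z. - f z"] by (auto simp: less_top[symmetric] cong: measurable_cong_sets)
  show "(\<integral>z. f z \<partial>mixture I w m) = (\<Sum>i\<in>I. w i * (\<integral>z. f z \<partial>m i))"
    by (simp add: real_lebesgue_integral_def int' int tr right_diff_distrib sum_subtractf)
qed

lemma order_prod_linear:
  "order z (\<Prod>a\<leftarrow>as. [:- a, 1:]) = count_list as (z :: complex)"
proof (induction as)
  case (Cons a as)
  have "(\<Prod>a\<leftarrow>a # as. [:- a, 1:]) \<noteq> (0 :: complex poly)" 
    unfolding prod_list_zero_iff by auto
  then have "order z (\<Prod>a\<leftarrow>a # as. [:- a, 1:]) = order z [:- a, 1:] + order z (\<Prod>a\<leftarrow>as. [:- a, 1:])"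
    unfolding list.map prod_list.Cons by (rule order_mult)
  moreover have "order z [:- a, 1:] = (if a = z then 1 else 0)"
    using order_power_n_n[of a 1] by (auto intro: order_0I)
  ultimately show ?case using Cons by simp
qed (simp add: order_1_eq_0)

lemma sum_list_eq_sum_count:
  assumes "finite S" "set as \<subseteq> S"
  shows "(\<Sum>a\<leftarrow>as. f a) = (\<Sum>a\<in>S. real (count_list as a) * f a)"
  using assms(2)
proof (induction as)
  case (Cons x as)
  have "(\<Sum>a\<in>S. real (count_list (x # as) a) * f a) = (\<Sum>a\<in>S. (if a = x then f a else 0) + real (count_list as a) * f a)"
    by (intro sum.cong) (auto simp: algebra_simps)
  then show ?case using Cons assms(1) by (simp add: sum.distrib)
qed simp

lemma integral_esm:
  fixes f :: "complex \<Rightarrow> real"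
  assumes B: "B \<in> carrier_mat n n" and as: "char_poly B = (\<Prod>a\<leftarrow>as. [:- a, 1:])" and f: "f \<in> borel_measurable borel"
  shows "(\<integral>z. f z \<partial>empirical_spectral_measure B) = (\<Sum>a\<leftarrow>as. f a) / n"
proof -
  have sp: "spectrum B = set as"
    unfolding spectrum_root_char_poly[OF B] as by (auto simp: poly_prod_list prod_list_zero_iff)
  have "(\<integral>z. f z \<partial>empirical_spectral_measure B) = (\<Sum>a\<in>set as. real (count_list as a) / n * f a)"
    unfolding empirical_spectral_measure_def sp
    using B f by (subst integral_mixture) (auto simp: as order_prod_linear integral_return integrable_iff_bounded nn_integral_return)
  also have "\<dots> = (\<Sum>a\<in>set as. real (count_list as a) * f a) / n"
    by (simp add: sum_divide_distrib)
  also have "(\<Sum>a\<in>set as. real (count_list as a) * f a) = (\<Sum>a\<leftarrow>as. f a)"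
    by (rule sum_list_eq_sum_count[symmetric]) auto
  finally show ?thesis .
qed

text \<open>The bridge from eigenvalues to determinants: ln |det (B - z)| is the sum of ln |z - a|
  over the eigenvalues with multiplicity. Because of \<open>ln 0 = 0\<close> this can fail at the
  eigenvalues themselves, which form a finite set.\<close>

lemma integral_esm_potential:
  fixes \<Phi> :: "complex \<Rightarrow> real"
  assumes B: "B \<in> carrier_mat n n" and \<Phi> [measurable]: "\<Phi> \<in> borel_measurable borel"
    and b: "\<And>z. \<bar>\<Phi> z\<bar> \<le> M" and s: "\<And>z. R < cmod z \<Longrightarrow> \<Phi> z = 0" and R: "0 \<le> R"
  shows "(\<integral>w. (\<integral>z. \<Phi> z * ln (cmod (z - w)) \<partial>lborel) \<partial>empirical_spectral_measure B)
      = (\<integral>z. \<Phi> z * ln (cmod (det (B - z \<cdot>\<^sub>m 1\<^sub>m n))) \<partial>lborel) / n"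
    and "integrable lborel (\<lambda>z. \<Phi> z * ln (cmod (det (B - z \<cdot>\<^sub>m 1\<^sub>m n))))"
proof -
  obtain as where as: "char_poly B = (\<Prod>a\<leftarrow>as. [:- a, 1:])"
    using char_poly_factorized[OF B] by auto
  have int: "integrable lborel (\<lambda>z. \<Phi> z * ln (cmod (z - w)))" for w
    using integral_potential_swap(3)[of "return borel w" "cmod w" \<Phi> M R] assms
    by (simp add: prob_space_return AE_return integral_return)
  have lnp: "ln (\<Prod>a\<leftarrow>bs. cmod (z - a)) = (\<Sum>a\<leftarrow>bs. ln (cmod (z - a)))" if "z \<notin> set bs" for bs z
    using that
  proof (induction bs)
    case (Cons a bs)
    have "0 < (\<Prod>a\<leftarrow>bs. cmod (z - a))" using Cons.prems
      by (induction bs) auto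
    then show ?case using Cons by (simp add: ln_mult_pos)
  qed simp
  have eq: "AE z in lborel. (\<Sum>a\<leftarrow>as. \<Phi> z * ln (cmod (z - a))) = \<Phi> z * ln (cmod (det (B - z \<cdot>\<^sub>m 1\<^sub>m n)))"
  proof -
    have "AE z in lborel. z \<notin> set as"
      by (rule AE_not_in) (auto intro: countable_imp_null_set_lborel countable_finite)
    then show ?thesis
    proof eventually_elim
      case (elim z)
      show ?case unfolding cmod_det_sub_scalar[OF B as] lnp[OF elim] by (simp add: sum_list_const_mult)
    qed
  qed
  have ints: "integrable lborel (\<lambda>z. \<Sum>a\<leftarrow>bs. \<Phi> z * ln (cmod (z - a)))"
    "(\<integral>z. (\<Sum>a\<leftarrow>bs. \<Phi> z * ln (cmod (z - a))) \<partial>lborel) = (\<Sum>a\<leftarrow>bs. \<integral>z. \<Phi> z * ln (cmod (z - a)) \<partial>lborel)" for bs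
    by (induction bs) (auto simp: int)
  have md: "(\<lambda>z. \<Phi> z * ln (cmod (det (B - z \<cdot>\<^sub>m 1\<^sub>m n)))) \<in> borel_measurable lborel"
    unfolding cmod_det_sub_scalar[OF B as]
  proof -
    have "(\<lambda>z. \<Prod>a\<leftarrow>bs. cmod (z - a)) \<in> borel_measurable borel" for bs
      by (induction bs) auto
    then show "(\<lambda>z. \<Phi> z * ln (\<Prod>a\<leftarrow>as. cmod (z - a))) \<in> borel_measurable lborel" by measurable
  qed
  show "integrable lborel (\<lambda>z. \<Phi> z * ln (cmod (det (B - z \<cdot>\<^sub>m 1\<^sub>m n))))"
    using integrable_cong_AE[OF borel_measurable_integrable[OF ints(1)] md eq] ints(1) by simp
  have m: "(\<lambda>w. \<integral>z. \<Phi> z * ln (cmod (z - w)) \<partial>lborel) \<in> borel_measurable borel"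
    by measurable
  have "(\<integral>w. (\<integral>z. \<Phi> z * ln (cmod (z - w)) \<partial>lborel) \<partial>empirical_spectral_measure B) = (\<Sum>a\<leftarrow>as. \<integral>z. \<Phi> z * ln (cmod (z - a)) \<partial>lborel) / n"
    by (rule integral_esm[OF B as m])
  also have "(\<Sum>a\<leftarrow>as. \<integral>z. \<Phi> z * ln (cmod (z - a)) \<partial>lborel) = (\<integral>z. \<Phi> z * ln (cmod (det (B - z \<cdot>\<^sub>m 1\<^sub>m n))) \<partial>lborel)"
    unfolding ints(2)[symmetric] by (rule integral_cong_AE[OF borel_measurable_integrable[OF ints(1)] md eq])
  finally show "(\<integral>w. (\<integral>z. \<Phi> z * ln (cmod (z - w)) \<partial>lborel) \<partial>empirical_spectral_measure B)
      = (\<integral>z. \<Phi> z * ln (cmod (det (B - z \<cdot>\<^sub>m 1\<^sub>m n))) \<partial>lborel) / n" .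
qed

section \<open>Comparison of the log-determinant with the limiting potential\<close>

text \<open>The easy half of Stirling's formula; the induction step is k ln (1 + 1/k) \<le>
  1.\<close>

lemma ln_fact_ge: "real k * ln (real k) - real k \<le> ln (fact k :: real)"
proof (induction k)
  case (Suc k)
  show ?case
  proof (cases "k = 0")
    case False
    have "real k * ln (real (Suc k) / real k) \<le> real k * (real (Suc k) / real k - 1)"
      using False by (intro mult_left_mono ln_le_minus_one) auto
    also have "\<dots> = 1" using False by (simp add: field_simps)
    finally have "real k * ln (real (Suc k)) \<le> real k * ln (real k) + 1"
      using False by (simp add: ln_div algebra_simps)
    then have "real (Suc k) * ln (real (Suc k)) - real (Suc k) \<le> ln (real (Suc k)) + (real k * ln (real k) - real k)"
      by (simp add: algebra_simps)
    also have "\<dots> \<le> ln (real (Suc k)) + ln (fact k)" using Suc by simp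
    also have "\<dots> = ln (fact (Suc k))" by (simp add: ln_mult_pos)
    finally show ?thesis .
  qed simp
qed simp

text \<open>Up to the Stirling error k, k! falls short of n^k by k ln (n/k) in the logarithm, and
  both are controlled by sqrt (k n): use ln (n/k) \<le> 2 sqrt (n/k) and k \<le> n. The bound is
  o(n) as soon as k = o(n).\<close>

lemma fact_deficit:
  assumes "k \<le> n" "0 < n"
  shows "real k * ln (real n) - ln (fact k :: real) \<le> 3 * sqrt (real k * real n)"
proof (cases "k = 0")
  case False
  define s where "s = sqrt (real n / real k)"
  have s: "0 < s" "s\<^sup>2 = real n / real k" using assms False by (auto simp: s_def)
  have "ln (real n / real k) = 2 * ln s" using s by (metis ln_realpow of_nat_numeral)
  also have "\<dots> \<le> 2 * s" using s(1) ln_less_self[of s] by linarith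
  finally have "real k * (ln (real n) - ln (real k)) \<le> real k * (2 * s)"
    using assms False by (intro mult_left_mono) (auto simp: ln_div)
  moreover have "real k * s = sqrt (real k * real n)"
  proof -
    have "real k * s = sqrt ((real k)\<^sup>2) * sqrt (real n / real k)" by (simp add: s_def)
    also have "\<dots> = sqrt (real k * real n)"
      using False by (simp only: real_sqrt_mult[symmetric]) (simp add: power2_eq_square)
    finally show ?thesis .
  qed
  moreover have "real k \<le> sqrt (real k * real n)"
    using assms by (intro real_le_rsqrt) (simp add: power2_eq_square mult_left_mono)
  ultimately show ?thesis using ln_fact_ge[of k] by (simp add: algebra_simps)
qed simp

lemma neg_ln_one_minus:
  assumes "0 \<le> x" "x \<le> 1/2" shows "- ln (1 - x) \<le> 2 * (x::real)"
proof -
  have "- ln (1 - x) = ln (1 / (1 - x))" using assms by (simp add: ln_div)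
  also have "\<dots> \<le> 1 / (1 - x) - 1" using assms by (intro ln_le_minus_one) auto
  also have "\<dots> = x / (1 - x)" using assms by (simp add: field_simps)
  also have "\<dots> \<le> x / (1/2)" using assms by (intro divide_left_mono) auto
  finally show ?thesis by simp
qed

section \<open>Logarithmic form of the determinant bounds\<close>

context jordan_blocks
begin

context
  fixes \<beta> \<eta> Nr :: real
  assumes Nr: "Nr = real n" and n2: "2 \<le> Nr" and \<eta>: "0 < \<eta>" "\<eta> < \<beta>" and \<tau>_eq: "\<tau> = Nr powr (- \<beta> + \<eta>)"
begin

text \<open>The share of block i in \<open>limit_potential\<close>: dimension times the potential of
  its limiting circle, see \<open>ln_max_rad\<close>.\<close>

definition U :: "nat \<Rightarrow> real" where
  "U i = ln (max (cmod (w i) ^ d i) (Nr powr (- \<beta>)))"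

definition num_decaying :: real where "num_decaying = (\<Sum>i<m. if decaying i then 1 else 0)"

definition dim_near_unit :: real where "dim_near_unit = (\<Sum>i<m. if near_unit i then real (d i) else 0)"

lemma ln_power_n: "0 < x \<Longrightarrow> ln (x ^ n) = Nr * ln x" for x :: real
  unfolding Nr by (rule ln_realpow)

lemma ln_\<tau>: "ln \<tau> = (- \<beta> + \<eta>) * ln (Nr)"
  unfolding \<tau>_eq using n2 by (simp add: ln_powr)

lemma powr_le_\<tau>: "Nr powr (- \<beta>) \<le> \<tau>"
  unfolding \<tau>_eq using n2 \<eta> by (intro powr_mono) auto

lemma powr_pos: "0 < Nr powr (- \<beta>)" "ln (Nr powr (- \<beta>)) = - \<beta> * ln (Nr)"
  using n2 by (auto simp: ln_powr)

lemma regular_ge: "i < m \<Longrightarrow> \<not> near_unit i \<Longrightarrow> \<not> decaying i \<Longrightarrow> \<tau> \<le> cmod (w i) ^ d i"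
proof -
  assume i: "i < m" "\<not> near_unit i" "\<not> decaying i"
  show ?thesis
  proof (cases "cmod (w i) \<le> 1 - \<kappa>")
    case True
    then show ?thesis using i by (simp add: decaying_def)
  next
    case False
    then have "1 \<le> cmod (w i)" using i \<kappa> by (auto simp: near_unit_def abs_less_iff)
    then have "1 \<le> cmod (w i) ^ d i" by simp
    then show ?thesis using \<tau> by linarith
  qed
qed

lemma U_ge: "- \<beta> * ln (Nr) \<le> U i" "0 < cmod (w i) \<Longrightarrow> real (d i) * ln (cmod (w i)) \<le> U i"
proof -
  have "ln (Nr powr (- \<beta>)) \<le> U i" unfolding U_def using powr_pos by (subst ln_le_cancel_iff) (auto simp: less_max_iff_disj)
  then show "- \<beta> * ln (Nr) \<le> U i" using powr_pos by simp
  assume w: "0 < cmod (w i)"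
  then have "ln (cmod (w i) ^ d i) \<le> U i" unfolding U_def using powr_pos by (subst ln_le_cancel_iff) (auto simp: less_max_iff_disj)
  then show "real (d i) * ln (cmod (w i)) \<le> U i" using w by (simp add: ln_realpow)
qed

text \<open>For a decaying block ln \<tau> exceeds the floor -\<beta> ln N of \<open>U\<close> by
  \<eta> ln N. In a near-unit block |w| is at least 1/2, so each row loses at most ln 3 + ln 2,
  which is at most 5.\<close>

lemma ln_ub_le:
  assumes i: "i < m"
  shows "0 < ub i" "ln (ub i) \<le> U i + \<eta> * ln (Nr) * (if decaying i then 1 else 0) + 5 * (if near_unit i then real (d i) else 0)"
proof -
  consider "near_unit i" "\<not> decaying i" | "decaying i" "\<not> near_unit i" | "\<not> near_unit i" "\<not> decaying i"
    using near_unit_not_decaying by blast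
  then have "0 < ub i \<and> ln (ub i) \<le> U i + \<eta> * ln (Nr) * (if decaying i then 1 else 0) + 5 * (if near_unit i then real (d i) else 0)"
  proof cases
    case 1
    have w: "1/2 \<le> cmod (w i)" using 1 \<kappa> by (auto simp: near_unit_def abs_less_iff)
    have "- ln (cmod (w i)) \<le> ln 2"
    proof -
      have "ln (1/2) \<le> ln (cmod (w i))" by (subst ln_le_cancel_iff) (use w in auto)
      then show ?thesis by (simp add: ln_div)
    qed
    moreover have "ln (2::real) \<le> 1" "ln (3::real) \<le> 2" using ln_le_minus_one[of 2] ln_le_minus_one[of 3] by auto
    ultimately have "ln 3 - ln (cmod (w i)) \<le> 5" by linarith
    then have "real (d i) * (ln 3 - ln (cmod (w i))) \<le> real (d i) * 5" by (intro mult_left_mono) auto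
    moreover have "0 < cmod (w i)" using w by linarith
    ultimately show ?thesis using 1 U_ge(2)[of i] by (simp add: ub_def ln_realpow algebra_simps)
  next
    case 2
    then show ?thesis using U_ge(1)[of i] \<tau> by (simp add: ub_def ln_\<tau> algebra_simps)
  next
    case 3
    have p: "0 < cmod (w i) ^ d i" using regular_ge[OF i 3] \<tau> by linarith
    then have "ln (cmod (w i) ^ d i) \<le> U i" unfolding U_def by (subst ln_le_cancel_iff) auto
    then show ?thesis using 3 p by (simp add: ub_def)
  qed
  then show "0 < ub i" "ln (ub i) \<le> U i + \<eta> * ln (Nr) * (if decaying i then 1 else 0) + 5 * (if near_unit i then real (d i) else 0)"
    by auto
qed

text \<open>A decaying block has \<open>lb\<close> equal to 1 but potential at most ln \<tau> =
  (\<eta> - \<beta>) ln N. This negative term is kept, to be balanced by the factor of order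
  \<open>N powr (-\<beta>)\<close> that the noise contributes for the replaced row.\<close>

lemma U_le_ln_lb:
  assumes i: "i < m"
  shows "0 < lb i" "U i \<le> ln (lb i) + (\<eta> - \<beta>) * ln (Nr) * (if decaying i then 1 else 0) + (if near_unit i then real (d i) else 0)"
proof -
  have \<beta>1: "Nr powr (- \<beta>) \<le> 1" using powr_le_\<tau> \<tau> by linarith
  consider "near_unit i" "\<not> decaying i" | "decaying i" "\<not> near_unit i" | "\<not> near_unit i" "\<not> decaying i"
    using near_unit_not_decaying by blast
  then have "0 < lb i \<and> U i \<le> ln (lb i) + (\<eta> - \<beta>) * ln (Nr) * (if decaying i then 1 else 0) + (if near_unit i then real (d i) else 0)"
  proof cases
    case 1
    have w: "cmod (w i) \<le> 2" using 1 \<kappa> by (auto simp: near_unit_def abs_less_iff)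
    have "cmod (w i) ^ d i \<le> 2 ^ d i" using w by (intro power_mono) auto
    moreover have "Nr powr (- \<beta>) \<le> 2 ^ d i" using \<beta>1 one_le_power[of "2::real" "d i"] by linarith
    ultimately have "U i \<le> ln (2 ^ d i)" unfolding U_def using powr_pos by (subst ln_le_cancel_iff) (auto simp: less_max_iff_disj)
    also have "\<dots> = real (d i) * ln 2" by (simp add: ln_realpow)
    also have "\<dots> \<le> real (d i) * 1" using ln_le_minus_one[of 2] by (intro mult_left_mono) auto
    finally show ?thesis using 1 by (simp add: lb_def)
  next
    case 2
    have "U i \<le> ln \<tau>" unfolding U_def using 2 powr_pos powr_le_\<tau> \<tau>
      by (subst ln_le_cancel_iff) (auto simp: less_max_iff_disj decaying_def)
    then show ?thesis using 2 by (simp add: lb_def ln_\<tau> algebra_simps)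
  next
    case 3
    have t: "\<tau> \<le> cmod (w i) ^ d i" by (rule regular_ge[OF i 3])
    then have "max (cmod (w i) ^ d i) (Nr powr (- \<beta>)) = cmod (w i) ^ d i" using powr_le_\<tau> by simp
    then show ?thesis using 3 t \<tau> by (simp add: lb_def U_def)
  qed
  then show "0 < lb i" "U i \<le> ln (lb i) + (\<eta> - \<beta>) * ln (Nr) * (if decaying i then 1 else 0) + (if near_unit i then real (d i) else 0)"
    by auto
qed

text \<open>In a decaying block d * (- ln |w|) is at least - ln \<tau> = (\<beta> - \<eta>) ln N.
  The count of such blocks, multiplied by ln N, is thus paid for by logarithmic singularities with
  total mass \<open>n\<close>, where counting all blocks would only give m ln N.\<close>

lemma num_decaying_bound:
  assumes "\<And>i. i < m \<Longrightarrow> w i \<noteq> 0"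
  shows "(\<beta> - \<eta>) * ln (Nr) * num_decaying \<le> (\<Sum>i<m. real (d i) * lnm (w i))"
proof -
  have "(\<beta> - \<eta>) * ln (Nr) * (if decaying i then 1 else 0) \<le> real (d i) * lnm (w i)" if i: "i < m" for i
  proof (cases "decaying i")
    case True
    have w: "0 < cmod (w i)" using assms[OF i] by simp
    have "ln (cmod (w i) ^ d i) \<le> ln \<tau>" using True w \<tau> by (subst ln_le_cancel_iff) (auto simp: decaying_def)
    then have "(\<beta> - \<eta>) * ln (Nr) \<le> real (d i) * (- ln (cmod (w i)))"
      using w by (simp add: ln_realpow ln_\<tau> algebra_simps)
    also have "\<dots> \<le> real (d i) * lnm (w i)" by (intro mult_left_mono) (auto simp: lnm_def)
    finally show ?thesis using True by simp
  qed (simp add: lnm_nonneg)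
  then show ?thesis unfolding num_decaying_def sum_distrib_left by (intro sum_mono) auto
qed

lemma num_decaying_le: "num_decaying \<le> real m" and num_decaying_nonneg: "0 \<le> num_decaying" and dim_near_unit_nonneg: "0 \<le> dim_near_unit"
proof -
  have "num_decaying \<le> (\<Sum>i<m. 1)" unfolding num_decaying_def by (intro sum_mono) auto
  then show "num_decaying \<le> real m" by simp
qed (simp_all add: num_decaying_def dim_near_unit_def sum_nonneg)

lemma card_repl': "real (card {p. p < n \<and> noise_row p}) = num_decaying + dim_near_unit"
proof -
  have "real (card {p. p < n \<and> noise_row p}) = (\<Sum>i<m. (if decaying i then 1 else 0) + (if near_unit i then real (d i) else 0))"
    unfolding card_noise_row of_nat_sum using near_unit_not_decaying by (intro sum.cong) auto
  then show ?thesis by (simp add: num_decaying_def dim_near_unit_def sum.distrib)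
qed

context
  fixes \<Lambda> g :: real
  assumes \<Lambda>: "1 / (\<kappa> ^ 3 * \<tau>) \<le> \<Lambda>"
    and \<Lambda>_small: "\<And>i. i < m \<Longrightarrow> cmod (w i) \<le> 1 - \<kappa> \<Longrightarrow> \<tau> \<le> cmod (w i) ^ d i \<Longrightarrow>
      real (d i) \<le> \<Lambda> * cmod (w i) ^ d i"
    and g: "0 \<le> g" "g * \<Lambda> \<le> 1/2"
begin

lemma ln_dt_upper:
  assumes E: "\<And>v. l2 n (mv n E v) \<le> g * l2 n v" and nz: "dt n (\<lambda>p q. A p q + E p q) \<noteq> 0"
  shows "ln (cmod (dt n (\<lambda>p q. A p q + E p q))) \<le> (\<Sum>i<m. U i) + Nr * (\<kappa> + g * \<Lambda>) + \<eta> * ln (Nr) * num_decaying + 5 * dim_near_unit"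
proof -
  have \<Lambda>0: "0 \<le> \<Lambda>" using \<Lambda> \<kappa> \<tau> by (meson divide_nonneg_nonneg less_imp_le mult_nonneg_nonneg order_trans zero_le_one zero_le_power)
  have q: "0 < 1 + \<kappa> + g * \<Lambda>" using \<kappa> g \<Lambda>0 by (simp add: add_pos_nonneg)
  have pub: "0 < (\<Prod>i<m. ub i)" using ln_ub_le(1) by (intro prod_pos) auto
  have "ln (cmod (dt n (\<lambda>p q. A p q + E p q))) \<le> ln ((1 + \<kappa> + g * \<Lambda>) ^ n * (\<Prod>i<m. ub i))"
    using cmod_dt_upper[OF \<Lambda> \<Lambda>_small E g(1)] nz q pub by (subst ln_le_cancel_iff) auto
  also have "\<dots> = Nr * ln (1 + \<kappa> + g * \<Lambda>) + (\<Sum>i<m. ln (ub i))"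
    proof -
    have "ln (\<Prod>i<m. ub i) = (\<Sum>i<m. ln (ub i))" by (rule ln_prod) (auto dest!: ln_ub_le(1))
    then show ?thesis using q pub by (simp add: ln_mult_pos ln_power_n)
  qed
  also have "Nr * ln (1 + \<kappa> + g * \<Lambda>) \<le> Nr * (\<kappa> + g * \<Lambda>)"
    using q ln_le_minus_one[OF q] n2 by (intro mult_left_mono) auto
  also have "(\<Sum>i<m. ln (ub i)) \<le> (\<Sum>i<m. U i + \<eta> * ln (Nr) * (if decaying i then 1 else 0) + 5 * (if near_unit i then real (d i) else 0))"
    using ln_ub_le(2) by (intro sum_mono) auto
  also have "\<dots> = (\<Sum>i<m. U i) + \<eta> * ln (Nr) * num_decaying + 5 * dim_near_unit"
    by (simp only: sum.distrib num_decaying_def dim_near_unit_def sum_distrib_left)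
  finally show ?thesis by simp
qed

definition Lb :: real where "Lb = (1 - g * \<Lambda>) ^ n * (\<Prod>i<m. lb i)"

definition num_noise_rows :: nat where "num_noise_rows = card {p. p < n \<and> noise_row p}"

text \<open>Chosen so that \<open>det_scale powr (-1/2)\<close> is the right-hand side of \<open>nn_integral_ninv_dt\<close> with \<open>L = Lb\<close>.\<close>

definition det_scale :: real where
  "det_scale = (Nr powr (- \<beta> - 1/2)) ^ num_noise_rows * sqrt (fact num_noise_rows) / 36 ^ num_noise_rows * Lb"

lemma Lb_pos: "0 < Lb"
  unfolding Lb_def using g U_le_ln_lb(1) by (intro mult_pos_pos prod_pos zero_less_power) auto

lemma det_scale_pos: "0 < det_scale"
  unfolding det_scale_def using Lb_pos n2 by simp

text \<open>The factor \<open>Nr powr (- \<beta> - 1/2)\<close> of each noise row and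
  \<open>sqrt (fact num_noise_rows)\<close> combine to about \<open>Nr powr (- \<beta>)\<close> per
  row. This matches the potential of a decaying block up to \<eta> ln N, while near-unit rows pay
  \<beta> ln N extra. The factorial deficit costs 3/2 and the power of 36 at most 10 times sqrt (k
  Nr), together below 12.\<close>

lemma sum_U_le_ln_det_scale:
  "(\<Sum>i<m. U i) \<le> ln det_scale + \<eta> * ln (Nr) * num_decaying + (1 + \<beta> * ln (Nr)) * dim_near_unit + 12 * sqrt (real num_noise_rows * Nr) + 2 * Nr * (g * \<Lambda>)"
proof -
  let ?L = "ln (Nr)"
  have plb: "0 < (\<Prod>i<m. lb i)" using U_le_ln_lb(1) by (intro prod_pos) auto
  have k: "real num_noise_rows = num_decaying + dim_near_unit" unfolding num_noise_rows_def by (rule card_repl')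
  have kn: "num_noise_rows \<le> n"
  proof -
    have "num_noise_rows \<le> card {..<n}" unfolding num_noise_rows_def by (intro card_mono) auto
    then show ?thesis by simp
  qed
  have "(\<Sum>i<m. U i) \<le> (\<Sum>i<m. ln (lb i) + (\<eta> - \<beta>) * ?L * (if decaying i then 1 else 0) + (if near_unit i then real (d i) else 0))"
    using U_le_ln_lb(2) by (intro sum_mono) auto
  also have "\<dots> = (\<Sum>i<m. ln (lb i)) + (\<eta> - \<beta>) * ?L * num_decaying + dim_near_unit"
    by (simp only: sum.distrib num_decaying_def dim_near_unit_def sum_distrib_left)
  finally have 1: "(\<Sum>i<m. U i) \<le> (\<Sum>i<m. ln (lb i)) + (\<eta> - \<beta>) * ?L * num_decaying + dim_near_unit" .
  have f1: "ln Lb = Nr * ln (1 - g * \<Lambda>) + (\<Sum>i<m. ln (lb i))"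
  proof -
    have "ln (\<Prod>i<m. lb i) = (\<Sum>i<m. ln (lb i))" by (rule ln_prod) (auto dest!: U_le_ln_lb(1))
    then show ?thesis unfolding Lb_def using g plb by (simp add: ln_mult_pos ln_power_n)
  qed
  have f2: "ln det_scale = real num_noise_rows * ((- \<beta> - 1/2) * ?L) + ln (fact num_noise_rows) / 2 - real num_noise_rows * ln 36 + ln Lb"
  proof -
    have "ln det_scale = ln ((Nr powr (- \<beta> - 1/2)) ^ num_noise_rows * sqrt (fact num_noise_rows) / 36 ^ num_noise_rows) + ln Lb"
      unfolding det_scale_def using Lb_pos n2 by (intro ln_mult_pos) auto
    also have "ln ((Nr powr (- \<beta> - 1/2)) ^ num_noise_rows * sqrt (fact num_noise_rows) / 36 ^ num_noise_rows) = ln ((Nr powr (- \<beta> - 1/2)) ^ num_noise_rows) + ln (sqrt (fact num_noise_rows)) - ln (36 ^ num_noise_rows)"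
      using n2 by (simp add: ln_div ln_mult_pos)
    also have "\<dots> = real num_noise_rows * ((- \<beta> - 1/2) * ?L) + ln (fact num_noise_rows) / 2 - real num_noise_rows * ln 36"
      using n2 by (simp add: ln_realpow ln_powr ln_sqrt)
    finally show ?thesis .
  qed
  have f3: "- ln (1 - g * \<Lambda>) \<le> 2 * (g * \<Lambda>)"
  proof (rule neg_ln_one_minus)
    have "0 \<le> \<Lambda>" using \<Lambda> \<kappa> \<tau> by (meson divide_nonneg_nonneg less_imp_le mult_nonneg_nonneg order_trans zero_le_one zero_le_power)
    then show "0 \<le> g * \<Lambda>" using g by simp
  qed (use g in simp)
  then have f4: "- (Nr * ln (1 - g * \<Lambda>)) \<le> 2 * Nr * (g * \<Lambda>)"
    using mult_left_mono[of "- ln (1 - g * \<Lambda>)" "2 * (g * \<Lambda>)" "Nr"] n2 by simp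
  have f5: "real num_noise_rows * ?L - ln (fact num_noise_rows) \<le> 3 * sqrt (real num_noise_rows * Nr)"
    unfolding Nr by (rule fact_deficit[OF kn]) (use n2 Nr in \<open>simp del: of_nat_sum\<close>)
  have f6: "real num_noise_rows * ln 36 \<le> 10 * sqrt (real num_noise_rows * Nr)"
  proof -
    have "ln (36::real) = 2 * ln 6" using ln_realpow[of 6 2] by simp
    then have "ln (36::real) \<le> 10" using ln_le_minus_one[of 6] by simp
    moreover have "real num_noise_rows \<le> sqrt (real num_noise_rows * Nr)"
      using kn unfolding Nr by (intro real_le_rsqrt) (simp add: power2_eq_square mult_left_mono del: of_nat_sum)
    ultimately show ?thesis by (metis mult.commute mult_mono of_nat_0_le_iff zero_le_numeral)
  qed
  have f7: "real num_noise_rows * ((- \<beta> - 1/2) * ?L) = - (\<beta> * ?L * num_decaying) - \<beta> * ?L * dim_near_unit - real num_noise_rows * ?L / 2"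
    by (simp add: k algebra_simps add_divide_distrib)
  have f8: "0 \<le> sqrt (real num_noise_rows * Nr)" using n2 by simp
  define sq where "sq = sqrt (real num_noise_rows * Nr)"
  have "(\<eta> - \<beta>) * ?L * num_decaying = \<eta> * ?L * num_decaying - (\<beta> * ?L) * num_decaying" "(1 + \<beta> * ?L) * dim_near_unit = dim_near_unit + (\<beta> * ?L) * dim_near_unit"
    "2 * Nr * (g * \<Lambda>) = 2 * (Nr * (g * \<Lambda>))"
    by (simp_all add: algebra_simps)
  then show ?thesis
    using 1 f1 f2 f4 f5 f6 f7 f8 unfolding sq_def[symmetric] by linarith
qed

end

end

end

section \<open>Choice of the scales for a fixed large N\<close>

locale noisy_blocks =
  fixes m :: nat and d :: "nat \<Rightarrow> nat" and c :: "nat \<Rightarrow> complex" and \<beta> \<eta> :: real and N :: nat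
  assumes d_pos: "\<And>i. i < m \<Longrightarrow> 0 < d i" and N: "boff d m = N"
    and \<eta>: "0 < \<eta>" "\<eta> < \<beta>" and L2: "2 \<le> ln (real N)"
    and small: "real N powr (- \<eta> / 2) * ((1 + \<beta>) * ln (real N) ^ 6) \<le> 1 / 2"
begin

definition L :: real where "L = ln (real N)"
text \<open>The annuli have area of order \<kappa>, and their rows cost up to order ln N + 1 / sqrt
  \<kappa> each. With 1 / L^2 both L \<kappa> and sqrt \<kappa> tend to 0, while powers of 1 /
  \<kappa> remain powers of ln N.\<close>

definition \<kappa> :: real where "\<kappa> = 1 / L\<^sup>2"
definition \<tau> :: real where "\<tau> = real N powr (- \<beta> + \<eta>)"
text \<open>\<open>L ^ 6 / \<tau>\<close> is exactly \<open>1 / (\<kappa> ^ 3 * \<tau>)\<close>; the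
  factor 1 + \<beta> makes room for the dimension of kept blocks in
  \<open>\<Lambda>_small\<close>.\<close>

definition \<Lambda> :: real where "\<Lambda> = (1 + \<beta>) * L ^ 6 / \<tau>"
definition \<delta> :: real where "\<delta> = real N powr (- \<beta> - 1/2)"
text \<open>The operator norm of the Gaussian matrix is of order sqrt N; t allows an extra
  \<open>N powr (\<eta>/2)\<close>. Then \<open>\<delta> * t / \<tau>\<close> is
  \<open>N powr (-\<eta>/2)\<close>, so the noise stays small against \<open>H\<close>; \<zeta> is
  this relative size, with the powers of ln N included.\<close>

definition t :: real where "t = real N powr (1/2 + \<eta>/2)"
definition \<zeta> :: real where "\<zeta> = real N powr (- \<eta> / 2) * ((1 + \<beta>) * L ^ 6)"

lemma Npos: "2 \<le> real N" "0 < N"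
proof -
  have "0 < N"
  proof (rule ccontr)
    assume "\<not> 0 < N"
    then show False using L2 by simp
  qed
  then show "0 < N" .
  have "ln (real N) \<le> real N - 1" using \<open>0 < N\<close> by (intro ln_le_minus_one) simp
  then show "2 \<le> real N" using L2 by simp
qed

lemma L_ge: "2 \<le> L" using L2 by (simp add: L_def)

lemma L_pow: "1 \<le> L ^ k" using L_ge by (intro one_le_power) auto

lemma \<kappa>: "0 < \<kappa>" "\<kappa> \<le> 1/2"
proof -
  have "2\<^sup>2 \<le> L\<^sup>2" using L_ge by (intro power_mono) auto
  then show "0 < \<kappa>" "\<kappa> \<le> 1/2" unfolding \<kappa>_def by (auto simp: divide_le_eq)
qed

lemma \<tau>: "0 < \<tau>" "\<tau> < 1"
  using Npos \<eta> powr_less_mono[of "- \<beta> + \<eta>" 0 "real N"] by (auto simp: \<tau>_def)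

lemma blocks: "jordan_blocks m d \<kappa> \<tau>"
  by unfold_locales (use d_pos \<kappa> \<tau> in auto)

lemma \<Lambda>: "1 / (\<kappa> ^ 3 * \<tau>) \<le> \<Lambda>"
proof -
  have "1 / (\<kappa> ^ 3 * \<tau>) = L ^ 6 / \<tau>" by (simp add: \<kappa>_def power_divide power_mult[symmetric])
  also have "\<dots> \<le> \<Lambda>" unfolding \<Lambda>_def using \<tau> \<eta> L_pow[of 6]
    by (intro divide_right_mono) (auto simp: algebra_simps)
  finally show ?thesis .
qed

lemma \<Lambda>_pos: "0 \<le> \<Lambda>"
  unfolding \<Lambda>_def using \<tau> \<eta> L_pow[of 6] by (intro divide_nonneg_nonneg mult_nonneg_nonneg) auto

text \<open>From |w| \<le> 1 - \<kappa> and |w|^k \<ge> \<tau> one gets k \<kappa> \<le> - ln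
  \<tau>, so k is at most of order L^3: a kept block inside the unit circle has polylogarithmic
  size.\<close>

lemma \<Lambda>_small:
  assumes "cmod w \<le> 1 - \<kappa>" "\<tau> \<le> cmod w ^ k"
  shows "real k \<le> \<Lambda> * cmod w ^ k"
proof (cases "k = 0")
  case False
  then have w: "0 < cmod w" using assms(2) \<tau> by (cases "w = 0") (auto simp: zero_power)
  have "ln \<tau> \<le> ln (cmod w ^ k)" using assms(2) \<tau> w by (subst ln_le_cancel_iff) auto
  also have "\<dots> = real k * ln (cmod w)" using w by (simp add: ln_realpow)
  also have "\<dots> \<le> real k * (- \<kappa>)" using ln_le_minus_one[OF w] assms(1) by (intro mult_left_mono) auto
  finally have "real k * \<kappa> \<le> - ln \<tau>" by simp
  also have "\<dots> = (\<beta> - \<eta>) * L" using Npos by (simp add: \<tau>_def L_def ln_powr algebra_simps)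
  also have "\<dots> \<le> (1 + \<beta>) * L" using \<eta> L_ge by (intro mult_right_mono) auto
  finally have "real k * \<kappa> * L\<^sup>2 \<le> (1 + \<beta>) * L * L\<^sup>2" by (intro mult_right_mono) auto
  moreover have "real k * \<kappa> * L\<^sup>2 = real k" using L_ge by (simp add: \<kappa>_def)
  ultimately have "real k \<le> (1 + \<beta>) * L * L\<^sup>2" by argo
  also have "\<dots> = (1 + \<beta>) * L ^ 3" by (simp add: power2_eq_square power3_eq_cube)
  finally have "real k \<le> (1 + \<beta>) * L ^ 3" .
  also have "\<dots> \<le> (1 + \<beta>) * L ^ 6" using \<eta> L_ge by (intro mult_left_mono power_increasing) auto
  also have "\<dots> = \<Lambda> * \<tau>" using \<tau> by (simp add: \<Lambda>_def)
  also have "\<dots> \<le> \<Lambda> * cmod w ^ k" by (intro mult_left_mono assms \<Lambda>_pos)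
  finally show ?thesis .
qed (use \<Lambda>_pos in simp)

lemma \<delta>t: "\<delta> * t * \<Lambda> = \<zeta>" "0 < \<delta>" "0 < t" "\<zeta> \<le> 1/2" "0 \<le> \<zeta>"
proof -
  have "\<delta> * t / \<tau> = real N powr (- \<eta> / 2)"
    unfolding \<delta>_def t_def \<tau>_def using Npos
    by (simp add: powr_add[symmetric] powr_diff[symmetric] field_simps)
  then have "\<delta> * t / \<tau> * ((1 + \<beta>) * L ^ 6) = \<zeta>" by (simp add: \<zeta>_def)
  then show "\<delta> * t * \<Lambda> = \<zeta>" by (simp add: \<Lambda>_def)
  show "0 < \<delta>" "0 < t" using Npos by (auto simp: \<delta>_def t_def)
  show "\<zeta> \<le> 1/2" using small by (simp add: \<zeta>_def L_def)
  show "0 \<le> \<zeta>" using \<eta> L_pow[of 6] by (simp add: \<zeta>_def)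
qed

definition Az :: "complex \<Rightarrow> nat \<Rightarrow> nat \<Rightarrow> complex" where
  "Az z = bd m d (\<lambda>i. jrows (c i - z))"

definition Y :: "(nat \<times> nat \<Rightarrow> real) \<Rightarrow> complex \<Rightarrow> real" where
  "Y x z = cmod (dt N (\<lambda>p q. Az z p q + of_real (\<delta> * x (p, q))))"

definition limit_potential :: "complex \<Rightarrow> real" where
  "limit_potential z = (\<Sum>i<m. ln (max (cmod (c i - z) ^ d i) (real N powr (- \<beta>))))"

text \<open>The error that remains outside the event of an unusually small determinant. The first
  line pays \<eta> ln N per decaying block through \<open>num_decaying_bound\<close>, the second
  pays for near-unit rows, and the third collects errors independent of z.\<close>

definition Q :: "complex \<Rightarrow> real" where
  "Q z = \<eta> / (\<beta> - \<eta>) * (\<Sum>i<m. real (d i) * lnm (z - c i))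
       + (5 + \<beta> * L + 12 / sqrt \<kappa>) * (\<Sum>i<m. real (d i) * indicator {z. \<bar>cmod (z - c i) - 1\<bar> < \<kappa>} z)
       + (12 * sqrt (real m * real N) + 12 * sqrt \<kappa> * real N + 2 * real N * \<zeta> + real N * \<kappa>)"

definition noise_space :: "(nat \<times> nat \<Rightarrow> real) measure" where
  "noise_space = PiM ({..<N} \<times> {..<N}) (\<lambda>_. ngauss)"

lemma noise_bound:
  assumes "x \<in> net_event N t"
  shows "l2 N (mv N (\<lambda>p q. of_real (\<delta> * x (p, q))) v) \<le> \<delta> * t * l2 N v"
proof -
  have "l2 N (mv N (\<lambda>p q. of_real (\<delta> * x (p, q))) v) = l2 N (\<lambda>i. of_real \<delta> * mv N (\<lambda>p q. of_real (x (p, q))) v i)"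
    by (simp add: mv_def sum_distrib_left mult.assoc)
  also have "\<dots> = \<delta> * l2 N (mv N (\<lambda>p q. of_real (x (p, q))) v)" using \<delta>t by (simp add: l2_cmult)
  also have "\<dots> \<le> \<delta> * (t * l2 N v)"
    using \<delta>t by (intro mult_left_mono l2_mv_of_real_le[OF Npos(2) assms]) auto
  finally show ?thesis by (simp add: mult.assoc)
qed

text \<open>The upper bound holds pointwise on \<open>net_event\<close>. The lower bound is
  probabilistic: a moment of order -1/2 bounded by \<open>T powr (-1/2)\<close> means that the
  determinant is rarely much smaller than T.\<close>

lemma potential_sandwich:
  assumes z: "\<And>i. i < m \<Longrightarrow> z \<noteq> c i"
  shows "x \<in> net_event N t \<Longrightarrow> Y x z \<noteq> 0 \<Longrightarrow> ln (Y x z) \<le> limit_potential z + Q z"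
    and "\<exists>T>0. limit_potential z - Q z \<le> ln T \<and>
      (\<integral>\<^sup>+x. indicator (net_event N t) x * ninv ((Y x z)\<^sup>2) \<partial>noise_space) \<le> ennreal (T powr (-1/2))"
proof -
  interpret J: jordan_blocks m d "\<lambda>i. c i - z" \<kappa> \<tau> by (rule blocks)
  have nr: "real N = real (boff d m)" unfolding N ..
  have NrL: "ln (real N) = L" by (simp add: L_def)
  note J1 = nr Npos(1) \<eta> \<tau>_def
  have Ls: "real (d i) \<le> \<Lambda> * cmod (c i - z) ^ d i" if "i < m" "cmod (c i - z) \<le> 1 - \<kappa>" "\<tau> \<le> cmod (c i - z) ^ d i" for i
    by (rule \<Lambda>_small) (use that in auto)
  have g: "0 \<le> \<delta> * t" "\<delta> * t * \<Lambda> \<le> 1/2" using \<delta>t by auto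
  define num_decaying where "num_decaying = J.num_decaying"
  define dim_near_unit where "dim_near_unit = J.dim_near_unit"
  have cS0: "0 \<le> num_decaying" "num_decaying \<le> real m" "0 \<le> dim_near_unit"
    using J.num_decaying_le[OF J1] J.num_decaying_nonneg[OF J1] J.dim_near_unit_nonneg[OF J1] by (auto simp: num_decaying_def dim_near_unit_def)
  have "(\<beta> - \<eta>) * L * num_decaying \<le> (\<Sum>i<m. real (d i) * lnm (c i - z))"
    unfolding num_decaying_def NrL[symmetric] by (rule J.num_decaying_bound[OF J1]) (use z in auto)
  also have "\<dots> = (\<Sum>i<m. real (d i) * lnm (z - c i))" by (simp add: lnm_def norm_minus_commute)
  finally have "L * num_decaying \<le> 1 / (\<beta> - \<eta>) * (\<Sum>i<m. real (d i) * lnm (z - c i))"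
    using \<eta> by (simp add: field_simps)
  from mult_left_mono[OF this, of \<eta>] have S: "\<eta> * L * num_decaying \<le> \<eta> / (\<beta> - \<eta>) * (\<Sum>i<m. real (d i) * lnm (z - c i))"
    using \<eta> by (simp add: mult_ac)
  have F: "dim_near_unit = (\<Sum>i<m. real (d i) * indicator {z. \<bar>cmod (z - c i) - 1\<bar> < \<kappa>} z)"
    unfolding dim_near_unit_def J.dim_near_unit_def[OF J1] J.near_unit_def by (intro sum.cong) (auto simp: indicator_def norm_minus_commute)
  have UU: "(\<Sum>i<m. J.U \<beta> (real N) i) = limit_potential z" by (simp add: J.U_def[OF J1] limit_potential_def)
  have sk: "0 < sqrt \<kappa>" using \<kappa> by simp
  have sq0: "0 \<le> 12 / sqrt \<kappa> * dim_near_unit" "0 \<le> 12 * sqrt (real m * real N)" "0 \<le> 12 * sqrt \<kappa> * real N" "0 \<le> \<beta> * L * dim_near_unit"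
     "0 \<le> real N * \<kappa>" "0 \<le> real N * \<zeta>"
    using cS0 sk \<kappa> \<eta> L_ge \<delta>t by auto
  have Qd: "Q z = \<eta> / (\<beta> - \<eta>) * (\<Sum>i<m. real (d i) * lnm (z - c i)) + (5 * dim_near_unit + \<beta> * L * dim_near_unit + 12 / sqrt \<kappa> * dim_near_unit)
       + (12 * sqrt (real m * real N) + 12 * sqrt \<kappa> * real N + 2 * (real N * \<zeta>) + real N * \<kappa>)"
    unfolding Q_def F[symmetric] by (simp add: algebra_simps)
  show "ln (Y x z) \<le> limit_potential z + Q z" if x: "x \<in> net_event N t" and nz: "Y x z \<noteq> 0"
  proof -
    have "ln (Y x z) \<le> limit_potential z + real N * (\<kappa> + \<delta> * t * \<Lambda>) + \<eta> * ln (real N) * J.num_decaying + 5 * J.dim_near_unit"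
      using J.ln_dt_upper[OF J1 \<Lambda> Ls g, of "\<lambda>p q. of_real (\<delta> * x (p, q))"] noise_bound[OF x] nz
      unfolding N UU Y_def Az_def J.A_def by simp
    then have "ln (Y x z) \<le> limit_potential z + (real N * \<kappa> + real N * \<zeta>) + \<eta> * L * num_decaying + 5 * dim_near_unit"
      unfolding \<delta>t(1) NrL num_decaying_def dim_near_unit_def by (simp add: distrib_left)
    then show ?thesis using S sq0 unfolding Qd by linarith
  qed
  define k where "k = J.num_noise_rows"
  define T where "T = J.det_scale \<beta> (real N) \<Lambda> (\<delta> * t)"
  have Tpos: "0 < T" unfolding T_def by (rule J.det_scale_pos[OF J1 \<Lambda> Ls g])
  have num_noise_rows: "k = card {p. p < boff d m \<and> J.noise_row p}"
    unfolding k_def by (rule J.num_noise_rows_def[OF J1 \<Lambda> Ls g])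
  have kc: "real k = num_decaying + dim_near_unit" unfolding num_noise_rows num_decaying_def dim_near_unit_def by (rule J.card_repl'[OF J1])
  have "limit_potential z \<le> ln T + \<eta> * L * num_decaying + (1 + \<beta> * L) * dim_near_unit + 12 * sqrt (real k * real N) + 2 * real N * \<zeta>"
    using J.sum_U_le_ln_det_scale[OF J1 \<Lambda> Ls g] unfolding UU T_def NrL \<delta>t(1) num_decaying_def dim_near_unit_def k_def .
  \<comment> \<open>The inequality between arithmetic and geometric means, balanced by sqrt
    \<kappa>, makes the near-unit part linear in \<open>dim_near_unit\<close>. Its integral in z is
    then known, and the factor 1 / sqrt \<kappa> meets the area \<kappa> of the annuli.\<close>
  moreover have "sqrt (real k * real N) \<le> sqrt (real m * real N) + (sqrt \<kappa> * real N + dim_near_unit / sqrt \<kappa>)"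
  proof -
    have "real k * real N \<le> real m * real N + dim_near_unit * real N"
      unfolding kc distrib_right using cS0 by (intro add_right_mono mult_right_mono) auto
    then have "sqrt (real k * real N) \<le> sqrt (real m * real N + dim_near_unit * real N)" by simp
    also have "\<dots> \<le> sqrt (real m * real N) + sqrt (dim_near_unit * real N)"
      using cS0 by (intro sqrt_add_le_add_sqrt) auto
    also have "sqrt (dim_near_unit * real N) \<le> sqrt \<kappa> * real N + dim_near_unit / sqrt \<kappa>"
    proof (rule real_le_lsqrt)
      have "dim_near_unit * real N = (sqrt \<kappa> * real N) * (dim_near_unit / sqrt \<kappa>)" using sk by simp
      also have "\<dots> \<le> (sqrt \<kappa> * real N + dim_near_unit / sqrt \<kappa>)\<^sup>2"
      proof -
        have ab: "0 \<le> sqrt \<kappa> * real N" "0 \<le> dim_near_unit / sqrt \<kappa>" using sk cS0 by auto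
        have "a * b \<le> (a + b)\<^sup>2" if "0 \<le> a" "0 \<le> b" for a b :: real
          using that mult_nonneg_nonneg[OF that] by (simp add: power2_eq_square algebra_simps add_nonneg_nonneg)
        from this[OF ab] show ?thesis .
      qed
      finally show "dim_near_unit * real N \<le> (sqrt \<kappa> * real N + dim_near_unit / sqrt \<kappa>)\<^sup>2" .
    qed (use sk cS0 in auto)
    finally show ?thesis by simp
  qed
  moreover have "(1 + \<beta> * L) * dim_near_unit = dim_near_unit + \<beta> * L * dim_near_unit" "12 / sqrt \<kappa> * dim_near_unit = 12 * (dim_near_unit / sqrt \<kappa>)"
    "2 * real N * \<zeta> = 2 * (real N * \<zeta>)" "12 * sqrt \<kappa> * real N = 12 * (sqrt \<kappa> * real N)"
    by (simp_all add: algebra_simps)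
  ultimately have UT: "limit_potential z - Q z \<le> ln T" using S sq0 cS0 unfolding Qd by linarith
  define Lb where "Lb = J.Lb \<Lambda> (\<delta> * t)"
  have LbE: "Lb = (1 - \<delta> * t * \<Lambda>) ^ boff d m * (\<Prod>i<m. J.lb i)"
    unfolding Lb_def by (rule J.Lb_def[OF J1 \<Lambda> Ls g])
  have Lb: "0 < Lb" unfolding Lb_def by (rule J.Lb_pos[OF J1 \<Lambda> Ls g])
  \<comment> \<open>On \<open>net_event\<close> the noise in the kept rows changes the determinant
    of the repaired matrix by a controlled factor, so the lower bound demanded by
    \<open>nn_integral_ninv_dt\<close> holds there.\<close>
  have "net_event N t \<subseteq> {x. Lb \<le> cmod (dt N (\<lambda>p. if p \<in> {p. p < N \<and> J.noise_row p} then unit_row (J.noise_col p) else (\<lambda>q. Az z p q + of_real (\<delta> * x (p, q)))))}"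
  proof (clarify)
    fix x assume x: "x \<in> net_event N t"
    have "Lb \<le> cmod (dt (boff d m) (\<lambda>p q. if J.noise_row p then unit_row (J.noise_col p) q else J.A p q + of_real (\<delta> * x (p, q))))"
      unfolding LbE using noise_bound[OF x] g
      by (intro J.cmod_dt_lower[OF \<Lambda> Ls]) (auto simp: N)
    also have "\<dots> = cmod (dt N (\<lambda>p. if p \<in> {p. p < N \<and> J.noise_row p} then unit_row (J.noise_col p) else (\<lambda>q. Az z p q + of_real (\<delta> * x (p, q)))))"
      unfolding N Az_def J.A_def by (intro arg_cong[where f = cmod] dt_cong) auto
    finally show "Lb \<le> cmod (dt N (\<lambda>p. if p \<in> {p. p < N \<and> J.noise_row p} then unit_row (J.noise_col p) else (\<lambda>q. Az z p q + of_real (\<delta> * x (p, q)))))" .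
  qed
  then have "(\<integral>\<^sup>+x. indicator (net_event N t) x * ninv ((Y x z)\<^sup>2) \<partial>noise_space)
     \<le> (\<integral>\<^sup>+x. ninv ((cmod (dt N (\<lambda>p q. Az z p q + of_real (\<delta> * x (p, q)))))\<^sup>2) *
       indicator {x. Lb \<le> cmod (dt N (\<lambda>p. if p \<in> {p. p < N \<and> J.noise_row p} then unit_row (J.noise_col p) else (\<lambda>q. Az z p q + of_real (\<delta> * x (p, q)))))} x \<partial>noise_space)"
    by (intro nn_integral_mono) (auto simp: Y_def indicator_def)
  also have "\<dots> \<le> (6 * ennreal (\<delta> powr (-1/2))) ^ card {p. p < N \<and> J.noise_row p} * ninv (fact (card {p. p < N \<and> J.noise_row p}) * Lb\<^sup>2)"
    unfolding noise_space_def
    by (rule nn_integral_ninv_dt) (use J.inj_on_noise_col J.noise_col_less \<delta>t Lb in \<open>auto simp: N\<close>)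
  also have "card {p. p < N \<and> J.noise_row p} = k" unfolding num_noise_rows N ..
  also have "(6 * ennreal (\<delta> powr (-1/2))) ^ k * ninv (fact k * Lb\<^sup>2) = ennreal (T powr (-1/2))"
  proof -
    have Td: "T = \<delta> ^ k * sqrt (fact k) / 36 ^ k * Lb"
      unfolding T_def Lb_def k_def by (subst J.det_scale_def[OF J1 \<Lambda> Ls g]) (simp_all add: \<delta>_def)
    have a1: "(\<delta> ^ k) powr (-1/2) = (\<delta> powr (-1/2)) ^ k" for k
      using \<delta>t by (simp add: powr_powr powr_realpow[symmetric] mult.commute)
    have a2: "(36 ^ k :: real) powr (-1/2) = (1/6) ^ k"
    proof -
      have "(36 :: real) powr (-1/2) = 1/6"
        by (simp add: powr_minus_divide powr_half_sqrt)
      moreover have "(36 ^ k :: real) powr (-1/2) = (36 powr (-1/2)) ^ k"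
        by (simp add: powr_powr powr_realpow[symmetric] mult.commute)
      ultimately show ?thesis by (simp only:)
    qed
    have "(Lb\<^sup>2) powr (-1/4) = (Lb powr 2) powr (-1/4)" using Lb by (simp add: powr_numeral)
    also have "\<dots> = Lb powr (-1/2)" by (simp only: powr_powr) simp
    finally have a4: "Lb powr (-1/2) = (Lb\<^sup>2) powr (-1/4)" ..
    have "sqrt (fact k) powr (-1/2) = (fact k powr (1/2)) powr (-1/2)" by (simp add: powr_half_sqrt)
    also have "\<dots> = fact k powr (-1/4)" by (simp only: powr_powr) simp
    finally have a3: "sqrt (fact k) powr (-1/2) = fact k powr (-1/4)" .
    have "T powr (-1/2) = (\<delta> powr (-1/2)) ^ k * fact k powr (-1/4) * 6 ^ k * (Lb\<^sup>2) powr (-1/4)"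
    proof -
      have "T powr (-1/2) = (\<delta> ^ k) powr (-1/2) * sqrt (fact k) powr (-1/2) / (36 ^ k) powr (-1/2) * Lb powr (-1/2)"
        unfolding Td using \<delta>t Lb by (simp add: powr_mult powr_divide)
      then show ?thesis unfolding a1 a2 a3 a4 by (simp add: power_one_over)
    qed
    then show ?thesis
      using Lb by (simp add: ninv_def powr_mult power_mult_distrib ennreal_power ennreal_mult[symmetric] ennreal_numeral[symmetric] mult_ac del: ennreal_numeral)
  qed
  finally show "\<exists>T>0. limit_potential z - Q z \<le> ln T \<and>
      (\<integral>\<^sup>+x. indicator (net_event N t) x * ninv ((Y x z)\<^sup>2) \<partial>noise_space) \<le> ennreal (T powr (-1/2))"
    using Tpos UT by blast
qed

section \<open>Averaging the error over z and over the noise\<close>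

definition Bmat :: "(nat \<times> nat \<Rightarrow> real) \<Rightarrow> complex mat" where
  "Bmat x = mat N N (\<lambda>(p, q). bd m d (\<lambda>i. jrows (c i)) p q + of_real (\<delta> * x (p, q)))"

lemma Bmat_carrier: "Bmat x \<in> carrier_mat N N"
  by (simp add: Bmat_def)

lemma Az_eq: "p < N \<Longrightarrow> q < N \<Longrightarrow> Az z p q = bd m d (\<lambda>i. jrows (c i)) p q - (if p = q then z else 0)"
proof -
  assume "p < N" "q < N"
  then have "bd m d (\<lambda>i. jrows (c i)) p q - (if p = q then z else 0)
      = bd m d (\<lambda>i j k. jrows (c i) j k - (if j = k then z else 0)) p q"
    by (intro bd_sub_diag) (simp_all add: N)
  moreover have "(\<lambda>i j k. jrows (c i) j k - (if j = k then z else 0)) = (\<lambda>i. jrows (c i - z))"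
    by (auto simp: jrows_def fun_eq_iff)
  ultimately show ?thesis by (simp add: Az_def)
qed

lemma Y_eq: "Y x z = cmod (det (Bmat x - z \<cdot>\<^sub>m 1\<^sub>m N))"
proof -
  have "mat N N (\<lambda>(p, q). Az z p q + of_real (\<delta> * x (p, q))) = Bmat x - z \<cdot>\<^sub>m 1\<^sub>m N"
    by (intro eq_matI) (auto simp: Bmat_def Az_eq)
  then show ?thesis by (simp add: Y_def dt_def)
qed

lemma AE_regular: "AE z in lborel. Y x z \<noteq> 0 \<and> (\<forall>i<m. z \<noteq> c i)"
proof -
  obtain as where as: "char_poly (Bmat x) = (\<Prod>a\<leftarrow>as. [:- a, 1:])"
    using char_poly_factorized[OF Bmat_carrier] by auto
  have "AE z in lborel. z \<notin> set as \<union> c ` {..<m}"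
    by (rule AE_not_in) (auto intro!: countable_imp_null_set_lborel countable_finite)
  then show ?thesis
  proof eventually_elim
    case (elim z)
    have "0 < (\<Prod>a\<leftarrow>bs. cmod (z - a))" if "z \<notin> set bs" for bs
      using that by (induction bs) auto
    from this[of as] elim show ?case
      by (auto simp: Y_eq cmod_det_sub_scalar[OF Bmat_carrier as])
  qed
qed

lemma measurable_limit_potential [measurable]: "limit_potential \<in> borel_measurable borel"
  unfolding limit_potential_def[abs_def] by measurable

lemma measurable_Q [measurable]: "Q \<in> borel_measurable borel"
  unfolding Q_def[abs_def] by measurable

lemma measurable_Y: "(\<lambda>(x, z). Y x z) \<in> borel_measurable (noise_space \<Otimes>\<^sub>M borel)"
proof -
  have "(\<lambda>xz. dt N (\<lambda>p q. Az (snd xz) p q + of_real (\<delta> * fst xz (p, q)))) \<in> borel_measurable (noise_space \<Otimes>\<^sub>M borel)"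
  proof (rule borel_measurable_dt)
    fix p q assume pq: "p < N" "q < N"
    have 1: "(\<lambda>xz. fst xz (p, q)) \<in> borel_measurable (noise_space \<Otimes>\<^sub>M borel)"
      using measurable_compose[OF measurable_fst measurable_PiM_ngauss_component[of "(p, q)" "{..<N} \<times> {..<N}"]] pq
      by (simp add: noise_space_def)
    show "(\<lambda>xz. Az (snd xz) p q + of_real (\<delta> * fst xz (p, q))) \<in> borel_measurable (noise_space \<Otimes>\<^sub>M borel)"
      unfolding Az_eq[OF pq] using 1 by measurable
  qed
  then show ?thesis unfolding Y_def case_prod_unfold by measurable
qed

lemma sets_net_event: "net_event N t \<inter> space noise_space \<in> sets noise_space"
proof -
  have "net_event N t \<inter> space noise_space = {g \<in> space noise_space. \<forall>k\<in>net N. \<forall>l\<in>net N. \<bar>bil N g (\<lambda>p. of_int (k p)) (\<lambda>p. of_int (l p))\<bar> \<le> 8 * real N * t}"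
    by (auto simp: net_event_def)
  also have "\<dots> \<in> sets noise_space"
    unfolding noise_space_def
    by (intro sets.sets_Collect_finite_All finite_net) measurable
  finally show ?thesis .
qed

lemma sum_d: "(\<Sum>i<m. real (d i)) = real N"
  unfolding N[symmetric] by simp

definition Qint :: "real \<Rightarrow> real" where
  "Qint R = \<eta> / (\<beta> - \<eta>) * 16 * real N + (5 + \<beta> * L + 12 / sqrt \<kappa>) * (4 * pi * \<kappa> * real N)
     + (12 * sqrt (real m * real N) + 12 * sqrt \<kappa> * real N + 2 * real N * \<zeta> + real N * \<kappa>) * (pi * R\<^sup>2)"

lemma Q_nonneg: "0 \<le> Q z"
proof -
  have "0 \<le> L" using L_ge by simp
  then have "0 \<le> (5 + \<beta> * L + 12 / sqrt \<kappa>)" using \<kappa> \<eta> by (intro add_nonneg_nonneg) auto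
  with \<open>0 \<le> L\<close> show ?thesis unfolding Q_def using \<eta> \<kappa> \<delta>t
    by (intro add_nonneg_nonneg mult_nonneg_nonneg sum_nonneg) (auto simp: lnm_nonneg)
qed

text \<open>Each logarithmic singularity has integral at most 16 and each annulus area at most 4
  \<pi> \<kappa>, irrespective of the centres; since the dimensions sum to N, the configuration of
  the eigenvalues c drops out.\<close>

lemma nn_integral_Q:
  assumes R: "0 \<le> R"
  shows "(\<integral>\<^sup>+z. ennreal (Q z) * indicator (cball 0 R) z \<partial>lborel) \<le> ennreal (Qint R)"
proof -
  define \<alpha> where "\<alpha> = \<eta> / (\<beta> - \<eta>)"
  define b where "b = 5 + \<beta> * L + 12 / sqrt \<kappa>"
  define e where "e = 12 * sqrt (real m * real N) + 12 * sqrt \<kappa> * real N + 2 * real N * \<zeta> + real N * \<kappa>"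
  have nn: "0 \<le> \<alpha>" "0 \<le> b" "0 \<le> e"
    using \<eta> \<kappa> L_ge \<delta>t order_trans[OF _ L_ge, of 0] by (auto simp: \<alpha>_def b_def e_def intro!: add_nonneg_nonneg mult_nonneg_nonneg)
  have [measurable]: "cball (0::complex) R \<in> sets borel" by (simp add: borel_closed)
  let ?A = "\<lambda>i. {z. \<bar>cmod (z - c i) - 1\<bar> < \<kappa>}"
  have Qz: "Q z = (\<Sum>i<m. \<alpha> * real (d i) * lnm (z - c i)) + (\<Sum>i<m. b * real (d i) * indicator (?A i) z) + e" for z
    by (simp only: Q_def \<alpha>_def b_def e_def sum_distrib_left mult.assoc)
  have "(\<integral>\<^sup>+z. ennreal (Q z) * indicator (cball 0 R) z \<partial>lborel) \<le>
    (\<integral>\<^sup>+z. (\<Sum>i<m. ennreal (\<alpha> * real (d i)) * ennreal (lnm (z - c i))) + (\<Sum>i<m. ennreal (b * real (d i)) * indicator (?A i) z)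
       + ennreal e * indicator (cball 0 R) z \<partial>lborel)"
  proof (rule nn_integral_mono)
    fix z :: complex
    have s0: "0 \<le> (\<Sum>i<m. \<alpha> * real (d i) * lnm (z - c i))" "0 \<le> (\<Sum>i<m. b * real (d i) * indicator (?A i) z)"
      using nn by (auto intro!: sum_nonneg mult_nonneg_nonneg simp: lnm_nonneg)
    have "ennreal (Q z) = ennreal (\<Sum>i<m. \<alpha> * real (d i) * lnm (z - c i)) + ennreal (\<Sum>i<m. b * real (d i) * indicator (?A i) z) + ennreal e"
      unfolding Qz using s0 nn by (simp add: ennreal_plus)
    also have "ennreal (\<Sum>i<m. \<alpha> * real (d i) * lnm (z - c i)) = (\<Sum>i<m. ennreal (\<alpha> * real (d i)) * ennreal (lnm (z - c i)))"
      using nn by (subst sum_ennreal[symmetric]) (auto simp: ennreal_mult lnm_nonneg)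
    also have "ennreal (\<Sum>i<m. b * real (d i) * indicator (?A i) z) = (\<Sum>i<m. ennreal (b * real (d i)) * indicator (?A i) z)"
      using nn by (subst sum_ennreal[symmetric]) (auto simp: indicator_def intro!: sum.cong)
    finally show "ennreal (Q z) * indicator (cball 0 R) z \<le> (\<Sum>i<m. ennreal (\<alpha> * real (d i)) * ennreal (lnm (z - c i))) + (\<Sum>i<m. ennreal (b * real (d i)) * indicator (?A i) z)
       + ennreal e * indicator (cball 0 R) z"
      by (auto simp: indicator_def)
  qed
  also have "\<dots> = (\<Sum>i<m. ennreal (\<alpha> * real (d i)) * (\<integral>\<^sup>+z. ennreal (lnm (z - c i)) \<partial>lborel))
     + (\<Sum>i<m. ennreal (b * real (d i)) * emeasure lborel (?A i)) + ennreal e * emeasure lborel (cball (0::complex) R)"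
  proof -
    have e1: "(\<integral>\<^sup>+z. (\<Sum>i<m. ennreal (\<alpha> * real (d i)) * ennreal (lnm (z - c i))) \<partial>lborel)
        = (\<Sum>i<m. ennreal (\<alpha> * real (d i)) * (\<integral>\<^sup>+z. ennreal (lnm (z - c i)) \<partial>lborel))"
      by (subst nn_integral_sum) (auto simp: nn_integral_cmult)
    have "(\<integral>\<^sup>+z. (\<Sum>i<m. ennreal (b * real (d i)) * indicator (?A i) z) \<partial>lborel)
        = (\<Sum>i<m. \<integral>\<^sup>+z. ennreal (b * real (d i)) * indicator (?A i) z \<partial>lborel)"
      by (rule nn_integral_sum) measurable
    also have "\<dots> = (\<Sum>i<m. ennreal (b * real (d i)) * emeasure lborel (?A i))"
      by (intro sum.cong refl nn_integral_cmult_indicator) simp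
    finally have e2: "(\<integral>\<^sup>+z. (\<Sum>i<m. ennreal (b * real (d i)) * indicator (?A i) z) \<partial>lborel)
        = (\<Sum>i<m. ennreal (b * real (d i)) * emeasure lborel (?A i))" .
    have e3: "(\<integral>\<^sup>+z. ennreal e * indicator (cball (0::complex) R) z \<partial>lborel) = ennreal e * emeasure lborel (cball (0::complex) R)"
      by (rule nn_integral_cmult_indicator) simp
    show ?thesis unfolding e1[symmetric] e2[symmetric] e3[symmetric]
      by (subst nn_integral_add[symmetric]; measurable; subst nn_integral_add[symmetric]; measurable)
  qed
  also have "\<dots> \<le> (\<Sum>i<m. ennreal (\<alpha> * real (d i)) * ennreal 16)
     + (\<Sum>i<m. ennreal (b * real (d i)) * ennreal (4 * pi * \<kappa>)) + ennreal e * ennreal (pi * R\<^sup>2)"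
    using \<kappa> R by (intro add_mono sum_mono mult_left_mono nn_integral_lnm_translate emeasure_annulus)
      (auto simp: emeasure_cball unit_ball_vol_2)
  also have "(\<Sum>i<m. ennreal (\<alpha> * real (d i)) * ennreal 16) = ennreal (\<alpha> * 16 * real N)"
    using nn by (simp only: ennreal_mult[symmetric] mult_nonneg_nonneg of_nat_0_le_iff zero_le_numeral)
      (subst sum_ennreal, simp, simp add: sum_d[symmetric] sum_distrib_left mult_ac)
  also have "(\<Sum>i<m. ennreal (b * real (d i)) * ennreal (4 * pi * \<kappa>)) = ennreal (b * (4 * pi * \<kappa> * real N))"
  proof -
    have "ennreal (b * real (d i)) * ennreal (4 * pi * \<kappa>) = ennreal (b * (4 * pi * \<kappa> * real (d i)))" for i
      using nn \<kappa> by (subst ennreal_mult[symmetric]) (auto simp: mult_ac)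
    then show ?thesis using nn \<kappa>
      by (simp only:) (subst sum_ennreal, simp, simp add: sum_d[symmetric] sum_distrib_left mult_ac)
  qed
  also have "ennreal e * ennreal (pi * R\<^sup>2) = ennreal (e * (pi * R\<^sup>2))" using nn by (simp add: ennreal_mult)
  also have "ennreal (\<alpha> * 16 * real N) + ennreal (b * (4 * pi * \<kappa> * real N)) + ennreal (e * (pi * R\<^sup>2)) = ennreal (Qint R)"
    using nn \<kappa> by (simp add: Qint_def \<alpha>_def[symmetric] b_def[symmetric] e_def[symmetric] ennreal_plus[symmetric] del: ennreal_plus)
  finally show ?thesis .
qed

text \<open>The deviation is at most \<open>Q\<close> plus the shortfall p of ln Y below
  \<open>limit_potential - Q\<close>. The order of integration is exchanged, since the moment bound
  is available for fixed z; it bounds the mean shortfall by 2, hence the summand 2 \<pi>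
  R^2.\<close>

theorem mean_abs_deviation:
  assumes R: "0 \<le> R"
  shows "(\<integral>\<^sup>+x. indicator (net_event N t) x * (\<integral>\<^sup>+z. ennreal \<bar>ln (Y x z) - limit_potential z\<bar> * indicator (cball 0 R) z \<partial>lborel) \<partial>noise_space)
    \<le> ennreal (Qint R + 2 * pi * R\<^sup>2)"
proof -
  interpret NS: prob_space noise_space
    unfolding noise_space_def by (rule prob_space_PiM) (rule gauss_prob.prob_space_axioms)
  interpret P: pair_sigma_finite noise_space "lborel :: complex measure" by standard
  have [measurable]: "cball (0::complex) R \<in> sets borel" by (simp add: borel_closed)
  define Om where "Om = net_event N t \<inter> space noise_space"
  have Om [measurable]: "Om \<in> sets noise_space" unfolding Om_def by (rule sets_net_event)
  define p where "p x z = max 0 (limit_potential z - Q z - ln (Y x z))" for x z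
  note measurable_Y [measurable]
  have mp [measurable]: "(\<lambda>(x, z). p x z) \<in> borel_measurable (noise_space \<Otimes>\<^sub>M borel)"
    unfolding p_def case_prod_unfold using measurable_Y[unfolded case_prod_unfold] by measurable
  have inner: "(\<integral>\<^sup>+z. ennreal \<bar>ln (Y x z) - limit_potential z\<bar> * indicator (cball 0 R) z \<partial>lborel)
     \<le> (\<integral>\<^sup>+z. (ennreal (Q z) + ennreal (p x z)) * indicator (cball 0 R) z \<partial>lborel)" if x: "x \<in> net_event N t" for x
  proof (rule nn_integral_mono_AE, use AE_regular[of x] in eventually_elim)
    case (elim z)
    have "\<bar>ln (Y x z) - limit_potential z\<bar> \<le> Q z + p x z"
      using potential_sandwich(1)[of z x] elim x Q_nonneg[of z] unfolding p_def by (auto simp: abs_le_iff)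
    then have "ennreal \<bar>ln (Y x z) - limit_potential z\<bar> \<le> ennreal (Q z) + ennreal (p x z)"
      using Q_nonneg[of z] ennreal_plus[of "Q z" "p x z"] ennreal_leI[of _ "Q z + p x z"] by (simp add: p_def del: ennreal_max_0)
    then show ?case by (rule mult_right_mono) simp
  qed
  have "(\<integral>\<^sup>+x. indicator (net_event N t) x * (\<integral>\<^sup>+z. ennreal \<bar>ln (Y x z) - limit_potential z\<bar> * indicator (cball 0 R) z \<partial>lborel) \<partial>noise_space)
    \<le> (\<integral>\<^sup>+x. (\<integral>\<^sup>+z. indicator Om x * ((ennreal (Q z) + ennreal (p x z)) * indicator (cball 0 R) z) \<partial>lborel) \<partial>noise_space)"
  proof (rule nn_integral_mono)
    fix x assume xs: "x \<in> space noise_space"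
    show "indicator (net_event N t) x * (\<integral>\<^sup>+z. ennreal \<bar>ln (Y x z) - limit_potential z\<bar> * indicator (cball 0 R) z \<partial>lborel)
      \<le> (\<integral>\<^sup>+z. indicator Om x * ((ennreal (Q z) + ennreal (p x z)) * indicator (cball 0 R) z) \<partial>lborel)"
    proof (cases "x \<in> net_event N t")
      case True
      then have "indicator Om x = (1::ennreal)" "indicator (net_event N t) x = (1::ennreal)"
        using xs by (auto simp: Om_def)
      then show ?thesis using inner[OF True] by (simp only: mult_1_left)
    qed simp
  qed
  also have "\<dots> = (\<integral>\<^sup>+z. (\<integral>\<^sup>+x. indicator Om x * ((ennreal (Q z) + ennreal (p x z)) * indicator (cball 0 R) z) \<partial>noise_space) \<partial>lborel)"
    by (rule P.Fubini'[symmetric]) measurable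
  also have "\<dots> \<le> (\<integral>\<^sup>+z. (ennreal (Q z) * indicator (cball 0 R) z + 2 * indicator (cball 0 R) z) \<partial>lborel)"
  proof (rule nn_integral_mono_AE, use AE_regular[of undefined] in eventually_elim)
    case (elim z)
    obtain T where T: "0 < T" "limit_potential z - Q z \<le> ln T"
      "(\<integral>\<^sup>+x. indicator (net_event N t) x * ninv ((Y x z)\<^sup>2) \<partial>noise_space) \<le> ennreal (T powr (-1/2))"
      using potential_sandwich(2)[of z] elim by blast
    have Ym: "(\<lambda>x. Y x z) \<in> borel_measurable noise_space"
      using measurable_compose[OF measurable_Pair2' measurable_Y, of z] by simp
    \<comment> \<open>ln (T / Y) is twice the logarithm of sqrt (T / Y), hence at most 2 sqrt (T /
      Y): the moment of order -1/2 controls the logarithmic shortfall, and its bound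
      \<open>T powr (-1/2)\<close> cancels T.\<close>
    have pb: "ennreal (p x z) \<le> ennreal (2 * T powr (1/2)) * ninv ((Y x z)\<^sup>2)" for x
    proof (cases "Y x z = 0")
      case True
      then show ?thesis using T by (simp add: ninv_def ennreal_mult_top)
    next
      case False
      then have Yp: "0 < Y x z" by (simp add: Y_def)
      have Tp: "0 < T powr (1/2) * Y x z powr (-1/2)" using T Yp by simp
      have "ln T - ln (Y x z) = 2 * ln (T powr (1/2) * Y x z powr (-1/2))"
        using T Yp by (simp add: ln_mult_pos ln_powr)
      also have "\<dots> \<le> 2 * (T powr (1/2) * Y x z powr (-1/2))"
        using ln_less_self[OF Tp] by simp
      finally have "p x z \<le> 2 * T powr (1/2) * Y x z powr (-1/2)"
        using T(2) Tp by (simp add: p_def)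
      moreover have "ninv ((Y x z)\<^sup>2) = ennreal (Y x z powr (-1/2))"
      proof -
        have "((Y x z)\<^sup>2) powr (-1/4) = (Y x z powr 2) powr (-1/4)" using Yp by (simp add: powr_numeral)
        also have "\<dots> = Y x z powr (-1/2)" by (simp only: powr_powr) simp
        finally show ?thesis using Yp by (simp add: ninv_def)
      qed
      ultimately show ?thesis by (simp add: ennreal_mult[symmetric] ennreal_leI)
    qed
    have "(\<integral>\<^sup>+x. indicator Om x * ennreal (p x z) \<partial>noise_space) \<le> (\<integral>\<^sup>+x. ennreal (2 * T powr (1/2)) * (indicator Om x * ninv ((Y x z)\<^sup>2)) \<partial>noise_space)"
      by (intro nn_integral_mono) (use pb in \<open>auto simp: indicator_def\<close>)
    also have "\<dots> = ennreal (2 * T powr (1/2)) * (\<integral>\<^sup>+x. indicator Om x * ninv ((Y x z)\<^sup>2) \<partial>noise_space)"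
      by (rule nn_integral_cmult) (use Ym Om in measurable)
    also have "(\<integral>\<^sup>+x. indicator Om x * ninv ((Y x z)\<^sup>2) \<partial>noise_space) \<le> ennreal (T powr (-1/2))"
      by (rule order_trans[OF nn_integral_mono T(3)]) (auto simp: Om_def indicator_def)
    also have "ennreal (2 * T powr (1/2)) * ennreal (T powr (-1/2)) = 2"
      using T(1) by (simp add: ennreal_mult[symmetric] mult.assoc powr_add[symmetric])
    finally have i2: "(\<integral>\<^sup>+x. indicator Om x * ennreal (p x z) \<partial>noise_space) \<le> 2" by (simp add: mult_left_mono)
    have pm: "(\<lambda>x. ennreal (p x z)) \<in> borel_measurable noise_space"
      unfolding p_def using Ym by measurable
    have "(\<integral>\<^sup>+x. indicator Om x * ((ennreal (Q z) + ennreal (p x z)) * indicator (cball 0 R) z) \<partial>noise_space)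
       = (\<integral>\<^sup>+x. (ennreal (Q z) * indicator Om x + indicator Om x * ennreal (p x z)) * indicator (cball 0 R) z \<partial>noise_space)"
      by (intro nn_integral_cong) (simp add: distrib_left distrib_right mult_ac)
    also have "\<dots> = (\<integral>\<^sup>+x. ennreal (Q z) * indicator Om x + indicator Om x * ennreal (p x z) \<partial>noise_space) * indicator (cball 0 R) z"
      by (rule nn_integral_multc) (use pm Om in measurable)
    also have "(\<integral>\<^sup>+x. ennreal (Q z) * indicator Om x + indicator Om x * ennreal (p x z) \<partial>noise_space)
       = ennreal (Q z) * emeasure noise_space Om + (\<integral>\<^sup>+x. indicator Om x * ennreal (p x z) \<partial>noise_space)"
      using pm Om by (subst nn_integral_add) (auto simp: nn_integral_cmult_indicator)
    also have "\<dots> \<le> ennreal (Q z) * 1 + 2"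
      by (intro add_mono mult_left_mono i2 NS.emeasure_le_1) auto
    finally show ?case by (simp add: distrib_right mult_right_mono)
  qed
  also have "\<dots> = (\<integral>\<^sup>+z. ennreal (Q z) * indicator (cball 0 R) z \<partial>lborel) + 2 * emeasure lborel (cball (0::complex) R)"
    by (subst nn_integral_add) (auto simp: nn_integral_cmult_indicator)
  also have "\<dots> \<le> ennreal (Qint R) + 2 * ennreal (pi * R\<^sup>2)"
    using R by (intro add_mono nn_integral_Q) (auto simp: emeasure_cball unit_ball_vol_2)
  also have "\<dots> = ennreal (Qint R + 2 * pi * R\<^sup>2)"
  proof -
    have "0 \<le> Qint R" unfolding Qint_def using \<eta> \<kappa> \<delta>t order_trans[OF _ L_ge, of 0]
      by (intro add_nonneg_nonneg mult_nonneg_nonneg) auto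
    then show ?thesis by (simp add: ennreal_mult[symmetric] ennreal_numeral[symmetric] ennreal_plus[symmetric] mult.assoc del: ennreal_plus ennreal_numeral)
  qed
  finally show ?thesis .
qed

end

section \<open>Reduction to compactly supported test functions\<close>

definition cutoff :: "nat \<Rightarrow> complex \<Rightarrow> real" where
  "cutoff k z = max 0 (min 1 (real k + 1 - cmod z))"

lemma cutoff_props:
  "continuous_on UNIV (cutoff k)" "0 \<le> cutoff k z" "cutoff k z \<le> 1"
  "real k + 1 < cmod z \<Longrightarrow> cutoff k z = 0" "cmod z \<le> real k \<Longrightarrow> cutoff k z = 1"
  by (auto simp: cutoff_def[abs_def] intro!: continuous_intros)

lemma cutoff_tendsto: "(\<lambda>k. cutoff k z) \<longlonglongrightarrow> 1"
proof -
  obtain k0 :: nat where k0: "cmod z \<le> real k0" using real_arch_simple by blast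
  have "eventually (\<lambda>k. cutoff k z = 1) sequentially"
    using eventually_ge_at_top[of k0] by eventually_elim (use k0 in \<open>auto intro!: cutoff_props(5)\<close>)
  then show ?thesis by (rule tendsto_eventually)
qed

lemma esm_list:
  assumes B: "B \<in> carrier_mat n n"
  obtains as where "length as = n"
    "\<And>f :: complex \<Rightarrow> real. f \<in> borel_measurable borel \<Longrightarrow> (\<integral>z. f z \<partial>empirical_spectral_measure B) = (\<Sum>a\<leftarrow>as. f a) / n"
proof -
  obtain as where "char_poly B = (\<Prod>a\<leftarrow>as. [:- a, 1:])" "length as = n"
    using char_poly_factorized[OF B] by auto
  then show ?thesis using that integral_esm[OF B] by blast
qed

lemma borel_measurable_det:
  fixes B :: "'w \<Rightarrow> complex mat"
  assumes B: "\<And>\<omega>. \<omega> \<in> space M \<Longrightarrow> B \<omega> \<in> carrier_mat n n"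
    and m: "\<And>i j. i < n \<Longrightarrow> j < n \<Longrightarrow> (\<lambda>\<omega>. B \<omega> $$ (i, j)) \<in> borel_measurable M"
  shows "(\<lambda>(\<omega>, z). det (B \<omega> - z \<cdot>\<^sub>m 1\<^sub>m n)) \<in> borel_measurable (M \<Otimes>\<^sub>M borel)"
proof -
  have "(\<lambda>x. dt n (\<lambda>i j. B (fst x) $$ (i, j) - (if i = j then snd x else 0))) \<in> borel_measurable (M \<Otimes>\<^sub>M borel)"
  proof (rule borel_measurable_dt)
    fix i j assume ij: "i < n" "j < n"
    have "(\<lambda>x. B (fst x) $$ (i, j)) \<in> borel_measurable (M \<Otimes>\<^sub>M borel)"
      by (rule measurable_compose[OF measurable_fst m[OF ij]])
    then show "(\<lambda>x. B (fst x) $$ (i, j) - (if i = j then snd x else 0)) \<in> borel_measurable (M \<Otimes>\<^sub>M borel)"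
      by (cases "i = j") auto
  qed
  moreover have "dt n (\<lambda>i j. B (fst x) $$ (i, j) - (if i = j then snd x else 0)) = (case x of (\<omega>, z) \<Rightarrow> det (B \<omega> - z \<cdot>\<^sub>m 1\<^sub>m n))"
    if x: "x \<in> space (M \<Otimes>\<^sub>M borel)" for x
  proof -
    have "fst x \<in> space M" using x by (auto simp: space_pair_measure)
    from B[OF this] have "mat n n (\<lambda>(i, j). B (fst x) $$ (i, j) - (if i = j then snd x else 0)) = B (fst x) - snd x \<cdot>\<^sub>m 1\<^sub>m n"
      by (intro eq_matI) auto
    then show ?thesis by (simp add: dt_def case_prod_unfold)
  qed
  ultimately show ?thesis by (subst measurable_cong[symmetric]) auto
qed

text \<open>Measurability is obtained without choosing eigenvalues measurably: for a test function
  that is a logarithmic potential, the spectral integral is an integral in z of ln |det|, which is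
  jointly measurable.\<close>

lemma measurable_integral_esm_potential:
  fixes B :: "'w \<Rightarrow> complex mat" and \<Phi> :: "complex \<Rightarrow> real"
  assumes B: "\<And>\<omega>. \<omega> \<in> space M \<Longrightarrow> B \<omega> \<in> carrier_mat n n"
    and m: "\<And>i j. i < n \<Longrightarrow> j < n \<Longrightarrow> (\<lambda>\<omega>. B \<omega> $$ (i, j)) \<in> borel_measurable M"
    and \<Phi>: "\<Phi> \<in> borel_measurable borel" "\<And>z. \<bar>\<Phi> z\<bar> \<le> b" "\<And>z. R < cmod z \<Longrightarrow> \<Phi> z = 0" "0 \<le> R"
  shows "(\<lambda>\<omega>. \<integral>w. (\<integral>z. \<Phi> z * ln (cmod (z - w)) \<partial>lborel) \<partial>empirical_spectral_measure (B \<omega>)) \<in> borel_measurable M"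
proof -
  have "(\<lambda>(\<omega>, z). \<Phi> z * ln (cmod (det (B \<omega> - z \<cdot>\<^sub>m 1\<^sub>m n)))) \<in> borel_measurable (M \<Otimes>\<^sub>M lborel)"
    using borel_measurable_det[OF B m] \<Phi>(1) unfolding case_prod_unfold by measurable
  then have "(\<lambda>\<omega>. \<integral>z. \<Phi> z * ln (cmod (det (B \<omega> - z \<cdot>\<^sub>m 1\<^sub>m n))) \<partial>lborel) \<in> borel_measurable M"
    by (rule lborel.borel_measurable_lebesgue_integral)
  then have "(\<lambda>\<omega>. (\<integral>z. \<Phi> z * ln (cmod (det (B \<omega> - z \<cdot>\<^sub>m 1\<^sub>m n))) \<partial>lborel) / n) \<in> borel_measurable M" by simp
  then show ?thesis
    by (rule measurable_cong[THEN iffD1, rotated]) (simp add: integral_esm_potential(1)[OF B \<Phi>])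
qed

text \<open>A continuous \<phi> is the pointwise limit of its cutoffs, and each cutoff is uniformly
  close to a logarithmic potential, with error 1 / (k + 1). Spectral integrals are finite averages,
  so pointwise convergence suffices.\<close>

lemma measurable_integral_esm:
  fixes B :: "'w \<Rightarrow> complex mat" and \<phi> :: "complex \<Rightarrow> real"
  assumes B: "\<And>\<omega>. \<omega> \<in> space M \<Longrightarrow> B \<omega> \<in> carrier_mat n n"
    and m: "\<And>i j. i < n \<Longrightarrow> j < n \<Longrightarrow> (\<lambda>\<omega>. B \<omega> $$ (i, j)) \<in> borel_measurable M"
    and \<phi>: "continuous_on UNIV \<phi>"
  shows "(\<lambda>\<omega>. \<integral>z. \<phi> z \<partial>empirical_spectral_measure (B \<omega>)) \<in> borel_measurable M"
proof -
  have "\<exists>\<Phi>. \<Phi> \<in> borel_measurable borel \<and> (\<exists>b R. (\<forall>z. \<bar>\<Phi> z\<bar> \<le> b) \<and> (\<forall>z. R < cmod z \<longrightarrow> \<Phi> z = 0) \<and> 0 \<le> R) \<and>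
     (\<forall>w. \<bar>(\<integral>z. \<Phi> z * ln (cmod (z - w)) \<partial>lborel) - \<phi> w * cutoff k w\<bar> \<le> 1 / real (Suc k))" for k
  proof -
    have c: "continuous_on UNIV (\<lambda>w. \<phi> w * cutoff k w)" by (intro continuous_intros \<phi> cutoff_props)
    have z: "\<And>z. real k + 1 < cmod z \<Longrightarrow> \<phi> z * cutoff k z = 0" and p: "0 < 1 / real (Suc k)"
      by (simp_all add: cutoff_props(4))
    obtain \<Phi> b R where "\<Phi> \<in> borel_measurable borel" "\<And>z. \<bar>\<Phi> z\<bar> \<le> b" "\<And>z. R < cmod z \<Longrightarrow> \<Phi> z = 0" "0 \<le> R"
       "\<And>w. \<bar>(\<integral>z. \<Phi> z * ln (cmod (z - w)) \<partial>lborel) - \<phi> w * cutoff k w\<bar> \<le> 1 / real (Suc k)"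
      by (rule log_potential_approx[OF c, of "real k + 1", OF _ p]) (rule z, assumption, rule that, assumption+)
    then show ?thesis by (intro exI[of _ \<Phi>] conjI allI exI[of _ b] exI[of _ R] impI) auto
  qed
  then have "\<forall>k. \<exists>\<Phi>. \<Phi> \<in> borel_measurable borel \<and> (\<exists>b R. (\<forall>z. \<bar>\<Phi> z\<bar> \<le> b) \<and> (\<forall>z. R < cmod z \<longrightarrow> \<Phi> z = 0) \<and> 0 \<le> R) \<and>
     (\<forall>w. \<bar>(\<integral>z. \<Phi> z * ln (cmod (z - w)) \<partial>lborel) - \<phi> w * cutoff k w\<bar> \<le> 1 / real (Suc k))" by (rule allI)
  from choice[OF this] obtain \<Phi> where \<Phi>: "\<And>k. \<Phi> k \<in> borel_measurable borel"
     "\<And>k. \<exists>b R. (\<forall>z. \<bar>\<Phi> k z\<bar> \<le> b) \<and> (\<forall>z. R < cmod z \<longrightarrow> \<Phi> k z = 0) \<and> 0 \<le> R"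
     "\<And>k w. \<bar>(\<integral>z. \<Phi> k z * ln (cmod (z - w)) \<partial>lborel) - \<phi> w * cutoff k w\<bar> \<le> 1 / real (Suc k)"
    by auto
  define g where "g k w = (\<integral>z. \<Phi> k z * ln (cmod (z - w)) \<partial>lborel)" for k w
  have gm: "g k \<in> borel_measurable borel" for k
    unfolding g_def[abs_def] using \<Phi>(1)[of k] by measurable
  have lim: "(\<lambda>k. g k w) \<longlonglongrightarrow> \<phi> w" for w
  proof -
    have "(\<lambda>k. g k w - \<phi> w * cutoff k w) \<longlonglongrightarrow> 0"
    proof (rule Lim_null_comparison)
      show "\<forall>\<^sub>F k in sequentially. norm (g k w - \<phi> w * cutoff k w) \<le> 1 / real (Suc k)"
        using \<Phi>(3) by (simp add: g_def)
      show "(\<lambda>k. 1 / real (Suc k)) \<longlonglongrightarrow> 0" using LIMSEQ_inverse_real_of_nat by (simp add: inverse_eq_divide)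
    qed
    moreover have "(\<lambda>k. \<phi> w * cutoff k w) \<longlonglongrightarrow> \<phi> w * 1" by (intro tendsto_intros cutoff_tendsto)
    ultimately have "(\<lambda>k. (g k w - \<phi> w * cutoff k w) + \<phi> w * cutoff k w) \<longlonglongrightarrow> 0 + \<phi> w * 1" by (rule tendsto_add)
    then show ?thesis by simp
  qed
  have fm: "\<phi> \<in> borel_measurable borel" by (rule borel_measurable_continuous_onI[OF \<phi>])
  have "(\<lambda>\<omega>. \<integral>w. g k w \<partial>empirical_spectral_measure (B \<omega>)) \<in> borel_measurable M" for k
  proof -
    obtain b R where bR: "\<And>z. \<bar>\<Phi> k z\<bar> \<le> b" "\<And>z. R < cmod z \<Longrightarrow> \<Phi> k z = 0" "0 \<le> R" using \<Phi>(2)[of k] by auto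
    show ?thesis unfolding g_def by (rule measurable_integral_esm_potential[OF B m \<Phi>(1) bR])
  qed
  then show ?thesis
  proof (rule borel_measurable_LIMSEQ_real[rotated])
    fix \<omega> assume "\<omega> \<in> space M"
    then obtain as where as: "\<And>f :: complex \<Rightarrow> real. f \<in> borel_measurable borel \<Longrightarrow> (\<integral>z. f z \<partial>empirical_spectral_measure (B \<omega>)) = (\<Sum>a\<leftarrow>as. f a) / n"
      using esm_list[OF B] by metis
    have "(\<lambda>k. \<Sum>a\<leftarrow>bs. g k a) \<longlonglongrightarrow> (\<Sum>a\<leftarrow>bs. \<phi> a)" for bs
      by (induction bs) (auto intro!: tendsto_add lim)
    then have "(\<lambda>k. (\<Sum>a\<leftarrow>as. g k a) / n) \<longlonglongrightarrow> (\<Sum>a\<leftarrow>as. \<phi> a) / n"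
      by (cases "n = 0") (auto intro!: tendsto_divide)
    then show "(\<lambda>k. \<integral>w. g k w \<partial>empirical_spectral_measure (B \<omega>)) \<longlonglongrightarrow> (\<integral>z. \<phi> z \<partial>empirical_spectral_measure (B \<omega>))"
      by (simp add: as gm fm)
  qed
qed

lemma integral_uniform_esm_bound:
  fixes f g :: "complex \<Rightarrow> real"
  assumes B: "B \<in> carrier_mat n n" and n: "0 < n" and fg: "f \<in> borel_measurable borel" "g \<in> borel_measurable borel"
    and le: "\<And>z. \<bar>f z - g z\<bar> \<le> e"
  shows "\<bar>(\<integral>z. f z \<partial>empirical_spectral_measure B) - (\<integral>z. g z \<partial>empirical_spectral_measure B)\<bar> \<le> e"
proof -
  obtain as where as: "length as = n" "\<And>f :: complex \<Rightarrow> real. f \<in> borel_measurable borel \<Longrightarrow> (\<integral>z. f z \<partial>empirical_spectral_measure B) = (\<Sum>a\<leftarrow>as. f a) / n"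
    using esm_list[OF B] by metis
  have "\<bar>(\<Sum>a\<leftarrow>bs. f a) - (\<Sum>a\<leftarrow>bs. g a)\<bar> \<le> real (length bs) * e" for bs
  proof (induction bs)
    case (Cons b bs)
    then show ?case using le[of b] by (simp add: algebra_simps abs_le_iff)
  qed simp
  from this[of as] show ?thesis
    using n by (simp add: as fg diff_divide_distrib[symmetric] abs_divide divide_le_eq mult.commute)
qed

text \<open>Tightness comes from the limit: since \<mu> has total mass 1, some cutoff has
  \<mu>-integral close to 1. The hypothesis applied to this cutoff shows that the spectral measures
  lose equally little mass with high probability.\<close>

lemma weak_limit_of_compactly_supported:
  fixes P :: "nat \<Rightarrow> 'w measure" and B :: "nat \<Rightarrow> 'w \<Rightarrow> complex mat" and \<phi> :: "complex \<Rightarrow> real"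
  assumes P: "\<And>N. prob_space (P N)"
    and B: "\<And>N \<omega>. \<omega> \<in> space (P N) \<Longrightarrow> B N \<omega> \<in> carrier_mat N N"
    and m: "\<And>N i j. i < N \<Longrightarrow> j < N \<Longrightarrow> (\<lambda>\<omega>. B N \<omega> $$ (i, j)) \<in> borel_measurable (P N)"
    and \<mu>: "prob_space \<mu>" "sets \<mu> = sets borel"
    and cc: "\<And>(\<psi> :: complex \<Rightarrow> real) R e. continuous_on UNIV \<psi> \<Longrightarrow> (\<And>z. R < cmod z \<Longrightarrow> \<psi> z = 0) \<Longrightarrow> 0 < e \<Longrightarrow>
      (\<lambda>N. measure (P N) {\<omega>\<in>space (P N). \<bar>(\<integral>z. \<psi> z \<partial>empirical_spectral_measure (B N \<omega>)) - (\<integral>z. \<psi> z \<partial>\<mu>)\<bar> > e}) \<longlonglongrightarrow> 0"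
    and \<phi>: "continuous_on UNIV \<phi>" "bounded (range \<phi>)"
  shows "converges_in_prob P (\<lambda>N \<omega>. \<integral>z. \<phi> z \<partial>empirical_spectral_measure (B N \<omega>)) (\<integral>z. \<phi> z \<partial>\<mu>)"
  unfolding converges_in_prob_def
proof (intro conjI allI impI)
  let ?L = "\<lambda>N \<omega>. empirical_spectral_measure (B N \<omega>)"
  show "(\<lambda>\<omega>. \<integral>z. \<phi> z \<partial>?L N \<omega>) \<in> borel_measurable (P N)" for N
    by (rule measurable_integral_esm[OF B m \<phi>(1)])
  fix e :: real assume e: "0 < e"
  interpret mu: prob_space \<mu> by fact
  obtain K0 where "\<And>z. norm (\<phi> z) \<le> K0" using \<phi>(2) by (auto simp: bounded_iff)
  define K where "K = max K0 0 + 1"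
  have K: "0 < K" "\<bar>\<phi> z\<bar> \<le> K" for z using \<open>\<And>z. norm (\<phi> z) \<le> K0\<close>[of z] by (auto simp: K_def)
  have fm: "f \<in> borel_measurable borel" if "continuous_on UNIV f" for f :: "complex \<Rightarrow> real"
    by (rule borel_measurable_continuous_onI[OF that])
  have fmu: "f \<in> borel_measurable \<mu>" if "continuous_on UNIV f" for f :: "complex \<Rightarrow> real"
    using fm[OF that] \<mu>(2) by (simp cong: measurable_cong_sets)
  have ci: "integrable \<mu> (cutoff k)" for k
    by (rule mu.integrable_const_bound[of _ 1]) (auto simp: cutoff_props fmu)
  have "(\<lambda>k. \<integral>z. cutoff k z \<partial>\<mu>) \<longlonglongrightarrow> (\<integral>z. 1 \<partial>\<mu>)"
    by (rule integral_dominated_convergence[where w = "\<lambda>_. 1"])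
       (auto simp: cutoff_props fmu cutoff_tendsto intro!: AE_I2)
  then have "(\<lambda>k. \<integral>z. cutoff k z \<partial>\<mu>) \<longlonglongrightarrow> 1" by (simp add: mu.prob_space)
  then obtain k where "dist (\<integral>z. cutoff k z \<partial>\<mu>) 1 < e / (8 * K)"
    using metric_LIMSEQ_D[of _ 1 "e / (8 * K)"] e K by (metis divide_pos_pos mult_pos_pos order_refl zero_less_numeral)
  then have k: "1 - (\<integral>z. cutoff k z \<partial>\<mu>) < e / (8 * K)" by (simp add: dist_real_def)
  let ?\<chi> = "cutoff k" and ?\<psi> = "\<lambda>z. \<phi> z * cutoff k z"
  have c\<psi>: "continuous_on UNIV ?\<psi>" by (intro continuous_intros \<phi> cutoff_props)
  let ?A = "\<lambda>N. {\<omega>\<in>space (P N). \<bar>(\<integral>z. ?\<psi> z \<partial>?L N \<omega>) - (\<integral>z. ?\<psi> z \<partial>\<mu>)\<bar> > e / 4}"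
  let ?C = "\<lambda>N. {\<omega>\<in>space (P N). \<bar>(\<integral>z. ?\<chi> z \<partial>?L N \<omega>) - (\<integral>z. ?\<chi> z \<partial>\<mu>)\<bar> > e / (4 * K)}"
  let ?E = "\<lambda>N. {\<omega>\<in>space (P N). \<bar>(\<integral>z. \<phi> z \<partial>?L N \<omega>) - (\<integral>z. \<phi> z \<partial>\<mu>)\<bar> > e}"
  have A0: "(\<lambda>N. measure (P N) (?A N)) \<longlonglongrightarrow> 0"
    by (rule cc[OF c\<psi>, of "real k + 1"]) (use e in \<open>auto simp: cutoff_props(4)\<close>)
  have C0: "(\<lambda>N. measure (P N) (?C N)) \<longlonglongrightarrow> 0"
    by (rule cc[OF cutoff_props(1), of "real k + 1"]) (use e K in \<open>auto simp: cutoff_props(4)\<close>)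
  \<comment> \<open>Outside \<open>?A N\<close> and \<open>?C N\<close> the error is at most e/4 for
    the cut function, e/8 for the mass that \<mu> loses and e/8 + e/4 for the mass that the spectral
    measure loses, in total less than e.\<close>
  have sub: "?E N \<subseteq> ?A N \<union> ?C N" if N: "0 < N" for N
  proof
    fix \<omega> assume \<omega>: "\<omega> \<in> ?E N"
    then have BN: "B N \<omega> \<in> carrier_mat N N" using B by auto
    obtain as where as: "length as = N" "\<And>f :: complex \<Rightarrow> real. f \<in> borel_measurable borel \<Longrightarrow> (\<integral>z. f z \<partial>?L N \<omega>) = (\<Sum>a\<leftarrow>as. f a) / N"
      using esm_list[OF BN] by metis
    have pt: "\<bar>\<phi> z - ?\<psi> z\<bar> \<le> K * (1 - ?\<chi> z)" for z
    proof -
      have "\<phi> z - ?\<psi> z = \<phi> z * (1 - ?\<chi> z)" by (simp add: algebra_simps)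
      then show ?thesis using K(2)[of z] cutoff_props(3)[of k z] by (simp add: abs_mult mult_right_mono)
    qed
    have "\<bar>(\<Sum>a\<leftarrow>bs. \<phi> a) - (\<Sum>a\<leftarrow>bs. ?\<psi> a)\<bar> \<le> K * (real (length bs) - (\<Sum>a\<leftarrow>bs. ?\<chi> a))" for bs
    proof (induction bs)
      case (Cons b bs)
      then show ?case using pt[of b] by (simp add: algebra_simps abs_le_iff)
    qed simp
    from this[of as] have "\<bar>((\<Sum>a\<leftarrow>as. \<phi> a) - (\<Sum>a\<leftarrow>as. ?\<psi> a)) / N\<bar> \<le> K * (real N - (\<Sum>a\<leftarrow>as. ?\<chi> a)) / N"
      using N as(1) by (simp add: abs_divide divide_right_mono)
    also have "K * (real N - (\<Sum>a\<leftarrow>as. ?\<chi> a)) / N = K * (1 - (\<Sum>a\<leftarrow>as. ?\<chi> a) / N)"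
      using N by (simp add: field_simps)
    finally have d1: "\<bar>(\<integral>z. \<phi> z \<partial>?L N \<omega>) - (\<integral>z. ?\<psi> z \<partial>?L N \<omega>)\<bar> \<le> K * (1 - (\<integral>z. ?\<chi> z \<partial>?L N \<omega>))"
      using fm[OF \<phi>(1)] fm[OF c\<psi>] fm[OF cutoff_props(1)] by (simp add: as(2) diff_divide_distrib)
    have i\<phi>: "integrable \<mu> \<phi>" by (rule mu.integrable_const_bound[of _ K]) (auto simp: K fmu \<phi>)
    have i\<psi>: "integrable \<mu> ?\<psi>"
      by (rule Bochner_Integration.integrable_bound[OF i\<phi>])
         (auto simp: fmu c\<psi> abs_mult cutoff_props mult_left_le intro!: AE_I2)
    have "\<bar>(\<integral>z. \<phi> z \<partial>\<mu>) - (\<integral>z. ?\<psi> z \<partial>\<mu>)\<bar> = \<bar>\<integral>z. \<phi> z - ?\<psi> z \<partial>\<mu>\<bar>"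
      using i\<phi> i\<psi> by simp
    also have "\<dots> \<le> (\<integral>z. \<bar>\<phi> z - ?\<psi> z\<bar> \<partial>\<mu>)" using integral_norm_bound[of \<mu> "\<lambda>z. \<phi> z - ?\<psi> z"] by simp
    also have "\<dots> \<le> (\<integral>z. K * (1 - ?\<chi> z) \<partial>\<mu>)"
      by (rule integral_mono) (use i\<phi> i\<psi> ci[of k] pt in auto)
    also have "\<dots> = K * (1 - (\<integral>z. ?\<chi> z \<partial>\<mu>))" using ci[of k] by (simp add: mu.prob_space)
    finally have d2: "\<bar>(\<integral>z. \<phi> z \<partial>\<mu>) - (\<integral>z. ?\<psi> z \<partial>\<mu>)\<bar> \<le> K * (1 - (\<integral>z. ?\<chi> z \<partial>\<mu>))" .
    have k': "K * (1 - (\<integral>z. ?\<chi> z \<partial>\<mu>)) \<le> e / 8"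
      using mult_left_mono[OF less_imp_le[OF k], of K] K by simp
    show "\<omega> \<in> ?A N \<union> ?C N"
    proof (rule ccontr)
      assume "\<omega> \<notin> ?A N \<union> ?C N"
      then have a: "\<bar>(\<integral>z. ?\<psi> z \<partial>?L N \<omega>) - (\<integral>z. ?\<psi> z \<partial>\<mu>)\<bar> \<le> e / 4" and c: "\<bar>(\<integral>z. ?\<chi> z \<partial>?L N \<omega>) - (\<integral>z. ?\<chi> z \<partial>\<mu>)\<bar> \<le> e / (4 * K)"
        using \<omega> by auto
      have "K * \<bar>(\<integral>z. ?\<chi> z \<partial>?L N \<omega>) - (\<integral>z. ?\<chi> z \<partial>\<mu>)\<bar> \<le> e / 4"
        using mult_left_mono[OF c, of K] K by simp
      then have "K * (1 - (\<integral>z. ?\<chi> z \<partial>?L N \<omega>)) \<le> K * (1 - (\<integral>z. ?\<chi> z \<partial>\<mu>)) + e / 4"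
      proof -
        have "K * (1 - (\<integral>z. ?\<chi> z \<partial>?L N \<omega>)) = K * (1 - (\<integral>z. ?\<chi> z \<partial>\<mu>)) - K * ((\<integral>z. ?\<chi> z \<partial>?L N \<omega>) - (\<integral>z. ?\<chi> z \<partial>\<mu>))"
          by (simp add: algebra_simps)
        moreover have "- (K * ((\<integral>z. ?\<chi> z \<partial>?L N \<omega>) - (\<integral>z. ?\<chi> z \<partial>\<mu>))) \<le> K * \<bar>(\<integral>z. ?\<chi> z \<partial>?L N \<omega>) - (\<integral>z. ?\<chi> z \<partial>\<mu>)\<bar>"
          using K by (metis abs_le_D2 abs_mult abs_of_pos order_refl)
        ultimately show ?thesis using \<open>K * \<bar>_\<bar> \<le> e / 4\<close> by linarith
      qed
      then have "\<bar>(\<integral>z. \<phi> z \<partial>?L N \<omega>) - (\<integral>z. \<phi> z \<partial>\<mu>)\<bar> \<le> e"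
        using d1 d2 a k' e by linarith
      then show False using \<omega> by simp
    qed
  qed
  have mA: "?A N \<in> sets (P N)" "?C N \<in> sets (P N)" "?E N \<in> sets (P N)" for N
    using measurable_integral_esm[where M = "P N" and B = "B N", OF B m c\<psi>] measurable_integral_esm[where M = "P N" and B = "B N", OF B m cutoff_props(1)[of k]]
      measurable_integral_esm[where M = "P N" and B = "B N", OF B m \<phi>(1)] by measurable
  show "(\<lambda>N. measure (P N) (?E N)) \<longlonglongrightarrow> 0"
  proof (rule tendsto_sandwich[OF _ _ tendsto_const])
    show "\<forall>\<^sub>F N in sequentially. 0 \<le> measure (P N) (?E N)" by simp
    show "\<forall>\<^sub>F N in sequentially. measure (P N) (?E N) \<le> measure (P N) (?A N) + measure (P N) (?C N)"
      using eventually_gt_at_top[of 0]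
    proof eventually_elim
      case (elim N)
      interpret PN: prob_space "P N" by (rule P)
      have "measure (P N) (?E N) \<le> measure (P N) (?A N \<union> ?C N)"
        using sub[OF elim] mA[of N] by (intro PN.finite_measure_mono) auto
      also have "\<dots> \<le> measure (P N) (?A N) + measure (P N) (?C N)"
        using mA[of N] by (intro measure_Un_le) auto
      finally show ?case .
    qed
    show "(\<lambda>N. measure (P N) (?A N) + measure (P N) (?C N)) \<longlonglongrightarrow> 0"
      using tendsto_add[OF A0 C0] by simp
  qed
qed

lemma nn_integral_markov:
  assumes f: "f \<in> borel_measurable M" and e: "0 < e" and A: "A \<in> sets M"
    and le: "\<And>x. x \<in> A \<Longrightarrow> ennreal e \<le> f x"
  shows "emeasure M A \<le> ennreal (1 / e) * (\<integral>\<^sup>+x. f x \<partial>M)"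
proof -
  have "emeasure M A = (\<integral>\<^sup>+x. indicator A x \<partial>M)" using A by simp
  also have "\<dots> \<le> (\<integral>\<^sup>+x. ennreal (1 / e) * f x \<partial>M)"
  proof (rule nn_integral_mono)
    fix x show "indicator A x \<le> ennreal (1 / e) * f x"
    proof (cases "x \<in> A")
      case True
      have "1 = ennreal (1 / e) * ennreal e" using e by (simp add: ennreal_mult[symmetric])
      also have "\<dots> \<le> ennreal (1 / e) * f x" by (rule mult_left_mono[OF le[OF True]]) simp
      finally show ?thesis using True by simp
    qed simp
  qed
  also have "\<dots> = ennreal (1 / e) * (\<integral>\<^sup>+x. f x \<partial>M)" by (rule nn_integral_cmult[OF f])
  finally show ?thesis .
qed

definition log_potential :: "(complex \<Rightarrow> real) \<Rightarrow> complex \<Rightarrow> real" where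
  "log_potential \<Phi> w = (\<integral>z. \<Phi> z * ln (cmod (z - w)) \<partial>lborel)"

section \<open>Deviation of spectral integrals of logarithmic potentials\<close>

context noisy_blocks
begin

text \<open>With d = a ln N this is \<open>block_radius\<close>; its d-th power is the floor
  \<open>N powr (-\<beta>)\<close> in \<open>limit_potential\<close>.\<close>

definition rad :: "nat \<Rightarrow> real" where "rad i = real N powr (- \<beta> / real (d i))"

lemma rad_pos: "0 < rad i"
  using Npos by (simp add: rad_def)

lemma rad_pow: "i < m \<Longrightarrow> rad i ^ d i = real N powr (- \<beta>)"
  using d_pos[of i] Npos by (simp add: rad_def powr_power)

lemma ln_max_rad:
  assumes "i < m" "z \<noteq> c i"
  shows "real (d i) * ln (max (cmod (z - c i)) (rad i)) = ln (max (cmod (c i - z) ^ d i) (real N powr (- \<beta>)))"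
proof -
  have "max (cmod (c i - z) ^ d i) (rad i ^ d i) = max (cmod (z - c i)) (rad i) ^ d i"
    using rad_pos[of i] power_mono[of "rad i" "cmod (z - c i)" "d i"] power_mono[of "cmod (z - c i)" "rad i" "d i"]
    by (cases "cmod (z - c i) \<le> rad i") (auto simp: max_def norm_minus_commute)
  then show ?thesis using assms rad_pos[of i] by (simp add: rad_pow ln_realpow less_max_iff_disj)
qed

context
  fixes \<Phi> :: "complex \<Rightarrow> real" and b R :: real
  assumes \<Phi> [measurable]: "\<Phi> \<in> borel_measurable borel" and b: "\<And>z. \<bar>\<Phi> z\<bar> \<le> b"
    and s: "\<And>z. R < cmod z \<Longrightarrow> \<Phi> z = 0" and R: "0 \<le> R"
begin

abbreviation pot :: "complex \<Rightarrow> real" where "pot \<equiv> log_potential \<Phi>"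

lemma circle_pot:
  "integrable (uniform_circle (c i) (rad i)) pot"
  "(\<integral>w. pot w \<partial>uniform_circle (c i) (rad i)) = (\<integral>z. \<Phi> z * ln (max (cmod (z - c i)) (rad i)) \<partial>lborel)"
  "integrable lborel (\<lambda>z. \<Phi> z * ln (max (cmod (z - c i)) (rad i)))"
proof -
  note sw = integral_potential_swap[OF prob_space_uniform_circle sets_uniform_circle
      AE_uniform_circle_bounded[OF less_imp_le[OF rad_pos[of i]], of "c i"] \<Phi> b s R]
  have ae: "AE z in lborel. \<Phi> z * (\<integral>u. ln (cmod (z - u)) \<partial>uniform_circle (c i) (rad i))
      = \<Phi> z * ln (max (cmod (z - c i)) (rad i))"
    using AE_cmod_ne[of "c i" "rad i"] by eventually_elim (simp add: circle_potential[OF rad_pos])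
  have me: "(\<lambda>z. \<Phi> z * ln (max (cmod (z - c i)) (rad i))) \<in> borel_measurable lborel" by measurable
  have mi: "(\<lambda>z. \<Phi> z * (\<integral>u. ln (cmod (z - u)) \<partial>uniform_circle (c i) (rad i))) \<in> borel_measurable lborel"
    using sw(3) by (rule borel_measurable_integrable)
  show "integrable (uniform_circle (c i) (rad i)) pot" using sw(2) by (simp add: log_potential_def[abs_def])
  show "(\<integral>w. pot w \<partial>uniform_circle (c i) (rad i)) = (\<integral>z. \<Phi> z * ln (max (cmod (z - c i)) (rad i)) \<partial>lborel)"
    unfolding log_potential_def using sw(1) integral_cong_AE[OF mi me ae] by (rule trans)
  show "integrable lborel (\<lambda>z. \<Phi> z * ln (max (cmod (z - c i)) (rad i)))"
    using sw(3) integrable_cong_AE[OF mi me ae] by simp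
qed

lemma sum_circle_pot:
  "(\<Sum>i<m. real (d i) / N * (\<integral>w. pot w \<partial>uniform_circle (c i) (rad i))) = (\<integral>z. \<Phi> z * limit_potential z \<partial>lborel) / N"
  "integrable lborel (\<lambda>z. \<Phi> z * limit_potential z)"
proof -
  let ?h = "\<lambda>i z. real (d i) * (\<Phi> z * ln (max (cmod (z - c i)) (rad i)))"
  have i: "integrable lborel (?h i)" for i by (intro integrable_mult_right circle_pot(3))
  have ae: "AE z in lborel. (\<Sum>i<m. ?h i z) = \<Phi> z * limit_potential z"
    using AE_regular[of undefined]
  proof eventually_elim
    case (elim z)
    have "?h i z = \<Phi> z * ln (max (cmod (c i - z) ^ d i) (real N powr (- \<beta>)))" if "i < m" for i
      using ln_max_rad[OF that, of z] elim that by (metis mult.left_commute)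
    then show ?case unfolding limit_potential_def sum_distrib_left by (intro sum.cong) auto
  qed
  have iS: "integrable lborel (\<lambda>z. \<Sum>i<m. ?h i z)" by (intro Bochner_Integration.integrable_sum i)
  have mU: "(\<lambda>z. \<Phi> z * limit_potential z) \<in> borel_measurable lborel" by measurable
  show "integrable lborel (\<lambda>z. \<Phi> z * limit_potential z)"
    using iS integrable_cong_AE[OF borel_measurable_integrable[OF iS] mU ae] by simp
  have "(\<integral>z. \<Phi> z * limit_potential z \<partial>lborel) = (\<integral>z. (\<Sum>i<m. ?h i z) \<partial>lborel)"
    by (rule integral_cong_AE[OF borel_measurable_integrable[OF iS] mU ae, symmetric])
  also have "\<dots> = (\<Sum>i<m. \<integral>z. ?h i z \<partial>lborel)" by (rule Bochner_Integration.integral_sum) (rule i)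
  also have "\<dots> = (\<Sum>i<m. real (d i) * (\<integral>w. pot w \<partial>uniform_circle (c i) (rad i)))"
    by (simp add: circle_pot(2))
  finally show "(\<Sum>i<m. real (d i) / N * (\<integral>w. pot w \<partial>uniform_circle (c i) (rad i))) = (\<integral>z. \<Phi> z * limit_potential z \<partial>lborel) / N"
    by (simp add: sum_divide_distrib)
qed

lemma esm_pot:
  "(\<integral>w. pot w \<partial>empirical_spectral_measure (Bmat x)) = (\<integral>z. \<Phi> z * ln (Y x z) \<partial>lborel) / N"
  "integrable lborel (\<lambda>z. \<Phi> z * ln (Y x z))"
  using integral_esm_potential[OF Bmat_carrier \<Phi> b s R] by (simp_all add: log_potential_def Y_eq)

text \<open>Both spectral and circle integrals of the potential are integrals in z against \<Phi>,
  of ln Y and of \<open>limit_potential\<close>. On \<open>net_event\<close> Markov's inequality is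
  applied to the mean deviation; the first summand bounds the complement.\<close>

lemma pot_deviation_prob:
  fixes e :: real
  assumes e: "0 < e"
  shows "measure noise_space {x\<in>space noise_space. e < \<bar>(\<integral>w. pot w \<partial>empirical_spectral_measure (Bmat x))
        - (\<Sum>i<m. real (d i) / N * (\<integral>w. pot w \<partial>uniform_circle (c i) (rad i)))\<bar>}
     \<le> 2 * (2 ^ 16 * 3) ^ (2 * N) * exp (- t\<^sup>2 / 8) + b / (N * e) * (Qint R + 2 * pi * R\<^sup>2)"
proof -
  interpret NS: prob_space noise_space
    unfolding noise_space_def by (rule prob_space_PiM) (rule gauss_prob.prob_space_axioms)
  have b0: "0 \<le> b" using b[of 0] by linarith
  define D where "D x = (\<integral>z. \<Phi> z * ln (Y x z) \<partial>lborel) / N - (\<integral>z. \<Phi> z * limit_potential z \<partial>lborel) / N" for x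
  define F where "F x = (\<integral>\<^sup>+z. ennreal \<bar>ln (Y x z) - limit_potential z\<bar> * indicator (cball 0 R) z \<partial>lborel)" for x
  have Ym: "(\<lambda>(x, z). Y x z) \<in> borel_measurable (noise_space \<Otimes>\<^sub>M lborel)" using measurable_Y by simp
  have "(\<lambda>(x, z). \<Phi> z * ln (Y x z)) \<in> borel_measurable (noise_space \<Otimes>\<^sub>M lborel)"
    using Ym unfolding case_prod_unfold by measurable
  then have "(\<lambda>x. \<integral>z. \<Phi> z * ln (Y x z) \<partial>lborel) \<in> borel_measurable noise_space"
    by (rule lborel.borel_measurable_lebesgue_integral)
  then have Dm [measurable]: "D \<in> borel_measurable noise_space" unfolding D_def[abs_def] by measurable
  have [measurable]: "cball 0 R \<in> sets (borel :: complex measure)" by simp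
  have m2: "(\<lambda>(x, z). ennreal \<bar>ln (Y x z) - limit_potential z\<bar> * indicator (cball 0 R) z) \<in> borel_measurable (noise_space \<Otimes>\<^sub>M lborel)"
    using Ym unfolding case_prod_unfold by measurable
  from m2 have Fm [measurable]: "F \<in> borel_measurable noise_space"
    unfolding F_def[abs_def] by (rule lborel.borel_measurable_nn_integral)
  have DF: "ennreal \<bar>D x\<bar> \<le> ennreal (b / N) * F x" if x: "x \<in> space noise_space" for x
  proof -
    have i: "integrable lborel (\<lambda>z. \<Phi> z * ln (Y x z) - \<Phi> z * limit_potential z)"
      by (intro Bochner_Integration.integrable_diff esm_pot(2) sum_circle_pot(2))
    have "D x = (\<integral>z. \<Phi> z * ln (Y x z) - \<Phi> z * limit_potential z \<partial>lborel) / N"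
      by (simp add: D_def esm_pot(2) sum_circle_pot(2) diff_divide_distrib)
    then have "ennreal \<bar>D x\<bar> = ennreal (1 / N) * ennreal (norm (\<integral>z. \<Phi> z * ln (Y x z) - \<Phi> z * limit_potential z \<partial>lborel))"
      by (simp add: ennreal_mult[symmetric] abs_divide)
    also have "\<dots> \<le> ennreal (1 / N) * (\<integral>\<^sup>+z. ennreal (norm (\<Phi> z * ln (Y x z) - \<Phi> z * limit_potential z)) \<partial>lborel)"
      by (rule mult_left_mono[OF integral_norm_bound_ennreal[OF i]]) simp
    also have "\<dots> \<le> ennreal (1 / N) * (\<integral>\<^sup>+z. ennreal b * (ennreal \<bar>ln (Y x z) - limit_potential z\<bar> * indicator (cball 0 R) z) \<partial>lborel)"
    proof (intro mult_left_mono nn_integral_mono)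
      fix z
      have "norm (\<Phi> z * ln (Y x z) - \<Phi> z * limit_potential z) = \<bar>\<Phi> z\<bar> * \<bar>ln (Y x z) - limit_potential z\<bar>"
        by (simp add: abs_mult[symmetric] algebra_simps)
      also have "\<dots> \<le> b * \<bar>ln (Y x z) - limit_potential z\<bar>" by (rule mult_right_mono[OF b]) simp
      finally have le: "norm (\<Phi> z * ln (Y x z) - \<Phi> z * limit_potential z) \<le> b * \<bar>ln (Y x z) - limit_potential z\<bar>" .
      show "ennreal (norm (\<Phi> z * ln (Y x z) - \<Phi> z * limit_potential z)) \<le> ennreal b * (ennreal \<bar>ln (Y x z) - limit_potential z\<bar> * indicator (cball 0 R) z)"
      proof (cases "cmod z \<le> R")
        case True
        then show ?thesis using ennreal_leI[OF le] b0 by (simp add: ennreal_mult)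
      next
        case False
        then show ?thesis using s[of z] by simp
      qed
    qed simp
    also have "\<dots> = ennreal (1 / N) * (ennreal b * F x)"
    proof -
      have "(\<lambda>z. ennreal \<bar>ln (Y x z) - limit_potential z\<bar> * indicator (cball 0 R) z) \<in> borel_measurable lborel"
        using measurable_Pair2[OF m2 x] by simp
      then show ?thesis unfolding F_def by (subst nn_integral_cmult) auto
    qed
    also have "\<dots> = ennreal (b / N) * F x" using b0 by (simp add: mult.assoc[symmetric] ennreal_mult[symmetric])
    finally show ?thesis .
  qed
  let ?E = "net_event N t \<inter> space noise_space"
  let ?A = "{x\<in>space noise_space. e < \<bar>D x\<bar>}"
  have EA: "?A \<inter> ?E \<in> sets noise_space" by (intro sets.Int sets_net_event) measurable
  have EC: "space noise_space - ?E \<in> sets noise_space" by (intro sets.Diff sets_net_event) simp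
  have Gm: "(\<lambda>x. ennreal (b / N) * (indicator ?E x * F x)) \<in> borel_measurable noise_space"
    using sets_net_event by measurable
  have "emeasure noise_space (?A \<inter> ?E) \<le> ennreal (1 / e) * (\<integral>\<^sup>+x. ennreal (b / N) * (indicator ?E x * F x) \<partial>noise_space)"
  proof (rule nn_integral_markov[OF Gm e EA])
    fix x assume x: "x \<in> ?A \<inter> ?E"
    then have "ennreal e \<le> ennreal \<bar>D x\<bar>" by (intro ennreal_leI) simp
    also have "ennreal \<bar>D x\<bar> \<le> ennreal (b / N) * F x" using x by (intro DF) simp
    finally show "ennreal e \<le> ennreal (b / N) * (indicator ?E x * F x)" using x by simp
  qed
  also have "(\<integral>\<^sup>+x. ennreal (b / N) * (indicator ?E x * F x) \<partial>noise_space) = ennreal (b / N) * (\<integral>\<^sup>+x. indicator ?E x * F x \<partial>noise_space)"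
    by (rule nn_integral_cmult) (use sets_net_event in measurable)
  also have "(\<integral>\<^sup>+x. indicator ?E x * F x \<partial>noise_space) = (\<integral>\<^sup>+x. indicator (net_event N t) x * F x \<partial>noise_space)"
    by (rule nn_integral_cong) (auto split: split_indicator)
  also have "ennreal (1 / e) * (ennreal (b / N) * (\<integral>\<^sup>+x. indicator (net_event N t) x * F x \<partial>noise_space))
      \<le> ennreal (1 / e) * (ennreal (b / N) * ennreal (Qint R + 2 * pi * R\<^sup>2))"
    using mean_abs_deviation[OF R] unfolding F_def by (intro mult_left_mono) auto
  also have "\<dots> = ennreal (b / (N * e) * max 0 (Qint R + 2 * pi * R\<^sup>2))"
    using b0 e by (cases "0 \<le> Qint R + 2 * pi * R\<^sup>2") (simp_all add: ennreal_mult[symmetric] ennreal_neg max_def mult.commute)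
  also have "max 0 (Qint R + 2 * pi * R\<^sup>2) = Qint R + 2 * pi * R\<^sup>2"
  proof -
    have "0 \<le> Qint R" unfolding Qint_def using \<eta> \<kappa> \<delta>t(5) L_ge
      by (intro add_nonneg_nonneg mult_nonneg_nonneg divide_nonneg_nonneg) auto
    then show ?thesis by simp
  qed
  finally have p1: "emeasure noise_space (?A \<inter> ?E) \<le> ennreal (b / (N * e) * (Qint R + 2 * pi * R\<^sup>2))" .
  have "space noise_space - ?E = space noise_space - net_event N t" by auto
  then have p2: "emeasure noise_space (space noise_space - ?E) \<le> ennreal (2 * (2 ^ 16 * 3) ^ (2 * N) * exp (- t\<^sup>2 / 8))"
    using emeasure_net_event[OF Npos(2) \<delta>t(3)] by (simp add: noise_space_def)
  have "0 \<le> Qint R" unfolding Qint_def using \<eta> \<kappa> \<delta>t(5) L_ge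
    by (intro add_nonneg_nonneg mult_nonneg_nonneg divide_nonneg_nonneg) auto
  then have nn: "0 \<le> b / (N * e) * (Qint R + 2 * pi * R\<^sup>2)" using b0 e by simp
  have "measure noise_space ?A \<le> measure noise_space ((space noise_space - ?E) \<union> (?A \<inter> ?E))"
    using EA EC by (intro NS.finite_measure_mono) auto
  also have "\<dots> \<le> measure noise_space (space noise_space - ?E) + measure noise_space (?A \<inter> ?E)"
    using EA EC by (intro measure_Un_le) auto
  also have "\<dots> \<le> 2 * (2 ^ 16 * 3) ^ (2 * N) * exp (- t\<^sup>2 / 8) + b / (N * e) * (Qint R + 2 * pi * R\<^sup>2)"
  proof (rule add_mono)
    show "measure noise_space (space noise_space - ?E) \<le> 2 * (2 ^ 16 * 3) ^ (2 * N) * exp (- t\<^sup>2 / 8)"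
      using p2 by (simp add: NS.emeasure_eq_measure)
    show "measure noise_space (?A \<inter> ?E) \<le> b / (N * e) * (Qint R + 2 * pi * R\<^sup>2)"
      using p1 nn by (simp add: NS.emeasure_eq_measure)
  qed
  finally show ?thesis unfolding esm_pot(1) sum_circle_pot(1) D_def .
qed

end

end

section \<open>Convergence of the empirical spectral measures\<close>

lemma std_gaussian_matrix_measurable:
  assumes "std_gaussian_matrix P n G" "i < n" "j < n"
  shows "(\<lambda>\<omega>. G \<omega> $$ (i, j)) \<in> borel_measurable P"
  using assms distributed_measurable[of P lborel "\<lambda>\<omega>. G \<omega> $$ (i, j)" std_normal_density]
  by (auto simp: std_gaussian_matrix_def)

text \<open>Transfers the estimates from the given probability space to the product space on which
  the rows were integrated out.\<close>

lemma distr_std_gaussian_matrix: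
  fixes G :: "'w \<Rightarrow> real mat"
  assumes P: "prob_space P" and G: "std_gaussian_matrix P n G" and n: "0 < n"
  defines "X \<equiv> \<lambda>\<omega>. \<lambda>ij\<in>{..<n} \<times> {..<n}. G \<omega> $$ ij"
  shows "X \<in> P \<rightarrow>\<^sub>M PiM ({..<n} \<times> {..<n}) (\<lambda>_. ngauss)"
    and "distr P (PiM ({..<n} \<times> {..<n}) (\<lambda>_. ngauss)) X = PiM ({..<n} \<times> {..<n}) (\<lambda>_. ngauss)"
proof -
  interpret P: prob_space P by fact
  let ?I = "{..<n} \<times> {..<n}"
  have ne: "?I \<noteq> {}" using n by auto
  have m: "(\<lambda>\<omega>. G \<omega> $$ ij) \<in> P \<rightarrow>\<^sub>M borel" if "ij \<in> ?I" for ij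
    using that std_gaussian_matrix_measurable[OF G] by auto
  have ss: "sets (PiM ?I (\<lambda>_. borel)) = sets (PiM ?I (\<lambda>_. ngauss))" by (rule sets_PiM_cong) auto
  have Xm: "X \<in> P \<rightarrow>\<^sub>M PiM ?I (\<lambda>_. borel)" unfolding X_def by (rule measurable_restrict) (rule m)
  then show "X \<in> P \<rightarrow>\<^sub>M PiM ?I (\<lambda>_. ngauss)" by (simp only: measurable_cong_sets[OF refl ss])
  have "P.indep_vars (\<lambda>_. borel) (\<lambda>ij \<omega>. G \<omega> $$ ij) ?I" using G by (simp add: std_gaussian_matrix_def)
  then have "distr P (PiM ?I (\<lambda>_. borel)) X = PiM ?I (\<lambda>ij. distr P borel (\<lambda>\<omega>. G \<omega> $$ ij))"
    unfolding X_def using P.indep_vars_iff_distr_eq_PiM'[OF ne m] by simp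
  also have "\<dots> = PiM ?I (\<lambda>_. ngauss)"
  proof (rule PiM_cong[OF refl])
    fix ij assume "ij \<in> ?I"
    then have "distributed P lborel (\<lambda>\<omega>. G \<omega> $$ ij) std_normal_density"
      using G by (auto simp: std_gaussian_matrix_def)
    from distributed_distr_eq_density[OF this] have "distr P lborel (\<lambda>\<omega>. G \<omega> $$ ij) = ngauss" .
    moreover have "distr P borel (\<lambda>\<omega>. G \<omega> $$ ij) = distr P lborel (\<lambda>\<omega>. G \<omega> $$ ij)"
      by (rule distr_cong) auto
    ultimately show "distr P borel (\<lambda>\<omega>. G \<omega> $$ ij) = ngauss" by simp
  qed
  finally have "distr P (PiM ?I (\<lambda>_. borel)) X = PiM ?I (\<lambda>_. ngauss)" .
  moreover have "distr P (PiM ?I (\<lambda>_. borel)) X = distr P (PiM ?I (\<lambda>_. ngauss)) X"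
    by (rule distr_cong) (simp_all add: ss)
  ultimately show "distr P (PiM ?I (\<lambda>_. ngauss)) X = PiM ?I (\<lambda>_. ngauss)" by simp
qed

lemma (in noisy_blocks) Qint_eq:
  "Qint R = real N * (16 * (\<eta> / (\<beta> - \<eta>)) + (5 + \<beta> * ln (real N) + 12 * ln (real N)) * (4 * pi / (ln (real N))\<^sup>2)
     + (12 * sqrt (real m / real N) + 12 / ln (real N) + 2 * (real N powr (- \<eta> / 2) * ((1 + \<beta>) * ln (real N) ^ 6))
        + 1 / (ln (real N))\<^sup>2) * (pi * R\<^sup>2))"
proof -
  have L0: "0 < L" using L_ge by simp
  have s: "sqrt \<kappa> = 1 / L" "12 / sqrt \<kappa> = 12 * L" using L0 by (simp_all add: \<kappa>_def real_sqrt_divide)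
  have q: "sqrt (real m * real N) = real N * sqrt (real m / real N)"
  proof -
    have "real m * real N = (real N)\<^sup>2 * (real m / real N)" using Npos by (simp add: power2_eq_square)
    then show ?thesis by (simp only: real_sqrt_mult real_sqrt_abs abs_of_nat)
  qed
  show ?thesis unfolding Qint_def s q \<zeta>_def
    by (simp add: \<kappa>_def L_def[symmetric]) (simp add: algebra_simps)
qed

text \<open>All errors vanish as N grows except the price of the threshold \<tau>, which depends on
  \<eta> alone. The number of blocks enters as sqrt (l N / N).\<close>

lemma Qint_limit:
  fixes l :: "nat \<Rightarrow> nat" and \<beta> \<eta> R :: real
  assumes l: "(\<lambda>N. real (l N)) \<in> o(\<lambda>N. real N)" and \<eta>: "0 < \<eta>"
  shows "(\<lambda>N. 16 * (\<eta> / (\<beta> - \<eta>)) + (5 + \<beta> * ln (real N) + 12 * ln (real N)) * (4 * pi / (ln (real N))\<^sup>2)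
     + (12 * sqrt (real (l N) / real N) + 12 / ln (real N) + 2 * (real N powr (- \<eta> / 2) * ((1 + \<beta>) * ln (real N) ^ 6))
        + 1 / (ln (real N))\<^sup>2) * (pi * R\<^sup>2) + 2 * pi * R\<^sup>2 / real N) \<longlonglongrightarrow> 16 * (\<eta> / (\<beta> - \<eta>))"
proof -
  have 1: "(\<lambda>N::nat. (5 + \<beta> * ln (real N) + 12 * ln (real N)) * (4 * pi / (ln (real N))\<^sup>2)) \<longlonglongrightarrow> 0"
    by real_asymp
  have 2: "(\<lambda>N. sqrt (real (l N) / real N)) \<longlonglongrightarrow> 0"
    using tendsto_real_sqrt[OF smalloD_tendsto[OF l]] by simp
  have 3: "(\<lambda>N::nat. 12 / ln (real N)) \<longlonglongrightarrow> 0" by real_asymp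
  have 4: "(\<lambda>N::nat. real N powr (- \<eta> / 2) * ((1 + \<beta>) * ln (real N) ^ 6)) \<longlonglongrightarrow> 0" using \<eta> by real_asymp
  have 5: "(\<lambda>N::nat. 1 / (ln (real N))\<^sup>2) \<longlonglongrightarrow> 0" by real_asymp
  have 6: "(\<lambda>N::nat. 2 * pi * R\<^sup>2 / real N) \<longlonglongrightarrow> 0" by real_asymp
  have "(\<lambda>N. 16 * (\<eta> / (\<beta> - \<eta>)) + (5 + \<beta> * ln (real N) + 12 * ln (real N)) * (4 * pi / (ln (real N))\<^sup>2)
     + (12 * sqrt (real (l N) / real N) + 12 / ln (real N) + 2 * (real N powr (- \<eta> / 2) * ((1 + \<beta>) * ln (real N) ^ 6))
        + 1 / (ln (real N))\<^sup>2) * (pi * R\<^sup>2) + 2 * pi * R\<^sup>2 / real N)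
    \<longlonglongrightarrow> 16 * (\<eta> / (\<beta> - \<eta>)) + 0 + (12 * 0 + 0 + 2 * 0 + 0) * (pi * R\<^sup>2) + 0"
    by (intro tendsto_add tendsto_mult_left tendsto_mult_right tendsto_const 1 2 3 4 5 6)
  then show ?thesis by simp
qed

text \<open>The number of net pairs is exponential in N, but t^2 =
  \<open>N powr (1 + \<eta>)\<close> grows faster than linearly.\<close>

lemma net_event_prob_limit:
  assumes "0 < (\<eta>::real)"
  shows "(\<lambda>N. 2 * (2 ^ 16 * 3) ^ (2 * N) * exp (- (real N powr (1/2 + \<eta>/2))\<^sup>2 / 8)) \<longlonglongrightarrow> (0::real)"
proof -
  define C :: real where "C = ln (2 ^ 16 * 3)"
  have "(\<lambda>N. 2 * exp (2 * C * real N - real N powr (1 + \<eta>) / 8)) \<longlonglongrightarrow> 0"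
    using assms by real_asymp
  moreover have "2 * exp (2 * C * real N - real N powr (1 + \<eta>) / 8)
      = 2 * (2 ^ 16 * 3) ^ (2 * N) * exp (- (real N powr (1/2 + \<eta>/2))\<^sup>2 / 8)" for N :: nat
  proof -
    have "exp C = 2 ^ 16 * 3" unfolding C_def by (rule exp_ln) simp
    moreover have "exp (2 * C * real N) = exp C ^ (2 * N)"
      by (simp add: exp_of_nat_mult[symmetric] mult_ac)
    moreover have "(real N powr (1/2 + \<eta>/2))\<^sup>2 = real N powr (1 + \<eta>)"
      by (simp add: power2_eq_square powr_add[symmetric])
    ultimately show ?thesis by (simp only: exp_diff exp_minus divide_inverse mult_minus_left mult.assoc)
  qed
  ultimately show ?thesis by simp
qed

locale perturbed_jordan =
  fixes \<gamma> :: real and l :: "nat \<Rightarrow> nat" and a :: "nat \<Rightarrow> nat \<Rightarrow> real"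
    and d :: "nat \<Rightarrow> nat \<Rightarrow> nat" and c :: "nat \<Rightarrow> nat \<Rightarrow> complex"
    and P :: "nat \<Rightarrow> 'w measure" and G :: "nat \<Rightarrow> 'w \<Rightarrow> real mat"
  assumes a_pos: "\<And>N i. N \<ge> 2 \<Longrightarrow> i \<in> {1..l N} \<Longrightarrow> a N i > 0"
    and dim: "\<And>N i. N \<ge> 2 \<Longrightarrow> i \<in> {1..l N} \<Longrightarrow> real (d N i) = a N i * ln (real N)"
    and dim_sum: "\<And>N. N \<ge> 2 \<Longrightarrow> (\<Sum>i=1..l N. a N i * ln (real N)) = real N"
    and prob: "\<And>N. prob_space (P N)"
    and gauss: "\<And>N. std_gaussian_matrix (P N) N (G N)"
    and gamma: "\<gamma> > 1 / 2"
    and l_small: "(\<lambda>N. real (l N)) \<in> o(\<lambda>N. real N)"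
begin

text \<open>Blocks are numbered from 1 in the model and from 0 in \<open>noisy_blocks\<close>, hence
  the \<open>Suc\<close>.\<close>

abbreviation admissible :: "real \<Rightarrow> nat \<Rightarrow> bool" where
  "admissible \<eta> N \<equiv> noisy_blocks (l N) (\<lambda>i. d N (Suc i)) (\<gamma> - 1/2) \<eta> N"

definition pmat :: "nat \<Rightarrow> 'w \<Rightarrow> complex mat" where
  "pmat N \<omega> = perturbed_matrix \<gamma> (block_matrix l d c N) N (G N \<omega>)"

lemma pmat_entry:
  assumes "\<omega> \<in> space (P N)" "i < N" "j < N"
  shows "pmat N \<omega> $$ (i, j) = block_matrix l d c N $$ (i, j) + of_real (real N powr (- \<gamma>) * G N \<omega> $$ (i, j))"
  using gauss[of N] assms by (auto simp: pmat_def perturbed_matrix_def std_gaussian_matrix_def)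

lemma pmat_carrier: "\<omega> \<in> space (P N) \<Longrightarrow> pmat N \<omega> \<in> carrier_mat N N"
  using gauss[of N] by (auto simp: pmat_def perturbed_matrix_def std_gaussian_matrix_def)

lemma pmat_measurable:
  assumes ij: "i < N" "j < N" shows "(\<lambda>\<omega>. pmat N \<omega> $$ (i, j)) \<in> borel_measurable (P N)"
proof -
  have [measurable]: "(\<lambda>\<omega>. G N \<omega> $$ (i, j)) \<in> borel_measurable (P N)"
    by (rule std_gaussian_matrix_measurable[OF gauss ij])
  have "(\<lambda>\<omega>. block_matrix l d c N $$ (i, j) + of_real (real N powr (- \<gamma>) * G N \<omega> $$ (i, j))) \<in> borel_measurable (P N)"
    by measurable
  then show ?thesis using pmat_entry[OF _ ij] by (subst measurable_cong) auto
qed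

lemma sum_Suc_shift: "(\<Sum>i<l N. f (Suc i)) = (\<Sum>i=1..l N. f i)" for f :: "nat \<Rightarrow> 'z :: comm_monoid_add"
  by (simp add: sum.atLeast1_atMost_eq lessThan_atLeast0)

lemma boff_eq: "N \<ge> 2 \<Longrightarrow> boff (\<lambda>i. d N (Suc i)) (l N) = N"
proof -
  assume N: "N \<ge> 2"
  have "real (\<Sum>i=1..l N. d N i) = real N" using dim[OF N] dim_sum[OF N] by simp
  then show ?thesis unfolding sum_Suc_shift by linarith
qed

lemma noisy:
  assumes \<eta>: "0 < \<eta>" "\<eta> < \<gamma> - 1/2"
  shows "\<forall>\<^sub>F N in sequentially. admissible \<eta> N"
proof -
  have "(\<lambda>N::nat. real N powr (- \<eta> / 2) * ((1 + (\<gamma> - 1/2)) * ln (real N) ^ 6)) \<longlonglongrightarrow> 0" using \<eta>(1) by real_asymp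
  then have "\<forall>\<^sub>F N in sequentially. real N powr (- \<eta> / 2) * ((1 + (\<gamma> - 1/2)) * ln (real N) ^ 6) < 1 / 2"
    by (rule order_tendstoD) simp
  moreover have "\<forall>\<^sub>F N :: nat in sequentially. 2 \<le> ln (real N)" by real_asymp
  ultimately show ?thesis using eventually_ge_at_top[of 2]
  proof eventually_elim
    case (elim N)
    show ?case
    proof
      fix i assume i: "i < l N"
      have "0 < a N (Suc i) * ln (real N)" using a_pos[of N "Suc i"] i elim by simp
      then show "0 < d N (Suc i)" using dim[of N "Suc i"] i elim by simp
    qed (use elim \<eta> boff_eq in auto)
  qed
qed

lemma circle_mixture_integral:
  fixes f :: "complex \<Rightarrow> real"
  assumes N: "N \<ge> 2" and f: "f \<in> borel_measurable borel"
    and int: "\<And>i. i < l N \<Longrightarrow> integrable (uniform_circle (c N (Suc i)) (real N powr (- (\<gamma> - 1/2) / real (d N (Suc i))))) f"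
  shows "(\<integral>z. f z \<partial>circle_mixture \<gamma> l a c N)
      = (\<Sum>i<l N. real (d N (Suc i)) / N * (\<integral>z. f z \<partial>uniform_circle (c N (Suc i)) (real N powr (- (\<gamma> - 1/2) / real (d N (Suc i))))))"
    and "integrable (circle_mixture \<gamma> l a c N) f"
proof -
  have r: "block_radius \<gamma> a N i = real N powr (- (\<gamma> - 1/2) / real (d N i))" if "i \<in> {1..l N}" for i
  proof -
    have "0 < a N i" "0 < ln (real N)" using a_pos[OF N that] N by auto
    then show ?thesis using N by (simp add: block_radius_def dim[OF N that] powr_def)
  qed
  have i: "integrable (uniform_circle (c N i) (block_radius \<gamma> a N i)) f" if "i \<in> {1..l N}" for i
    using int[of "i - 1"] that r[OF that] by (cases i) auto
  have w: "0 \<le> a N i * ln (real N) / real N" if "i \<in> {1..l N}" for i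
    using a_pos[OF N that] N by simp
  note mix = integral_mixture[of "{1..l N}" "\<lambda>i. uniform_circle (c N i) (block_radius \<gamma> a N i)" f, OF _ _ f i w]
  show "integrable (circle_mixture \<gamma> l a c N) f" unfolding circle_mixture_def by (rule mix(2)) auto
  have "(\<integral>z. f z \<partial>circle_mixture \<gamma> l a c N)
     = (\<Sum>i=1..l N. a N i * ln (real N) / real N * (\<integral>z. f z \<partial>uniform_circle (c N i) (block_radius \<gamma> a N i)))"
    unfolding circle_mixture_def by (rule mix(1)) auto
  also have "\<dots> = (\<Sum>i=1..l N. real (d N i) / real N * (\<integral>z. f z \<partial>uniform_circle (c N i) (real N powr (- (\<gamma> - 1/2) / real (d N i)))))"
    by (intro sum.cong refl) (simp only: r dim[OF N])
  finally show "(\<integral>z. f z \<partial>circle_mixture \<gamma> l a c N)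
      = (\<Sum>i<l N. real (d N (Suc i)) / N * (\<integral>z. f z \<partial>uniform_circle (c N (Suc i)) (real N powr (- (\<gamma> - 1/2) / real (d N (Suc i))))))"
    by (simp only: sum_Suc_shift[symmetric])
qed

lemma prob_space_circle_mixture:
  assumes N: "N \<ge> 2" shows "prob_space (circle_mixture \<gamma> l a c N)"
proof
  have "emeasure (circle_mixture \<gamma> l a c N) UNIV = (\<Sum>i=1..l N. ennreal (a N i * ln (real N) / real N))"
    using prob_space.emeasure_space_1[OF prob_space_uniform_circle]
    by (simp add: circle_mixture_def emeasure_mixture sets_eq_imp_space_eq[OF sets_uniform_circle])
  also have "\<dots> = ennreal (\<Sum>i=1..l N. a N i * ln (real N) / real N)"
    by (rule sum_ennreal) (use a_pos[OF N] N in \<open>simp add: less_imp_le\<close>)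
  also have "(\<Sum>i=1..l N. a N i * ln (real N) / real N) = 1"
    using dim_sum[OF N] N by (simp add: sum_divide_distrib[symmetric])
  finally show "emeasure (circle_mixture \<gamma> l a c N) (space (circle_mixture \<gamma> l a c N)) = 1"
    by (simp add: circle_mixture_def)
qed

text \<open>The entries of \<open>G N\<close> push \<open>P N\<close> forward to
  \<open>noise_space\<close> and carry \<open>pmat N\<close> to \<open>Bmat\<close>. The bound is
  written out explicitly in N and \<eta>, because \<eta> is still to be chosen.\<close>

lemma pot_deviation:
  fixes \<Phi> :: "complex \<Rightarrow> real" and e :: real
  assumes admissible: "admissible \<eta> N" and \<Phi>: "\<Phi> \<in> borel_measurable borel" and b: "\<And>z. \<bar>\<Phi> z\<bar> \<le> b"
    and s: "\<And>z. R < cmod z \<Longrightarrow> \<Phi> z = 0" and R: "0 \<le> R" and e: "0 < e"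
  shows "measure (P N) {\<omega>\<in>space (P N). e < \<bar>(\<integral>w. log_potential \<Phi> w \<partial>empirical_spectral_measure (pmat N \<omega>))
        - (\<integral>w. log_potential \<Phi> w \<partial>circle_mixture \<gamma> l a c N)\<bar>}
     \<le> 2 * (2 ^ 16 * 3) ^ (2 * N) * exp (- (real N powr (1/2 + \<eta>/2))\<^sup>2 / 8)
       + b / e * (16 * (\<eta> / ((\<gamma> - 1/2) - \<eta>)) + (5 + (\<gamma> - 1/2) * ln (real N) + 12 * ln (real N)) * (4 * pi / (ln (real N))\<^sup>2)
     + (12 * sqrt (real (l N) / real N) + 12 / ln (real N) + 2 * (real N powr (- \<eta> / 2) * ((1 + (\<gamma> - 1/2)) * ln (real N) ^ 6))
        + 1 / (ln (real N))\<^sup>2) * (pi * R\<^sup>2) + 2 * pi * R\<^sup>2 / real N)"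
proof -
  interpret NB: noisy_blocks "l N" "\<lambda>i. d N (Suc i)" "\<lambda>i. c N (Suc i)" "\<gamma> - 1/2" \<eta> N by fact
  have N: "N \<ge> 2" "0 < N" using NB.Npos by auto
  let ?I = "{..<N} \<times> {..<N}"
  define X where "X \<omega> = (\<lambda>ij\<in>?I. G N \<omega> $$ ij)" for \<omega>
  have X: "X \<in> P N \<rightarrow>\<^sub>M NB.noise_space" "distr (P N) NB.noise_space X = NB.noise_space"
    using distr_std_gaussian_matrix[OF prob gauss N(2)] by (simp_all add: X_def[abs_def] NB.noise_space_def)
  have Beq: "pmat N \<omega> = NB.Bmat (X \<omega>)" if \<omega>: "\<omega> \<in> space (P N)" for \<omega>
  proof (rule eq_matI)
    show "dim_row (pmat N \<omega>) = dim_row (NB.Bmat (X \<omega>))" "dim_col (pmat N \<omega>) = dim_col (NB.Bmat (X \<omega>))"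
      using pmat_carrier[OF \<omega>] by (auto simp: NB.Bmat_def)
    fix i j assume "i < dim_row (NB.Bmat (X \<omega>))" "j < dim_col (NB.Bmat (X \<omega>))"
    then have ij: "i < N" "j < N" by (auto simp: NB.Bmat_def)
    have "[1..<Suc (l N)] = map Suc [0..<l N]" by (simp add: map_Suc_upt)
    then have "block_matrix l d c N = jordan_matrix (map (\<lambda>i. (d N (Suc i), c N (Suc i))) [0..<l N])"
      by (simp add: block_matrix_def o_def)
    then have "block_matrix l d c N $$ (i, j) = bd (l N) (\<lambda>i. d N (Suc i)) (\<lambda>i. jrows (c N (Suc i))) i j"
      by (simp add: jordan_matrix_bdiag bd_def jrows_def[abs_def])
    moreover have "NB.\<delta> = real N powr (- \<gamma>)" by (simp add: NB.\<delta>_def)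
    ultimately show "pmat N \<omega> $$ (i, j) = NB.Bmat (X \<omega>) $$ (i, j)"
      using pmat_entry[OF \<omega> ij] ij by (simp add: NB.Bmat_def X_def)
  qed
  define m where "m = (\<Sum>i<l N. real (d N (Suc i)) / N * (\<integral>w. log_potential \<Phi> w \<partial>uniform_circle (c N (Suc i)) (NB.rad i)))"
  have gm: "log_potential \<Phi> \<in> borel_measurable borel"
    unfolding log_potential_def[abs_def] using \<Phi> by measurable
  have meq: "(\<integral>w. log_potential \<Phi> w \<partial>circle_mixture \<gamma> l a c N) = m"
    using circle_mixture_integral(1)[OF N(1) gm] NB.circle_pot(1)[OF \<Phi> b s R] by (simp add: m_def NB.rad_def)
  let ?D = "\<lambda>x. \<bar>(\<integral>w. log_potential \<Phi> w \<partial>empirical_spectral_measure (NB.Bmat x)) - m\<bar>"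
  have "{x\<in>space NB.noise_space. e < ?D x} \<in> sets NB.noise_space"
  proof -
    have "(\<lambda>(x, z). \<Phi> z * ln (NB.Y x z)) \<in> borel_measurable (NB.noise_space \<Otimes>\<^sub>M lborel)"
      using NB.measurable_Y \<Phi> unfolding case_prod_unfold by measurable
    then have "(\<lambda>x. \<integral>z. \<Phi> z * ln (NB.Y x z) \<partial>lborel) \<in> borel_measurable NB.noise_space"
      by (rule lborel.borel_measurable_lebesgue_integral)
    then have [measurable]: "(\<lambda>x. (\<integral>z. \<Phi> z * ln (NB.Y x z) \<partial>lborel) / N) \<in> borel_measurable NB.noise_space" by simp
    define h where "h x = (\<integral>z. \<Phi> z * ln (NB.Y x z) \<partial>lborel) / N" for x
    have [measurable]: "h \<in> borel_measurable NB.noise_space" unfolding h_def[abs_def] by fact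
    have "{x\<in>space NB.noise_space. e < \<bar>h x - m\<bar>} \<in> sets NB.noise_space" by measurable
    then show ?thesis using NB.esm_pot(1)[OF \<Phi> b s R] by (simp add: h_def)
  qed
  from measure_distr[OF X(1) this] have "measure NB.noise_space {x\<in>space NB.noise_space. e < ?D x}
      = measure (P N) (X -` {x\<in>space NB.noise_space. e < ?D x} \<inter> space (P N))"
    unfolding X(2) .
  also have "X -` {x\<in>space NB.noise_space. e < ?D x} \<inter> space (P N)
     = {\<omega>\<in>space (P N). e < \<bar>(\<integral>w. log_potential \<Phi> w \<partial>empirical_spectral_measure (pmat N \<omega>)) - m\<bar>}"
    using measurable_space[OF X(1)] Beq by auto
  finally have "measure (P N) {\<omega>\<in>space (P N). e < \<bar>(\<integral>w. log_potential \<Phi> w \<partial>empirical_spectral_measure (pmat N \<omega>)) - m\<bar>}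
     \<le> 2 * (2 ^ 16 * 3) ^ (2 * N) * exp (- NB.t\<^sup>2 / 8) + b / (N * e) * (NB.Qint R + 2 * pi * R\<^sup>2)"
    using NB.pot_deviation_prob[OF \<Phi> b s R e] by (simp add: m_def)
  also have "b / (N * e) * (NB.Qint R + 2 * pi * R\<^sup>2) = b / e * (NB.Qint R / N + 2 * pi * R\<^sup>2 / N)"
    using N e by (simp add: field_simps)
  also have "NB.Qint R / N = 16 * (\<eta> / ((\<gamma> - 1/2) - \<eta>)) + (5 + (\<gamma> - 1/2) * ln (real N) + 12 * ln (real N)) * (4 * pi / (ln (real N))\<^sup>2)
     + (12 * sqrt (real (l N) / real N) + 12 / ln (real N) + 2 * (real N powr (- \<eta> / 2) * ((1 + (\<gamma> - 1/2)) * ln (real N) ^ 6))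
        + 1 / (ln (real N))\<^sup>2) * (pi * R\<^sup>2)"
    unfolding NB.Qint_eq using N by simp
  finally show ?thesis unfolding meq NB.t_def .
qed

text \<open>The probability does not involve \<eta>, only its bound does. For each target y first
  \<eta> is chosen so small that the limiting bound is below y, then N is taken large.\<close>

lemma pot_limit:
  fixes \<Phi> :: "complex \<Rightarrow> real" and e :: real
  assumes \<Phi>: "\<Phi> \<in> borel_measurable borel" and b: "\<And>z. \<bar>\<Phi> z\<bar> \<le> b"
    and s: "\<And>z. R < cmod z \<Longrightarrow> \<Phi> z = 0" and R: "0 \<le> R" and e: "0 < e"
  shows "(\<lambda>N. measure (P N) {\<omega>\<in>space (P N). e < \<bar>(\<integral>w. log_potential \<Phi> w \<partial>empirical_spectral_measure (pmat N \<omega>))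
        - (\<integral>w. log_potential \<Phi> w \<partial>circle_mixture \<gamma> l a c N)\<bar>}) \<longlonglongrightarrow> 0"
    (is "(\<lambda>N. ?p N) \<longlonglongrightarrow> 0")
proof (rule order_tendstoI)
  fix y :: real assume "y < 0"
  then show "\<forall>\<^sub>F N in sequentially. y < ?p N" by (intro always_eventually allI) (rule less_le_trans, assumption, simp)
next
  fix y :: real assume y: "0 < y"
  define \<beta> where "\<beta> = \<gamma> - 1/2"
  have \<beta>: "0 < \<beta>" using gamma by (simp add: \<beta>_def)
  have "((\<lambda>\<eta>. b / e * (16 * (\<eta> / (\<beta> - \<eta>)))) \<longlongrightarrow> b / e * (16 * (0 / (\<beta> - 0)))) (at_right 0)"
    using \<beta> by (intro tendsto_intros) auto
  then have "\<forall>\<^sub>F \<eta> in at_right 0. b / e * (16 * (\<eta> / (\<beta> - \<eta>))) < y"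
    by (rule order_tendstoD) (use y in simp)
  moreover have "\<forall>\<^sub>F \<eta> in at_right 0. 0 < \<eta> \<and> \<eta> < \<beta>"
    using eventually_at_right_real[OF \<beta>] by eventually_elim auto
  ultimately have "\<forall>\<^sub>F \<eta> in at_right 0. b / e * (16 * (\<eta> / (\<beta> - \<eta>))) < y \<and> 0 < \<eta> \<and> \<eta> < \<beta>"
    by (rule eventually_conj)
  then obtain \<eta> where \<eta>: "b / e * (16 * (\<eta> / (\<beta> - \<eta>))) < y" "0 < \<eta>" "\<eta> < \<beta>"
    using eventually_happens[of _ "at_right (0::real)"] by auto
  note lim = tendsto_add[OF net_event_prob_limit[OF \<eta>(2)]
      tendsto_mult_left[OF Qint_limit[OF l_small \<eta>(2), of \<beta> R], of "b / e"]]
  have "0 + b / e * (16 * (\<eta> / (\<beta> - \<eta>))) < y" using \<eta>(1) by simp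
  from order_tendstoD(2)[OF lim this] noisy[OF \<eta>(2) \<eta>(3)[unfolded \<beta>_def]]
  show "\<forall>\<^sub>F N in sequentially. ?p N < y"
  proof eventually_elim
    case (elim N)
    from pot_deviation[OF elim(2) \<Phi> b s R e] elim(1) show ?case unfolding \<beta>_def by (rule le_less_trans)
  qed
qed

lemma integral_mixture_close:
  fixes f g :: "complex \<Rightarrow> real"
  assumes N: "N \<ge> 2" and f: "integrable (circle_mixture \<gamma> l a c N) f" "integrable (circle_mixture \<gamma> l a c N) g"
    and le: "\<And>z. \<bar>f z - g z\<bar> \<le> e"
  shows "\<bar>(\<integral>z. f z \<partial>circle_mixture \<gamma> l a c N) - (\<integral>z. g z \<partial>circle_mixture \<gamma> l a c N)\<bar> \<le> e"
proof -
  interpret prob_space "circle_mixture \<gamma> l a c N" by (rule prob_space_circle_mixture[OF N])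
  have "\<bar>(\<integral>z. f z \<partial>circle_mixture \<gamma> l a c N) - (\<integral>z. g z \<partial>circle_mixture \<gamma> l a c N)\<bar>
      = norm (\<integral>z. f z - g z \<partial>circle_mixture \<gamma> l a c N)" using f by simp
  also have "\<dots> \<le> (\<integral>z. norm (f z - g z) \<partial>circle_mixture \<gamma> l a c N)" by (rule integral_norm_bound)
  also have "\<dots> \<le> (\<integral>z. e \<partial>circle_mixture \<gamma> l a c N)"
    by (rule integral_mono) (use f le in auto)
  also have "\<dots> = e" by (simp add: prob_space)
  finally show ?thesis .
qed

text \<open>\<psi> is replaced by a logarithmic potential on both sides at a cost of e/8 each, and
  the circle mixture by \<mu> at a cost of e/4. A deviation above e thus forces a deviation of the
  potential above e/4.\<close>

lemma esm_limit:
  fixes \<psi> :: "complex \<Rightarrow> real" and \<mu> :: "complex measure"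
  assumes conv: "weakly_converges (circle_mixture \<gamma> l a c) \<mu>"
    and \<psi>: "continuous_on UNIV \<psi>" and s: "\<And>z. R0 < cmod z \<Longrightarrow> \<psi> z = 0" and e: "0 < e"
  shows "(\<lambda>N. measure (P N) {\<omega>\<in>space (P N). \<bar>(\<integral>z. \<psi> z \<partial>empirical_spectral_measure (pmat N \<omega>)) - (\<integral>z. \<psi> z \<partial>\<mu>)\<bar> > e}) \<longlonglongrightarrow> 0"
proof -
  have s1: "\<And>z. max R0 0 < cmod z \<Longrightarrow> \<psi> z = 0" using s by simp
  obtain K where K: "\<And>z. \<bar>\<psi> z\<bar> \<le> K" using compact_support_bounded[OF \<psi> s1] by blast
  have bd: "bounded (range \<psi>)" using K by (auto simp: bounded_iff intro!: exI[of _ K])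
  have fm: "\<psi> \<in> borel_measurable borel" by (rule borel_measurable_continuous_onI[OF \<psi>])
  have e8: "0 < e / 8" using e by simp
  obtain \<Phi> b R where \<Phi>: "\<Phi> \<in> borel_measurable borel" "\<And>z. \<bar>\<Phi> z\<bar> \<le> b" "\<And>z. R < cmod z \<Longrightarrow> \<Phi> z = 0" "0 \<le> R"
      and ap: "\<And>w. \<bar>(\<integral>z. \<Phi> z * ln (cmod (z - w)) \<partial>lborel) - \<psi> w\<bar> \<le> e / 8"
    by (rule log_potential_approx[OF \<psi>, of R0, OF _ e8]) (rule s, assumption, rule that, assumption+)
  let ?g = "log_potential \<Phi>"
  have gm: "?g \<in> borel_measurable borel"
    unfolding log_potential_def[abs_def] using \<Phi>(1) by measurable
  have ap: "\<bar>?g w - \<psi> w\<bar> \<le> e / 8" for w using ap[of w] by (simp add: log_potential_def)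
  let ?L = "\<lambda>N \<omega>. empirical_spectral_measure (pmat N \<omega>)" and ?m = "circle_mixture \<gamma> l a c"
  have c1: "(\<lambda>N. \<integral>z. \<psi> z \<partial>?m N) \<longlonglongrightarrow> (\<integral>z. \<psi> z \<partial>\<mu>)"
    using conv \<psi> bd by (simp add: weakly_converges_def)
  have e4: "0 < e / 4" using e by simp
  have c2: "\<forall>\<^sub>F N in sequentially. \<bar>(\<integral>z. \<psi> z \<partial>?m N) - (\<integral>z. \<psi> z \<partial>\<mu>)\<bar> < e / 4"
    using tendstoD[OF c1 e4] by (simp add: dist_real_def)
  let ?E = "\<lambda>N. {\<omega>\<in>space (P N). \<bar>(\<integral>z. \<psi> z \<partial>?L N \<omega>) - (\<integral>z. \<psi> z \<partial>\<mu>)\<bar> > e}"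
  let ?F = "\<lambda>N. {\<omega>\<in>space (P N). e / 4 < \<bar>(\<integral>z. ?g z \<partial>?L N \<omega>) - (\<integral>z. ?g z \<partial>?m N)\<bar>}"
  have lim: "(\<lambda>N. measure (P N) (?F N)) \<longlonglongrightarrow> 0" by (rule pot_limit[OF \<Phi> e4])
  have le: "\<forall>\<^sub>F N in sequentially. measure (P N) (?E N) \<le> measure (P N) (?F N)"
    using c2 eventually_ge_at_top[of 2]
  proof eventually_elim
    case (elim N)
    then have N: "N \<ge> 2" "0 < N" by auto
    interpret PN: prob_space "P N" by (rule prob)
    have i\<psi>: "integrable (uniform_circle z r) \<psi>" for z r
    proof -
      interpret U: prob_space "uniform_circle z r" by (rule prob_space_uniform_circle)
      show ?thesis by (rule U.integrable_const_bound[of _ K]) (use K fm in \<open>auto cong: measurable_cong_sets\<close>)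
    qed
    have ig: "integrable (uniform_circle z r) ?g" for z r
    proof -
      interpret U: prob_space "uniform_circle z r" by (rule prob_space_uniform_circle)
      have "\<bar>?g w\<bar> \<le> K + e / 8" for w using ap[of w] K[of w] by linarith
      then show ?thesis by (intro U.integrable_const_bound[of _ "K + e / 8"]) (use gm in \<open>auto cong: measurable_cong_sets\<close>)
    qed
    have d1: "\<bar>(\<integral>z. ?g z \<partial>?m N) - (\<integral>z. \<psi> z \<partial>?m N)\<bar> \<le> e / 8"
      by (rule integral_mixture_close[OF N(1) circle_mixture_integral(2)[OF N(1) gm ig] circle_mixture_integral(2)[OF N(1) fm i\<psi>] ap])
    have "?E N \<subseteq> ?F N"
    proof
      fix \<omega> assume \<omega>: "\<omega> \<in> ?E N"
      then have "\<bar>(\<integral>z. ?g z \<partial>?L N \<omega>) - (\<integral>z. \<psi> z \<partial>?L N \<omega>)\<bar> \<le> e / 8"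
        by (intro integral_uniform_esm_bound[OF pmat_carrier N(2) gm fm ap]) simp
      moreover have "e < \<bar>(\<integral>z. \<psi> z \<partial>?L N \<omega>) - (\<integral>z. \<psi> z \<partial>\<mu>)\<bar>" using \<omega> by simp
      ultimately have "e / 4 < \<bar>(\<integral>z. ?g z \<partial>?L N \<omega>) - (\<integral>z. ?g z \<partial>?m N)\<bar>"
        using d1 elim(1) e by linarith
      then show "\<omega> \<in> ?F N" using \<omega> by simp
    qed
    moreover have "(\<lambda>\<omega>. \<integral>z. ?g z \<partial>?L N \<omega>) \<in> borel_measurable (P N)"
      using measurable_integral_esm_potential[OF pmat_carrier pmat_measurable \<Phi>] by (simp add: log_potential_def)
    then have "?F N \<in> sets (P N)" by measurable
    ultimately show ?case by (intro PN.finite_measure_mono)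
  qed
  show ?thesis by (rule tendsto_sandwich[OF _ le tendsto_const lim]) simp
qed

end

theorem theorem1p4:
  fixes \<gamma> :: real
    and l :: "nat \<Rightarrow> nat"
    and a :: "nat \<Rightarrow> nat \<Rightarrow> real"
    and d :: "nat \<Rightarrow> nat \<Rightarrow> nat"
    and c :: "nat \<Rightarrow> nat \<Rightarrow> complex"
    and P :: "nat \<Rightarrow> 'w measure"
    and G :: "nat \<Rightarrow> 'w \<Rightarrow> real mat"
    and K :: "complex set"
    and \<mu> :: "complex measure"
  assumes a_pos: "\<And>N i. N \<ge> 2 \<Longrightarrow> i \<in> {1..l N} \<Longrightarrow> a N i > 0"
    and dim: "\<And>N i. N \<ge> 2 \<Longrightarrow> i \<in> {1..l N} \<Longrightarrow> real (d N i) = a N i * ln (real N)"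
    and dim_sum: "\<And>N. N \<ge> 2 \<Longrightarrow> (\<Sum>i=1..l N. a N i * ln (real N)) = real N"
    and prob: "\<And>N. prob_space (P N)"
    and gauss: "\<And>N. std_gaussian_matrix (P N) N (G N)"
    and gamma: "\<gamma> > 1 / 2"
    and l_small: "(\<lambda>N. real (l N)) \<in> o(\<lambda>N. real N)"
    and good: "\<exists>\<epsilon>'\<in>{0<..<2 * \<gamma> - 1}. UNIV - good_set \<gamma> l a c \<epsilon>' \<in> null_sets lebesgue"
    and K_compact: "compact K"
    and supported: "\<And>N. N \<ge> 2 \<Longrightarrow> emeasure (circle_mixture \<gamma> l a c N) (UNIV - K) = 0"
    and mu_prob: "prob_space \<mu>"
    and mu_borel: "sets \<mu> = sets borel"
    and conv: "weakly_converges (circle_mixture \<gamma> l a c) \<mu>"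
  shows "weakly_converges_in_prob P
           (\<lambda>N \<omega>. empirical_spectral_measure
              (perturbed_matrix \<gamma> (block_matrix l d c N) N (G N \<omega>))) \<mu>"
proof -
  interpret perturbed_jordan \<gamma> l a d c P G
    by (rule perturbed_jordan.intro[OF a_pos dim dim_sum prob gauss gamma l_small])
  show ?thesis
    unfolding weakly_converges_in_prob_def pmat_def[symmetric]
  proof (intro allI impI)
    fix \<phi> :: "complex \<Rightarrow> real"
    assume \<phi>: "continuous_on UNIV \<phi>" "bounded (range \<phi>)"
    have cc: "(\<lambda>N. measure (P N) {\<omega>\<in>space (P N). \<bar>(\<integral>z. \<psi> z \<partial>empirical_spectral_measure (pmat N \<omega>)) - (\<integral>z. \<psi> z \<partial>\<mu>)\<bar> > e}) \<longlonglongrightarrow> 0"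
      if "continuous_on UNIV \<psi>" "\<And>z. R < cmod z \<Longrightarrow> \<psi> z = 0" "0 < e" for \<psi> :: "complex \<Rightarrow> real" and R e
      by (rule esm_limit[OF conv that])
    show "converges_in_prob P (\<lambda>N \<omega>. \<integral>z. \<phi> z \<partial>empirical_spectral_measure (pmat N \<omega>)) (\<integral>z. \<phi> z \<partial>\<mu>)"
      by (rule weak_limit_of_compactly_supported[where B = pmat, OF prob pmat_carrier pmat_measurable mu_prob mu_borel cc \<phi>])
  qed
qed

end
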